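(* Let $\mathbb F$ be a field of characteristic $0$, let $c\in\mathbb F$ be arbitrary, let $\mathcal Vir^c$ be the Virasoro PVA of central charge $c$, and let $\bar R^{\mathrm{vir}}=\mathbb F[\partial]L$ be the Virasoro LCA at central charge zero. Then $$H^n_{\mathrm{PV}}(\mathcal Vir^c,\mathcal Vir^c)\simeq H^n_{\mathrm{LC}}(\bar R^{\mathrm{vir}},\mathbb F)=\begin{cases}\mathbb F\,[Y^n],& n=0,2,3,\\ 0,&\text{otherwise},\end{cases}$$ where $Y^0=1+\langle\partial\rangle=\int1$, and $Y^2$, $Y^3$ are the cochains determined by $$Y^2_{\lambda_1,\lambda_2}(L\otimes L)=\lambda_1^3+\langle\partial+\lambda_1+\lambda_2\rangle,$$ $$Y^3_{\lambda_1,\lambda_2,\lambda_3}(L\otimes L\otimes L)=(\lambda_1-\lambda_2)(\lambda_1-\lambda_3)(\lambda_2-\lambda_3)+\langle\partial+\lambda_1+\lambda_2+\lambda_3\rangle.$$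
   Context: $\mathbb F$ is a field of characteristic $0$. Everything here is purely even. LCA: a Lie conformal algebra is an $\mathbb F[\partial]$-module $R$ with a bilinear map $R\otimes R\to R[\lambda]$, $a\otimes b\mapsto[a_\lambda b]$, with $[\partial a_\lambda b]=-\lambda[a_\lambda b]$, $[a_\lambda\partial b]=(\lambda+\partial)[a_\lambda b]$, $[a_\lambda b]=-[b_{-\lambda-\partial}a]$ ($\partial$ acting from the left on coefficients), $[a_\lambda[b_\mu c]]-[b_\mu[a_\lambda c]]=[[a_\lambda b]_{\lambda+\mu}c]$. An $R$-module is an $\mathbb F[\partial]$-module $M$ with a bilinear map $R\otimes M\to M[\lambda]$, $a\otimes m\mapsto a_\lambda m$, with $(\partial a)_\lambda m=-\lambda a_\lambda m$, $a_\lambda(\partial m)=(\lambda+\partial)(a_\lambda m)$, $a_\lambda(b_\mu m)-b_\mu(a_\lambda m)=[a_\lambda b]_{\lambda+\mu}m$. LCA cohomology: $C^n_{\mathrm{LC}}(R,M)$, $n\ge0$, is the space of linear maps $Y:R^{\otimes n}\to M[\lambda_1,\dots,\lambda_n]/\langle\partial+\lambda_1+\cdots+\lambda_n\rangle$ ($\langle\Phi\rangle$ = image of $\Phi$) with $Y_{\lambda_1,\dots,\lambda_n}(\cdots\otimes\partial a_i\otimes\cdots)=-\lambda_iY_{\lambda_1,\dots,\lambda_n}(\cdots\otimes a_i\otimes\cdots)$, skewsymmetric under simultaneous permutations of the $a_i$ and the $\lambda_i$; $C^0_{\mathrm{LC}}=M/\partial M$. The differential $d:C^n_{\mathrm{LC}}\to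 C^{n+1}_{\mathrm{LC}}$, $d^2=0$, is $$(dY)_{\lambda_0,\dots,\lambda_n}(a_0\otimes\cdots\otimes a_n)=\sum_{i=0}^n(-1)^{n+i+1}{a_i}_{\lambda_i}Y_{\lambda_0,\overset{i}{\check\dots},\lambda_n}(a_0\otimes\overset{i}{\check\cdots}\otimes a_n)+\sum_{i<j}(-1)^{n+i+j+1}Y_{\lambda_i+\lambda_j,\lambda_0,\overset{i}{\check\dots}\overset{j}{\check\dots},\lambda_n}([{a_i}_{\lambda_i}a_j]\otimes a_0\otimes\overset{i}{\check\cdots}\overset{j}{\check\cdots}\otimes a_n),$$ with $\check{}$ meaning omission; $H^n_{\mathrm{LC}}(R,M)=\ker(d|_{C^n})/d(C^{n-1})$. PVA: a Poisson vertex algebra is a commutative associative unital algebra $\mathcal V$ with a derivation $\partial$ and an LCA $\lambda$-bracket satisfying $[a_\lambda bc]=[a_\lambda b]c+[a_\lambda c]b$. The variational PVA complex with coefficients in the adjoint module, $C^n_{\mathrm{PV}}(\mathcal V,\mathcal V)\subset C^n_{\mathrm{LC}}(\mathcal V,\mathcal V)$, is the subcomplex of cochains satisfying the Leibniz rules $Y(\cdots\otimes b_ic_i\otimes\cdots)=(e^{\partial\partial_{\lambda_i}}b_i)Y(\cdots\otimes c_i\otimes\cdots)+(e^{\partial\partial_{\lambda_i}}c_i)Y(\cdots\otimes b_i\otimes\cdots)$ in each slot $i$, where $(e^{\partial\partial_\lambda}a)P(\lambda)=\sum_{k\ge0}\frac1{k!}(\partial^ka)\frac{d^kP}{d\lambda^k}$;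 $H^n_{\mathrm{PV}}$ is its cohomology with respect to $d$. A PVA cochain is determined by its values on generators of $\mathcal V$ as a differential algebra. Virasoro: $\mathcal Vir^c=\mathbb F[L^{(n)}\mid n\ge0]$, $L^{(n)}=\partial^nL$, polynomial algebra with the unique PVA $\lambda$-bracket such that $[L_\lambda L]=(\partial+2\lambda)L+\frac c{12}\lambda^3$. $\bar R^{\mathrm{vir}}$ is the free rank-one $\mathbb F[\partial]$-module on $L$ with $[L_\lambda L]=(\partial+2\lambda)L$. In $H_{\mathrm{LC}}(\bar R^{\mathrm{vir}},\mathbb F)$, $\mathbb F$ is the trivial module: $\partial$ and $L$ act by zero. $\int$ denotes the quotient map to the space modulo the image of $\partial$. *)

theory Defs
  imports
    "HOL-Algebra.Module"
    "HOL-Algebra.AbelCoset"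
    "HOL-Library.Poly_Mapping"
    "HOL-Library.FuncSet"
    "HOL-Computational_Algebra.Polynomial"
    "HOL-Combinatorics.Permutations"
begin

section \<open>Quotients of vector spaces\<close>

text \<open>
  Vector spaces that are subspaces, function spaces or quotients are records of \<^typ>\<open>('f, 'v) module\<close>;
  the ring fields \<^const>\<open>monoid.mult\<close> and \<^const>\<open>one\<close> play no role and are left \<^const>\<open>undefined\<close>.
  Maps on a quotient are given on representatives. They are only used where the result does not
  depend on the choice.
\<close>

definition rep :: "'v set \<Rightarrow> 'v"
  where "rep A = (SOME v. v \<in> A)"

definition quot_space :: "('f, 'v) module \<Rightarrow> 'v set \<Rightarrow> ('f, 'v set) module"
  where "quot_space V U =
    \<lparr>carrier = a_rcosets\<^bsub>V\<^esub> U, monoid.mult = undefined, one = undefined,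
     zero = U, add = set_add V, module.smult = (\<lambda>x A. U +>\<^bsub>V\<^esub> (x \<odot>\<^bsub>V\<^esub> rep A))\<rparr>"

definition lin_isomorphic :: "('f, 'v) module \<Rightarrow> ('f, 'w) module \<Rightarrow> bool"
  where "lin_isomorphic V W \<longleftrightarrow>
    (\<exists>h. bij_betw h (carrier V) (carrier W) \<and>
      (\<forall>u\<in>carrier V. \<forall>v\<in>carrier V. h (u \<oplus>\<^bsub>V\<^esub> v) = h u \<oplus>\<^bsub>W\<^esub> h v) \<and>
      (\<forall>x. \<forall>v\<in>carrier V. h (x \<odot>\<^bsub>V\<^esub> v) = x \<odot>\<^bsub>W\<^esub> h v))"

definition is_line_on :: "('f, 'v) module \<Rightarrow> 'v \<Rightarrow> bool"
  where "is_line_on V v \<longleftrightarrow>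
    v \<in> carrier V \<and> v \<noteq> \<zero>\<^bsub>V\<^esub> \<and> carrier V = {x \<odot>\<^bsub>V\<^esub> v | x. True}"

section \<open>Cohomology of a complex\<close>

definition cocycles :: "(nat \<Rightarrow> ('f, 'v) module) \<Rightarrow> (nat \<Rightarrow> 'v \<Rightarrow> 'v) \<Rightarrow> nat \<Rightarrow> 'v set"
  where "cocycles C d n = {Y \<in> carrier (C n). d n Y = \<zero>\<^bsub>C (Suc n)\<^esub>}"

definition coboundaries :: "(nat \<Rightarrow> ('f, 'v) module) \<Rightarrow> (nat \<Rightarrow> 'v \<Rightarrow> 'v) \<Rightarrow> nat \<Rightarrow> 'v set"
  where "coboundaries C d n =
    (case n of 0 \<Rightarrow> {\<zero>\<^bsub>C 0\<^esub>} | Suc m \<Rightarrow> d m ` carrier (C m))"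

definition cohomology ::
    "(nat \<Rightarrow> ('f, 'v) module) \<Rightarrow> (nat \<Rightarrow> 'v \<Rightarrow> 'v) \<Rightarrow> nat \<Rightarrow> ('f, 'v set) module"
  where "cohomology C d n =
    quot_space ((C n)\<lparr>carrier := cocycles C d n\<rparr>) (coboundaries C d n)"

definition coh_class ::
    "(nat \<Rightarrow> ('f, 'v) module) \<Rightarrow> (nat \<Rightarrow> 'v \<Rightarrow> 'v) \<Rightarrow> nat \<Rightarrow> 'v \<Rightarrow> 'v set"
  where "coh_class C d n Y = coboundaries C d n +>\<^bsub>C n\<^esub> Y"

section \<open>Polynomials in several variables with coefficients in a vector space\<close>

text \<open>
  \<open>M[\<lambda>\<^sub>0, \<lambda>\<^sub>1, \<dots>]\<close>: a monomial is a finitely supported exponent function. Everywhere \<open>s\<close> is the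
  scalar multiplication of \<open>M\<close>.
\<close>

type_synonym 'm lpoly = "(nat \<Rightarrow>\<^sub>0 nat) \<Rightarrow>\<^sub>0 'm"

definition lam :: "nat \<Rightarrow> 'm::comm_ring_1 lpoly"
  where "lam i = Poly_Mapping.single (Poly_Mapping.single i 1) 1"

definition lpolys :: "nat \<Rightarrow> 'm::zero lpoly set"
  where "lpolys n = {p. \<forall>t\<in>Poly_Mapping.keys p. Poly_Mapping.keys t \<subseteq> {..<n}}"

definition lmult ::
    "('f \<Rightarrow> 'm \<Rightarrow> 'm) \<Rightarrow> 'f::zero lpoly \<Rightarrow> 'm::comm_monoid_add lpoly \<Rightarrow> 'm lpoly"
  where "lmult s q p =
    (\<Sum>u\<in>Poly_Mapping.keys q. \<Sum>t\<in>Poly_Mapping.keys p.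
      Poly_Mapping.single (u + t) (s (Poly_Mapping.lookup q u) (Poly_Mapping.lookup p t)))"

definition lsubst ::
    "('f \<Rightarrow> 'm \<Rightarrow> 'm) \<Rightarrow> (nat \<Rightarrow> 'f::comm_ring_1 lpoly) \<Rightarrow> 'm::comm_monoid_add lpoly \<Rightarrow> 'm lpoly"
  where "lsubst s \<sigma> p =
    (\<Sum>t\<in>Poly_Mapping.keys p.
      lmult s (\<Prod>k\<in>Poly_Mapping.keys t. \<sigma> k ^ Poly_Mapping.lookup t k)
        (Poly_Mapping.single 0 (Poly_Mapping.lookup p t)))"

definition leval ::
    "('f \<Rightarrow> 'm \<Rightarrow> 'm) \<Rightarrow> 'm::comm_monoid_add poly \<Rightarrow> 'f::comm_ring_1 lpoly \<Rightarrow> 'm lpoly"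
  where "leval s P q =
    (\<Sum>k\<le>degree P. lmult s (q ^ k) (Poly_Mapping.single 0 (coeff P k)))"

definition lderiv :: "nat \<Rightarrow> 'm::comm_ring_1 lpoly \<Rightarrow> 'm lpoly"
  where "lderiv i p =
    (\<Sum>t\<in>Poly_Mapping.keys p.
      Poly_Mapping.single (t - Poly_Mapping.single i 1)
        (of_nat (Poly_Mapping.lookup t i) * Poly_Mapping.lookup p t))"

section \<open>Lie conformal algebras and their modules\<close>

text \<open>
  The underlying spaces are whole types. \<open>R[\<lambda>]\<close> is \<^typ>\<open>'r poly\<close>, so that multiplication by
  \<open>\<lambda>\<close> is \<^term>\<open>pCons 0\<close> and an operator of \<open>R\<close> acts on coefficients by \<^const>\<open>map_poly\<close>.
\<close>

record ('f, 'm) dmod =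
  scl :: "'f \<Rightarrow> 'm \<Rightarrow> 'm"
  der :: "'m \<Rightarrow> 'm"

record (overloaded) ('f, 'r, 'm) conf_module = "('f, 'm) dmod" +
  act :: "'r \<Rightarrow> 'm \<Rightarrow> 'm poly"

text \<open>A Lie conformal algebra is presented by its adjoint action \<open>a \<mapsto> [a\<^sub>\<lambda> _]\<close>.\<close>

type_synonym ('f, 'r) conf_alg = "('f, 'r, 'r) conf_module"

definition is_dmod :: "('f::field_char_0, 'm::ab_group_add, 'z) dmod_scheme \<Rightarrow> bool"
  where "is_dmod M \<longleftrightarrow>
    vector_space (scl M) \<and> Vector_Spaces.linear (scl M) (scl M) (der M)"

text \<open>\<open>a\<^sub>q p\<close>, the \<open>\<lambda>\<close>-action of \<open>a\<close> with \<open>\<lambda> = q\<close>, extended to polynomials \<open>p\<close>.\<close>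

definition lact ::
    "('f::comm_ring_1, 'r, 'm::comm_monoid_add) conf_module \<Rightarrow> 'r \<Rightarrow> 'f lpoly \<Rightarrow> 'm lpoly \<Rightarrow> 'm lpoly"
  where "lact M a q p =
    (\<Sum>t\<in>Poly_Mapping.keys p.
      lmult (scl M) (Poly_Mapping.single t 1)
        (leval (scl M) (act M a (Poly_Mapping.lookup p t)) q))"

text \<open>The axioms of the action; in the last one \<open>\<lambda>\<close> is \<^term>\<open>lam 0\<close> and \<open>\<mu>\<close> is \<^term>\<open>lam 1\<close>.\<close>

definition is_conf_action ::
    "('f::field_char_0, 'r::ab_group_add) conf_alg \<Rightarrow> ('f, 'r, 'm::ab_group_add) conf_module \<Rightarrow> bool"
  where "is_conf_action R M \<longleftrightarrow>
    (\<forall>a b m. act M (a + b) m = act M a m + act M b m) \<and>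
    (\<forall>a m k. act M a (m + k) = act M a m + act M a k) \<and>
    (\<forall>x a m. act M (scl R x a) m = map_poly (scl M x) (act M a m)) \<and>
    (\<forall>x a m. act M a (scl M x m) = map_poly (scl M x) (act M a m)) \<and>
    (\<forall>a m. act M (der R a) m = - pCons 0 (act M a m)) \<and>
    (\<forall>a m. act M a (der M m) = pCons 0 (act M a m) + map_poly (der M) (act M a m)) \<and>
    (\<forall>a b m.
      lact M a (lam 0) (lact M b (lam 1) (Poly_Mapping.single 0 m)) -
      lact M b (lam 1) (lact M a (lam 0) (Poly_Mapping.single 0 m)) =
      (\<Sum>k\<le>degree (act R a b).
        lmult (scl M) (lam 0 ^ k)
          (lact M (coeff (act R a b) k) (lam 0 + lam 1) (Poly_Mapping.single 0 m))))"

definition is_lca :: "('f::field_char_0, 'r::ab_group_add) conf_alg \<Rightarrow> bool"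
  where "is_lca R \<longleftrightarrow>
    is_dmod R \<and> is_conf_action R R \<and>
    (\<forall>a b. act R a b =
      - (\<Sum>k\<le>degree (act R b a).
          ((\<lambda>P. - pCons 0 P - map_poly (der R) P) ^^ k) [:coeff (act R b a) k:]))"

section \<open>The LCA complex\<close>

text \<open>
  The variables \<open>\<lambda>\<^sub>1, \<dots>, \<lambda>\<^sub>n\<close> of an \<open>n\<close>-cochain are \<^term>\<open>lam 0\<close>, \<open>\<dots>\<close>, \<^term>\<open>lam (n - 1)\<close>.
  A linear map on \<open>R\<^sup>\<otimes>\<^sup>n\<close> is given by its values \<^term>\<open>Y [a\<^sub>1, a\<^sub>2]\<close>, \<open>\<dots>\<close> on pure tensors, i.e. as a
  multilinear function on lists of length \<open>n\<close>.
\<close>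

definition lspace :: "('f, 'm::comm_monoid_add, 'z) dmod_scheme \<Rightarrow> nat \<Rightarrow> ('f, 'm lpoly) module"
  where "lspace M n =
    \<lparr>carrier = lpolys n, monoid.mult = undefined, one = undefined,
     zero = 0, add = (+), module.smult = (\<lambda>x. Poly_Mapping.map (scl M x))\<rparr>"

definition lrel :: "('f::comm_ring_1, 'm::comm_monoid_add, 'z) dmod_scheme \<Rightarrow> nat \<Rightarrow> 'm lpoly set"
  where "lrel M n =
    (\<lambda>p. Poly_Mapping.map (der M) p + lmult (scl M) (\<Sum>i<n. lam i) p) ` lpolys n"

definition lquot ::
    "('f::comm_ring_1, 'm::comm_monoid_add, 'z) dmod_scheme \<Rightarrow> nat \<Rightarrow> ('f, 'm lpoly set) module"
  where "lquot M n = quot_space (lspace M n) (lrel M n)"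

definition lcoset ::
    "('f::comm_ring_1, 'm::comm_monoid_add, 'z) dmod_scheme \<Rightarrow> nat \<Rightarrow> 'm lpoly \<Rightarrow> 'm lpoly set"
  where "lcoset M n p = lrel M n +>\<^bsub>lspace M n\<^esub> p"

definition lc_cochains ::
    "('f::field_char_0, 'r::ab_group_add) conf_alg \<Rightarrow> ('f, 'r, 'm::ab_group_add) conf_module \<Rightarrow> nat
      \<Rightarrow> ('r list \<Rightarrow> 'm lpoly set) set"
  where "lc_cochains R M n =
    {Y \<in> {as. length as = n} \<rightarrow>\<^sub>E carrier (lquot M n).
      (\<forall>as i a b. length as = n \<and> i < n \<longrightarrow>
        Y (as[i := a + b]) = Y (as[i := a]) \<oplus>\<^bsub>lquot M n\<^esub> Y (as[i := b])) \<and>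
      (\<forall>as i x a. length as = n \<and> i < n \<longrightarrow>
        Y (as[i := scl R x a]) = x \<odot>\<^bsub>lquot M n\<^esub> Y (as[i := a])) \<and>
      (\<forall>as i a. length as = n \<and> i < n \<longrightarrow>
        Y (as[i := der R a]) = lcoset M n (- lmult (scl M) (lam i) (rep (Y (as[i := a]))))) \<and>
      (\<forall>as \<pi>. length as = n \<and> \<pi> permutes {..<n} \<longrightarrow>
        lcoset M n (lsubst (scl M) (\<lambda>k. lam (\<pi> k)) (rep (Y (permute_list \<pi> as)))) =
        of_int (sign \<pi>) \<odot>\<^bsub>lquot M n\<^esub> Y as)}"

definition lc_complex ::
    "('f::field_char_0, 'r::ab_group_add) conf_alg \<Rightarrow> ('f, 'r, 'm::ab_group_add) conf_module \<Rightarrow> nat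
      \<Rightarrow> ('f, 'r list \<Rightarrow> 'm lpoly set) module"
  where "lc_complex R M n =
    \<lparr>carrier = lc_cochains R M n, monoid.mult = undefined, one = undefined,
     zero = (\<lambda>as\<in>{as. length as = n}. \<zero>\<^bsub>lquot M n\<^esub>),
     add = (\<lambda>Y Z. \<lambda>as\<in>{as. length as = n}. Y as \<oplus>\<^bsub>lquot M n\<^esub> Z as),
     module.smult = (\<lambda>x Y. \<lambda>as\<in>{as. length as = n}. x \<odot>\<^bsub>lquot M n\<^esub> Y as)\<rparr>"

text \<open>
  \<^term>\<open>omit n I\<close> lists the indices \<open>0, \<dots>, n\<close> outside \<open>I\<close>. In the second sum,
  \<open>[a\<^sub>i \<^sub>\<lambda>\<^sub>i a\<^sub>j]\<close> is expanded in powers of \<open>\<lambda>\<^sub>i\<close>.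
\<close>

definition omit :: "nat \<Rightarrow> nat set \<Rightarrow> nat list"
  where "omit n I = filter (\<lambda>k. k \<notin> I) [0..<Suc n]"

definition lc_diff ::
    "('f::field_char_0, 'r::ab_group_add) conf_alg \<Rightarrow> ('f, 'r, 'm::ab_group_add) conf_module \<Rightarrow> nat
      \<Rightarrow> ('r list \<Rightarrow> 'm lpoly set) \<Rightarrow> ('r list \<Rightarrow> 'm lpoly set)"
  where "lc_diff R M n Y = (\<lambda>as\<in>{as. length as = Suc n}. lcoset M (Suc n)
    ((\<Sum>i\<le>n. lmult (scl M) ((-1) ^ (n + i + 1))
        (lact M (as ! i) (lam i)
          (lsubst (scl M) (\<lambda>k. lam (omit n {i} ! k))
            (rep (Y (map ((!) as) (omit n {i}))))))) +
     (\<Sum>j\<le>n. \<Sum>i<j. \<Sum>k\<le>degree (act R (as ! i) (as ! j)).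
        lmult (scl M) ((-1) ^ (n + i + j + 1) * lam i ^ k)
          (lsubst (scl M)
            (\<lambda>l. case l of 0 \<Rightarrow> lam i + lam j | Suc l' \<Rightarrow> lam (omit n {i, j} ! l'))
            (rep (Y (coeff (act R (as ! i) (as ! j)) k # map ((!) as) (omit n {i, j}))))))))"

section \<open>Poisson vertex algebras and the variational complex\<close>

definition is_pva :: "('f::field_char_0, 'v::comm_ring_1) conf_alg \<Rightarrow> bool"
  where "is_pva V \<longleftrightarrow>
    is_lca V \<and>
    (\<forall>x a b. scl V x (a * b) = scl V x a * b) \<and>
    (\<forall>a b. der V (a * b) = der V a * b + a * der V b) \<and>
    (\<forall>a b c. act V a (b * c) = Polynomial.smult c (act V a b) + Polynomial.smult b (act V a c))"

text \<open>\<open>(e\<^bsup>\<partial>\<partial>\<^sub>i\<^esup> b) p\<close> with \<open>\<partial>\<^sub>i = \<partial>/\<partial>\<lambda>\<^sub>i\<close>; only finitely many terms are nonzero.\<close>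

definition exp_mult :: "('f::field_char_0, 'v::comm_ring_1, 'z) dmod_scheme \<Rightarrow> nat \<Rightarrow> 'v \<Rightarrow> 'v lpoly \<Rightarrow> 'v lpoly"
  where "exp_mult V i b p =
    Sum_any (\<lambda>k. Poly_Mapping.map (scl V (1 / fact k))
      (Poly_Mapping.single 0 ((der V ^^ k) b) * (lderiv i ^^ k) p))"

definition pv_complex ::
    "('f::field_char_0, 'v::comm_ring_1) conf_alg \<Rightarrow> nat \<Rightarrow> ('f, 'v list \<Rightarrow> 'v lpoly set) module"
  where "pv_complex V n = (lc_complex V V n)
    \<lparr>carrier := {Y \<in> lc_cochains V V n.
      \<forall>as i b c. length as = n \<and> i < n \<longrightarrow>
        Y (as[i := b * c]) =
          lcoset V n (exp_mult V i b (rep (Y (as[i := c]))) + exp_mult V i c (rep (Y (as[i := b]))))}\<rparr>"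

abbreviation H_LC ::
    "('f::field_char_0, 'r::ab_group_add) conf_alg \<Rightarrow> ('f, 'r, 'm::ab_group_add) conf_module \<Rightarrow> nat
      \<Rightarrow> ('f, ('r list \<Rightarrow> 'm lpoly set) set) module"
  where "H_LC R M \<equiv> cohomology (lc_complex R M) (lc_diff R M)"

abbreviation H_PV ::
    "('f::field_char_0, 'v::comm_ring_1) conf_alg \<Rightarrow> nat \<Rightarrow> ('f, ('v list \<Rightarrow> 'v lpoly set) set) module"
  where "H_PV V \<equiv> cohomology (pv_complex V) (lc_diff V V)"

definition determined_cochain ::
    "('f, 'r list \<Rightarrow> 'm lpoly set) module \<Rightarrow> 'r list \<Rightarrow> 'm lpoly set \<Rightarrow> ('r list \<Rightarrow> 'm lpoly set) \<Rightarrow> bool"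
  where "determined_cochain C as A Y \<longleftrightarrow>
    Y \<in> carrier C \<and> Y as = A \<and> (\<forall>Z\<in>carrier C. Z as = A \<longrightarrow> Z = Y)"

section \<open>The Virasoro examples\<close>

text \<open>\<open>\<F>[L\<^sup>(\<^sup>n\<^sup>) | n \<ge> 0]\<close>, where the \<open>n\<close>-th variable stands for \<open>L\<^sup>(\<^sup>n\<^sup>)\<close>.\<close>

type_synonym 'f vir = "(nat \<Rightarrow>\<^sub>0 nat) \<Rightarrow>\<^sub>0 'f"

definition virL :: "nat \<Rightarrow> 'f::field_char_0 vir"
  where "virL n = Poly_Mapping.single (Poly_Mapping.single n 1) 1"

definition vir_der :: "'f::field_char_0 vir \<Rightarrow> 'f vir"
  where "vir_der p =
    (\<Sum>t\<in>Poly_Mapping.keys p. \<Sum>i\<in>Poly_Mapping.keys t.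
      Poly_Mapping.single (t - Poly_Mapping.single i 1 + Poly_Mapping.single (Suc i) 1)
        (of_nat (Poly_Mapping.lookup t i) * Poly_Mapping.lookup p t))"

text \<open>
  The bracket is not given by a formula: a PVA bracket on this differential algebra is
  determined by \<open>[L\<^sub>\<lambda> L]\<close>, so at most one \<open>V\<close> satisfies the predicate for a given \<open>c\<close>.
\<close>

definition is_virasoro_pva :: "'f::field_char_0 \<Rightarrow> ('f, 'f vir) conf_alg \<Rightarrow> bool"
  where "is_virasoro_pva c V \<longleftrightarrow>
    is_pva V \<and>
    scl V = (\<lambda>x p. Poly_Mapping.single 0 x * p) \<and>
    der V = vir_der \<and>
    act V (virL 0) (virL 0) =
      [:der V (virL 0), 2 * virL 0:] + monom (Poly_Mapping.single 0 (c / 12)) 3"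

text \<open>
  \<open>\<F>[\<partial>]L\<close> is \<^typ>\<open>'f poly\<close> with \<open>L = 1\<close>. Sesquilinearity turns \<open>[L\<^sub>\<lambda> L] = (\<partial> + 2\<lambda>)L\<close> into
  \<open>[f(\<partial>)L\<^sub>\<lambda> g(\<partial>)L] = f(-\<lambda>) g(\<partial> + \<lambda>) (\<partial> + 2\<lambda>)L\<close>.
\<close>

definition rvir :: "('f::field_char_0, 'f poly) conf_alg"
  where "rvir =
    \<lparr>scl = Polynomial.smult, der = pCons 0,
     act = (\<lambda>f g.
       poly (map_poly (\<lambda>x. [:[:x:]:]) f) [:0, -1:] *
       poly (map_poly (\<lambda>x. [:[:x:]:]) g) [:[:0, 1:], 1:] *
       [:[:0, 1:], 2:])\<rparr>"

lemma act_rvir_L_L: "act rvir 1 1 = [:der rvir 1, 2 * 1:]"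
  by (simp add: rvir_def one_pCons numeral_poly map_poly_pCons)

lemma act_rvir_der_left: "act rvir (der rvir f) g = - pCons 0 (act rvir f g)"
  by (simp add: rvir_def map_poly_pCons algebra_simps)

lemma act_rvir_der_right:
  "act rvir f (der rvir g) = pCons 0 (act rvir f g) + map_poly (der rvir) (act rvir f g)"
proof -
  have *: "pCons 0 P + map_poly (pCons 0) P = [:[:0, 1:], 1:] * P" for P :: "'a poly poly"
    by (rule poly_eqI) (simp add: coeff_map_poly coeff_pCons algebra_simps split: nat.split)
  have "poly (map_poly (\<lambda>x. [:[:x:]:]) (pCons 0 g)) q = q * poly (map_poly (\<lambda>x. [:[:x:]:]) g) q"
    for q :: "'a poly poly"
    by (simp add: map_poly_pCons)
  then show ?thesis
    unfolding rvir_def by (simp only: conf_module.simps dmod.simps * ac_simps)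
qed

definition triv :: "('f::field_char_0, 'f poly, 'f) conf_module"
  where "triv = \<lparr>scl = (*), der = (\<lambda>_. 0), act = (\<lambda>_ _. 0)\<rparr>"

lemma is_dmod_rvir: "is_dmod rvir"
  by (auto simp: is_dmod_def rvir_def vector_space_def Vector_Spaces.linear_def module_hom_def
      module_hom_axioms_def Modules.module_def algebra_simps smult_add_left smult_add_right)

lemma is_dmod_triv: "is_dmod triv"
  by (auto simp: is_dmod_def triv_def vector_space_def Vector_Spaces.linear_def module_hom_def
      module_hom_axioms_def Modules.module_def algebra_simps)

lemma is_conf_action_triv: "is_conf_action rvir triv"
proof -
  have "lact triv a q p = 0" for a :: "'a poly" and q p
    by (simp add: lact_def triv_def leval_def lmult_def)
  then show ?thesis
    by (simp add: is_conf_action_def) (simp add: triv_def lmult_def)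
qed

end

theory Submission
  imports Defs
begin

text \<open>
  Both complexes have cochains determined by their value on copies of \<open>L\<close>, a skewsymmetric polynomial
  \<open>P(\<lambda>\<^sub>1, \<dots>, \<lambda>\<^sub>n)\<close> with coefficients in a module \<open>M\<close> of the Lie algebra spanned by
  \<open>L\<^sub>\<lambda>\<close> and \<open>[L\<^sub>\<lambda>, L\<^sub>\<mu>] = (\<lambda> - \<mu>) L\<^bsub>\<lambda>+\<mu>\<^esub>\<close>, where \<open>M = \<F>\<close> or \<open>M = Vir\<^sup>c\<close>. The differential
  becomes the Chevalley-Eilenberg differential of this Lie algebra, on polynomials modulo the image of
  \<open>\<partial> + \<lambda>\<^sub>1 + \<dots> + \<lambda>\<^sub>n\<close>, the Lie derivative along \<open>L\<^sub>0\<close>. By Cartan's formula for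
  \<open>L\<^sub>(\<^sub>1\<^sub>) = d/d\<lambda> L\<^sub>\<lambda>\<close> at \<open>\<lambda> = 0\<close>, the unreduced complex is exact outside total degree
  (conformal weight plus polynomial degree) \<open>n\<close>. A nonzero skewsymmetric polynomial in \<open>n\<close> variables
  has degree at least \<open>n(n - 1)/2\<close>, and \<open>M\<close> has no weight \<open>1\<close> and only constants in weight \<open>0\<close>,
  so few classes are left to inspect, and these do not depend on \<open>M\<close> or on \<open>c\<close>.

  For the PVA complex, a cochain is recovered from its values on \<open>L\<close> because in each slot it is a map
  determined by sesquilinearity and the Leibniz rule; the differential preserves this property, so
  it suffices to compute it on \<open>L\<close>.
\<close>

section \<open>Vector space records and their quotients\<close>

text \<open>The complexes are quotients: a cocycle is given by P with dP = DQ, where D is \<partial>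
  plus the sum of the variables. In at least one variable D is injective, and it commutes with d, so
  Q is closed as well; d and D both raise the total degree N by one, so P and Q share the same N.
  Cartan's formula makes Q exact unless N = n + 1, and then P is exact modulo D unless N = n. Hence
  a class can live only in the total degrees n and n + 1. The central term of [L_\<lambda> L] is a
  scalar. Scalars act by zero, and the Leibniz rule forces a cochain with an entry 1 to vanish; what
  remains of c, in the action of L on coefficients, only affects scalars whose value never matters.
  Two devices shape the proof. Polynomials are compared through their values at scalar points, where
  L_\<lambda> becomes a family of operators and d acts on functions of lists. And a cochain value is
  only a coset, skewsymmetric modulo the image of D; averaging over permutations, possible in
  characteristic 0, produces a truly skewsymmetric representative.\<close>

locale vsp =
  fixes V :: "('f::field, 'v) module" (structure)
  assumes zero_closed: "\<zero> \<in> carrier V"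
    and add_closed: "u \<in> carrier V \<Longrightarrow> v \<in> carrier V \<Longrightarrow> u \<oplus> v \<in> carrier V"
    and smult_closed: "v \<in> carrier V \<Longrightarrow> x \<odot> v \<in> carrier V"
    and add_assoc: "u \<in> carrier V \<Longrightarrow> v \<in> carrier V \<Longrightarrow> w \<in> carrier V \<Longrightarrow>
      (u \<oplus> v) \<oplus> w = u \<oplus> (v \<oplus> w)"
    and add_comm: "u \<in> carrier V \<Longrightarrow> v \<in> carrier V \<Longrightarrow> u \<oplus> v = v \<oplus> u"
    and zero_add: "v \<in> carrier V \<Longrightarrow> \<zero> \<oplus> v = v"
    and add_neg: "v \<in> carrier V \<Longrightarrow> v \<oplus> (- 1) \<odot> v = \<zero>"
    and smult_add: "u \<in> carrier V \<Longrightarrow> v \<in> carrier V \<Longrightarrow> x \<odot> (u \<oplus> v) = x \<odot> u \<oplus> x \<odot> v"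
    and add_smult: "v \<in> carrier V \<Longrightarrow> (x + y) \<odot> v = x \<odot> v \<oplus> y \<odot> v"
    and smult_smult: "v \<in> carrier V \<Longrightarrow> x \<odot> (y \<odot> v) = (x * y) \<odot> v"
    and smult_one: "v \<in> carrier V \<Longrightarrow> 1 \<odot> v = v"
begin

lemma add_left_comm:
  "u \<in> carrier V \<Longrightarrow> v \<in> carrier V \<Longrightarrow> w \<in> carrier V \<Longrightarrow> u \<oplus> (v \<oplus> w) = v \<oplus> (u \<oplus> w)"
  by (metis add_assoc add_comm)

lemma add_zero: "v \<in> carrier V \<Longrightarrow> v \<oplus> \<zero> = v"
  using add_comm[OF _ zero_closed] zero_add by simp

lemma zero_smult: "v \<in> carrier V \<Longrightarrow> 0 \<odot> v = \<zero>"
  by (metis add.right_inverse add_neg add_smult smult_one)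

lemma smult_zero: "x \<odot> \<zero> = \<zero>"
  by (metis mult_zero_right smult_smult zero_closed zero_smult)

lemma neg_add: "v \<in> carrier V \<Longrightarrow> (- 1) \<odot> v \<oplus> v = \<zero>"
  by (metis add_comm add_neg smult_closed)

lemma smult_eq_zeroD:
  assumes "v \<in> carrier V" "x \<odot> v = \<zero>" "x \<noteq> 0"
  shows "v = \<zero>"
proof -
  have "v = (inverse x * x) \<odot> v"
    using assms by (simp add: smult_one)
  also have "\<dots> = inverse x \<odot> (x \<odot> v)"
    using assms(1) by (simp only: smult_smult)
  also have "\<dots> = inverse x \<odot> \<zero>"
    by (simp only: assms(2))
  finally show ?thesis
    by (simp add: smult_zero)
qed

lemma smult_left_inject:
  assumes "v \<in> carrier V" "v \<noteq> \<zero>" "x \<odot> v = y \<odot> v"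
  shows "x = y"
proof (rule ccontr)
  assume "x \<noteq> y"
  moreover have "(x - y) \<odot> v = \<zero>"
  proof -
    have "(x + (- 1) * y) \<odot> v = y \<odot> v \<oplus> (- 1) \<odot> (y \<odot> v)"
      using assms by (simp only: add_smult smult_smult)
    then show ?thesis
      using assms by (simp add: add_neg smult_closed)
  qed
  ultimately show False
    using assms smult_eq_zeroD by auto
qed

end

text \<open>The two cohomologies are compared without a chain map: both are computed, and spaces
  spanned by one nonzero vector are matched through their generators.\<close>

lemma lin_isomorphic_lines:
  assumes "vsp V" "is_line_on V v" "vsp W" "is_line_on W w"
  shows "lin_isomorphic V W"
proof -
  interpret V: vsp V by fact
  interpret W: vsp W by fact
  have v: "v \<in> carrier V" "v \<noteq> \<zero>\<^bsub>V\<^esub>" "carrier V = {x \<odot>\<^bsub>V\<^esub> v | x. True}"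
    and w: "w \<in> carrier W" "w \<noteq> \<zero>\<^bsub>W\<^esub>" "carrier W = {x \<odot>\<^bsub>W\<^esub> w | x. True}"
    using assms by (auto simp: is_line_on_def)
  \<comment> \<open>\<open>h\<close> transports the coordinate with respect to v, which is unique
    because v is nonzero.\<close>
  define h where "h u = (THE x. u = x \<odot>\<^bsub>V\<^esub> v) \<odot>\<^bsub>W\<^esub> w" for u
  have h: "h (x \<odot>\<^bsub>V\<^esub> v) = x \<odot>\<^bsub>W\<^esub> w" for x
    unfolding h_def using V.smult_left_inject[OF v(1,2)] by (intro arg_cong2[of _ _ _ _ "(\<odot>\<^bsub>W\<^esub>)"]) auto
  have "bij_betw h (carrier V) (carrier W)"
    unfolding bij_betw_def
  proof
    show "inj_on h (carrier V)"
      using W.smult_left_inject[OF w(1,2)] by (fastforce simp: inj_on_def v(3) h)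
    show "h ` carrier V = carrier W"
      by (auto simp: v(3) w(3) h image_iff) (metis h)
  qed
  moreover have "h (u \<oplus>\<^bsub>V\<^esub> u') = h u \<oplus>\<^bsub>W\<^esub> h u'" if "u \<in> carrier V" "u' \<in> carrier V" for u u'
    using that by (auto simp: v(3) h W.add_smult[OF w(1), symmetric] V.add_smult[OF v(1), symmetric])
  moreover have "h (x \<odot>\<^bsub>V\<^esub> u) = x \<odot>\<^bsub>W\<^esub> h u" if "u \<in> carrier V" for x u
    using that by (auto simp: v(3) h W.smult_smult[OF w(1)] V.smult_smult[OF v(1)])
  ultimately show ?thesis
    unfolding lin_isomorphic_def by blast
qed

lemma lin_isomorphic_zero:
  assumes "vsp V" "carrier V = {\<zero>\<^bsub>V\<^esub>}" "vsp W" "carrier W = {\<zero>\<^bsub>W\<^esub>}"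
  shows "lin_isomorphic V W"
  unfolding lin_isomorphic_def
proof (intro exI conjI)
  show "bij_betw (\<lambda>_. \<zero>\<^bsub>W\<^esub>) (carrier V) (carrier W)"
    by (simp add: assms bij_betw_def)
qed (use vsp.zero_add[OF assms(3) vsp.zero_closed[OF assms(3)]] vsp.smult_zero[OF assms(3)] in auto)

locale subsp = vsp +
  fixes U
  assumes sub: "U \<subseteq> carrier V"
    and zero_mem: "\<zero> \<in> U"
    and add_mem: "u \<in> U \<Longrightarrow> v \<in> U \<Longrightarrow> u \<oplus> v \<in> U"
    and smult_mem: "v \<in> U \<Longrightarrow> x \<odot> v \<in> U"
begin

lemma mem_coset_iff: "w \<in> U +> v \<longleftrightarrow> (\<exists>u\<in>U. w = u \<oplus> v)"
  by (auto simp: a_r_coset_def')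

lemma coset_self: "v \<in> carrier V \<Longrightarrow> v \<in> U +> v"
  unfolding mem_coset_iff using zero_add[symmetric] zero_mem by blast

text \<open>The choice made by \<open>rep\<close> enters only through this fact, so a map given on
  representatives is well defined once translating its argument by U does not change the coset of
  the result.\<close>

lemma rep_coset:
  assumes "v \<in> carrier V"
  shows "\<exists>u\<in>U. rep (U +> v) = u \<oplus> v"
  using someI[of "\<lambda>w. w \<in> U +> v", OF coset_self[OF assms]]
  unfolding rep_def mem_coset_iff .

lemma coset_add_mem:
  assumes "u \<in> U" "v \<in> carrier V"
  shows "U +> (u \<oplus> v) = U +> v"
proof (rule Set.set_eqI)
  fix w
  have u: "u \<in> carrier V" using assms sub by auto
  show "w \<in> U +> (u \<oplus> v) \<longleftrightarrow> w \<in> U +> v"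
  proof
    assume "w \<in> U +> (u \<oplus> v)"
    then obtain u' where "u' \<in> U" "w = u' \<oplus> (u \<oplus> v)" by (auto simp: mem_coset_iff)
    then have "w = (u' \<oplus> u) \<oplus> v" "u' \<oplus> u \<in> U"
      using assms sub u add_mem by (auto simp: add_assoc)
    then show "w \<in> U +> v"
      unfolding mem_coset_iff by blast
  next
    assume "w \<in> U +> v"
    then obtain u' where u': "u' \<in> U" "w = u' \<oplus> v" by (auto simp: mem_coset_iff)
    then have c: "u' \<in> carrier V" using sub by auto
    have "(u' \<oplus> (- 1) \<odot> u) \<oplus> (u \<oplus> v) = u' \<oplus> (((- 1) \<odot> u \<oplus> u) \<oplus> v)"
      using u c assms by (simp add: add_assoc add_closed smult_closed)
    also have "\<dots> = w"
      using u c assms u' by (simp add: neg_add zero_add)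
    finally have "w = (u' \<oplus> (- 1) \<odot> u) \<oplus> (u \<oplus> v)" by (rule sym)
    then show "w \<in> U +> (u \<oplus> v)"
      unfolding mem_coset_iff using add_mem[OF u'(1) smult_mem[OF assms(1)]] by blast
  qed
qed

lemma coset_eq_iff:
  assumes "v \<in> carrier V" "w \<in> carrier V"
  shows "U +> v = U +> w \<longleftrightarrow> v \<oplus> (- 1) \<odot> w \<in> U"
proof
  assume "U +> v = U +> w"
  then obtain u where u: "u \<in> U" "v = u \<oplus> w"
    using coset_self[OF assms(1)] by (auto simp: mem_coset_iff)
  moreover have "u \<oplus> w \<oplus> (- 1) \<odot> w = u"
    using u subsetD[OF sub u(1)] assms by (simp add: add_assoc add_neg smult_closed add_zero)
  ultimately show "v \<oplus> (- 1) \<odot> w \<in> U" by simp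
next
  assume *: "v \<oplus> (- 1) \<odot> w \<in> U"
  have "v = (v \<oplus> (- 1) \<odot> w) \<oplus> w"
    using assms by (simp add: add_assoc neg_add smult_closed add_zero)
  then show "U +> v = U +> w"
    using coset_add_mem[OF * assms(2)] by simp
qed

lemma coset_zero: "U +> \<zero> = U"
  using subsetD[OF sub] add_zero by (auto simp: mem_coset_iff)

lemma coset_eq_sub_iff:
  assumes "v \<in> carrier V"
  shows "U +> v = U \<longleftrightarrow> v \<in> U"
proof
  assume "U +> v = U"
  then show "v \<in> U" using coset_self[OF assms] by simp
next
  assume "v \<in> U"
  from coset_add_mem[OF this zero_closed] show "U +> v = U"
    by (simp only: coset_zero add_zero[OF assms])
qed

lemma coset_add:
  assumes "v \<in> carrier V" "w \<in> carrier V"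
  shows "(U +> v) <+> (U +> w) = U +> (v \<oplus> w)"
proof (rule Set.set_eqI)
  fix z
  show "z \<in> (U +> v) <+> (U +> w) \<longleftrightarrow> z \<in> U +> (v \<oplus> w)"
  proof
    assume "z \<in> (U +> v) <+> (U +> w)"
    then obtain a b where ab: "a \<in> U" "b \<in> U" "z = (a \<oplus> v) \<oplus> (b \<oplus> w)"
      by (auto simp: set_add_def' mem_coset_iff)
    then have "a \<in> carrier V" "b \<in> carrier V" using sub by auto
    then have "z = (a \<oplus> b) \<oplus> (v \<oplus> w)"
      using ab assms by (simp add: add_assoc add_left_comm add_closed)
    then show "z \<in> U +> (v \<oplus> w)"
      using ab add_mem by (auto simp: mem_coset_iff)
  next
    assume "z \<in> U +> (v \<oplus> w)"
    then obtain a where a: "a \<in> U" "z = a \<oplus> (v \<oplus> w)" by (auto simp: mem_coset_iff)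
    then have "z = (a \<oplus> v) \<oplus> w" using sub assms by (auto simp: add_assoc)
    then show "z \<in> (U +> v) <+> (U +> w)"
      unfolding set_add_def' using a coset_self[OF assms(2)] mem_coset_iff[of "a \<oplus> v" v] by blast
  qed
qed

lemma quot_smult:
  assumes "v \<in> carrier V"
  shows "U +> (x \<odot> rep (U +> v)) = U +> (x \<odot> v)"
proof -
  obtain u where u: "u \<in> U" "rep (U +> v) = u \<oplus> v" using rep_coset[OF assms] by auto
  then have "x \<odot> rep (U +> v) = x \<odot> u \<oplus> x \<odot> v"
    using assms sub by (auto simp: smult_add)
  then show ?thesis
    using coset_add_mem[OF smult_mem[OF u(1)] smult_closed[OF assms]] by simp
qed

lemma carrier_quot: "carrier (quot_space V U) = {U +> v | v. v \<in> carrier V}"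
  by (auto simp: quot_space_def A_RCOSETS_def')

lemma zero_quot: "\<zero>\<^bsub>quot_space V U\<^esub> = U"
  by (simp add: quot_space_def)

lemma add_quot: "v \<in> carrier V \<Longrightarrow> w \<in> carrier V \<Longrightarrow>
    (U +> v) \<oplus>\<^bsub>quot_space V U\<^esub> (U +> w) = U +> (v \<oplus> w)"
  by (simp add: quot_space_def coset_add)

lemma smult_quot: "v \<in> carrier V \<Longrightarrow> x \<odot>\<^bsub>quot_space V U\<^esub> (U +> v) = U +> (x \<odot> v)"
  by (simp add: quot_space_def quot_smult)

lemma vsp_quot: "vsp (quot_space V U)"
proof
  let ?Q = "quot_space V U"
  show "\<zero>\<^bsub>?Q\<^esub> \<in> carrier ?Q"
    using coset_zero zero_closed by (auto simp: carrier_quot zero_quot)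
  fix u assume "u \<in> carrier ?Q"
  then obtain a where a: "a \<in> carrier V" "u = U +> a" by (auto simp: carrier_quot)
  show "\<zero>\<^bsub>?Q\<^esub> \<oplus>\<^bsub>?Q\<^esub> u = u"
    using a add_quot[OF zero_closed a(1)] by (simp add: zero_quot coset_zero zero_add)
  show "u \<oplus>\<^bsub>?Q\<^esub> (- 1) \<odot>\<^bsub>?Q\<^esub> u = \<zero>\<^bsub>?Q\<^esub>"
    using a by (simp add: smult_quot add_quot smult_closed add_neg coset_zero zero_quot)
  show "1 \<odot>\<^bsub>?Q\<^esub> u = u"
    using a by (simp add: smult_quot smult_one)
  fix x
  show "x \<odot>\<^bsub>?Q\<^esub> u \<in> carrier ?Q"
    using a smult_closed by (auto simp: smult_quot carrier_quot)
  fix y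
  show "(x + y) \<odot>\<^bsub>?Q\<^esub> u = x \<odot>\<^bsub>?Q\<^esub> u \<oplus>\<^bsub>?Q\<^esub> y \<odot>\<^bsub>?Q\<^esub> u"
    using a by (simp add: smult_quot add_quot smult_closed add_smult)
  show "x \<odot>\<^bsub>?Q\<^esub> (y \<odot>\<^bsub>?Q\<^esub> u) = (x * y) \<odot>\<^bsub>?Q\<^esub> u"
    using a by (simp add: smult_quot smult_closed smult_smult)
next
  let ?Q = "quot_space V U"
  fix u v assume "u \<in> carrier ?Q" "v \<in> carrier ?Q"
  then obtain a b where a: "a \<in> carrier V" "u = U +> a" "b \<in> carrier V" "v = U +> b"
    by (auto simp: carrier_quot)
  show "u \<oplus>\<^bsub>?Q\<^esub> v \<in> carrier ?Q"
    using a add_closed by (auto simp: add_quot carrier_quot)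
  show "u \<oplus>\<^bsub>?Q\<^esub> v = v \<oplus>\<^bsub>?Q\<^esub> u"
    using a add_comm by (simp add: add_quot)
  show "x \<odot>\<^bsub>?Q\<^esub> (u \<oplus>\<^bsub>?Q\<^esub> v) = x \<odot>\<^bsub>?Q\<^esub> u \<oplus>\<^bsub>?Q\<^esub> x \<odot>\<^bsub>?Q\<^esub> v" for x
    using a by (simp add: smult_quot add_quot add_closed smult_closed smult_add)
  fix w assume "w \<in> carrier ?Q"
  then obtain c where "c \<in> carrier V" "w = U +> c" by (auto simp: carrier_quot)
  then show "(u \<oplus>\<^bsub>?Q\<^esub> v) \<oplus>\<^bsub>?Q\<^esub> w = u \<oplus>\<^bsub>?Q\<^esub> (v \<oplus>\<^bsub>?Q\<^esub> w)"
    using a by (simp add: add_quot add_closed add_assoc)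
qed

end

section \<open>Evaluation of polynomials in several variables\<close>

definition mon :: "(nat \<Rightarrow> 's::comm_monoid_mult) \<Rightarrow> (nat \<Rightarrow>\<^sub>0 nat) \<Rightarrow> 's"
  where "mon \<phi> t = (\<Prod>k\<in>Poly_Mapping.keys t. \<phi> k ^ Poly_Mapping.lookup t k)"

lemma mon_superset:
  assumes "finite A" "Poly_Mapping.keys t \<subseteq> A"
  shows "mon \<phi> t = (\<Prod>k\<in>A. \<phi> k ^ Poly_Mapping.lookup t k)"
  unfolding mon_def using assms
  by (intro prod.mono_neutral_left) (auto simp: in_keys_iff)

lemma mon_zero [simp]: "mon \<phi> 0 = 1"
  by (simp add: mon_def)

lemma mon_single [simp]: "mon \<phi> (Poly_Mapping.single i m) = \<phi> i ^ m"
  by (cases "m = 0") (simp_all add: mon_def)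

lemma mon_add: "mon \<phi> (s + t) = mon \<phi> s * mon \<phi> t"
proof -
  let ?A = "Poly_Mapping.keys s \<union> Poly_Mapping.keys t"
  have "finite ?A" "Poly_Mapping.keys (s + t) \<subseteq> ?A"
    using keys_add[of s t] by auto
  then show ?thesis
    by (simp add: mon_superset[of ?A] lookup_add power_add prod.distrib)
qed

lemma mon_cong: "(\<And>k. k \<in> Poly_Mapping.keys t \<Longrightarrow> \<phi> k = \<psi> k) \<Longrightarrow> mon \<phi> t = mon \<psi> t"
  by (simp add: mon_def)

definition rhom :: "('m::comm_ring_1 \<Rightarrow> 's::comm_ring_1) \<Rightarrow> bool"
  where "rhom h \<longleftrightarrow> h 1 = 1 \<and> (\<forall>a b. h (a + b) = h a + h b) \<and> (\<forall>a b. h (a * b) = h a * h b)"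

lemma rhomD:
  assumes "rhom h"
  shows "h 0 = 0" "h 1 = 1" "h (a + b) = h a + h b" "h (a * b) = h a * h b" "h (- a) = - h a"
    "h (a - b) = h a - h b"
proof -
  interpret additive h by standard (use assms in \<open>auto simp: rhom_def\<close>)
  show "h 0 = 0" "h 1 = 1" "h (a + b) = h a + h b" "h (a * b) = h a * h b" "h (- a) = - h a"
    "h (a - b) = h a - h b"
    using assms by (auto simp: rhom_def zero minus diff)
qed

lemma rhom_of_nat: "rhom h \<Longrightarrow> h (of_nat n) = of_nat n"
  by (induction n) (auto simp: rhomD)

lemma rhom_power: "rhom h \<Longrightarrow> h (a ^ n) = h a ^ n"
  by (induction n) (auto simp: rhomD)

lemma rhom_prod: "rhom h \<Longrightarrow> h (prod f A) = (\<Prod>x\<in>A. h (f x))"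
  by (induction A rule: infinite_finite_induct) (auto simp: rhomD)

lemma rhom_sum: "rhom h \<Longrightarrow> h (sum f A) = (\<Sum>x\<in>A. h (f x))"
  by (induction A rule: infinite_finite_induct) (auto simp: rhomD)

lemma rhom_mon: "rhom h \<Longrightarrow> h (mon \<phi> t) = mon (\<lambda>k. h (\<phi> k)) t"
  by (simp add: mon_def rhom_prod rhom_power)

lemma rhom_id: "rhom (\<lambda>x. x)"
  by (simp add: rhom_def)

lemma rhom_single_zero: "rhom (Poly_Mapping.single (0 :: 'k::comm_monoid_add))"
  by (simp add: rhom_def single_add mult_single)

lemma rhom_const_poly: "rhom (\<lambda>a. [:a:])"
  by (simp add: rhom_def one_pCons)

lemma lpoly_sum_monomials:
  "(\<Sum>t\<in>Poly_Mapping.keys p. Poly_Mapping.single t (Poly_Mapping.lookup p t)) = p"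
proof (rule poly_mapping_eqI)
  fix k
  have "Poly_Mapping.lookup (\<Sum>t\<in>Poly_Mapping.keys p. Poly_Mapping.single t (Poly_Mapping.lookup p t)) k
    = (\<Sum>t\<in>Poly_Mapping.keys p. if t = k then Poly_Mapping.lookup p t else 0)"
    by (auto simp: lookup_sum lookup_single when_def intro!: sum.cong)
  also have "\<dots> = Poly_Mapping.lookup p k"
    by (auto simp: sum.delta in_keys_iff)
  finally show "Poly_Mapping.lookup (\<Sum>t\<in>Poly_Mapping.keys p. Poly_Mapping.single t (Poly_Mapping.lookup p t)) k
    = Poly_Mapping.lookup p k" .
qed

lemma sum_keys_superset:
  assumes "finite A" "Poly_Mapping.keys p \<subseteq> A" "\<And>t. f t 0 = 0"
  shows "(\<Sum>t\<in>Poly_Mapping.keys p. f t (Poly_Mapping.lookup p t)) = (\<Sum>t\<in>A. f t (Poly_Mapping.lookup p t))"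
  using assms by (intro sum.mono_neutral_left) (auto simp: in_keys_iff)

lemma sum_keys_add:
  fixes p q :: "'k \<Rightarrow>\<^sub>0 'm::ab_group_add"
  assumes "\<And>t a b. f t (a + b) = (f t a + f t b :: 'n::ab_group_add)"
  shows "(\<Sum>t\<in>Poly_Mapping.keys (p + q). f t (Poly_Mapping.lookup (p + q) t)) =
    (\<Sum>t\<in>Poly_Mapping.keys p. f t (Poly_Mapping.lookup p t)) +
    (\<Sum>t\<in>Poly_Mapping.keys q. f t (Poly_Mapping.lookup q t))"
proof -
  let ?A = "Poly_Mapping.keys p \<union> Poly_Mapping.keys q"
  have z: "f t 0 = 0" for t using assms[of t 0 0] by simp
  have A: "finite ?A" "Poly_Mapping.keys (p + q) \<subseteq> ?A" "Poly_Mapping.keys p \<subseteq> ?A" "Poly_Mapping.keys q \<subseteq> ?A"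
    using keys_add[of p q] by auto
  note S = sum_keys_superset[of ?A _ f, OF A(1) _ z]
  show ?thesis
    unfolding S[OF A(2)] S[OF A(3)] S[OF A(4)] by (simp add: lookup_add assms sum.distrib)
qed

lemma additive_lpoly_eqI:
  fixes f g :: "('k \<Rightarrow>\<^sub>0 'm::ab_group_add) \<Rightarrow> 'n::ab_group_add"
  assumes "additive f" "additive g" "\<And>t c. f (Poly_Mapping.single t c) = g (Poly_Mapping.single t c)"
  shows "f p = g p"
proof -
  interpret f: additive f by fact
  interpret g: additive g by fact
  have "f (\<Sum>t\<in>Poly_Mapping.keys p. Poly_Mapping.single t (Poly_Mapping.lookup p t)) =
    g (\<Sum>t\<in>Poly_Mapping.keys p. Poly_Mapping.single t (Poly_Mapping.lookup p t))"
    by (simp add: f.sum g.sum assms)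
  then show ?thesis by (simp add: lpoly_sum_monomials)
qed

text \<open>The homomorphism of the universal property of polynomial rings: \<open>h\<close> on
  coefficients, \<open>\<phi> i\<close> for the variable \<open>lam i\<close>. Evaluation at a
  point, separation of one variable and specialisation of all variables but one are
  instances.\<close>

definition lhom :: "('m::comm_ring_1 \<Rightarrow> 's::comm_ring_1) \<Rightarrow> (nat \<Rightarrow> 's) \<Rightarrow> 'm lpoly \<Rightarrow> 's"
  where "lhom h \<phi> p = (\<Sum>t\<in>Poly_Mapping.keys p. h (Poly_Mapping.lookup p t) * mon \<phi> t)"

lemma lhom_add: "rhom h \<Longrightarrow> lhom h \<phi> (p + q) = lhom h \<phi> p + lhom h \<phi> q"
  unfolding lhom_def by (rule sum_keys_add) (simp add: rhomD algebra_simps)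

lemma additive_lhom: "rhom h \<Longrightarrow> additive (lhom h \<phi>)"
  by (simp add: additive_def lhom_add)

lemma lhom_single: "rhom h \<Longrightarrow> lhom h \<phi> (Poly_Mapping.single t c) = h c * mon \<phi> t"
  by (cases "c = 0") (auto simp: lhom_def rhomD)

lemma lhom_mult:
  assumes "rhom h"
  shows "lhom h \<phi> (p * q) = lhom h \<phi> p * lhom h \<phi> q"
proof -
  note ad = additive.add[OF additive_lhom[OF assms]]
  have 1: "lhom h \<phi> (Poly_Mapping.single t c * q) = lhom h \<phi> (Poly_Mapping.single t c) * lhom h \<phi> q" for t c
    by (rule additive_lpoly_eqI[of "\<lambda>q. lhom h \<phi> (Poly_Mapping.single t c * q)" "\<lambda>q. lhom h \<phi> (Poly_Mapping.single t c) * lhom h \<phi> q"])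
      (auto simp: additive_def ad algebra_simps mult_single lhom_single[OF assms] mon_add rhomD[OF assms])
  show ?thesis
    by (rule additive_lpoly_eqI[of "\<lambda>p. lhom h \<phi> (p * q)" "\<lambda>p. lhom h \<phi> p * lhom h \<phi> q"])
      (simp_all add: additive_def ad distrib_right 1)
qed

lemma lhom_one: "rhom h \<Longrightarrow> lhom h \<phi> 1 = 1"
  by (simp flip: single_one add: lhom_single rhomD)

lemma rhom_lhom: "rhom h \<Longrightarrow> rhom (lhom h \<phi>)"
  by (simp add: rhom_def lhom_one lhom_add lhom_mult)

lemma lhom_const: "rhom h \<Longrightarrow> lhom h \<phi> (Poly_Mapping.single 0 c) = h c"
  by (simp add: lhom_single)

lemma lhom_lam: "rhom h \<Longrightarrow> lhom h \<phi> (lam i) = \<phi> i"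
  by (simp add: lam_def lhom_single rhomD)

lemma lhom_cong: "(\<And>t. t \<in> Poly_Mapping.keys p \<Longrightarrow> mon \<phi> t = mon \<psi> t) \<Longrightarrow> lhom h \<phi> p = lhom h \<psi> p"
  by (simp add: lhom_def)

lemma lhom_lpolys_cong:
  "p \<in> lpolys n \<Longrightarrow> (\<And>k. k < n \<Longrightarrow> \<phi> k = \<psi> k) \<Longrightarrow> lhom h \<phi> p = lhom h \<psi> p"
  by (intro lhom_cong mon_cong) (auto simp: lpolys_def)

lemma lam_power: "lam i ^ m = Poly_Mapping.single (Poly_Mapping.single i m) 1"
  by (induction m) (simp_all add: lam_def mult_single single_add[symmetric])

text \<open>Building polynomials by multiplication with one variable at a time suits operators such
  as \<open>lderiv\<close> and \<open>exp_mult\<close>, whose commutation with a single variable is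
  simple.\<close>

lemma lpolys_induct [consumes 1, case_names const lam add]:
  assumes "p \<in> lpolys n"
    and const: "\<And>c. P (Poly_Mapping.single 0 c)"
    and lam: "\<And>i p. i < n \<Longrightarrow> p \<in> lpolys n \<Longrightarrow> P p \<Longrightarrow> P (lam i * p)"
    and add: "\<And>p q. p \<in> lpolys n \<Longrightarrow> q \<in> lpolys n \<Longrightarrow> P p \<Longrightarrow> P q \<Longrightarrow> P (p + q)"
  shows "P (p :: 'm::comm_ring_1 lpoly)"
proof -
  have keys_lp: "Poly_Mapping.single t c \<in> lpolys n" if "Poly_Mapping.keys t \<subseteq> {..<n}" for t and c :: 'm
    using that by (auto simp: lpolys_def split: if_splits)
  have mono: "P (Poly_Mapping.single t c)" if "Poly_Mapping.keys t \<subseteq> {..<n}" for t c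
    using that
  proof (induction "\<Sum>k\<in>Poly_Mapping.keys t. Poly_Mapping.lookup t k" arbitrary: t rule: less_induct)
    case less
    show ?case
    proof (cases "t = 0")
      case True then show ?thesis using const by simp
    next
      case False
      then obtain i where i: "i \<in> Poly_Mapping.keys t" by fastforce
      define s where "s = t - Poly_Mapping.single i 1"
      have t: "t = Poly_Mapping.single i 1 + s"
        using i by (intro poly_mapping_eqI) (auto simp: s_def lookup_add lookup_minus lookup_single when_def in_keys_iff)
      have ks: "Poly_Mapping.keys s \<subseteq> Poly_Mapping.keys t"
        by (auto simp: s_def in_keys_iff lookup_minus)
      have "(\<Sum>k\<in>Poly_Mapping.keys s. Poly_Mapping.lookup s k) = (\<Sum>k\<in>Poly_Mapping.keys t. Poly_Mapping.lookup s k)"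
        using ks by (intro sum.mono_neutral_left) (auto simp: in_keys_iff)
      also have "\<dots> < (\<Sum>k\<in>Poly_Mapping.keys t. Poly_Mapping.lookup t k)"
        using i by (intro sum_strict_mono_ex1) (auto simp: s_def lookup_minus in_keys_iff intro!: bexI[of _ i])
      finally have "P (Poly_Mapping.single s c)"
        using less ks by blast
      moreover have "Poly_Mapping.single t c = lam i * Poly_Mapping.single s c"
        using t by (simp add: lam_def mult_single)
      ultimately show ?thesis
        using lam[of i "Poly_Mapping.single s c"] keys_lp[of s c] i less.prems ks by auto
    qed
  qed
  have "P (\<Sum>t\<in>A. Poly_Mapping.single t (Poly_Mapping.lookup p t)) \<and>
    (\<Sum>t\<in>A. Poly_Mapping.single t (Poly_Mapping.lookup p t)) \<in> lpolys n"
    if "finite A" "A \<subseteq> Poly_Mapping.keys p" for A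
    using that
  proof (induction A)
    case empty
    have "P 0" using const[of 0] by simp
    then show ?case by (simp add: lpolys_def)
  next
    case (insert t A)
    have "Poly_Mapping.keys t \<subseteq> {..<n}" using insert assms(1) by (auto simp: lpolys_def)
    note k = keys_lp[OF this, of "Poly_Mapping.lookup p t"] mono[OF this, of "Poly_Mapping.lookup p t"]
    have "a + b \<in> lpolys n" if "a \<in> lpolys n" "b \<in> lpolys n" for a b :: "'m lpoly"
      using that keys_add[of a b] by (auto simp: lpolys_def)
    then show ?case using insert k add by auto
  qed
  from this[of "Poly_Mapping.keys p"] show ?thesis
    by (simp add: lpoly_sum_monomials)
qed

lemma mem_lpolys: "\<exists>n. p \<in> lpolys n"
proof -
  let ?A = "\<Union>t\<in>Poly_Mapping.keys p. Poly_Mapping.keys t"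
  have "finite ?A" by simp
  then obtain n where "\<forall>k\<in>?A. k < n" using finite_nat_set_iff_bounded by blast
  then show ?thesis by (auto simp: lpolys_def intro!: exI[of _ n])
qed

lemma lpoly_induct [case_names const lam add]:
  assumes "\<And>c. P (Poly_Mapping.single 0 c)"
    and "\<And>i p. P p \<Longrightarrow> P (lam i * p)"
    and "\<And>p q. P p \<Longrightarrow> P q \<Longrightarrow> P (p + q)"
  shows "P (p :: 'm::comm_ring_1 lpoly)"
proof -
  obtain n where "p \<in> lpolys n" using mem_lpolys by blast
  then show ?thesis
    by (induction rule: lpolys_induct) (use assms in auto)
qed

text \<open>An operator that commutes with a scalar may be applied before or after evaluation at it.
  This converts the \<open>map_poly\<close> of the sesquilinearity axioms into identities between
  values.\<close>

lemma poly_map_poly_additive: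
  assumes "additive h" "\<And>a. h (a * x) = h a * y"
  shows "poly (map_poly h p) y = h (poly p x)"
proof -
  interpret additive h by fact
  show ?thesis
    by (induction p) (simp_all add: map_poly_pCons zero add assms(2) mult.commute[of x] mult.commute[of y])
qed

section \<open>Values of polynomials at scalar points\<close>

locale coef =
  fixes \<kappa> :: "'f::field_char_0 \<Rightarrow> 'm::idom"
  assumes \<kappa>: "rhom \<kappa>"
begin

lemmas \<kappa>_simps = rhomD[OF \<kappa>] rhom_of_nat[OF \<kappa>] rhom_power[OF \<kappa>]

lemma \<kappa>_eq_0_iff: "\<kappa> x = 0 \<longleftrightarrow> x = 0"
proof
  assume "\<kappa> x = 0"
  then have "\<kappa> (x * inverse x) = 0" by (simp add: \<kappa>_simps)
  then show "x = 0" by (cases "x = 0") (simp_all add: \<kappa>_simps)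
qed (simp add: \<kappa>_simps)

lemma \<kappa>_inj: "\<kappa> x = \<kappa> y \<longleftrightarrow> x = y"
  using \<kappa>_eq_0_iff[of "x - y"] by (simp add: \<kappa>_simps)

lemma poly_\<kappa>_eqI:
  assumes "\<And>x. poly p (\<kappa> x) = poly q (\<kappa> x)"
  shows "p = q"
proof -
  have "infinite (range \<kappa>)"
    by (metis \<kappa>_inj finite_imageD infinite_UNIV_char_0 injI)
  moreover have "range \<kappa> \<subseteq> {x. poly (p - q) x = 0}" using assms by auto
  ultimately have "infinite {x. poly (p - q) x = 0}"
    using finite_subset by blast
  then have "p - q = 0"
    using poly_roots_finite[of "p - q"] by blast
  then show ?thesis by simp
qed

text \<open>Points have scalar coordinates, embedded by \<open>\<kappa>\<close>, although the
  coefficients lie in a larger domain: operators linear over the scalars, such as \<partial> or a_x,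
  then commute with evaluation.\<close>

definition ev :: "(nat \<Rightarrow> 'f) \<Rightarrow> 'm lpoly \<Rightarrow> 'm"
  where "ev \<phi> = lhom (\<lambda>x. x) (\<lambda>k. \<kappa> (\<phi> k))"

definition evF :: "(nat \<Rightarrow> 'f) \<Rightarrow> 'f lpoly \<Rightarrow> 'f"
  where "evF \<phi> = lhom (\<lambda>x. x) \<phi>"

lemma rhom_ev: "rhom (ev \<phi>)"
  unfolding ev_def by (rule rhom_lhom[OF rhom_id])

lemma rhom_evF: "rhom (evF \<phi>)"
  unfolding evF_def by (rule rhom_lhom[OF rhom_id])

lemmas ev_simps = rhomD[OF rhom_ev] rhom_sum[OF rhom_ev] rhom_power[OF rhom_ev] rhom_prod[OF rhom_ev]
lemmas evF_simps = rhomD[OF rhom_evF] rhom_sum[OF rhom_evF] rhom_power[OF rhom_evF] rhom_prod[OF rhom_evF]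

lemma additive_ev: "additive (ev \<phi>)"
  by (simp add: additive_def ev_simps)

lemma ev_single: "ev \<phi> (Poly_Mapping.single t c) = \<kappa> (mon \<phi> t) * c"
  by (simp add: ev_def lhom_single[OF rhom_id] rhom_mon[OF \<kappa>])

lemma ev_const: "ev \<phi> (Poly_Mapping.single 0 c) = c"
  by (simp add: ev_single \<kappa>_simps)

lemma ev_lam: "ev \<phi> (lam i) = \<kappa> (\<phi> i)"
  by (simp add: ev_def lhom_lam[OF rhom_id])

lemma evF_lam: "evF \<phi> (lam i) = \<phi> i"
  by (simp add: evF_def lhom_lam[OF rhom_id])

lemma evF_single: "evF \<phi> (Poly_Mapping.single t c) = mon \<phi> t * c"
  by (simp add: evF_def lhom_single[OF rhom_id])

lemma ev_lpolys_cong: "p \<in> lpolys n \<Longrightarrow> (\<And>k. k < n \<Longrightarrow> \<phi> k = \<psi> k) \<Longrightarrow> ev \<phi> p = ev \<psi> p"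
  unfolding ev_def by (rule lhom_lpolys_cong) auto

text \<open>The variables are eliminated one at a time, comparing coefficients of powers of \<open>\<lambda>\<^sub>m\<close>.\<close>

lemma ev_eq_0D:
  assumes "p \<in> lpolys n" "\<And>\<phi>. ev \<phi> p = 0"
  shows "p = 0"
  using assms
proof (induction n arbitrary: p)
  case 0
  have "t = 0" if "t \<in> Poly_Mapping.keys p" for t
    using 0(1) that by (auto simp: lpolys_def)
  then have "p = Poly_Mapping.single 0 (Poly_Mapping.lookup p 0)"
    by (intro poly_mapping_eqI) (auto simp: lookup_single when_def in_keys_iff)
  then show ?case using 0(2) ev_const by (metis single_zero)
next
  case (Suc n)
  define sl where "sl e = Abs_poly_mapping (\<lambda>t. if Poly_Mapping.lookup t n = 0
     then Poly_Mapping.lookup p (t + Poly_Mapping.single n e) else 0)" for e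
  have fin: "finite {t. (if Poly_Mapping.lookup t n = 0
     then Poly_Mapping.lookup p (t + Poly_Mapping.single n e) else 0) \<noteq> 0}" for e
  proof (rule finite_subset)
    show "{t. (if Poly_Mapping.lookup t n = 0
     then Poly_Mapping.lookup p (t + Poly_Mapping.single n e) else 0) \<noteq> 0}
      \<subseteq> (\<lambda>t. t - Poly_Mapping.single n e) ` Poly_Mapping.keys p"
    proof
      fix t assume "t \<in> {t. (if Poly_Mapping.lookup t n = 0
        then Poly_Mapping.lookup p (t + Poly_Mapping.single n e) else 0) \<noteq> 0}"
      then have "t + Poly_Mapping.single n e \<in> Poly_Mapping.keys p"
        by (auto simp: in_keys_iff split: if_splits)
      then show "t \<in> (\<lambda>t. t - Poly_Mapping.single n e) ` Poly_Mapping.keys p"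
        by (intro image_eqI[of _ _ "t + Poly_Mapping.single n e"]) auto
    qed
  qed simp
  have sl: "Poly_Mapping.lookup (sl e) t = (if Poly_Mapping.lookup t n = 0
     then Poly_Mapping.lookup p (t + Poly_Mapping.single n e) else 0)" for e t
    unfolding sl_def using fin by (subst lookup_Abs_poly_mapping) auto
  have sl_mem: "sl e \<in> lpolys n" for e
    unfolding lpolys_def
  proof (intro CollectI ballI subsetI)
    fix t k assume "t \<in> Poly_Mapping.keys (sl e)" "k \<in> Poly_Mapping.keys t"
    then have "Poly_Mapping.lookup t n = 0" "t + Poly_Mapping.single n e \<in> Poly_Mapping.keys p"
        "Poly_Mapping.lookup t k \<noteq> 0"
      by (auto simp: sl in_keys_iff split: if_splits)
    moreover from this have "k \<in> Poly_Mapping.keys (t + Poly_Mapping.single n e)"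
      by (auto simp: in_keys_iff lookup_add)
    ultimately have "k < Suc n" "k \<noteq> n" using Suc.prems(1) by (auto simp: lpolys_def)
    then show "k \<in> {..<n}" by auto
  qed
  define E where "E = Suc (Max (insert 0 ((\<lambda>t. Poly_Mapping.lookup t n) ` Poly_Mapping.keys p)))"
  have E: "Poly_Mapping.lookup t n < E" if "t \<in> Poly_Mapping.keys p" for t
    unfolding E_def less_Suc_eq_le using that by (intro Max_ge) auto
  have p: "p = (\<Sum>e<E. lam n ^ e * sl e)"
  proof (rule poly_mapping_eqI)
    fix t
    have "Poly_Mapping.lookup (lam n ^ e * sl e) t =
      (if e = Poly_Mapping.lookup t n then Poly_Mapping.lookup p t else 0)" for e
    proof -
      define s where "s = Poly_Mapping.update n 0 t"
      have st: "t = Poly_Mapping.single n (Poly_Mapping.lookup t n) + s"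
        by (intro poly_mapping_eqI) (auto simp: s_def lookup_add lookup_single lookup_update when_def)
      have "Poly_Mapping.lookup (lam n ^ e * sl e) t =
        (\<Sum>u\<in>Poly_Mapping.keys (sl e). Poly_Mapping.lookup (Poly_Mapping.single (Poly_Mapping.single n e + u) (Poly_Mapping.lookup (sl e) u)) t)"
        by (subst lpoly_sum_monomials[of "sl e", symmetric])
           (simp add: lam_power sum_distrib_left lookup_sum mult_single)
      also have "\<dots> = (\<Sum>u\<in>Poly_Mapping.keys (sl e). if u = s then (if e = Poly_Mapping.lookup t n then Poly_Mapping.lookup p t else 0) else 0)"
      proof (intro sum.cong refl)
        fix u assume "u \<in> Poly_Mapping.keys (sl e)"
        then have u0: "Poly_Mapping.lookup u n = 0" by (auto simp: sl in_keys_iff split: if_splits)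
        have "Poly_Mapping.single n e + u = t \<longleftrightarrow> u = s \<and> e = Poly_Mapping.lookup t n"
        proof
          assume *: "Poly_Mapping.single n e + u = t"
          have "e = Poly_Mapping.lookup t n" using u0 by (simp add: lookup_add flip: *)
          moreover have "u = s" using u0
            by (intro poly_mapping_eqI) (auto simp: s_def lookup_update lookup_add lookup_single when_def simp flip: *)
          ultimately show "u = s \<and> e = Poly_Mapping.lookup t n" by simp
        qed (use st in auto)
        then show "Poly_Mapping.lookup (Poly_Mapping.single (Poly_Mapping.single n e + u) (Poly_Mapping.lookup (sl e) u)) t
          = (if u = s then (if e = Poly_Mapping.lookup t n then Poly_Mapping.lookup p t else 0) else 0)"
          using u0 by (auto simp: lookup_single when_def sl add.commute)
      qed
      also have "\<dots> = (if e = Poly_Mapping.lookup t n then Poly_Mapping.lookup p t else 0)"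
      proof -
        have "Poly_Mapping.lookup p t = 0" if "s \<notin> Poly_Mapping.keys (sl (Poly_Mapping.lookup t n))"
          using that st by (auto simp: in_keys_iff sl add.commute s_def lookup_update)
        then show ?thesis by auto
      qed
      finally show ?thesis .
    qed
    then show "Poly_Mapping.lookup p t = Poly_Mapping.lookup (\<Sum>e<E. lam n ^ e * sl e) t"
      using E[of t] by (auto simp: lookup_sum in_keys_iff)
  qed
  have "sl e = 0" for e
  proof (rule Suc.IH[OF sl_mem])
    fix \<phi>
    have "poly (\<Sum>e<E. monom (ev \<phi> (sl e)) e) (\<kappa> x) = 0" for x
    proof -
      have "ev (\<phi>(n := x)) (sl e) = ev \<phi> (sl e)" for e
        by (rule ev_lpolys_cong[OF sl_mem]) auto
      then have "poly (\<Sum>e<E. monom (ev \<phi> (sl e)) e) (\<kappa> x) = ev (\<phi>(n := x)) p"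
        by (subst p) (simp add: ev_simps ev_lam poly_sum poly_monom mult.commute)
      then show ?thesis using Suc.prems by simp
    qed
    then have z: "(\<Sum>e<E. monom (ev \<phi> (sl e)) e) = 0"
      by (intro poly_\<kappa>_eqI) simp
    show "ev \<phi> (sl e) = 0"
    proof (cases "e < E")
      case True
      have "coeff (\<Sum>e<E. monom (ev \<phi> (sl e)) e) e = ev \<phi> (sl e)"
        using True by (simp add: coeff_sum)
      then show ?thesis by (simp add: z)
    next
      case False
      have "sl e = 0"
      proof (rule poly_mapping_eqI)
        fix t
        show "Poly_Mapping.lookup (sl e) t = Poly_Mapping.lookup 0 t"
          using False E[of "t + Poly_Mapping.single n e"] by (auto simp: sl in_keys_iff lookup_add)
      qed
      then show ?thesis by (simp add: ev_simps)
    qed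
  qed
  then show ?case by (subst p) simp
qed

text \<open>The scalars form an infinite subset of a domain, so values at scalar points determine a
  polynomial. Most later polynomial identities are proved by this rule, as identities between
  values.\<close>

lemma ev_eqI:
  assumes "\<And>\<phi>. ev \<phi> p = ev \<phi> q"
  shows "p = q"
proof -
  obtain n where "p - q \<in> lpolys n" using mem_lpolys by blast
  then have "p - q = 0" by (rule ev_eq_0D) (simp add: ev_simps assms)
  then show ?thesis by simp
qed

text \<open>Setting the variables from n on to zero deletes exactly the monomials that contain one
  of them; if no value changes, no such monomial occurs. Bounds on the variables thus follow from
  evaluation rules.\<close>

lemma mem_lpolysI:
  assumes "\<And>\<phi> \<psi>. (\<And>k. k < n \<Longrightarrow> \<phi> k = \<psi> k) \<Longrightarrow> ev \<phi> p = ev \<psi> p"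
  shows "(p :: 'm lpoly) \<in> lpolys n"
proof -
  define q where "q = Poly_Mapping.mapp (\<lambda>t c. if Poly_Mapping.keys t \<subseteq> {..<n} then c else 0) p"
  have q: "Poly_Mapping.lookup q t = (if Poly_Mapping.keys t \<subseteq> {..<n} then Poly_Mapping.lookup p t else 0)" for t
    by (auto simp: q_def lookup_mapp when_def in_keys_iff)
  have "p = q"
  proof (rule ev_eqI)
    fix \<phi> :: "nat \<Rightarrow> 'f"
    define \<psi> :: "nat \<Rightarrow> 'f" where "\<psi> k = (if k < n then \<phi> k else 0)" for k
    have m: "mon \<psi> t = (if Poly_Mapping.keys t \<subseteq> {..<n} then mon \<phi> t else 0)" for t
    proof (cases "Poly_Mapping.keys t \<subseteq> {..<n}")
      case True then show ?thesis by (auto simp: \<psi>_def intro!: mon_cong)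
    next
      case False
      then obtain k where "k \<in> Poly_Mapping.keys t" "\<not> k < n" by auto
      then show ?thesis using False by (auto simp: mon_def \<psi>_def in_keys_iff intro!: prod_zero bexI[of _ k])
    qed
    have "ev \<phi> p = ev \<psi> p" by (rule assms) (simp add: \<psi>_def)
    also have "\<dots> = (\<Sum>t\<in>Poly_Mapping.keys p. Poly_Mapping.lookup p t * \<kappa> (mon \<psi> t))"
      by (simp add: ev_def lhom_def rhom_mon[OF \<kappa>])
    also have "\<dots> = (\<Sum>t\<in>Poly_Mapping.keys p. Poly_Mapping.lookup q t * \<kappa> (mon \<phi> t))"
      by (intro sum.cong refl) (auto simp: m q \<kappa>_simps)
    also have "\<dots> = (\<Sum>t\<in>Poly_Mapping.keys q. Poly_Mapping.lookup q t * \<kappa> (mon \<phi> t))"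
      by (intro sum.mono_neutral_right) (auto simp: q in_keys_iff split: if_splits)
    also have "\<dots> = ev \<phi> q"
      by (simp add: ev_def lhom_def rhom_mon[OF \<kappa>])
    finally show "ev \<phi> p = ev \<phi> q" .
  qed
  moreover have "q \<in> lpolys n"
    unfolding lpolys_def by (auto simp: q in_keys_iff[of _ q] split: if_splits)
  ultimately show ?thesis by simp
qed

lemma mem_lpolys_iff:
  "(p :: 'm lpoly) \<in> lpolys n \<longleftrightarrow> (\<forall>\<phi> \<psi>. (\<forall>k<n. \<phi> k = \<psi> k) \<longrightarrow> ev \<phi> p = ev \<psi> p)"
proof
  assume "p \<in> lpolys n"
  then show "\<forall>\<phi> \<psi>. (\<forall>k<n. \<phi> k = \<psi> k) \<longrightarrow> ev \<phi> p = ev \<psi> p"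
    by (intro allI impI ev_lpolys_cong) auto
next
  assume "\<forall>\<phi> \<psi>. (\<forall>k<n. \<phi> k = \<psi> k) \<longrightarrow> ev \<phi> p = ev \<psi> p"
  then show "p \<in> lpolys n"
    by (intro mem_lpolysI) blast
qed

context
  fixes p q :: "'m lpoly"
begin

lemma lpolys_add: "p \<in> lpolys n \<Longrightarrow> q \<in> lpolys n \<Longrightarrow> p + q \<in> lpolys n"
  by (rule mem_lpolysI, simp only: ev_simps) (metis ev_lpolys_cong)

lemma lpolys_mult: "p \<in> lpolys n \<Longrightarrow> q \<in> lpolys n \<Longrightarrow> p * q \<in> lpolys n"
  by (rule mem_lpolysI, simp only: ev_simps) (metis ev_lpolys_cong)

lemma lpolys_minus: "p \<in> lpolys n \<Longrightarrow> - p \<in> lpolys n"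
  by (rule mem_lpolysI, simp only: ev_simps) (metis ev_lpolys_cong)

lemma lpolys_diff: "p \<in> lpolys n \<Longrightarrow> q \<in> lpolys n \<Longrightarrow> p - q \<in> lpolys n"
  by (rule mem_lpolysI, simp only: ev_simps) (metis ev_lpolys_cong)

lemma lpolys_power: "p \<in> lpolys n \<Longrightarrow> p ^ m \<in> lpolys n"
  by (rule mem_lpolysI, simp only: ev_simps) (metis ev_lpolys_cong)

lemma lpolys_const: "Poly_Mapping.single 0 (c :: 'm) \<in> lpolys n"
  by (simp add: mem_lpolys_iff ev_const)

lemma lpolys_0: "(0 :: 'm lpoly) \<in> lpolys n"
  by (simp add: mem_lpolys_iff ev_simps)

lemma lpolys_1: "(1 :: 'm lpoly) \<in> lpolys n"
  by (simp add: mem_lpolys_iff ev_simps)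

lemma lpolys_lam: "i < n \<Longrightarrow> (lam i :: 'm lpoly) \<in> lpolys n"
  by (simp add: mem_lpolys_iff ev_lam)

end

lemma lpolys_sum: "(\<And>x. x \<in> A \<Longrightarrow> f x \<in> lpolys n) \<Longrightarrow> (sum f A :: 'm lpoly) \<in> lpolys n"
  by (induction A rule: infinite_finite_induct) (auto simp: lpolys_0 lpolys_add)

abbreviation sc :: "'f \<Rightarrow> 'm \<Rightarrow> 'm"
  where "sc \<equiv> \<lambda>x m. \<kappa> x * m"

text \<open>This rule and the following ones replace the monomial sums behind \<open>lmult\<close>,
  \<open>lsubst\<close>, \<open>leval\<close> and \<open>lact\<close> by arithmetic of values: a
  substitution moves the point, an action is evaluated at a scalar.\<close>

lemma ev_lmult: "ev \<phi> (lmult sc q p) = \<kappa> (evF \<phi> q) * ev \<phi> p"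
proof -
  have "ev \<phi> (lmult sc q p) = (\<Sum>u\<in>Poly_Mapping.keys q. \<Sum>t\<in>Poly_Mapping.keys p.
      \<kappa> (Poly_Mapping.lookup q u * mon \<phi> u) * (\<kappa> (mon \<phi> t) * Poly_Mapping.lookup p t))"
    by (simp add: lmult_def ev_simps ev_single mon_add \<kappa>_simps mult_ac)
  also have "\<dots> = \<kappa> (\<Sum>u\<in>Poly_Mapping.keys q. Poly_Mapping.lookup q u * mon \<phi> u) *
     (\<Sum>t\<in>Poly_Mapping.keys p. \<kappa> (mon \<phi> t) * Poly_Mapping.lookup p t)"
    by (simp add: sum_distrib_left sum_distrib_right rhom_sum[OF \<kappa>] sum.swap[of _ "Poly_Mapping.keys p"])
  also have "\<dots> = \<kappa> (evF \<phi> q) * ev \<phi> p"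
    by (simp add: evF_def ev_def lhom_def rhom_mon[OF \<kappa>] mult.commute)
  finally show ?thesis .
qed

lemma ev_lsubst: "ev \<phi> (lsubst sc \<sigma> p) = ev (\<lambda>k. evF \<phi> (\<sigma> k)) p"
proof -
  have "evF \<phi> (\<Prod>k\<in>Poly_Mapping.keys t. \<sigma> k ^ Poly_Mapping.lookup t k) = mon (\<lambda>k. evF \<phi> (\<sigma> k)) t" for t
    by (simp add: evF_simps mon_def)
  then show ?thesis
    by (simp add: lsubst_def ev_simps ev_lmult ev_const) (simp add: ev_def lhom_def rhom_mon[OF \<kappa>] mult.commute)
qed

lemma ev_leval: "ev \<phi> (leval sc P q) = poly P (\<kappa> (evF \<phi> q))"
  by (simp add: leval_def ev_simps ev_lmult ev_const evF_simps poly_altdef \<kappa>_simps) (simp add: mult.commute)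

lemma ev_map:
  assumes "additive h" "\<And>x m. h (\<kappa> x * m) = \<kappa> x * h m"
  shows "ev \<phi> (Poly_Mapping.map h p) = h (ev \<phi> p)"
proof -
  interpret additive h by fact
  have "Poly_Mapping.map h (p + q) = Poly_Mapping.map h p + Poly_Mapping.map h q" for p q
  proof (rule poly_mapping_eqI)
    fix k
    show "Poly_Mapping.lookup (Poly_Mapping.map h (p + q)) k =
      Poly_Mapping.lookup (Poly_Mapping.map h p + Poly_Mapping.map h q) k"
      using add[of "Poly_Mapping.lookup p k" "Poly_Mapping.lookup q k"]
      by (auto simp: Poly_Mapping.map.rep_eq lookup_add when_def zero)
  qed
  note map_add = this
  show ?thesis
  proof (rule additive_lpoly_eqI[of "\<lambda>p. ev \<phi> (Poly_Mapping.map h p)" "\<lambda>p. h (ev \<phi> p)"])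
    show "additive (\<lambda>p. ev \<phi> (Poly_Mapping.map h p))"
      by (simp add: additive_def map_add ev_simps)
    show "additive (\<lambda>p. h (ev \<phi> p))"
      by (simp add: additive_def add ev_simps)
    show "ev \<phi> (Poly_Mapping.map h (Poly_Mapping.single t c)) = h (ev \<phi> (Poly_Mapping.single t c))" for t c
      by (cases "c = 0") (simp_all add: ev_single ev_simps zero assms(2) map_eq_zero_iff[THEN iffD2])
  qed
qed

lemma ev_lact:
  assumes "scl M = sc" "\<And>m k. act M a (m + k) = act M a m + act M a k"
    "\<And>x m. act M a (\<kappa> x * m) = map_poly (sc x) (act M a m)"
  shows "ev \<phi> (lact M a q p) = poly (act M a (ev \<phi> p)) (\<kappa> (evF \<phi> q))"
proof -
  have z: "act M a 0 = 0" using assms(2)[of 0 0] by (simp only: add_0_left add_cancel_right_right)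
  have s: "act M a (sum f A) = (\<Sum>x\<in>A. act M a (f x))" for f and A :: "(nat \<Rightarrow>\<^sub>0 nat) set"
    by (induction A rule: infinite_finite_induct) (auto simp: z assms(2))
  have "ev \<phi> (lact M a q p) = (\<Sum>t\<in>Poly_Mapping.keys p. \<kappa> (mon \<phi> t) * poly (act M a (Poly_Mapping.lookup p t)) (\<kappa> (evF \<phi> q)))"
    by (simp add: lact_def assms(1) ev_simps ev_lmult ev_leval evF_single)
  also have "\<dots> = (\<Sum>t\<in>Poly_Mapping.keys p. poly (act M a (\<kappa> (mon \<phi> t) * Poly_Mapping.lookup p t)) (\<kappa> (evF \<phi> q)))"
    unfolding assms(3)
    by (intro sum.cong refl poly_map_poly_additive[symmetric]) (auto simp: additive_def algebra_simps)
  also have "\<dots> = poly (act M a (\<Sum>t\<in>Poly_Mapping.keys p. \<kappa> (mon \<phi> t) * Poly_Mapping.lookup p t)) (\<kappa> (evF \<phi> q))"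
    by (simp add: s poly_sum)
  also have "(\<Sum>t\<in>Poly_Mapping.keys p. \<kappa> (mon \<phi> t) * Poly_Mapping.lookup p t) = ev \<phi> p"
    by (simp add: ev_def lhom_def rhom_mon[OF \<kappa>] mult.commute)
  finally show ?thesis .
qed

end

section \<open>The Chevalley-Eilenberg differential on lists\<close>

definition lieder :: "('x \<Rightarrow> 'x \<Rightarrow> 'x) \<Rightarrow> ('x \<Rightarrow> 'm \<Rightarrow> 'm) \<Rightarrow> 'x \<Rightarrow> ('x list \<Rightarrow> 'm) \<Rightarrow> 'x list \<Rightarrow> 'm::ab_group_add"
  where "lieder br ac x Z xs = ac x (Z xs) - (\<Sum>j<length xs. Z (xs[j := br x (xs ! j)]))"

text \<open>Cartan's formula, contraction by x after d equals the Lie derivative minus d after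
  contraction, taken as a definition by recursion on the argument list. It applies to every function
  of lists, and the standard identities become inductions on the list.\<close>

fun ced :: "('x \<Rightarrow> 'x \<Rightarrow> 'x) \<Rightarrow> ('x \<Rightarrow> 'm \<Rightarrow> 'm) \<Rightarrow> ('x list \<Rightarrow> 'm) \<Rightarrow> 'x list \<Rightarrow> 'm::ab_group_add"
  where
    "ced br ac Z [] = 0"
  | "ced br ac Z (x # xs) = lieder br ac x Z xs - ced br ac (\<lambda>ys. Z (x # ys)) xs"

lemma lieder_Cons:
  "lieder br ac x Z (y # ys) = lieder br ac x (\<lambda>zs. Z (y # zs)) ys - Z (br x y # ys)"
  by (simp add: lieder_def sum.lessThan_Suc_shift del: sum.lessThan_Suc)

definition alternating :: "('x list \<Rightarrow> 'm::ab_group_add) \<Rightarrow> bool"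
  where "alternating Z \<longleftrightarrow> (\<forall>us x y vs. Z (us @ x # y # vs) = - Z (us @ y # x # vs))"

lemma alternatingD: "alternating Z \<Longrightarrow> Z (us @ x # y # vs) = - Z (us @ y # x # vs)"
  unfolding alternating_def by blast

lemma alternating_Cons: "alternating Z \<Longrightarrow> alternating (\<lambda>ys. Z (x # ys))"
  unfolding alternating_def by (metis append_Cons)

lemma alternating_move:
  assumes "alternating Z"
  shows "Z (us @ x # vs) = (- 1) ^ length us * (Z (x # us @ vs) :: 'm::comm_ring_1)"
proof (induction us arbitrary: vs rule: rev_induct)
  case (snoc u us)
  have "Z ((us @ [u]) @ x # vs) = - Z (us @ x # u # vs)"
    using alternatingD[OF assms, of us u x vs] by simp
  then show ?case by (simp add: snoc)
qed simp

text \<open>A distant transposition is a conjugate of adjacent ones: x passes the first entry of the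
  gap, the induction hypothesis exchanges x and y, and y passes that entry back.\<close>

lemma alternating_swap:
  assumes "alternating Z"
  shows "Z (us @ x # ms @ y # vs) = - Z (us @ y # ms @ x # vs)"
proof (induction ms arbitrary: us)
  case Nil
  show ?case using alternatingD[OF assms, of us x y vs] by simp
next
  case (Cons m ms)
  have "Z (us @ x # (m # ms) @ y # vs) = - Z ((us @ [m]) @ x # ms @ y # vs)"
    using alternatingD[OF assms, of us x m "ms @ y # vs"] by simp
  also have "\<dots> = Z ((us @ [m]) @ y # ms @ x # vs)"
    by (simp only: Cons minus_minus)
  also have "\<dots> = - Z (us @ y # (m # ms) @ x # vs)"
    using alternatingD[OF assms, of us m y "ms @ x # vs"] by simp
  finally show ?case .
qed

lemma ced_cong:
  "(\<And>ys. Suc (length ys) = length xs \<Longrightarrow> Z ys = Z' ys) \<Longrightarrow> ced br ac Z xs = ced br ac Z' xs"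
proof (induction xs arbitrary: Z Z')
  case (Cons x xs)
  have "ced br ac (\<lambda>ys. Z (x # ys)) xs = ced br ac (\<lambda>ys. Z' (x # ys)) xs"
    by (rule Cons.IH) (simp add: Cons.prems)
  then show ?case by (simp add: lieder_def Cons.prems)
qed simp

locale ce =
  fixes br :: "'x \<Rightarrow> 'x \<Rightarrow> 'x" and ac :: "'x \<Rightarrow> 'm::ab_group_add \<Rightarrow> 'm"
  assumes ac_add: "ac x (m + k) = ac x m + ac x k"
begin

abbreviation \<theta> where "\<theta> \<equiv> lieder br ac"
abbreviation d where "d \<equiv> ced br ac"

lemma ac_diff: "ac x (m - k) = ac x m - ac x k"
  using ac_add[of x "m - k" k] by simp

lemma ac_0: "ac x 0 = 0"
  using ac_add[of x 0 0] by simp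

lemma ac_minus: "ac x (- m) = - ac x m"
  using ac_diff[of x 0 m] by (simp add: ac_0)

lemma ac_sum: "ac x (sum f A) = (\<Sum>a\<in>A. ac x (f a))"
  by (induction A rule: infinite_finite_induct) (auto simp: ac_0 ac_add)

lemma \<theta>_diff: "\<theta> x (\<lambda>ys. Z ys - Z' ys) xs = \<theta> x Z xs - \<theta> x Z' xs"
  by (simp add: lieder_def ac_diff sum_subtractf)

lemma d_diff: "d (\<lambda>ys. Z ys - Z' ys) xs = d Z xs - d Z' xs"
  by (induction xs arbitrary: Z Z') (auto simp: \<theta>_diff)

lemma d_zero: "d (\<lambda>ys. 0) xs = 0"
  using d_diff[of "\<lambda>_. 0" "\<lambda>_. 0"] by simp

text \<open>The bracket is asked to be skew only inside the slots of Z: \<open>brR\<close> itself is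
  not skew, since [a_x b] and -[b_y a] become equal only after a sesquilinear map is
  applied.\<close>

lemma d_alternating:
  assumes "alternating Z" "\<And>us x y vs. Z (us @ br x y # vs) = - Z (us @ br y x # vs)"
  shows "alternating (d Z)"
  unfolding alternating_def
proof (intro allI)
  fix us x y vs
  show "d Z (us @ x # y # vs) = - d Z (us @ y # x # vs)"
    using assms
  proof (induction us arbitrary: Z)
    case Nil
    have "Z (x # y # zs) = 0 - Z (y # x # zs)" for zs
      using alternatingD[OF Nil(1), of "[]" x y zs] by simp
    then have "d (\<lambda>zs. Z (x # y # zs)) vs = d (\<lambda>zs. 0 - Z (y # x # zs)) vs"
      by (intro ced_cong)
    then have 1: "d (\<lambda>zs. Z (x # y # zs)) vs = - d (\<lambda>zs. Z (y # x # zs)) vs"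
      by (simp only: d_diff d_zero) simp
    have 2: "Z (br x y # vs) = - Z (br y x # vs)"
      using Nil(2)[of "[]" x y vs] by simp
    show ?case
      by (simp add: lieder_Cons 1 2)
  next
    case (Cons u us)
    have "d (\<lambda>zs. Z (u # zs)) (us @ x # y # vs) = - d (\<lambda>zs. Z (u # zs)) (us @ y # x # vs)"
    proof (rule Cons.IH[OF alternating_Cons[OF Cons.prems(1)]])
      show "Z (u # us' @ br a b # vs') = - Z (u # us' @ br b a # vs')" for us' a b vs'
        using Cons.prems(2)[of "u # us'" a b vs'] by simp
    qed
    moreover have "\<theta> u Z (us @ x # y # vs) = - \<theta> u Z (us @ y # x # vs)"
    proof -
      let ?f = "\<lambda>x y j. Z ((us @ x # y # vs)[j := br u ((us @ x # y # vs) ! j)])"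
      let ?n = "length us"
      have al: "Z (as @ a # b # bs) = - Z (as @ b # a # bs)" for as a b bs
        by (rule alternatingD[OF Cons.prems(1)])
      \<comment> \<open>Slots before the exchanged pair, its two slots, and slots after it. The
        outer terms change sign one by one; the two inner terms also change places.\<close>
      have split: "(\<Sum>j<length (us @ x # y # vs). g j) =
         (\<Sum>j<?n. g j) + g ?n + g (Suc ?n) + (\<Sum>j<length vs. g (Suc (Suc (?n + j))))" for g :: "nat \<Rightarrow> 'm" and x y
      proof -
        have "(\<Sum>j<?n + k. g j) = (\<Sum>j<?n. g j) + (\<Sum>j<k. g (?n + j))" for k
          by (induction k) (auto simp: add.assoc)
        from this[of "Suc (Suc (length vs))"] show ?thesis
          by (simp add: sum.lessThan_Suc_shift add.assoc del: sum.lessThan_Suc)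
      qed
      have f1: "?f x y j = - ?f y x j" if "j < ?n" for j
        using that al[of "us[j := br u (us ! j)]" x y vs] by (simp add: nth_append list_update_append)
      have f2: "?f x y ?n = - ?f y x (Suc ?n)" "?f x y (Suc ?n) = - ?f y x ?n"
        using al[of us "br u x" y vs] al[of us x "br u y" vs] by (simp_all add: nth_append list_update_append)
      have f3: "?f x y (Suc (Suc (?n + j))) = - ?f y x (Suc (Suc (?n + j)))" for j
        using al[of us x y "vs[j := br u (vs ! j)]"] by (simp add: nth_append list_update_append)
      have "(\<Sum>j<length (us @ x # y # vs). ?f x y j) = - (\<Sum>j<length (us @ y # x # vs). ?f y x j)"
        unfolding split f2 f3 using f1 by (simp add: sum_negf)
      then show ?thesis
        unfolding lieder_def al[of us x y vs] ac_minus by simp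
    qed
    ultimately show ?case by simp
  qed
qed

text \<open>The arguments carry no addition, so the Jacobi identity can only be expressed after Z is
  applied.\<close>

definition jacobi :: "('x list \<Rightarrow> 'm) \<Rightarrow> bool"
  where "jacobi Z \<longleftrightarrow> (\<forall>us vs x y z. Z (us @ br x (br y z) # vs) =
    Z (us @ br (br x y) z # vs) + Z (us @ br y (br x z) # vs))"

lemma jacobi_Cons: "jacobi Z \<Longrightarrow> jacobi (\<lambda>ys. Z (x # ys))"
  unfolding jacobi_def by (metis append_Cons)

lemma jacobi_update:
  assumes "jacobi Z" "j < length xs"
  shows "Z (xs[j := br x (br y (xs ! j))]) = Z (xs[j := br (br x y) (xs ! j)]) + Z (xs[j := br y (br x (xs ! j))])"
proof -
  have "Z (take j xs @ br x (br y (xs ! j)) # drop (Suc j) xs) =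
    Z (take j xs @ br (br x y) (xs ! j) # drop (Suc j) xs) +
    Z (take j xs @ br y (br x (xs ! j)) # drop (Suc j) xs)"
    using assms(1) unfolding jacobi_def by blast
  then show ?thesis by (simp only: upd_conv_take_nth_drop[OF assms(2)])
qed

end

locale ce_module = ce +
  assumes ac_br: "ac x (ac y m) - ac y (ac x m) = ac (br x y) m"
begin

text \<open>In the double sum over slots, the terms with different slots are symmetric in the two
  operations and cancel; the diagonal terms combine by the Jacobi identity.\<close>

lemma \<theta>_commutator:
  assumes "jacobi Z"
  shows "\<theta> x (\<lambda>zs. \<theta> y Z zs) xs - \<theta> y (\<lambda>zs. \<theta> x Z zs) xs = \<theta> (br x y) Z xs"
proof -
  define U where "U a j = Z (xs[j := br a (xs ! j)])" for a j
  define W where "W a b j l = Z ((xs[j := br a (xs ! j)])[l := br b (xs[j := br a (xs ! j)] ! l)])" for a b j l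
  let ?n = "length xs"
  have th: "\<theta> a (\<lambda>zs. \<theta> b Z zs) xs = ac a (ac b (Z xs)) - (\<Sum>l<?n. ac a (U b l)) - (\<Sum>j<?n. ac b (U a j)) + (\<Sum>j<?n. \<Sum>l<?n. W a b j l)" for a b
    by (simp add: lieder_def ac_diff ac_sum sum_subtractf U_def W_def)
  have "(\<Sum>j<?n. \<Sum>l<?n. W x y j l) - (\<Sum>j<?n. \<Sum>l<?n. W y x j l) =
    (\<Sum>j<?n. \<Sum>l<?n. W x y j l - W y x l j)"
    by (subst sum.swap[of "\<lambda>j l. W y x j l"]) (simp add: sum_subtractf)
  also have "\<dots> = (\<Sum>j<?n. \<Sum>l<?n. if l = j then - U (br x y) j else 0)"
  proof (intro sum.cong refl)
    fix j l assume jl: "j \<in> {..<?n}" "l \<in> {..<?n}"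
    show "W x y j l - W y x l j = (if l = j then - U (br x y) j else 0)"
    proof (cases "l = j")
      case True
      then show ?thesis using jl jacobi_update[OF assms, of j xs x y] by (simp add: W_def U_def)
    next
      case False
      then show ?thesis using jl by (simp add: W_def list_update_swap)
    qed
  qed
  also have "\<dots> = - (\<Sum>j<?n. U (br x y) j)"
    by (simp add: sum_negf)
  finally have "(\<Sum>j<?n. \<Sum>l<?n. W x y j l) - (\<Sum>j<?n. \<Sum>l<?n. W y x j l) = - (\<Sum>j<?n. U (br x y) j)" .
  then show ?thesis
    unfolding th using ac_br[of x y "Z xs"] by (simp add: lieder_def U_def algebra_simps)
qed

text \<open>Induction along the recursion of d: contraction by y turns the claim into the commutator
  of two Lie derivatives, and the extra contraction by [x, y] from \<open>lieder_Cons\<close>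
  accounts for the rest.\<close>

lemma \<theta>_d: "jacobi Z \<Longrightarrow> \<theta> x (d Z) xs = d (\<theta> x Z) xs"
proof (induction xs arbitrary: Z)
  case Nil
  then show ?case by (simp add: lieder_def ac_0)
next
  case (Cons y ys)
  let ?i = "\<lambda>y zs. Z (y # zs)"
  have "\<theta> x (d Z) (y # ys) = \<theta> x (\<lambda>zs. \<theta> y Z zs - d (?i y) zs) ys - (\<theta> (br x y) Z ys - d (?i (br x y)) ys)"
    by (simp add: lieder_Cons)
  also have "\<dots> = \<theta> x (\<theta> y Z) ys - \<theta> (br x y) Z ys - (d (\<theta> x (?i y)) ys - d (?i (br x y)) ys)"
    using Cons.IH[OF jacobi_Cons[OF Cons.prems]] by (simp add: \<theta>_diff)
  also have "\<dots> = \<theta> y (\<theta> x Z) ys - d (\<lambda>zs. \<theta> x (?i y) zs - ?i (br x y) zs) ys"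
    using \<theta>_commutator[OF Cons.prems, of x y ys] by (simp add: d_diff algebra_simps)
  also have "\<dots> = d (\<theta> x Z) (y # ys)"
    by (simp add: lieder_Cons)
  finally show ?case .
qed

text \<open>Contracting d d by x gives the commutator of the Lie derivative with d, which is zero,
  plus d d of the contraction, which vanishes by induction.\<close>

lemma d_d: "jacobi Z \<Longrightarrow> d (d Z) xs = 0"
proof (induction xs arbitrary: Z)
  case (Cons x xs)
  have "d (d Z) (x # xs) = \<theta> x (d Z) xs - d (\<lambda>zs. \<theta> x Z zs - d (\<lambda>ys. Z (x # ys)) zs) xs"
    by simp
  also have "\<dots> = 0"
    using Cons.IH[OF jacobi_Cons[OF Cons.prems]] by (simp only: d_diff \<theta>_d[OF Cons.prems]) simp
  finally show ?case .
qed simp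

end

abbreviation del :: "nat \<Rightarrow> 'x list \<Rightarrow> 'x list"
  where "del i xs \<equiv> take i xs @ drop (Suc i) xs"

text \<open>The unrolled recursion, with each bracket left in the slot of its second argument. In
  this form the terms match substitutions in a polynomial, as needed for \<open>dW\<close>.\<close>

lemma ced_expand:
  fixes Z :: "'x list \<Rightarrow> 'm::comm_ring_1"
  shows "ced br ac Z xs = (\<Sum>i<length xs. (- 1) ^ i * (ac (xs ! i) (Z (del i xs)) -
    (\<Sum>j\<in>{i<..<length xs}. Z (del i (xs[j := br (xs ! i) (xs ! j)])))))"
proof (induction xs arbitrary: Z)
  case (Cons x xs)
  let ?T = "\<lambda>Z xs i. (- 1) ^ i * (ac (xs ! i) (Z (del i xs)) -
    (\<Sum>j\<in>{i<..<length xs}. Z (del i (xs[j := br (xs ! i) (xs ! j)]))))"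
  have shift: "(\<Sum>j\<in>{Suc i<..<Suc n}. g j) = (\<Sum>j\<in>{i<..<n}. g (Suc j))" for i n and g :: "nat \<Rightarrow> 'm"
    by (rule sum.reindex_bij_witness[of _ Suc "\<lambda>j. j - 1"]) auto
  have shift0: "(\<Sum>j\<in>{0<..<Suc n}. g j) = (\<Sum>j<n. g (Suc j))" for n and g :: "nat \<Rightarrow> 'm"
    by (rule sum.reindex_bij_witness[of _ Suc "\<lambda>j. j - 1"]) auto
  have 0: "?T Z (x # xs) 0 = lieder br ac x Z xs"
    by (simp add: lieder_def shift0)
  have S: "?T Z (x # xs) (Suc i) = - ?T (\<lambda>ys. Z (x # ys)) xs i" for i
    by (simp add: shift)
  have "(\<Sum>i<length (x # xs). ?T Z (x # xs) i) = ?T Z (x # xs) 0 + (\<Sum>i<length xs. ?T Z (x # xs) (Suc i))"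
    by (simp only: list.size(4) add_0_right add_Suc_right sum.lessThan_Suc_shift)
  also have "\<dots> = lieder br ac x Z xs - (\<Sum>i<length xs. ?T (\<lambda>ys. Z (x # ys)) xs i)"
    unfolding 0 S by (simp only: sum_negf) simp
  also have "\<dots> = ced br ac Z (x # xs)"
    by (simp only: ced.simps Cons[of "\<lambda>ys. Z (x # ys)"])
  finally show ?case by (rule sym)
qed simp

text \<open>Moving the bracket from slot j, which has become position j - 1, to the front costs
  (-1)^(j-1). The result has the shape of \<open>lc_diff\<close>, up to the global sign
  (-1)^(n+1).\<close>

lemma ced_expand_alternating:
  fixes Z :: "'x list \<Rightarrow> 'm::comm_ring_1"
  assumes "alternating Z"
  shows "ced br ac Z xs = (\<Sum>i<length xs. (- 1) ^ i * ac (xs ! i) (Z (del i xs))) +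
    (\<Sum>j<length xs. \<Sum>i<j. (- 1) ^ (i + j) * Z (br (xs ! i) (xs ! j) # del i (del j xs)))"
proof -
  have mv: "Z (del i (xs[j := w])) = (- 1) ^ (j - 1) * Z (w # del i (del j xs))" if "i < j" "j < length xs" for i j w
  proof -
    have 1: "del i (xs[j := w]) = (take i xs @ take (j - Suc i) (drop (Suc i) xs)) @ w # drop (Suc j) xs"
      using that by (simp add: drop_update_swap upd_conv_take_nth_drop drop_take)
    have 2: "(take i xs @ take (j - Suc i) (drop (Suc i) xs)) @ drop (Suc j) xs = del i (del j xs)"
      using that by (simp add: min_def drop_take)
    have 3: "length (take i xs @ take (j - Suc i) (drop (Suc i) xs)) = j - 1"
      using that by simp
    show ?thesis
      unfolding 1 alternating_move[OF assms] 3 2[symmetric] by simp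
  qed
  have *: "(- 1) ^ i * (ac (xs ! i) (Z (del i xs)) - (\<Sum>j\<in>{i<..<length xs}. Z (del i (xs[j := br (xs ! i) (xs ! j)])))) =
    (- 1) ^ i * ac (xs ! i) (Z (del i xs)) +
    (\<Sum>j\<in>{i<..<length xs}. (- 1) ^ (i + j) * Z (br (xs ! i) (xs ! j) # del i (del j xs)))" for i
  proof -
    have "- ((- 1) ^ i * Z (del i (xs[j := w]))) = (- 1) ^ (i + j) * Z (w # del i (del j xs))"
      if "i < j" "j < length xs" for j w
    proof -
      have "- ((- 1) ^ i * ((- 1) ^ (j - 1) * z)) = (- 1) ^ (i + j) * (z :: 'm)" for z
        using that by (cases j) (auto simp: power_add)
      then show ?thesis using mv[OF that, of w] by simp
    qed
    then have "(\<Sum>j\<in>{i<..<length xs}. - ((- 1) ^ i * Z (del i (xs[j := br (xs ! i) (xs ! j)])))) =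
      (\<Sum>j\<in>{i<..<length xs}. (- 1) ^ (i + j) * Z (br (xs ! i) (xs ! j) # del i (del j xs)))"
      by (intro sum.cong refl) auto
    then show ?thesis
      by (simp only: right_diff_distrib sum_distrib_left sum_negf) simp
  qed
  have "(\<Sum>i<length xs. \<Sum>j\<in>{i<..<length xs}. g i j) = (\<Sum>j<length xs. \<Sum>i<j. g i j)" for g :: "nat \<Rightarrow> nat \<Rightarrow> 'm"
    by (subst sum.Sigma, simp, simp, subst sum.Sigma, simp, simp)
       (rule sum.reindex_bij_witness[of _ "\<lambda>(a, b). (b, a)" "\<lambda>(a, b). (b, a)"], auto)
  then show ?thesis
    unfolding ced_expand * by (simp add: sum.distrib)
qed

text \<open>Naturality of d in the arguments. The brackets have to correspond only inside the slots
  of Z, which is what lets the central term of the Virasoro bracket disappear.\<close>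

lemma ced_transfer:
  assumes "\<And>us x y vs. Z (map f us @ br (f x) (f y) # map f vs) = Z (map f us @ f (br' x y) # map f vs)"
    and "\<And>x m. ac (f x) m = ac' x m"
  shows "ced br ac Z (map f xs) = ced br' ac' (\<lambda>ys. Z (map f ys)) xs"
  using assms(1)
proof (induction xs arbitrary: Z)
  case (Cons x xs)
  have "Z ((map f xs)[j := br (f x) (map f xs ! j)]) = Z (map f (xs[j := br' x (xs ! j)]))" if "j < length xs" for j
    using that Cons.prems[of "take j xs" x "xs ! j" "drop (Suc j) xs"]
    by (simp add: upd_conv_take_nth_drop take_map drop_map)
  then have "lieder br ac (f x) Z (map f xs) = lieder br' ac' x (\<lambda>ys. Z (map f ys)) xs"
    by (simp add: lieder_def assms(2))
  moreover have "ced br ac (\<lambda>ys. Z (f x # ys)) (map f xs) = ced br' ac' (\<lambda>ys. Z (f x # map f ys)) xs"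
    by (rule Cons.IH) (use Cons.prems[of "x # _"] in simp)
  ultimately show ?case by simp
qed simp

section \<open>The complex of polynomials with values in a graded Virasoro module\<close>

text \<open>Turns a list of n coordinates into a point; members of \<open>lpolys n\<close> do not
  see the padding.\<close>

definition lst :: "'a::zero list \<Rightarrow> nat \<Rightarrow> 'a"
  where "lst xs k = (if k < length xs then xs ! k else 0)"

lemma lst_map: "k < length xs \<Longrightarrow> lst (map f xs) k = f (xs ! k)"
  by (simp add: lst_def)

text \<open>The pair (x, r) stands for r L_x. The factor r is carried along so that the bracket of
  two such elements is again of this form.\<close>

definition br_vir :: "'f \<times> 'f \<Rightarrow> 'f \<times> 'f \<Rightarrow> 'f \<times> 'f::comm_ring_1"
  where "br_vir x y = (fst x + fst y, snd x * snd y * (fst x - fst y))"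

definition mdeg :: "(nat \<Rightarrow>\<^sub>0 nat) \<Rightarrow> nat"
  where "mdeg t = (\<Sum>k\<in>Poly_Mapping.keys t. Poly_Mapping.lookup t k)"

lemma mdeg_superset: "finite A \<Longrightarrow> Poly_Mapping.keys t \<subseteq> A \<Longrightarrow> mdeg t = (\<Sum>k\<in>A. Poly_Mapping.lookup t k)"
  unfolding mdeg_def by (intro sum.mono_neutral_left) (auto simp: in_keys_iff)

lemma mdeg_single: "mdeg (Poly_Mapping.single i m) = m"
  by (cases "m = 0") (simp_all add: mdeg_def)

lemma mdeg_add: "mdeg (s + t) = mdeg s + mdeg t"
proof -
  let ?A = "Poly_Mapping.keys s \<union> Poly_Mapping.keys t"
  have "finite ?A" "Poly_Mapping.keys (s + t) \<subseteq> ?A"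
    using keys_add[of s t] by auto
  then show ?thesis
    by (simp add: mdeg_superset[of ?A] lookup_add sum.distrib)
qed

text \<open>
  \<open>ell m\<close> is \<open>L\<^sub>\<lambda> m\<close>; the operator \<open>L\<^sub>(\<^sub>1\<^sub>)\<close> is diagonalisable with eigenvalues in \<open>\<nat>\<close>, and \<open>w k\<close> is the
  projection onto its eigenspace of eigenvalue \<open>k\<close>.
\<close>

locale vir_module = coef \<kappa> for \<kappa> :: "'f::field_char_0 \<Rightarrow> 'm::idom" +
  fixes dr :: "'m \<Rightarrow> 'm" and ell :: "'m \<Rightarrow> 'm poly" and w :: "nat \<Rightarrow> 'm \<Rightarrow> 'm"
  assumes der_add: "dr (m + m') = dr m + dr m'"
    and der_scale: "dr (\<kappa> x * m) = \<kappa> x * dr m"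
    and ell_add: "ell (m + m') = ell m + ell m'"
    and ell_scale: "ell (\<kappa> x * m) = Polynomial.smult (\<kappa> x) (ell m)"
    and ell_comm: "poly (ell (poly (ell m) (\<kappa> y))) (\<kappa> x) - poly (ell (poly (ell m) (\<kappa> x))) (\<kappa> y) =
      \<kappa> (x - y) * poly (ell m) (\<kappa> (x + y))"
    and ell_der: "poly (ell (dr m)) (\<kappa> x) = \<kappa> x * poly (ell m) (\<kappa> x) + dr (poly (ell m) (\<kappa> x))"
    and ell_coeff_0: "coeff (ell m) 0 = dr m"
    and ell_1: "ell 1 = 0"
    and w_add: "w k (m + m') = w k m + w k m'"
    and w_ell: "w k (coeff (ell m) 1) = of_nat k * w k m"
    and ell_w: "coeff (ell (w k m)) 1 = of_nat k * w k m"
    and w_sum: "\<exists>B. m = (\<Sum>k<B. w k m) \<and> (\<forall>k\<ge>B. w k m = 0)"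
    and weight_0: "coeff (ell m) 1 = 0 \<Longrightarrow> m \<in> range \<kappa>"
    and weight_1: "coeff (ell m) 1 = m \<Longrightarrow> m = 0"
begin

definition A :: "'f \<Rightarrow> 'm \<Rightarrow> 'm" where "A x m = poly (ell m) (\<kappa> x)"
definition H :: "'m \<Rightarrow> 'm" where "H m = coeff (ell m) 1"
definition ac :: "'f \<times> 'f \<Rightarrow> 'm \<Rightarrow> 'm" where "ac x m = \<kappa> (snd x) * A (fst x) m"

lemma A_add: "A x (m + k) = A x m + A x k"
  by (simp add: A_def ell_add)

lemma A_scale: "A x (\<kappa> y * m) = \<kappa> y * A x m"
  by (simp add: A_def ell_scale)

lemma additive_der: "additive dr"
  by (simp add: additive_def der_add)

lemma A_comm: "A x (A y m) - A y (A x m) = \<kappa> (x - y) * A (x + y) m"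
  unfolding A_def by (rule ell_comm)

lemma A_0: "A 0 m = dr m"
  by (simp add: A_def \<kappa>_simps ell_coeff_0 poly_0_coeff_0)

lemma additive_H: "additive H"
  by (simp add: additive_def H_def ell_add)

lemma H_scale: "H (\<kappa> x * m) = \<kappa> x * H m"
  by (simp add: H_def ell_scale)

lemma H_w: "H (w k m) = of_nat k * w k m" and w_H: "w k (H m) = of_nat k * w k m"
  unfolding H_def by (rule ell_w, rule w_ell)

lemma ell_\<kappa>: "ell (\<kappa> x) = 0"
  using ell_scale[of x 1] ell_1 by simp

lemma der_\<kappa>: "dr (\<kappa> x) = 0"
  using ell_coeff_0[of "\<kappa> x"] ell_\<kappa> by simp

lemma H_\<kappa>: "H (\<kappa> x) = 0"
  by (simp add: H_def ell_\<kappa>)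

text \<open>The coefficient of \<lambda> in the sesquilinearity rule: L_(1) \<partial> = L_(0) +
  \<partial> L_(1), with L_(0) = \<partial>. So \<partial> raises the weight by one.\<close>

lemma H_der: "H (dr m) = dr (H m) + dr m"
proof -
  have "ell (dr m) = pCons 0 (ell m) + map_poly dr (ell m)"
  proof (rule poly_\<kappa>_eqI)
    fix x
    have "poly (map_poly dr (ell m)) (\<kappa> x) = dr (poly (ell m) (\<kappa> x))"
      by (rule poly_map_poly_additive[OF additive_der]) (metis der_scale mult.commute)
    then show "poly (ell (dr m)) (\<kappa> x) = poly (pCons 0 (ell m) + map_poly dr (ell m)) (\<kappa> x)"
      by (simp add: ell_der)
  qed
  then show ?thesis
    by (simp add: H_def coeff_map_poly additive.zero[OF additive_der] coeff_pCons ell_coeff_0)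
qed

sublocale ce_module br_vir ac
proof
  show "ac x (m + k) = ac x m + ac x k" for x m k
    by (simp add: ac_def A_add algebra_simps)
  show "ac x (ac y m) - ac y (ac x m) = ac (br_vir x y) m" for x y m
  proof -
    have "ac x (ac y m) - ac y (ac x m) = \<kappa> (snd x * snd y) * (A (fst x) (A (fst y) m) - A (fst y) (A (fst x) m))"
      by (simp add: ac_def A_scale \<kappa>_simps algebra_simps)
    then show ?thesis
      by (simp add: A_comm ac_def br_vir_def \<kappa>_simps)
  qed
qed

text \<open>P as a function of n elements r L_x, multilinear in the factors r. The value 0 on lists
  of other lengths makes identities of functions on all lists available.\<close>

definition Zw :: "nat \<Rightarrow> 'm lpoly \<Rightarrow> ('f \<times> 'f) list \<Rightarrow> 'm"
  where "Zw n P xs = (if length xs = n then \<kappa> (prod_list (map snd xs)) * ev (lst (map fst xs)) P else 0)"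

lemma Zw_scale: "Zw n P (us @ (x, a * b) # vs) = \<kappa> a * Zw n P (us @ (x, b) # vs)"
  by (simp add: Zw_def \<kappa>_simps)

lemma Zw_smult: "Zw n P (us @ (x, a) # vs) = \<kappa> a * Zw n P (us @ (x, 1) # vs)"
  using Zw_scale[of n P us x a 1] by simp

lemma Zw_add_slot: "Zw n P (us @ (x, a + b) # vs) = Zw n P (us @ (x, a) # vs) + Zw n P (us @ (x, b) # vs)"
  by (subst (1 2 3) Zw_smult) (simp add: \<kappa>_simps algebra_simps)

lemma Zw_minus_slot: "Zw n P (us @ (x, - a) # vs) = - Zw n P (us @ (x, a) # vs)"
  by (subst (1 2) Zw_smult) (simp add: \<kappa>_simps)

text \<open>All three iterated brackets sit at the point x + y + z, so only their scalar factors are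
  compared; these satisfy the Jacobi identity of vector fields.\<close>

lemma jacobi_Zw: "jacobi (Zw n P)"
  unfolding jacobi_def
proof (intro allI)
  fix us vs and x y z :: "'f \<times> 'f"
  have 1: "fst x + (fst y + fst z) = fst x + fst y + fst z" "fst y + (fst x + fst z) = fst x + fst y + fst z"
    by simp_all
  have 2: "snd x * (snd y * snd z * (fst y - fst z)) * (fst x - (fst y + fst z)) =
     snd x * snd y * (fst x - fst y) * snd z * (fst x + fst y - fst z) +
     snd y * (snd x * snd z * (fst x - fst z)) * (fst y - (fst x + fst z))"
    by (simp add: algebra_simps)
  show "Zw n P (us @ br_vir x (br_vir y z) # vs) =
     Zw n P (us @ br_vir (br_vir x y) z # vs) + Zw n P (us @ br_vir y (br_vir x z) # vs)"
    unfolding br_vir_def fst_conv snd_conv 1 2 Zw_add_slot by simp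
qed

abbreviation evs :: "nat \<Rightarrow> (nat \<Rightarrow> 'f) \<Rightarrow> ('f \<times> 'f) list"
  where "evs n \<phi> \<equiv> map (\<lambda>k. (\<phi> k, 1)) [0..<n]"

lemma Zw_evs: "P \<in> lpolys n \<Longrightarrow> Zw n P (evs n \<phi>) = ev \<phi> P"
  by (auto simp: Zw_def \<kappa>_simps lst_def comp_def map_replicate_const intro!: ev_lpolys_cong)

lemma Zw_eqI:
  assumes "P \<in> lpolys n" "Q \<in> lpolys n" "\<And>xs. length xs = n \<Longrightarrow> Zw n P xs = Zw n Q xs"
  shows "P = Q"
  by (rule ev_eqI) (metis Zw_evs assms length_map length_upt minus_nat.diff_0)

text \<open>A module record over a dummy algebra whose single element acts as L; it makes
  \<open>lact\<close> usable for \<open>ell\<close>.\<close>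

definition MM :: "('f, unit, 'm) conf_module"
  where "MM = \<lparr>scl = sc, der = dr, act = (\<lambda>_. ell)\<rparr>"

lemma ev_lact_MM: "ev \<phi> (lact MM a q p) = A (evF \<phi> q) (ev \<phi> p)"
proof -
  have "map_poly ((*) c) p = Polynomial.smult c p" for c and p :: "'m poly"
    by (rule poly_eqI) (simp add: coeff_map_poly)
  then show ?thesis
    by (subst ev_lact) (auto simp: MM_def ell_add ell_scale A_def)
qed

abbreviation skip :: "nat \<Rightarrow> nat \<Rightarrow> nat"
  where "skip i k \<equiv> if k < i then k else Suc k"

text \<open>The polynomial whose values are those of \<open>ced\<close>. Removing slot i renumbers
  the variables by \<open>skip i\<close>; a bracket puts \<lambda>_i + \<lambda>_j in slot j, with
  factor \<lambda>_i - \<lambda>_j. The sign (-1)^(n+1) of \<open>lc_diff\<close> is left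
  out.\<close>

definition dW :: "nat \<Rightarrow> 'm lpoly \<Rightarrow> 'm lpoly"
  where "dW n P = (\<Sum>i<Suc n. (- 1) ^ i * (lact MM () (lam i) (lsubst sc (\<lambda>k. lam (skip i k)) P) -
    (\<Sum>j\<in>{i<..<Suc n}. (lam i - lam j) *
      lsubst sc (\<lambda>k. if skip i k = j then lam i + lam j else lam (skip i k)) P)))"

lemma ev_dW: "ev \<phi> (dW n P) = (\<Sum>i<Suc n. (- 1) ^ i * (A (\<phi> i) (ev (\<lambda>k. \<phi> (skip i k)) P) -
    (\<Sum>j\<in>{i<..<Suc n}. \<kappa> (\<phi> i - \<phi> j) *
      ev (\<lambda>k. if skip i k = j then \<phi> i + \<phi> j else \<phi> (skip i k)) P)))"
proof -
  have [simp]: "evF \<phi> (if b then p else q) = (if b then evF \<phi> p else evF \<phi> q)" for b p q by simp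
  show ?thesis
    unfolding dW_def by (simp add: ev_simps ev_lact_MM ev_lsubst evF_lam ev_lam evF_simps \<kappa>_simps del: sum.lessThan_Suc cong: if_cong)
qed

lemma lpolys_dW:
  assumes "P \<in> lpolys n"
  shows "dW n P \<in> lpolys (Suc n)"
proof (rule mem_lpolysI)
  fix \<phi> \<psi> :: "nat \<Rightarrow> 'f"
  assume *: "\<And>k. k < Suc n \<Longrightarrow> \<phi> k = \<psi> k"
  have "ev (\<lambda>k. \<phi> (skip i k)) P = ev (\<lambda>k. \<psi> (skip i k)) P" for i
    by (rule ev_lpolys_cong[OF assms]) (simp add: *)
  moreover have "ev (\<lambda>k. if skip i k = j then \<phi> i + \<phi> j else \<phi> (skip i k)) P =
      ev (\<lambda>k. if skip i k = j then \<psi> i + \<psi> j else \<psi> (skip i k)) P" if "i < Suc n" "j < Suc n" for i j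
    by (rule ev_lpolys_cong[OF assms]) (use that in \<open>simp add: *\<close>)
  ultimately show "ev \<phi> (dW n P) = ev \<psi> (dW n P)"
    unfolding ev_dW by (intro sum.cong refl arg_cong2[of _ _ _ _ "(*)"] arg_cong2[of _ _ _ _ "(-)"]) (auto simp: *)
qed

lemma prod_list_del:
  "i < length xs \<Longrightarrow> prod_list (map f xs) = (f (xs ! i) * prod_list (map f (del i xs)) :: 'a::comm_monoid_mult)"
  by (subst id_take_nth_drop[of i xs]) (simp_all add: ac_simps)

lemma nth_del: "i < length xs \<Longrightarrow> k < length xs - 1 \<Longrightarrow> del i xs ! k = xs ! skip i k"
  by (simp add: nth_append min_def)

lemma length_del: "i < length xs \<Longrightarrow> length (del i xs) = length xs - 1"
  by simp

lemma ced_Zw: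
  assumes "P \<in> lpolys n" "length xs = Suc n"
  shows "ced br_vir ac (Zw n P) xs = Zw (Suc n) (dW n P) xs"
proof -
  let ?\<phi> = "lst (map fst xs)" and ?r = "\<kappa> (prod_list (map snd xs))"
  have 1: "ac (xs ! i) (Zw n P (del i xs)) = ?r * A (?\<phi> i) (ev (\<lambda>k. ?\<phi> (skip i k)) P)" if "i < Suc n" for i
  proof -
    have "ev (lst (map fst (del i xs))) P = ev (\<lambda>k. ?\<phi> (skip i k)) P"
    proof (rule ev_lpolys_cong[OF assms(1)])
      fix k assume "k < n"
      then show "lst (map fst (del i xs)) k = ?\<phi> (skip i k)"
        using that assms(2) nth_del[of i xs k] lst_map[of k "del i xs" fst] length_del[of i xs]
        by (simp add: lst_map del: append_take_drop_id length_append map_append)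
    qed
    then show ?thesis
      using that assms(2) prod_list_del[of i xs snd] length_del[of i xs]
      by (simp add: Zw_def ac_def A_scale lst_def \<kappa>_simps mult.assoc)
  qed
  have 2: "Zw n P (del i (xs[j := br_vir (xs ! i) (xs ! j)])) = ?r * (\<kappa> (?\<phi> i - ?\<phi> j) *
      ev (\<lambda>k. if skip i k = j then ?\<phi> i + ?\<phi> j else ?\<phi> (skip i k)) P)" if "i < j" "j < Suc n" for i j
  proof -
    let ?b = "br_vir (xs ! i) (xs ! j)" let ?ys = "xs[j := ?b]"
    have e: "ev (lst (map fst (del i ?ys))) P = ev (\<lambda>k. if skip i k = j then ?\<phi> i + ?\<phi> j else ?\<phi> (skip i k)) P"
    proof (rule ev_lpolys_cong[OF assms(1)])
      fix k assume k: "k < n"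
      have "del i ?ys ! k = ?ys ! skip i k" "length (del i ?ys) = n"
        using nth_del[of i ?ys k] that assms(2) k by auto
      then have "lst (map fst (del i ?ys)) k = fst (?ys ! skip i k)"
        using k lst_map[of k "del i ?ys" fst] by (simp only:)
      also have "\<dots> = (if skip i k = j then ?\<phi> i + ?\<phi> j else ?\<phi> (skip i k))"
        using that assms(2) k by (auto simp: nth_list_update lst_def br_vir_def)
      finally show "lst (map fst (del i ?ys)) k = (if skip i k = j then ?\<phi> i + ?\<phi> j else ?\<phi> (skip i k))" .
    qed
    \<comment> \<open>Deletion of slot i < j moves slot j to position j - 1.\<close>
    have m: "j - 1 < length (del i xs)" using that assms(2) by auto
    have del: "del i ?ys = (del i xs)[j - 1 := ?b]"
    proof (rule nth_equalityI)
      fix k assume "k < length (del i ?ys)"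
      then have k: "k < n" using that assms(2) by auto
      have "del i ?ys ! k = ?ys ! skip i k" using nth_del[of i ?ys k] that assms(2) k by auto
      moreover have "del i xs ! k = xs ! skip i k" using nth_del[of i xs k] that assms(2) k by auto
      ultimately show "del i ?ys ! k = (del i xs)[j - 1 := ?b] ! k"
        using that assms(2) k m by (auto simp: nth_list_update simp del: append_take_drop_id length_append)
    qed (use that assms(2) in auto)
    have "(if j - 1 < i then j - 1 else Suc (j - 1)) = j" "j - 1 < length xs - 1" "i < length xs"
      using that assms(2) by auto
    then have nj: "del i xs ! (j - 1) = xs ! j"
      using nth_del[of i xs "j - 1"] by (simp only:)
    have p1: "prod_list (map snd (del i ?ys)) = snd ?b * prod_list (map snd (del (j - 1) (del i xs)))"
    proof -
      have "prod_list (map snd ((del i xs)[j - 1 := ?b])) = snd ((del i xs)[j - 1 := ?b] ! (j - 1)) *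
        prod_list (map snd (del (j - 1) ((del i xs)[j - 1 := ?b])))"
        by (rule prod_list_del) (use m in simp)
      also have "(del i xs)[j - 1 := ?b] ! (j - 1) = ?b" using m by (simp only: nth_list_update_eq)
      also have "del (j - 1) ((del i xs)[j - 1 := ?b]) = del (j - 1) (del i xs)"
        by (simp only: take_update_cancel order_refl drop_update_cancel lessI)
      finally show ?thesis unfolding del .
    qed
    have p2: "prod_list (map snd (del i xs)) = snd (xs ! j) * prod_list (map snd (del (j - 1) (del i xs)))"
      using prod_list_del[OF m, of snd] unfolding nj .
    have p3: "prod_list (map snd xs) = snd (xs ! i) * prod_list (map snd (del i xs))"
      by (rule prod_list_del) (use that assms(2) in auto)
    have b: "snd ?b = snd (xs ! i) * snd (xs ! j) * (?\<phi> i - ?\<phi> j)"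
      using that assms(2) by (simp add: br_vir_def lst_map)
    have "prod_list (map snd (del i ?ys)) = prod_list (map snd xs) * (?\<phi> i - ?\<phi> j)"
      unfolding p1 p3 p2 b by (simp only: mult_ac)
    moreover have "length (del i ?ys) = n" using that assms(2) by simp
    ultimately show ?thesis
      by (simp only: Zw_def e \<kappa>_simps if_True mult.assoc simp_thms)
  qed
  have "ced br_vir ac (Zw n P) xs = ?r * ev ?\<phi> (dW n P)"
    unfolding ced_expand ev_dW assms(2) sum_distrib_left
  proof (rule sum.cong[OF refl])
    fix i assume "i \<in> {..<Suc n}"
    then have i: "i < Suc n" by simp
    have "(\<Sum>j\<in>{i<..<Suc n}. Zw n P (del i (xs[j := br_vir (xs ! i) (xs ! j)]))) =
      ?r * (\<Sum>j\<in>{i<..<Suc n}. \<kappa> (?\<phi> i - ?\<phi> j) *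
        ev (\<lambda>k. if skip i k = j then ?\<phi> i + ?\<phi> j else ?\<phi> (skip i k)) P)"
      unfolding sum_distrib_left by (intro sum.cong refl 2) auto
    then show "(- 1) ^ i * (ac (xs ! i) (Zw n P (del i xs)) -
        (\<Sum>j\<in>{i<..<Suc n}. Zw n P (del i (xs[j := br_vir (xs ! i) (xs ! j)])))) =
      ?r * ((- 1) ^ i * (A (?\<phi> i) (ev (\<lambda>k. ?\<phi> (skip i k)) P) - (\<Sum>j\<in>{i<..<Suc n}. \<kappa> (?\<phi> i - ?\<phi> j) *
        ev (\<lambda>k. if skip i k = j then ?\<phi> i + ?\<phi> j else ?\<phi> (skip i k)) P)))"
      unfolding 1[OF i] by (simp only: right_diff_distrib mult.left_commute)
  qed
  then show ?thesis
    by (simp add: Zw_def assms(2))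
qed

lemma ced_Zw_other: "length xs \<noteq> Suc n \<Longrightarrow> ced br_vir ac (Zw n P) xs = 0"
proof -
  assume "length xs \<noteq> Suc n"
  then have "ced br_vir ac (Zw n P) xs = ced br_vir ac (\<lambda>_. 0) xs"
    by (intro ced_cong) (auto simp: Zw_def)
  then show ?thesis by (simp add: d_zero)
qed

lemma ced_Zw_eq: "P \<in> lpolys n \<Longrightarrow> ced br_vir ac (Zw n P) = Zw (Suc n) (dW n P)"
proof
  fix xs assume "P \<in> lpolys n"
  then show "ced br_vir ac (Zw n P) xs = Zw (Suc n) (dW n P) xs"
    using ced_Zw ced_Zw_other by (cases "length xs = Suc n") (auto simp: Zw_def)
qed

lemma dW_dW: "P \<in> lpolys n \<Longrightarrow> dW (Suc n) (dW n P) = 0"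
  by (rule Zw_eqI[of _ "Suc (Suc n)"])
    (simp_all add: lpolys_dW lpolys_0 d_d[OF jacobi_Zw] flip: ced_Zw_eq, simp add: Zw_def ev_simps)

lemma dW_add: "dW n (P + Q) = dW n P + dW n Q"
  by (rule ev_eqI)
    (simp add: ev_dW ev_simps A_add algebra_simps sum.distrib sum_subtractf del: sum.lessThan_Suc)

lemma dW_scale: "dW n (Poly_Mapping.single 0 (\<kappa> x) * P) = Poly_Mapping.single 0 (\<kappa> x) * dW n P"
proof (rule ev_eqI)
  fix \<phi>
  have "a * (\<kappa> x * b - (\<Sum>j\<in>S. c j * (\<kappa> x * e j))) = \<kappa> x * (a * (b - (\<Sum>j\<in>S. c j * e j)))"
    for a b and c e :: "nat \<Rightarrow> 'm" and S
    by (simp add: sum_distrib_left right_diff_distrib mult.left_commute)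
  then show "ev \<phi> (dW n (Poly_Mapping.single 0 (\<kappa> x) * P)) = ev \<phi> (Poly_Mapping.single 0 (\<kappa> x) * dW n P)"
    by (simp only: ev_dW ev_simps ev_const A_scale sum_distrib_left[of "\<kappa> x" _ "{..<Suc n}"])
qed

definition D :: "nat \<Rightarrow> 'm lpoly \<Rightarrow> 'm lpoly"
  where "D n P = Poly_Mapping.map dr P + lmult sc (\<Sum>i<n. lam i) P"

lemma ev_D: "ev \<phi> (D n P) = dr (ev \<phi> P) + \<kappa> (\<Sum>i<n. \<phi> i) * ev \<phi> P"
  by (simp add: D_def ev_simps ev_map[OF additive_der der_scale] ev_lmult evF_simps evF_lam)

lemma lpolys_D: "P \<in> lpolys n \<Longrightarrow> D n P \<in> lpolys n"
proof (rule mem_lpolysI)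
  fix \<phi> \<psi> :: "nat \<Rightarrow> 'f"
  assume P: "P \<in> lpolys n" and *: "\<And>k. k < n \<Longrightarrow> \<phi> k = \<psi> k"
  have "ev \<phi> P = ev \<psi> P" "sum \<phi> {..<n} = sum \<psi> {..<n}"
    by (rule ev_lpolys_cong[OF P *], assumption) (simp add: *)
  then show "ev \<phi> (D n P) = ev \<psi> (D n P)" by (simp only: ev_D)
qed

lemma D_add: "D n (P + Q) = D n P + D n Q"
  by (rule ev_eqI) (simp add: ev_D ev_simps der_add algebra_simps)

lemma D_scale: "D n (Poly_Mapping.single 0 (\<kappa> x) * P) = Poly_Mapping.single 0 (\<kappa> x) * D n P"
  by (rule ev_eqI) (simp add: ev_D ev_simps ev_const der_scale algebra_simps)

text \<open>\<open>\<partial> + \<lambda>\<^sub>1 + \<dots> + \<lambda>\<^sub>n\<close> is the Lie derivative along \<open>L\<^sub>\<lambda>\<close> at \<open>\<lambda> = 0\<close>, hence commutes with the differential.\<close>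

lemma lieder_Zw_0:
  assumes "P \<in> lpolys n"
  shows "lieder br_vir ac (0, 1) (Zw n P) = Zw n (D n P)"
proof
  fix xs
  show "lieder br_vir ac (0, 1) (Zw n P) xs = Zw n (D n P) xs"
  proof (cases "length xs = n")
    case True
    \<comment> \<open>[L_0, L_x] = -x L_x, so bracketing slot j multiplies the value by minus its
      coordinate; summed over j this yields the factor \<lambda>_1 + ... + \<lambda>_n of D.\<close>
    have "Zw n P (xs[j := br_vir (0, 1) (xs ! j)]) = - (\<kappa> (fst (xs ! j)) * Zw n P xs)" if "j < n" for j
    proof -
      have "Zw n P (take j xs @ (fst (xs ! j), - fst (xs ! j) * snd (xs ! j)) # drop (Suc j) xs) =
        - (\<kappa> (fst (xs ! j)) * Zw n P (take j xs @ (fst (xs ! j), snd (xs ! j)) # drop (Suc j) xs))"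
        unfolding Zw_scale by (simp add: \<kappa>_simps)
      then show ?thesis
        using that True by (simp add: br_vir_def upd_conv_take_nth_drop id_take_nth_drop[symmetric] mult.commute)
    qed
    then have "lieder br_vir ac (0, 1) (Zw n P) xs = dr (Zw n P xs) + \<kappa> (\<Sum>j<n. fst (xs ! j)) * Zw n P xs"
      using True by (simp add: lieder_def ac_def A_0 \<kappa>_simps sum_negf rhom_sum[OF \<kappa>] sum_distrib_right)
    also have "\<dots> = Zw n (D n P) xs"
      using True by (simp add: Zw_def ev_D der_scale lst_def algebra_simps)
    finally show ?thesis .
  qed (simp add: lieder_def Zw_def ac_def A_0 additive.zero[OF additive_der])
qed

lemma dW_D: "P \<in> lpolys n \<Longrightarrow> dW n (D n P) = D (Suc n) (dW n P)"
  by (rule Zw_eqI[of _ "Suc n"])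
    (simp_all add: lpolys_dW lpolys_D \<theta>_d[OF jacobi_Zw] flip: ced_Zw_eq lieder_Zw_0)

end

section \<open>Coefficients of the first power of a variable and contraction by L_(1)\<close>

context coef
begin

text \<open>The derivative at 0 of a polynomial function of a scalar, as a relation between function
  and value. It is single-valued because the field is infinite, and it is computed by the sum and
  product rules below.\<close>

definition lin1 :: "('f \<Rightarrow> 'm) \<Rightarrow> 'm \<Rightarrow> bool"
  where "lin1 f c \<longleftrightarrow> (\<exists>p. (\<forall>x. f x = poly p (\<kappa> x)) \<and> coeff p 1 = c)"

lemma lin1_unique: "lin1 f c \<Longrightarrow> lin1 f c' \<Longrightarrow> c = c'"
  unfolding lin1_def using poly_\<kappa>_eqI by metis

lemma lin1_poly: "lin1 (\<lambda>x. poly p (\<kappa> x)) (coeff p 1)"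
  unfolding lin1_def by blast

lemma lin1_const: "lin1 (\<lambda>_. c) 0"
  unfolding lin1_def by (intro exI[of _ "[:c:]"]) (simp add: coeff_pCons)

lemma lin1_\<kappa>: "lin1 \<kappa> 1"
  unfolding lin1_def by (intro exI[of _ "[:0, 1:]"]) (simp add: coeff_pCons)

lemma lin1_add: "lin1 f a \<Longrightarrow> lin1 g b \<Longrightarrow> lin1 (\<lambda>x. f x + g x) (a + b)"
  unfolding lin1_def by (metis poly_add coeff_add)

lemma lin1_diff: "lin1 f a \<Longrightarrow> lin1 g b \<Longrightarrow> lin1 (\<lambda>x. f x - g x) (a - b)"
  unfolding lin1_def by (metis poly_diff coeff_diff)

lemma lin1_sum: "(\<And>i. i \<in> S \<Longrightarrow> lin1 (f i) (c i)) \<Longrightarrow> lin1 (\<lambda>x. \<Sum>i\<in>S. f i x) (\<Sum>i\<in>S. c i)"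
  by (induction S rule: infinite_finite_induct) (auto intro: lin1_const lin1_add)

lemma lin1_mult:
  assumes "lin1 f a" "lin1 g b"
  shows "lin1 (\<lambda>x. f x * g x) (f 0 * b + a * g 0)"
proof -
  obtain p where p: "\<And>x. f x = poly p (\<kappa> x)" "coeff p 1 = a" using assms(1) unfolding lin1_def by blast
  obtain q where q: "\<And>x. g x = poly q (\<kappa> x)" "coeff q 1 = b" using assms(2) unfolding lin1_def by blast
  have "f 0 = coeff p 0" "g 0 = coeff q 0"
    by (simp_all add: p q \<kappa>_simps poly_0_coeff_0)
  moreover have "coeff (p * q) 1 = coeff p 0 * coeff q 1 + coeff p 1 * coeff q 0"
    by (simp add: coeff_mult)
  ultimately show ?thesis
    unfolding lin1_def using p q by (intro exI[of _ "p * q"]) simp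
qed

lemma lin1_linear:
  assumes "additive h" "\<And>x m. h (\<kappa> x * m) = \<kappa> x * h m" "lin1 f c"
  shows "lin1 (\<lambda>x. h (f x)) (h c)"
proof -
  obtain p where p: "\<And>x. f x = poly p (\<kappa> x)" "coeff p 1 = c" using assms(3) unfolding lin1_def by blast
  have "h (f x) = poly (map_poly h p) (\<kappa> x)" for x
    unfolding p(1) by (rule poly_map_poly_additive[symmetric, OF assms(1)]) (simp add: mult.commute[of _ "\<kappa> x"] assms(2))
  then show ?thesis
    unfolding lin1_def using p by (intro exI[of _ "map_poly h p"]) (simp add: coeff_map_poly additive.zero[OF assms(1)])
qed

text \<open>The derivative is stated after multiplication by y, which avoids the exponent m - 1;
  only this product occurs later.\<close>

lemma lin1_power: "\<exists>c. lin1 (\<lambda>x. \<kappa> ((y + x) ^ m)) c \<and> \<kappa> y * c = of_nat m * \<kappa> (y ^ m)"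
proof (induction m)
  case 0
  show ?case using lin1_const[of "\<kappa> 1"] by auto
next
  case (Suc m)
  then obtain c where c: "lin1 (\<lambda>x. \<kappa> ((y + x) ^ m)) c" "\<kappa> y * c = of_nat m * \<kappa> (y ^ m)" by blast
  have "lin1 (\<lambda>x. \<kappa> (y + x)) 1"
    using lin1_add[OF lin1_const[of "\<kappa> y"] lin1_\<kappa>] by (simp add: \<kappa>_simps)
  from lin1_mult[OF this c(1)] have "lin1 (\<lambda>x. \<kappa> ((y + x) ^ Suc m)) (\<kappa> y * c + \<kappa> (y ^ m))"
    by (simp add: \<kappa>_simps)
  moreover have "\<kappa> y * (\<kappa> y * c + \<kappa> (y ^ m)) = of_nat (Suc m) * \<kappa> (y ^ Suc m)"
    using c(2) by (simp add: \<kappa>_simps algebra_simps)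
  ultimately show ?case by blast
qed

end

definition wmap :: "('k \<Rightarrow> 'm \<Rightarrow> 'm) \<Rightarrow> ('k \<Rightarrow>\<^sub>0 'm::ab_group_add) \<Rightarrow> ('k \<Rightarrow>\<^sub>0 'm)"
  where "wmap f P = Poly_Mapping.mapp f P"

lemma lookup_wmap:
  assumes "\<And>t. additive (f t)"
  shows "Poly_Mapping.lookup (wmap f P) t = f t (Poly_Mapping.lookup P t)"
  using additive.zero[OF assms, of t] by (auto simp: wmap_def lookup_mapp when_def in_keys_iff)

lemma wmap_add:
  assumes "\<And>t. additive (f t)"
  shows "wmap f (P + Q) = wmap f P + wmap f Q"
  by (rule poly_mapping_eqI) (simp add: lookup_wmap[OF assms] lookup_add additive.add[OF assms])

lemma additive_wmap: "(\<And>t. additive (f t)) \<Longrightarrow> additive (wmap f)"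
  by (simp add: additive_def wmap_add)

lemma wmap_single:
  assumes "\<And>t. additive (f t)"
  shows "wmap f (Poly_Mapping.single t c) = Poly_Mapping.single t (f t c)"
  by (rule poly_mapping_eqI) (auto simp: lookup_wmap[OF assms] lookup_single when_def additive.zero[OF assms])

lemma lookup_const_mult:
  fixes P :: "'m::comm_ring_1 lpoly"
  shows "Poly_Mapping.lookup (Poly_Mapping.single 0 c * P) t = c * Poly_Mapping.lookup P t"
  by (auto simp: mult_map_scale_conv_mult[symmetric] Poly_Mapping.map.rep_eq when_def)

lemma additive_mult_left: "additive ((*) (c :: 'm::comm_ring_1))"
  by (simp add: additive_def algebra_simps)

context coef
begin

text \<open>The Euler operator \<lambda>_j d/d\<lambda>_j.\<close>

definition Eu :: "nat \<Rightarrow> 'm lpoly \<Rightarrow> 'm lpoly"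
  where "Eu j = wmap (\<lambda>t. (*) (of_nat (Poly_Mapping.lookup t j)))"

lemma lin1_ev_shift: "\<exists>c. lin1 (\<lambda>x. ev (\<phi>(j := \<phi> j + x)) P) c \<and> \<kappa> (\<phi> j) * c = ev \<phi> (Eu j P)"
proof -
  have 1: "\<exists>c. lin1 (\<lambda>x. ev (\<phi>(j := \<phi> j + x)) (Poly_Mapping.single t a)) c \<and>
    \<kappa> (\<phi> j) * c = ev \<phi> (Eu j (Poly_Mapping.single t a))" for t a
  proof -
    let ?S = "insert j (Poly_Mapping.keys t)" let ?m = "Poly_Mapping.lookup t j"
    define r where "r = (\<Prod>k\<in>Poly_Mapping.keys t - {j}. \<phi> k ^ Poly_Mapping.lookup t k)"
    have mon: "mon (\<phi>(j := y)) t = y ^ ?m * r" for y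
    proof -
      have "mon (\<phi>(j := y)) t = (\<Prod>k\<in>?S. (\<phi>(j := y)) k ^ Poly_Mapping.lookup t k)"
        by (rule mon_superset) auto
      also have "\<dots> = y ^ ?m * (\<Prod>k\<in>?S - {j}. (\<phi>(j := y)) k ^ Poly_Mapping.lookup t k)"
        by (subst prod.remove[of _ j]) auto
      also have "(\<Prod>k\<in>?S - {j}. (\<phi>(j := y)) k ^ Poly_Mapping.lookup t k) = r"
        unfolding r_def by (rule prod.cong) auto
      finally show ?thesis .
    qed
    obtain c where c: "lin1 (\<lambda>x. \<kappa> ((\<phi> j + x) ^ ?m)) c" "\<kappa> (\<phi> j) * c = of_nat ?m * \<kappa> (\<phi> j ^ ?m)"
      using lin1_power by blast
    have "lin1 (\<lambda>x. ev (\<phi>(j := \<phi> j + x)) (Poly_Mapping.single t a)) (c * (\<kappa> r * a))"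
      using lin1_mult[OF c(1) lin1_const[of "\<kappa> r * a"]]
      by (simp add: ev_single mon \<kappa>_simps mult.assoc)
    moreover have "\<kappa> (\<phi> j) * (c * (\<kappa> r * a)) = ev \<phi> (Eu j (Poly_Mapping.single t a))"
    proof -
      have "\<kappa> (\<phi> j) * (c * (\<kappa> r * a)) = (\<kappa> (\<phi> j) * c) * (\<kappa> r * a)" by (simp only: mult.assoc)
      also have "\<dots> = \<kappa> (mon (\<phi>(j := \<phi> j)) t) * (of_nat ?m * a)"
        unfolding c(2) mon by (simp add: \<kappa>_simps mult_ac)
      finally show ?thesis
        by (simp add: Eu_def wmap_single[OF additive_mult_left] ev_single)
    qed
    ultimately show ?thesis by blast
  qed
  then obtain c where c: "\<And>t a. lin1 (\<lambda>x. ev (\<phi>(j := \<phi> j + x)) (Poly_Mapping.single t a)) (c t a)"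
    "\<And>t a. \<kappa> (\<phi> j) * c t a = ev \<phi> (Eu j (Poly_Mapping.single t a))" by metis
  let ?s = "\<lambda>t. Poly_Mapping.single t (Poly_Mapping.lookup P t)"
  have "lin1 (\<lambda>x. \<Sum>t\<in>Poly_Mapping.keys P. ev (\<phi>(j := \<phi> j + x)) (?s t)) (\<Sum>t\<in>Poly_Mapping.keys P. c t (Poly_Mapping.lookup P t))"
    by (rule lin1_sum) (rule c)
  moreover have "(\<Sum>t\<in>Poly_Mapping.keys P. ev (\<phi>(j := \<phi> j + x)) (?s t)) = ev (\<phi>(j := \<phi> j + x)) P" for x
    by (simp only: rhom_sum[OF rhom_ev, symmetric] lpoly_sum_monomials)
  moreover have "\<kappa> (\<phi> j) * (\<Sum>t\<in>Poly_Mapping.keys P. c t (Poly_Mapping.lookup P t)) = ev \<phi> (Eu j P)"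
  proof -
    have "ev \<phi> (Eu j (\<Sum>t\<in>Poly_Mapping.keys P. ?s t)) = (\<Sum>t\<in>Poly_Mapping.keys P. ev \<phi> (Eu j (?s t)))"
      unfolding Eu_def by (simp only: additive.sum[OF additive_wmap[OF additive_mult_left]] rhom_sum[OF rhom_ev])
    then show ?thesis
      by (simp only: sum_distrib_left c(2) lpoly_sum_monomials)
  qed
  ultimately show ?thesis by (simp only:) blast
qed

text \<open>P as a polynomial in its first variable. The shift by \<open>case_nat\<close> renumbers
  the remaining variables from 0, as required after the removal of slot 0.\<close>

definition U :: "'m lpoly \<Rightarrow> 'm lpoly poly"
  where "U = lhom (\<lambda>a. [:Poly_Mapping.single 0 a:]) (case_nat [:0, 1:] (\<lambda>k. [:lam k:]))"

text \<open>Contraction by L_(1): L_x is put into the first slot and the coefficient of x is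
  taken.\<close>

definition K :: "'m lpoly \<Rightarrow> 'm lpoly"
  where "K P = coeff (U P) 1"

lemma rhom_U0: "rhom (\<lambda>a. [:Poly_Mapping.single 0 a:] :: 'm lpoly poly)"
  by (simp add: rhom_def single_add mult_single one_pCons mult.commute)

lemma U_add: "U (P + Q) = U P + U Q"
  unfolding U_def by (rule lhom_add[OF rhom_U0])

lemma K_add: "K (P + Q) = K P + K Q"
  by (simp add: K_def U_add)

lemma additive_K: "additive K"
  by (simp add: additive_def K_add)

lemma poly_U: "poly (map_poly (ev \<phi>) (U P)) (\<kappa> x) = ev (case_nat x \<phi>) P"
proof (induction P rule: lpoly_induct)
  case (const c)
  show ?case
    by (simp add: U_def lhom_const[OF rhom_U0] map_poly_pCons ev_const ev_simps)
next
  case (lam i P)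
  have "map_poly (ev \<phi>) (Polynomial.smult a q) = Polynomial.smult (ev \<phi> a) (map_poly (ev \<phi>) q)" for a q
    by (rule poly_eqI) (simp add: coeff_map_poly ev_simps)
  moreover have "map_poly (ev \<phi>) (pCons 0 q) = pCons 0 (map_poly (ev \<phi>) q)" for q
    by (rule poly_eqI) (simp add: coeff_map_poly ev_simps coeff_pCons split: nat.split)
  ultimately show ?case
    using lam by (cases i) (simp_all add: U_def lhom_mult[OF rhom_U0] lhom_lam[OF rhom_U0] ev_simps ev_lam)
next
  case (add P Q)
  have "map_poly (ev \<phi>) (U P + U Q) = map_poly (ev \<phi>) (U P) + map_poly (ev \<phi>) (U Q)"
    by (rule poly_eqI) (simp add: coeff_map_poly ev_simps)
  then show ?case using add by (simp add: U_add ev_simps)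
qed

lemma lin1_K: "lin1 (\<lambda>x. ev (case_nat x \<phi>) P) (ev \<phi> (K P))"
  using lin1_poly[of "map_poly (ev \<phi>) (U P)"] by (simp add: poly_U K_def coeff_map_poly ev_simps)

lemma lpolys_K:
  assumes "P \<in> lpolys (Suc n)"
  shows "K P \<in> lpolys n"
proof (rule mem_lpolysI)
  fix \<phi> \<psi> :: "nat \<Rightarrow> 'f"
  assume *: "\<And>k. k < n \<Longrightarrow> \<phi> k = \<psi> k"
  have "ev (case_nat x \<phi>) P = ev (case_nat x \<psi>) P" for x
    by (rule ev_lpolys_cong[OF assms]) (simp add: * split: nat.split)
  then have "lin1 (\<lambda>x. ev (case_nat x \<psi>) P) (ev \<phi> (K P))"
    using lin1_K[of \<phi> P] by simp
  then show "ev \<phi> (K P) = ev \<psi> (K P)"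
    using lin1_K lin1_unique by blast
qed

lemma K_lpolys_0:
  assumes "P \<in> lpolys 0"
  shows "K P = 0"
proof (rule ev_eqI)
  fix \<phi>
  have "ev (case_nat x \<phi>) P = ev \<phi> P" for x
    by (rule ev_lpolys_cong[OF assms]) simp
  then have "lin1 (\<lambda>x. ev (case_nat x \<phi>) P) 0"
    using lin1_const by simp
  then show "ev \<phi> (K P) = ev \<phi> 0"
    using lin1_K lin1_unique by (simp add: ev_simps) blast
qed

end

context vir_module
begin

text \<open>The differential is built from operators linear over the scalars, so it commutes with
  taking the coefficient of x.\<close>

lemma lin1_ced:
  assumes "\<And>ys. lin1 (\<lambda>x. Z x ys) (Z' ys)"
  shows "lin1 (\<lambda>x. ced br_vir ac (Z x) xs) (ced br_vir ac Z' xs)"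
  using assms
proof (induction xs arbitrary: Z Z')
  case Nil
  show ?case using lin1_const by simp
next
  case (Cons y ys)
  have ac: "lin1 (\<lambda>x. ac y (f x)) (ac y c)" if "lin1 f c" for f c
    using ac_add by (intro lin1_linear[OF _ _ that]) (simp add: additive_def, simp add: ac_def A_scale mult.left_commute)
  have "lin1 (\<lambda>x. lieder br_vir ac y (Z x) ys) (lieder br_vir ac y Z' ys)"
    unfolding lieder_def by (intro lin1_diff ac lin1_sum Cons.prems)
  moreover have "lin1 (\<lambda>x. ced br_vir ac (\<lambda>zs. Z x (y # zs)) ys) (ced br_vir ac (\<lambda>zs. Z' (y # zs)) ys)"
    by (rule Cons.IH) (rule Cons.prems)
  ultimately show ?case
    unfolding ced.simps by (rule lin1_diff)
qed

text \<open>The Lie derivative along L_(1): weight of the coefficient plus degree of the monomial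
  minus n. Each slot contributes -1 because the bracket [L_x, L_y] carries the factor x - y.\<close>

definition \<Theta> :: "nat \<Rightarrow> 'm lpoly \<Rightarrow> 'm lpoly"
  where "\<Theta> n = wmap (\<lambda>t c. H c + (of_nat (mdeg t) - of_nat n) * c)"

lemma additive_\<Theta>0: "additive (\<lambda>c. H c + a * c)"
  using additive.add[OF additive_H] by (simp add: additive_def algebra_simps)

lemma ev_\<Theta>:
  assumes "P \<in> lpolys n"
  shows "ev \<phi> (\<Theta> n P) = H (ev \<phi> P) - (\<Sum>j<n. ev \<phi> P - ev \<phi> (Eu j P))"
proof -
  have "\<Theta> n P = Poly_Mapping.map H P + (\<Sum>j<n. Eu j P) - Poly_Mapping.single 0 (of_nat n) * P"
  proof (rule poly_mapping_eqI)
    fix t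
    have "(\<Sum>j<n. of_nat (Poly_Mapping.lookup t j) * Poly_Mapping.lookup P t) = of_nat (mdeg t) * Poly_Mapping.lookup P t"
    proof (cases "t \<in> Poly_Mapping.keys P")
      case True
      then have "mdeg t = (\<Sum>j<n. Poly_Mapping.lookup t j)"
        using assms by (intro mdeg_superset) (auto simp: lpolys_def)
      then show ?thesis by (simp add: sum_distrib_right)
    qed (simp add: in_keys_iff)
    moreover have "Poly_Mapping.lookup (\<Theta> n P) t =
        H (Poly_Mapping.lookup P t) + (of_nat (mdeg t) - of_nat n) * Poly_Mapping.lookup P t"
      unfolding \<Theta>_def by (rule lookup_wmap[OF additive_\<Theta>0])
    moreover have "Poly_Mapping.lookup (Eu j P) t = of_nat (Poly_Mapping.lookup t j) * Poly_Mapping.lookup P t" for j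
      unfolding Eu_def by (rule lookup_wmap[OF additive_mult_left])
    moreover have "Poly_Mapping.lookup (Poly_Mapping.map H P) t = H (Poly_Mapping.lookup P t)"
      by (simp add: Poly_Mapping.map.rep_eq when_def additive.zero[OF additive_H])
    ultimately show "Poly_Mapping.lookup (\<Theta> n P) t =
      Poly_Mapping.lookup (Poly_Mapping.map H P + (\<Sum>j<n. Eu j P) - Poly_Mapping.single 0 (of_nat n) * P) t"
      unfolding lookup_minus lookup_add lookup_sum lookup_const_mult
      by (simp add: left_diff_distrib)
  qed
  then show ?thesis
    by (simp add: ev_simps rhom_of_nat[OF rhom_ev] ev_map[OF additive_H H_scale] ev_const sum_subtractf)
qed

text \<open>The differential arriving in degree n, with value 0 in degree 0, so that Cartan's
  formula and exactness are uniform in n.\<close>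

definition dm :: "nat \<Rightarrow> 'm lpoly \<Rightarrow> 'm lpoly"
  where "dm n P = (case n of 0 \<Rightarrow> 0 | Suc m \<Rightarrow> dW m P)"

text \<open>The defining recursion of \<open>ced\<close> with first argument L_x, compared in the
  coefficient of x. The contraction supplies \<open>K\<close>, and the Lie derivative along L_x
  supplies \<open>\<Theta>\<close>.\<close>

lemma cartan:
  assumes P: "P \<in> lpolys n"
  shows "dm n (K P) + K (dW n P) = \<Theta> n P"
proof (rule ev_eqI)
  fix \<phi>
  let ?xs = "evs n \<phi>"
  let ?f = "\<lambda>x. ced br_vir ac (Zw n P) ((x, 1) # ?xs)"
  have "?f x = ev (case_nat x \<phi>) (dW n P)" for x
  proof -
    have "?f x = ev (lst (x # map \<phi> [0..<n])) (dW n P)"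
      using P by (simp add: ced_Zw_eq Zw_def \<kappa>_simps comp_def map_replicate_const del: ced.simps)
    also have "\<dots> = ev (case_nat x \<phi>) (dW n P)"
      by (rule ev_lpolys_cong[OF lpolys_dW[OF P]]) (auto simp: lst_def split: nat.split)
    finally show ?thesis .
  qed
  then have 1: "lin1 ?f (ev \<phi> (K (dW n P)))"
    using lin1_K[of \<phi> "dW n P"] by (simp del: ced.simps)
  \<comment> \<open>The contraction of \<open>Zw n P\<close> by L_(1); for n = 0 there is no slot to
    contract.\<close>
  define Z' where "Z' ys = (case n of 0 \<Rightarrow> 0 | Suc m \<Rightarrow> Zw m (K P) ys)" for ys
  have "lin1 (\<lambda>x. Zw n P ((x, 1) # ys)) (Z' ys)" for ys
  proof (cases "length ys + 1 = n")
    case True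
    let ?\<psi> = "lst (map fst ys)"
    have "Zw n P ((x, 1) # ys) = \<kappa> (prod_list (map snd ys)) * ev (case_nat x ?\<psi>) P" for x
    proof -
      have "ev (lst (x # map fst ys)) P = ev (case_nat x ?\<psi>) P"
        using True by (intro ev_lpolys_cong[OF P]) (auto simp: lst_def split: nat.split)
      then show ?thesis using True by (simp add: Zw_def)
    qed
    moreover have "Z' ys = \<kappa> (prod_list (map snd ys)) * ev ?\<psi> (K P)"
      using True by (auto simp: Z'_def Zw_def)
    ultimately show ?thesis
      using lin1_mult[OF lin1_const[of "\<kappa> (prod_list (map snd ys))"] lin1_K[of ?\<psi> P]] by simp
  next
    case False
    then have "Zw n P ((x, 1) # ys) = 0" "Z' ys = 0" for x
      by (auto simp: Zw_def Z'_def split: nat.split)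
    then show ?thesis using lin1_const by simp
  qed
  then have "lin1 (\<lambda>x. ced br_vir ac (\<lambda>ys. Zw n P ((x, 1) # ys)) ?xs) (ced br_vir ac Z' ?xs)"
    by (rule lin1_ced)
  moreover have "ced br_vir ac Z' ?xs = ev \<phi> (dm n (K P))"
  proof (cases n)
    case 0
    then show ?thesis by (simp add: dm_def ev_simps)
  next
    case (Suc m)
    then have "Z' = Zw m (K P)" by (simp add: Z'_def fun_eq_iff)
    moreover have "K P \<in> lpolys m" using P Suc lpolys_K by blast
    ultimately show ?thesis
      using Suc Zw_evs[OF lpolys_dW, of "K P" m \<phi>] by (simp only: ced_Zw_eq dm_def nat.case)
  qed
  ultimately have 2: "lin1 (\<lambda>x. ced br_vir ac (\<lambda>ys. Zw n P ((x, 1) # ys)) ?xs) (ev \<phi> (dm n (K P)))"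
    by simp
  have Zj: "Zw n P (?xs[j := br_vir (x, 1) (?xs ! j)]) = (\<kappa> x - \<kappa> (\<phi> j)) * ev (\<phi>(j := \<phi> j + x)) P" if "j < n" for j x
  proof -
    have "prod_list (map snd (?xs[j := (x + \<phi> j, x - \<phi> j)])) = x - \<phi> j"
    proof -
      have r: "map snd (take a ?xs) = replicate (length (take a ?xs)) 1" "map snd (drop a ?xs) = replicate (length (drop a ?xs)) 1" for a
        by (auto simp: take_map drop_map comp_def map_replicate_const)
      show ?thesis using that by (simp add: upd_conv_take_nth_drop r)
    qed
    moreover have "ev (lst (map fst (?xs[j := (x + \<phi> j, x - \<phi> j)]))) P = ev (\<phi>(j := \<phi> j + x)) P"
      by (rule ev_lpolys_cong[OF P]) (use that in \<open>auto simp: lst_def map_update nth_list_update\<close>)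
    ultimately show ?thesis
      using that by (simp add: Zw_def br_vir_def \<kappa>_simps)
  qed
  \<comment> \<open>By the product rule, the coefficient of x in (x - \<phi>_j) P(..., \<phi>_j + x,
    ...) is P minus \<phi>_j times its partial derivative, that is, P minus
    \<open>Eu j P\<close>.\<close>
  have lj: "lin1 (\<lambda>x. Zw n P (?xs[j := br_vir (x, 1) (?xs ! j)])) (ev \<phi> P - ev \<phi> (Eu j P))" if "j < n" for j
  proof -
    obtain c where c: "lin1 (\<lambda>x. ev (\<phi>(j := \<phi> j + x)) P) c" "\<kappa> (\<phi> j) * c = ev \<phi> (Eu j P)"
      using lin1_ev_shift by blast
    have "lin1 (\<lambda>x. \<kappa> x - \<kappa> (\<phi> j)) 1" using lin1_diff[OF lin1_\<kappa> lin1_const[of "\<kappa> (\<phi> j)"]] by simp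
    from lin1_mult[OF this c(1)] show ?thesis
      using c(2) by (simp add: Zj[OF that] \<kappa>_simps)
  qed
  have "lin1 (\<lambda>x. ac (x, 1) (Zw n P ?xs)) (H (ev \<phi> P))"
    using lin1_poly[of "ell (ev \<phi> P)"] by (simp add: ac_def A_def H_def \<kappa>_simps Zw_evs[OF P])
  then have "lin1 (\<lambda>x. lieder br_vir ac (x, 1) (Zw n P) ?xs) (H (ev \<phi> P) - (\<Sum>j<n. ev \<phi> P - ev \<phi> (Eu j P)))"
    unfolding lieder_def length_map length_upt minus_nat.diff_0 by (intro lin1_diff lin1_sum lj) auto
  then have "lin1 ?f (ev \<phi> (\<Theta> n P) - ev \<phi> (dm n (K P)))"
    unfolding ced.simps ev_\<Theta>[OF P] by (rule lin1_diff[OF _ 2])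
  then have "ev \<phi> (K (dW n P)) = ev \<phi> (\<Theta> n P) - ev \<phi> (dm n (K P))"
    using lin1_unique[OF 1] by blast
  then show "ev \<phi> (dm n (K P) + K (dW n P)) = ev \<phi> (\<Theta> n P)"
    by (simp add: ev_simps)
qed

end

section \<open>Skewsymmetric polynomials and the grading by total degree\<close>

lemma sum_shifted_lessThan:
  "(\<Sum>N<(B::nat). if d \<le> N then f (N - d) else (0 :: 'a::comm_monoid_add)) = (\<Sum>k<B - d. f k)"
proof (induction B)
  case (Suc B)
  then show ?case by (cases "d \<le> B") (auto simp: Suc_diff_le)
qed simp

text \<open>When a new maximum b is inserted, A lies below b, so b is at least
  \<open>card A\<close>. The lemma is applied to the pairwise distinct exponents of a
  monomial.\<close>

lemma sum_lessThan_card_le: "finite A \<Longrightarrow> \<Sum>{..<card A} \<le> (\<Sum>A :: nat)"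
proof (induction A rule: finite_linorder_max_induct)
  case (insert b A)
  have "card A \<le> card {..<b}" using insert by (intro card_mono) auto
  then have "card A \<le> b" by simp
  moreover have "b \<notin> A" using insert by auto
  ultimately show ?case using insert by simp
qed simp

abbreviation swap_var :: "nat \<Rightarrow> nat \<Rightarrow> (nat \<Rightarrow>\<^sub>0 nat) \<Rightarrow> (nat \<Rightarrow>\<^sub>0 nat)"
  where "swap_var i j \<equiv> Poly_Mapping.map_key (Transposition.transpose i j)"

lemma inj_transpose: "inj (Transposition.transpose i j)"
  by (simp add: bij_is_inj)

lemma lookup_swap_var: "Poly_Mapping.lookup (swap_var i j t) k = Poly_Mapping.lookup t (Transposition.transpose i j k)"
  by (simp add: map_key.rep_eq[OF inj_transpose])

lemma swap_var_swap_var: "swap_var i j (swap_var i j t) = t"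
  by (rule poly_mapping_eqI) (simp add: lookup_swap_var)

lemma inj_swap_var: "inj (swap_var i j)"
  by (metis injI swap_var_swap_var)

lemma keys_swap_var: "Poly_Mapping.keys (swap_var i j t) = Transposition.transpose i j ` Poly_Mapping.keys t"
  by (auto simp: keys_map_key[OF inj_transpose] image_iff) (metis transpose_involutory)

lemma mon_swap_var: "mon \<phi> (swap_var i j t) = mon (\<phi> \<circ> Transposition.transpose i j) t"
  unfolding mon_def keys_swap_var
  by (subst prod.reindex) (auto intro: inj_on_subset[OF inj_transpose] simp: lookup_swap_var)

lemma mdeg_swap_var: "mdeg (swap_var i j t) = mdeg t"
  unfolding mdeg_def keys_swap_var
  by (subst sum.reindex) (auto intro: inj_on_subset[OF inj_transpose] simp: lookup_swap_var)

context coef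
begin

lemma of_nat_m_eq_iff: "(of_nat a :: 'm) = of_nat b \<longleftrightarrow> a = b"
  using \<kappa>_inj[of "of_nat a" "of_nat b"] by (simp add: \<kappa>_simps)

lemma ev_swap_var: "ev \<phi> (Poly_Mapping.map_key (swap_var i j) P) = ev (\<phi> \<circ> Transposition.transpose i j) P"
proof (rule additive_lpoly_eqI[of "\<lambda>P. ev \<phi> (Poly_Mapping.map_key (swap_var i j) P)"])
  show "additive (\<lambda>P. ev \<phi> (Poly_Mapping.map_key (swap_var i j) P))"
    by (simp add: additive_def map_key_plus[OF inj_swap_var] ev_simps)
  show "additive (ev (\<phi> \<circ> Transposition.transpose i j))" by (rule additive_ev)
  fix t c
  have "Poly_Mapping.map_key (swap_var i j) (Poly_Mapping.single t c) = Poly_Mapping.single (swap_var i j t) (c :: 'm)"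
    using map_key_single[OF inj_swap_var, of i j "swap_var i j t" c] by (simp add: swap_var_swap_var)
  then show "ev \<phi> (Poly_Mapping.map_key (swap_var i j) (Poly_Mapping.single t c)) =
    ev (\<phi> \<circ> Transposition.transpose i j) (Poly_Mapping.single t c)"
    by (simp add: ev_single mon_swap_var)
qed

text \<open>Phrased by coefficients, since the degree bounds are read off exponents;
  \<open>Sk_ev\<close> and \<open>SkI\<close> translate to and from values.\<close>

definition Sk :: "nat \<Rightarrow> 'm lpoly set"
  where "Sk n = {P \<in> lpolys n. \<forall>i<n. \<forall>j<n. i \<noteq> j \<longrightarrow>
    (\<forall>t. Poly_Mapping.lookup P (swap_var i j t) = - Poly_Mapping.lookup P t)}"

lemma Sk_lpolys: "P \<in> Sk n \<Longrightarrow> P \<in> lpolys n"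
  by (simp add: Sk_def)

lemma Sk_lookup: "P \<in> Sk n \<Longrightarrow> i < n \<Longrightarrow> j < n \<Longrightarrow> i \<noteq> j \<Longrightarrow>
    Poly_Mapping.lookup P (swap_var i j t) = - Poly_Mapping.lookup P t"
  by (simp add: Sk_def)

lemma Sk_ev:
  assumes "P \<in> Sk n" "i < n" "j < n" "i \<noteq> j"
  shows "ev (\<phi> \<circ> Transposition.transpose i j) P = - ev \<phi> P"
proof -
  have "Poly_Mapping.map_key (swap_var i j) P = - P"
    by (rule poly_mapping_eqI) (simp add: map_key.rep_eq[OF inj_swap_var] Sk_lookup[OF assms])
  then show ?thesis
    using ev_swap_var[of \<phi> i j P] by (simp add: ev_simps)
qed

lemma SkI:
  assumes "P \<in> lpolys n"
    "\<And>i j \<phi>. i < j \<Longrightarrow> j < n \<Longrightarrow> ev (\<phi> \<circ> Transposition.transpose i j) P = - ev \<phi> P"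
  shows "P \<in> Sk n"
proof -
  have lt: "Poly_Mapping.lookup P (swap_var i j t) = - Poly_Mapping.lookup P t" if "i < j" "j < n" for i j t
  proof -
    have "Poly_Mapping.map_key (swap_var i j) P = - P"
      by (rule ev_eqI) (simp add: ev_swap_var assms(2)[OF that] ev_simps)
    then have "Poly_Mapping.lookup (Poly_Mapping.map_key (swap_var i j) P) t = - Poly_Mapping.lookup P t"
      by simp
    then show ?thesis by (simp add: map_key.rep_eq[OF inj_swap_var])
  qed
  show ?thesis
    unfolding Sk_def
  proof (intro CollectI conjI allI impI assms(1))
    fix i j t assume "i < n" "j < n" "i \<noteq> j"
    then consider "i < j" "j < n" | "j < i" "i < n" by linarith
    then show "Poly_Mapping.lookup P (swap_var i j t) = - Poly_Mapping.lookup P t"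
      by cases (simp add: lt, simp add: lt transpose_commute[of i j])
  qed
qed

lemma Sk_add: "P \<in> Sk n \<Longrightarrow> Q \<in> Sk n \<Longrightarrow> P + Q \<in> Sk n"
  by (simp add: Sk_def lpolys_add lookup_add)

lemma Sk_diff: "P \<in> Sk n \<Longrightarrow> Q \<in> Sk n \<Longrightarrow> P - Q \<in> Sk n"
  by (simp add: Sk_def lpolys_diff lookup_minus)

lemma Sk_0: "0 \<in> Sk n"
  by (simp add: Sk_def lpolys_0)

lemma Sk_const_mult: "P \<in> Sk n \<Longrightarrow> Poly_Mapping.single 0 c * P \<in> Sk n"
  by (simp add: Sk_def lpolys_mult lpolys_const lookup_const_mult)

lemma Sk_sum: "(\<And>x. x \<in> I \<Longrightarrow> f x \<in> Sk n) \<Longrightarrow> sum f I \<in> Sk n"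
  by (induction I rule: infinite_finite_induct) (auto simp: Sk_0 Sk_add)

lemma Sk_K:
  assumes "P \<in> Sk (Suc n)"
  shows "K P \<in> Sk n"
proof (rule SkI[OF lpolys_K[OF Sk_lpolys[OF assms]]])
  fix i j \<phi> assume ij: "i < j" "j < n"
  have "ev (case_nat x (\<phi> \<circ> Transposition.transpose i j)) P = - ev (case_nat x \<phi>) P" for x
  proof -
    have "case_nat x (\<phi> \<circ> Transposition.transpose i j) = case_nat x \<phi> \<circ> Transposition.transpose (Suc i) (Suc j)"
      by (rule ext) (auto simp: Transposition.transpose_def split: nat.split)
    then show ?thesis using Sk_ev[OF assms, of "Suc i" "Suc j"] ij by simp
  qed
  then have "lin1 (\<lambda>x. 0 - ev (case_nat x \<phi>) P) (ev (\<phi> \<circ> Transposition.transpose i j) (K P))"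
    using lin1_K[of "\<phi> \<circ> Transposition.transpose i j" P] by simp
  moreover have "lin1 (\<lambda>x. 0 - ev (case_nat x \<phi>) P) (0 - ev \<phi> (K P))"
    by (rule lin1_diff[OF lin1_const lin1_K])
  ultimately show "ev (\<phi> \<circ> Transposition.transpose i j) (K P) = - ev \<phi> (K P)"
    using lin1_unique by fastforce
qed

text \<open>Two equal exponents would make a transposition fix the monomial, forcing its coefficient
  to equal its own negative, hence to be 0. Distinct exponents add up to at least 0 + 1 + ... + (n -
  1).\<close>

lemma Sk_exponents:
  assumes "P \<in> Sk n" "Poly_Mapping.lookup P t \<noteq> 0"
  shows "Poly_Mapping.keys t \<subseteq> {..<n}" "inj_on (Poly_Mapping.lookup t) {..<n}" "\<Sum>{..<n} \<le> mdeg t"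
proof -
  show keys: "Poly_Mapping.keys t \<subseteq> {..<n}"
    using assms Sk_lpolys[OF assms(1)] by (auto simp: lpolys_def in_keys_iff)
  show inj: "inj_on (Poly_Mapping.lookup t) {..<n}"
  proof (rule inj_onI, rule ccontr)
    fix i j assume ij: "i \<in> {..<n}" "j \<in> {..<n}" "Poly_Mapping.lookup t i = Poly_Mapping.lookup t j" "i \<noteq> j"
    have "swap_var i j t = t"
      by (rule poly_mapping_eqI) (use ij in \<open>auto simp: lookup_swap_var Transposition.transpose_def\<close>)
    then have "Poly_Mapping.lookup P t = - Poly_Mapping.lookup P t"
      using Sk_lookup[OF assms(1), of i j t] ij by simp
    then have "Poly_Mapping.lookup P t + Poly_Mapping.lookup P t = 0"
      by (rule eq_neg_iff_add_eq_0[THEN iffD1])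
    then have "of_nat 2 * Poly_Mapping.lookup P t = 0"
      by (simp only: of_nat_numeral mult_2)
    then show False
      using assms(2) of_nat_m_eq_iff[of 2 0] by simp
  qed
  have "mdeg t = (\<Sum>k<n. Poly_Mapping.lookup t k)"
    using keys by (intro mdeg_superset) auto
  also have "\<dots> = \<Sum>(Poly_Mapping.lookup t ` {..<n})"
    using inj by (simp add: sum.reindex)
  finally show "\<Sum>{..<n} \<le> mdeg t"
    using sum_lessThan_card_le[of "Poly_Mapping.lookup t ` {..<n}"] inj by (simp add: card_image)
qed

end

context vir_module
begin

text \<open>The coefficient of a monomial of degree m has weight N - m. The difference is formed in
  the coefficient ring; that a nonzero coefficient cannot have negative weight is part of
  \<open>eigen_nonzero\<close>.\<close>

definition homog :: "nat \<Rightarrow> 'm lpoly \<Rightarrow> bool"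
  where "homog N P \<longleftrightarrow>
    (\<forall>t. H (Poly_Mapping.lookup P t) = (of_nat N - of_nat (mdeg t)) * Poly_Mapping.lookup P t)"

lemmas H_add = additive.add[OF additive_H] and H_0 = additive.zero[OF additive_H]
  and H_diff = additive.diff[OF additive_H]

lemma homog_0: "homog N 0"
  by (simp add: homog_def H_0)

lemma homog_add: "homog N P \<Longrightarrow> homog N Q \<Longrightarrow> homog N (P + Q)"
  by (simp add: homog_def lookup_add H_add algebra_simps)

lemma homog_diff: "homog N P \<Longrightarrow> homog N Q \<Longrightarrow> homog N (P - Q)"
  by (simp add: homog_def lookup_minus H_diff algebra_simps)

lemma homog_scale: "homog N P \<Longrightarrow> homog N (Poly_Mapping.single 0 (\<kappa> x) * P)"
  by (simp add: homog_def lookup_const_mult H_scale mult.left_commute)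

lemma homog_sum: "(\<And>x. x \<in> I \<Longrightarrow> homog N (f x)) \<Longrightarrow> homog N (sum f I)"
  by (induction I rule: infinite_finite_induct) (auto simp: homog_0 homog_add)

lemma homog_single: "H c = (of_nat N - of_nat (mdeg t)) * c \<Longrightarrow> homog N (Poly_Mapping.single t c)"
  by (auto simp: homog_def lookup_single when_def H_0)

text \<open>Total degree N is the eigenvalue N - n of the Lie derivative, so on homogeneous elements
  Cartan's formula can be divided by N - n.\<close>

lemma homog_\<Theta>_iff:
  "homog N P \<longleftrightarrow> \<Theta> n P = Poly_Mapping.single 0 (\<kappa> (of_nat N - of_nat n)) * P"
proof -
  have "homog N P \<longleftrightarrow> (\<forall>t. Poly_Mapping.lookup (\<Theta> n P) t = Poly_Mapping.lookup (Poly_Mapping.single 0 (\<kappa> (of_nat N - of_nat n)) * P) t)"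
    unfolding homog_def \<Theta>_def lookup_wmap[OF additive_\<Theta>0] lookup_const_mult
    by (simp add: \<kappa>_simps algebra_simps)
  then show ?thesis by (simp add: poly_mapping_eq_iff fun_eq_iff)
qed

lemma w_0: "w k 0 = 0"
  using w_add[of k 0 0] by (simp only: add_0_left add_cancel_right_right)

lemma additive_w: "additive (w k)"
  by (simp add: additive_def w_add)

lemma w_of_nat: "w k (of_nat n * m) = of_nat n * w k m"
  by (induction n) (simp_all add: w_0 w_add algebra_simps)

text \<open>Projecting the eigenvalue equation to weight k multiplies the component by k on one side
  and by a - b on the other. Writing the condition as k + b = a avoids subtraction of natural
  numbers.\<close>

lemma w_eigen:
  assumes "H c = (of_nat a - of_nat b) * c"
  shows "w k c = (if k + b = a then c else 0)"
proof -
  have *: "w j c = 0" if "j + b \<noteq> a" for j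
  proof -
    have "H c + of_nat b * c = of_nat a * c" using assms by (simp add: algebra_simps)
    then have "w j (H c + of_nat b * c) = w j (of_nat a * c)" by simp
    then have "(of_nat (j + b) - of_nat a) * w j c = 0"
      by (simp add: w_add w_H w_of_nat left_diff_distrib distrib_right)
    then show ?thesis using that of_nat_m_eq_iff[of "j + b" a] by simp
  qed
  obtain B where B: "c = (\<Sum>j<B. w j c)" "\<forall>j\<ge>B. w j c = 0" using w_sum by blast
  have "w k c = c" if "k + b = a"
  proof -
    have "(\<Sum>j<B. w j c) = (\<Sum>j<B. if j = k then w k c else 0)"
      using * that by (intro sum.cong) auto
    then have "c = (if k < B then w k c else 0)" using B(1) by simp
    then show ?thesis using B(2) by (auto split: if_splits)
  qed
  then show ?thesis using * by simp
qed

lemma w_scale: "w k (\<kappa> x * m) = \<kappa> x * w k m"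
proof -
  obtain B where B: "m = (\<Sum>j<B. w j m)" "\<forall>j\<ge>B. w j m = 0" using w_sum by blast
  have "H (\<kappa> x * w j m) = (of_nat j - of_nat 0) * (\<kappa> x * w j m)" for j
    by (simp add: H_scale H_w mult.left_commute)
  note e = w_eigen[OF this]
  have "\<kappa> x * m = (\<Sum>j<B. \<kappa> x * w j m)" using B(1) by (metis sum_distrib_left)
  then have "w k (\<kappa> x * m) = (\<Sum>j<B. w k (\<kappa> x * w j m))"
    by (simp only: additive.sum[OF additive_w])
  also have "\<dots> = (\<Sum>j<B. if j = k then \<kappa> x * w k m else 0)"
    by (intro sum.cong) (auto simp: e)
  also have "\<dots> = \<kappa> x * w k m" using B(2) by auto
  finally show ?thesis .
qed

lemma eigen_nonzero:
  assumes "H c = (of_nat a - of_nat b) * c" "c \<noteq> 0"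
  shows "b \<le> a" "a \<noteq> Suc b" "a = b \<Longrightarrow> c \<in> range \<kappa>"
proof -
  obtain B where B: "c = (\<Sum>j<B. w j c)" using w_sum by blast
  show "b \<le> a"
  proof (rule ccontr)
    assume "\<not> b \<le> a"
    then have "(\<Sum>j<B. w j c) = 0" by (intro sum.neutral) (simp add: w_eigen[OF assms(1)])
    then show False using B assms(2) by simp
  qed
  show "a \<noteq> Suc b"
    using assms weight_1[of c] by (auto simp: H_def)
  show "a = b \<Longrightarrow> c \<in> range \<kappa>"
    using assms weight_0[of c] by (auto simp: H_def)
qed

lemma homog_lookup:
  assumes "homog N P" "Poly_Mapping.lookup P t \<noteq> 0"
  shows "mdeg t \<le> N" "N \<noteq> Suc (mdeg t)" "N = mdeg t \<Longrightarrow> Poly_Mapping.lookup P t \<in> range \<kappa>"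
  using eigen_nonzero[of "Poly_Mapping.lookup P t" N "mdeg t"] assms by (auto simp: homog_def)

definition proj :: "nat \<Rightarrow> 'm lpoly \<Rightarrow> 'm lpoly"
  where "proj N = wmap (\<lambda>t c. if mdeg t \<le> N then w (N - mdeg t) c else 0)"

lemma additive_proj0: "additive (\<lambda>c. if mdeg t \<le> N then w (N - mdeg t) c else 0)"
  by (simp add: additive_def w_add)

lemma lookup_proj: "Poly_Mapping.lookup (proj N P) t =
    (if mdeg t \<le> N then w (N - mdeg t) (Poly_Mapping.lookup P t) else 0)"
  unfolding proj_def by (rule lookup_wmap[OF additive_proj0])

lemma additive_proj: "additive (proj N)"
  unfolding proj_def by (rule additive_wmap[OF additive_proj0])

lemma homog_proj: "homog N (proj N P)"
  unfolding homog_def lookup_proj by (simp add: H_0 H_w of_nat_diff)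

lemma proj_homog: "homog N P \<Longrightarrow> proj M P = (if M = N then P else 0)"
proof (rule poly_mapping_eqI)
  fix t assume "homog N P"
  then have h: "H (Poly_Mapping.lookup P t) = (of_nat N - of_nat (mdeg t)) * Poly_Mapping.lookup P t"
    by (simp add: homog_def)
  then show "Poly_Mapping.lookup (proj M P) t = Poly_Mapping.lookup (if M = N then P else 0) t"
    using eigen_nonzero(1)[OF h] by (auto simp: lookup_proj w_eigen[OF h])
qed

lemma lpolys_proj: "P \<in> lpolys n \<Longrightarrow> proj N P \<in> lpolys n"
  by (auto simp: lpolys_def in_keys_iff[of _ "proj N P"] in_keys_iff[of _ P] lookup_proj w_0 split: if_splits)

lemma Sk_proj: "P \<in> Sk n \<Longrightarrow> proj N P \<in> Sk n"
  unfolding Sk_def using lpolys_proj additive.minus[OF additive_w] by (auto simp: lookup_proj mdeg_swap_var)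

lemma proj_sum: "\<exists>B. P = (\<Sum>N<B. proj N P)"
proof -
  have "\<forall>t. \<exists>b. \<forall>n\<ge>b. Poly_Mapping.lookup P t = (\<Sum>k<n. w k (Poly_Mapping.lookup P t))"
  proof
    fix t
    let ?c = "Poly_Mapping.lookup P t"
    obtain B where B: "?c = (\<Sum>k<B. w k ?c)" "\<forall>k\<ge>B. w k ?c = 0" using w_sum by blast
    have "(\<Sum>k<n. w k ?c) = (\<Sum>k<B. w k ?c)" if "B \<le> n" for n
      using that B(2) by (intro sum.mono_neutral_right) auto
    then show "\<exists>b. \<forall>n\<ge>b. ?c = (\<Sum>k<n. w k ?c)" using B(1) by metis
  qed
  then obtain b where b: "\<And>t n. b t \<le> n \<Longrightarrow> Poly_Mapping.lookup P t = (\<Sum>k<n. w k (Poly_Mapping.lookup P t))"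
    by metis
  define B where "B = (\<Sum>t\<in>Poly_Mapping.keys P. mdeg t + b t)"
  have "P = (\<Sum>N<B. proj N P)"
  proof (rule poly_mapping_eqI)
    fix t
    let ?c = "Poly_Mapping.lookup P t"
    have "Poly_Mapping.lookup (\<Sum>N<B. proj N P) t = (\<Sum>k<B - mdeg t. w k ?c)"
      unfolding lookup_sum lookup_proj by (rule sum_shifted_lessThan)
    also have "\<dots> = ?c"
    proof (cases "t \<in> Poly_Mapping.keys P")
      case True
      then have "mdeg t + b t \<le> B" unfolding B_def by (intro member_le_sum) auto
      then show ?thesis using b[of t "B - mdeg t"] by simp
    qed (simp add: in_keys_iff w_0)
    finally show "?c = Poly_Mapping.lookup (\<Sum>N<B. proj N P) t" by simp
  qed
  then show ?thesis by blast
qed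

lemma graded_operator:
  assumes "additive T" "\<And>N Q. Q \<in> lpolys n \<Longrightarrow> homog N Q \<Longrightarrow> homog (Suc N) (T Q)" "P \<in> lpolys n"
  shows "proj (Suc N) (T P) = T (proj N P)" "proj 0 (T P) = 0"
proof -
  obtain B where B: "P = (\<Sum>M<B. proj M P)" using proj_sum by blast
  have e: "proj N' (T (proj M P)) = (if N' = Suc M then T (proj M P) else 0)" for N' M
    by (rule proj_homog) (rule assms(2)[OF lpolys_proj[OF assms(3)] homog_proj])
  have "T P = (\<Sum>M<B. T (proj M P))"
    by (subst B) (simp only: additive.sum[OF assms(1)])
  then have s: "proj N' (T P) = (\<Sum>M<B. if N' = Suc M then T (proj M P) else 0)" for N'
    by (simp only: additive.sum[OF additive_proj] e)
  show "proj 0 (T P) = 0" by (simp add: s)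
  have "proj N P = (\<Sum>M<B. proj N (proj M P))"
    by (subst B) (simp only: additive.sum[OF additive_proj])
  also have "\<dots> = (\<Sum>M<B. if N = M then proj N P else 0)"
    by (intro sum.cong) (simp_all add: proj_homog[OF homog_proj])
  finally have z: "N \<ge> B \<Longrightarrow> proj N P = 0" by simp
  have "proj (Suc N) (T P) = (\<Sum>M<B. if N = M then T (proj M P) else 0)"
    by (simp add: s)
  also have "\<dots> = (if N < B then T (proj N P) else 0)"
    by (simp add: sum.delta)
  also have "\<dots> = T (proj N P)"
    using z additive.zero[OF assms(1)] by auto
  finally show "proj (Suc N) (T P) = T (proj N P)" .
qed

lemma additive_dW: "additive (dW n)"
  by (simp add: additive_def dW_add)

lemma additive_D: "additive (D n)"
  by (simp add: additive_def D_add)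

lemmas dW_0 = additive.zero[OF additive_dW] and dW_diff = additive.diff[OF additive_dW]
lemmas D_0 = additive.zero[OF additive_D] and D_diff = additive.diff[OF additive_D]

text \<open>Cartan's formula and d d = 0 make \<open>dW\<close> commute with
  \<open>\<Theta>\<close>, so the eigenvalue N - n is preserved; as n grows by one, so does
  N.\<close>

lemma homog_dW:
  assumes "P \<in> lpolys n" "homog N P"
  shows "homog (Suc N) (dW n P)"
proof -
  have dm: "dm n (K P) = \<Theta> n P - K (dW n P)"
    using cartan[OF assms(1)] by (simp add: algebra_simps)
  have dd: "dW n (dm n (K P)) = 0"
    using assms(1) lpolys_K dW_dW by (cases n) (auto simp: dm_def dW_0)
  have "\<Theta> (Suc n) (dW n P) = dW n (K (dW n P))"
    using cartan[OF lpolys_dW[OF assms(1)]] by (simp add: dW_dW[OF assms(1)] dm_def additive.zero[OF additive_K])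
  also have "\<dots> = dW n (\<Theta> n P)"
    using dd unfolding dm dW_diff by simp
  also have "\<dots> = Poly_Mapping.single 0 (\<kappa> (of_nat N - of_nat n)) * dW n P"
    using assms(2) by (simp add: homog_\<Theta>_iff[of _ _ n] dW_scale)
  finally show ?thesis
    by (simp add: homog_\<Theta>_iff[of _ _ "Suc n"])
qed

lemma D_single: "D n (Poly_Mapping.single t c) =
    Poly_Mapping.single t (dr c) + (\<Sum>i<n. Poly_Mapping.single (Poly_Mapping.single i 1 + t) c)"
  by (rule ev_eqI) (simp add: ev_D ev_simps ev_single mon_add \<kappa>_simps der_scale rhom_sum[OF \<kappa>] sum_distrib_right mult.assoc)

lemma homog_D:
  assumes "homog N P"
  shows "homog (Suc N) (D n P)"
proof -
  have "homog (Suc N) (D n (Poly_Mapping.single t c))" if h: "H c = (of_nat N - of_nat (mdeg t)) * c" for t c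
  proof -
    have "dr (H c) = (of_nat N - of_nat (mdeg t)) * dr c"
      using der_scale[of "of_nat N - of_nat (mdeg t)" c] h by (simp add: \<kappa>_simps)
    then have "homog (Suc N) (Poly_Mapping.single t (dr c))"
      by (intro homog_single) (simp add: H_der algebra_simps)
    moreover have "homog (Suc N) (Poly_Mapping.single (Poly_Mapping.single i 1 + t) c)" for i
      by (rule homog_single) (simp add: mdeg_add mdeg_single h)
    ultimately show ?thesis
      unfolding D_single by (intro homog_add homog_sum) auto
  qed
  moreover have "D n P = (\<Sum>t\<in>Poly_Mapping.keys P. D n (Poly_Mapping.single t (Poly_Mapping.lookup P t)))"
    by (simp only: additive.sum[OF additive_D, symmetric] lpoly_sum_monomials)
  ultimately show ?thesis
    using assms homog_sum[of "Poly_Mapping.keys P" "Suc N"] unfolding homog_def[of N] by (simp only:)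
qed

lemma proj_dW: "P \<in> lpolys n \<Longrightarrow> proj (Suc N) (dW n P) = dW n (proj N P)"
  by (rule graded_operator[OF additive_dW homog_dW])

lemma proj_D: "P \<in> lpolys n \<Longrightarrow> proj (Suc N) (D n P) = D n (proj N P)" "P \<in> lpolys n \<Longrightarrow> proj 0 (D n P) = 0"
  by (rule graded_operator[OF additive_D homog_D]; assumption)+

text \<open>A nonzero eigenvalue of \<open>\<partial>\<close> is impossible, because \<open>\<partial>\<close> raises the weight by one.\<close>

lemma dr_eigen:
  assumes "dr r = \<kappa> s * r" "s \<noteq> 0"
  shows "r = 0"
proof -
  have e: "w j (dr (w k r)) = (if j = Suc k then dr (w k r) else 0)" for j k
  proof -
    have "dr (H (w k r)) = of_nat k * dr (w k r)"
      using der_scale[of "of_nat k" "w k r"] by (simp add: H_w \<kappa>_simps)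
    then have "H (dr (w k r)) = (of_nat (Suc k) - of_nat 0) * dr (w k r)"
      by (simp add: H_der algebra_simps)
    from w_eigen[OF this] show ?thesis by simp
  qed
  obtain B where B: "r = (\<Sum>j<B. w j r)" using w_sum by blast
  have "w k r = 0" for k
  proof (induction k rule: less_induct)
    case (less k)
    have "w k (dr r) = (\<Sum>j<B. w k (dr (w j r)))"
      by (subst B) (simp only: additive.sum[OF additive_w] additive.sum[OF additive_der])
    also have "\<dots> = 0"
      using less by (intro sum.neutral) (auto simp: e additive.zero[OF additive_der])
    finally have "\<kappa> s * w k r = 0" by (simp add: assms(1) w_scale)
    then show ?case using assms(2) \<kappa>_eq_0_iff by simp
  qed
  then show ?thesis using B by simp
qed

text \<open>At a point with coordinate sum s the hypothesis says that the value of R is an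
  eigenvector of \<partial> for -s, so it is zero unless s = 0. Hence the product of R with the sum
  of the variables vanishes, and polynomials over a domain form a domain.\<close>

lemma D_inj:
  assumes "D (Suc n) R = 0"
  shows "R = 0"
proof -
  let ?l = "\<Sum>i<Suc n. lam i :: 'm lpoly"
  have "?l * R = 0"
  proof (rule ev_eqI)
    fix \<phi> :: "nat \<Rightarrow> 'f"
    let ?s = "\<Sum>i<Suc n. \<phi> i"
    have "dr (ev \<phi> R) + \<kappa> ?s * ev \<phi> R = 0"
      using assms ev_D[of \<phi> "Suc n" R] by (simp add: ev_simps)
    then have "dr (ev \<phi> R) = \<kappa> (- ?s) * ev \<phi> R"
      by (simp only: \<kappa>_simps eq_neg_iff_add_eq_0 mult_minus_left)
    from dr_eigen[OF this] have "?s = 0 \<or> ev \<phi> R = 0"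
      using neg_equal_0_iff_equal[of ?s] by blast
    moreover have "ev \<phi> ?l = \<kappa> ?s"
      by (simp only: rhom_sum[OF rhom_ev] ev_lam rhom_sum[OF \<kappa>])
    ultimately show "ev \<phi> (?l * R) = ev \<phi> 0"
      by (auto simp: ev_simps \<kappa>_simps simp del: sum.lessThan_Suc)
  qed
  moreover have "?l \<noteq> 0"
  proof
    assume "?l = 0"
    then have "ev (\<lambda>k. if k = 0 then 1 else 0) ?l = 0" by (simp only: ev_simps)
    moreover have "ev (\<lambda>k. if k = 0 then 1 else 0) ?l = 1"
      by (simp only: rhom_sum[OF rhom_ev] ev_lam) (simp add: \<kappa>_simps if_distrib[of \<kappa>] cong: if_cong)
    ultimately show False by simp
  qed
  ultimately show ?thesis using mult_eq_0_iff by blast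
qed

lemma Sk_alternating:
  assumes "P \<in> Sk n"
  shows "alternating (Zw n P)"
  unfolding alternating_def
proof (intro allI)
  fix us vs :: "('f \<times> 'f) list" and x y :: "'f \<times> 'f"
  let ?a = "us @ x # y # vs" and ?b = "us @ y # x # vs"
  show "Zw n P ?a = - Zw n P ?b"
  proof (cases "length ?a = n")
    case True
    let ?i = "length us"
    have "lst (map fst ?a) = lst (map fst ?b) \<circ> Transposition.transpose ?i (Suc ?i)"
      by (rule ext) (auto simp: lst_def Transposition.transpose_def nth_append nth_Cons split: nat.split)
    then have "ev (lst (map fst ?a)) P = - ev (lst (map fst ?b)) P"
      using Sk_ev[OF assms, of ?i "Suc ?i" "lst (map fst ?b)"] True by simp
    then show ?thesis using True by (simp add: Zw_def mult_ac)
  qed (simp add: Zw_def)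
qed

lemma alternating_Sk:
  assumes P: "P \<in> lpolys n" and alt: "alternating (Zw n P)"
  shows "P \<in> Sk n"
proof (rule SkI[OF P])
  fix i j and \<phi> :: "nat \<Rightarrow> 'f" assume ij: "i < j" "j < n"
  let ?\<tau> = "Transposition.transpose i j"
  have up: "[0..<n] = [0..<i] @ i # [Suc i..<j] @ j # [Suc j..<n]"
    using ij upt_add_eq_append[of 0 i "n - i"] upt_conv_Cons[of i n] upt_add_eq_append[of "Suc i" j "n - j"] upt_conv_Cons[of j n]
    by simp
  let ?f = "\<lambda>k. (\<phi> k, 1 :: 'f)"
  have "evs n (\<phi> \<circ> ?\<tau>) = map ?f [0..<i] @ ?f j # map ?f [Suc i..<j] @ ?f i # map ?f [Suc j..<n]"
    unfolding up using ij by (auto simp: Transposition.transpose_def)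
  moreover have "evs n \<phi> = map ?f [0..<i] @ ?f i # map ?f [Suc i..<j] @ ?f j # map ?f [Suc j..<n]"
    by (simp only: up list.map map_append)
  ultimately have "Zw n P (evs n (\<phi> \<circ> ?\<tau>)) = - Zw n P (evs n \<phi>)"
    using alternating_swap[OF alt, of "map ?f [0..<i]" "?f j" "map ?f [Suc i..<j]" "?f i" "map ?f [Suc j..<n]"] by (simp only:)
  then show "ev (\<phi> \<circ> ?\<tau>) P = - ev \<phi> P"
    by (simp only: Zw_evs[OF P])
qed

lemma Sk_dW:
  assumes "P \<in> Sk n"
  shows "dW n P \<in> Sk (Suc n)"
proof (rule alternating_Sk[OF lpolys_dW[OF Sk_lpolys[OF assms]]])
  have "alternating (ced br_vir ac (Zw n P))"
  proof (rule d_alternating[OF Sk_alternating[OF assms]])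
    fix us vs :: "('f \<times> 'f) list" and x y :: "'f \<times> 'f"
    have "fst y + fst x = fst x + fst y" "snd x * snd y * (fst x - fst y) = - (snd y * snd x * (fst y - fst x))"
      by (simp_all add: algebra_simps)
    then show "Zw n P (us @ br_vir x y # vs) = - Zw n P (us @ br_vir y x # vs)"
      unfolding br_vir_def by (simp only: Zw_minus_slot)
  qed
  then show "alternating (Zw (Suc n) (dW n P))"
    by (simp only: ced_Zw_eq[OF Sk_lpolys[OF assms]])
qed

lemma Sk_D:
  assumes "P \<in> Sk n"
  shows "D n P \<in> Sk n"
proof (rule SkI[OF lpolys_D[OF Sk_lpolys[OF assms]]])
  fix i j and \<phi> :: "nat \<Rightarrow> 'f" assume ij: "i < j" "j < n"
  have "(\<Sum>k<n. (\<phi> \<circ> Transposition.transpose i j) k) = (\<Sum>k<n. \<phi> k)"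
    using sum.permute[OF permutes_swap_id[of i "{..<n}" j], of \<phi>] ij by simp
  then show "ev (\<phi> \<circ> Transposition.transpose i j) (D n P) = - ev \<phi> (D n P)"
    using Sk_ev[OF assms, of i j \<phi>] ij by (simp add: ev_D additive.minus[OF additive_der])
qed

text \<open>D is symmetric in the variables, so it annihilates the sum of R and its transposed copy;
  injectivity of D makes that sum zero.\<close>

lemma Sk_D_inv:
  assumes "D (Suc n) R \<in> Sk (Suc n)" "R \<in> lpolys (Suc n)"
  shows "R \<in> Sk (Suc n)"
proof (rule SkI[OF assms(2)])
  fix i j and \<phi> :: "nat \<Rightarrow> 'f" assume ij: "i < j" "j < Suc n"
  let ?R = "Poly_Mapping.map_key (swap_var i j) R"
  have s: "(\<Sum>k<Suc n. (\<psi> \<circ> Transposition.transpose i j) k) = (\<Sum>k<Suc n. \<psi> k)" for \<psi> :: "nat \<Rightarrow> 'f"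
    using sum.permute[OF permutes_swap_id[of i "{..<Suc n}" j], of \<psi>] ij by (simp del: sum.lessThan_Suc)
  have "D (Suc n) (?R + R) = 0"
  proof (rule ev_eqI)
    fix \<psi>
    have "ev \<psi> (D (Suc n) ?R) = ev (\<psi> \<circ> Transposition.transpose i j) (D (Suc n) R)"
      unfolding ev_D ev_swap_var s ..
    then show "ev \<psi> (D (Suc n) (?R + R)) = ev \<psi> 0"
      using Sk_ev[OF assms(1), of i j \<psi>] ij by (simp add: D_add ev_simps)
  qed
  then have "ev \<phi> (?R + R) = 0" using D_inj ev_simps(1) by metis
  then show "ev (\<phi> \<circ> Transposition.transpose i j) R = - ev \<phi> R"
    by (simp add: ev_simps ev_swap_var eq_neg_iff_add_eq_0)
qed

lemma Sk_homog_eq_0: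
  assumes "P \<in> Sk n" "homog N P" "N < \<Sum>{..<n}"
  shows "P = 0"
proof (rule poly_mapping_eqI, rule ccontr)
  fix t assume "Poly_Mapping.lookup P t \<noteq> Poly_Mapping.lookup 0 t"
  then have "Poly_Mapping.lookup P t \<noteq> 0" by simp
  then show False
    using Sk_exponents(3)[OF assms(1)] homog_lookup(1)[OF assms(2)] assms(3) by fastforce
qed

end

section \<open>Skewsymmetric polynomials of low total degree in at most three variables\<close>

abbreviation t2 :: "nat \<Rightarrow> nat \<Rightarrow> (nat \<Rightarrow>\<^sub>0 nat)"
  where "t2 a b \<equiv> Poly_Mapping.single 0 a + Poly_Mapping.single 1 b"

abbreviation t3 :: "nat \<Rightarrow> nat \<Rightarrow> nat \<Rightarrow> (nat \<Rightarrow>\<^sub>0 nat)"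
  where "t3 a b c \<equiv> Poly_Mapping.single 0 a + Poly_Mapping.single 1 b + Poly_Mapping.single 2 c"

lemma t2_eq_iff: "t2 a b = t2 a' b' \<longleftrightarrow> a = a' \<and> b = b'"
proof
  assume "t2 a b = t2 a' b'"
  from arg_cong[OF this, of "\<lambda>t. (Poly_Mapping.lookup t 0, Poly_Mapping.lookup t 1)"]
  show "a = a' \<and> b = b'" by (simp add: lookup_add lookup_single)
qed simp

lemma t3_eq_iff: "t3 a b c = t3 a' b' c' \<longleftrightarrow> a = a' \<and> b = b' \<and> c = c'"
proof
  assume "t3 a b c = t3 a' b' c'"
  from arg_cong[OF this, of "\<lambda>t. (Poly_Mapping.lookup t 0, Poly_Mapping.lookup t 1, Poly_Mapping.lookup t 2)"]
  show "a = a' \<and> b = b' \<and> c = c'" by (simp add: lookup_add lookup_single)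
qed simp

lemma mdeg_t2: "mdeg (t2 a b) = a + b" and mdeg_t3: "mdeg (t3 a b c) = a + b + c"
  by (simp_all only: mdeg_add mdeg_single)

lemma keys_lessThan_1: "Poly_Mapping.keys (t :: nat \<Rightarrow>\<^sub>0 nat) \<subseteq> {..<1} \<Longrightarrow> \<exists>a. t = Poly_Mapping.single 0 a"
proof -
  assume *: "Poly_Mapping.keys t \<subseteq> {..<1}"
  have "t = Poly_Mapping.single 0 (Poly_Mapping.lookup t 0)"
  proof (rule poly_mapping_eqI)
    fix k :: nat
    have "k \<notin> Poly_Mapping.keys t" if "k \<noteq> 0" using * that by auto
    then show "Poly_Mapping.lookup t k = Poly_Mapping.lookup (Poly_Mapping.single 0 (Poly_Mapping.lookup t 0)) k"
      by (auto simp: lookup_single when_def in_keys_iff)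
  qed
  then show ?thesis by blast
qed

lemma keys_lessThan_2: "Poly_Mapping.keys (t :: nat \<Rightarrow>\<^sub>0 nat) \<subseteq> {..<2} \<Longrightarrow> \<exists>a b. t = t2 a b"
proof -
  assume *: "Poly_Mapping.keys t \<subseteq> {..<2}"
  have "t = t2 (Poly_Mapping.lookup t 0) (Poly_Mapping.lookup t 1)"
  proof (rule poly_mapping_eqI)
    fix k :: nat
    consider "k = 0" | "k = 1" | "k \<ge> 2" by linarith
    then show "Poly_Mapping.lookup t k = Poly_Mapping.lookup (t2 (Poly_Mapping.lookup t 0) (Poly_Mapping.lookup t 1)) k"
    proof cases
      case 3
      then have "k \<notin> Poly_Mapping.keys t" using * by auto
      then show ?thesis using 3 by (simp add: lookup_add lookup_single in_keys_iff when_def)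
    qed (simp_all add: lookup_add lookup_single)
  qed
  then show ?thesis by blast
qed

lemma keys_lessThan_3: "Poly_Mapping.keys (t :: nat \<Rightarrow>\<^sub>0 nat) \<subseteq> {..<3} \<Longrightarrow> \<exists>a b c. t = t3 a b c"
proof -
  assume *: "Poly_Mapping.keys t \<subseteq> {..<3}"
  have "t = t3 (Poly_Mapping.lookup t 0) (Poly_Mapping.lookup t 1) (Poly_Mapping.lookup t 2)"
  proof (rule poly_mapping_eqI)
    fix k :: nat
    consider "k = 0" | "k = 1" | "k = 2" | "k \<ge> 3" by linarith
    then show "Poly_Mapping.lookup t k = Poly_Mapping.lookup (t3 (Poly_Mapping.lookup t 0) (Poly_Mapping.lookup t 1) (Poly_Mapping.lookup t 2)) k"
    proof cases
      case 4
      then have "k \<notin> Poly_Mapping.keys t" using * by auto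
      then show ?thesis using 4 by (simp add: lookup_add lookup_single in_keys_iff when_def)
    qed (simp_all add: lookup_add lookup_single)
  qed
  then show ?thesis by blast
qed

lemma swap_var_t2: "swap_var 0 1 (t2 a b) = t2 b a"
  by (rule poly_mapping_eqI) (auto simp: lookup_swap_var lookup_add lookup_single Transposition.transpose_def when_def)

lemma swap_var_t3: "swap_var 0 1 (t3 a b c) = t3 b a c" "swap_var 1 2 (t3 a b c) = t3 a c b" "swap_var 0 2 (t3 a b c) = t3 c b a"
  by (rule poly_mapping_eqI, auto simp: lookup_swap_var lookup_add lookup_single Transposition.transpose_def when_def)+

context coef
begin

text \<open>Skewsymmetry lets exponents be sorted, and equal exponents carry coefficient zero, so
  strictly decreasing exponents decide. \<open>Sk3_eqI\<close> treats the six orders of three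
  exponents in the same way.\<close>

lemma Sk2_eqI:
  assumes "P \<in> Sk 2" "\<And>a b. b < a \<Longrightarrow> Poly_Mapping.lookup P (t2 a b) = 0"
  shows "P = 0"
proof (rule poly_mapping_eqI, rule ccontr)
  fix t assume "Poly_Mapping.lookup P t \<noteq> Poly_Mapping.lookup 0 t"
  then have nz: "Poly_Mapping.lookup P t \<noteq> 0" by simp
  obtain a b where t: "t = t2 a b" using keys_lessThan_2 Sk_exponents(1)[OF assms(1) nz] by blast
  have "Poly_Mapping.lookup P (t2 b a) = - Poly_Mapping.lookup P t"
    using Sk_lookup[OF assms(1), of 0 1 t] unfolding t swap_var_t2 by simp
  moreover have "a \<noteq> b"
  proof
    assume "a = b"
    then have "Poly_Mapping.lookup t 0 = Poly_Mapping.lookup t 1" by (simp add: t lookup_add lookup_single)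
    then show False using Sk_exponents(2)[OF assms(1) nz] by (auto dest: inj_onD)
  qed
  ultimately show False
    using nz assms(2)[of a b] assms(2)[of b a] unfolding t by (cases "a < b") auto
qed

lemma Sk3_eqI:
  assumes "P \<in> Sk 3" "\<And>a b c. c < b \<Longrightarrow> b < a \<Longrightarrow> Poly_Mapping.lookup P (t3 a b c) = 0"
  shows "P = 0"
proof (rule poly_mapping_eqI, rule ccontr)
  fix t assume "Poly_Mapping.lookup P t \<noteq> Poly_Mapping.lookup 0 t"
  then have nz: "Poly_Mapping.lookup P t \<noteq> 0" by simp
  obtain a b c where t: "t = t3 a b c" using keys_lessThan_3 Sk_exponents(1)[OF assms(1) nz] by blast
  define f where "f a b c = Poly_Mapping.lookup P (t3 a b c)" for a b c
  have f: "f b a c = - f a b c" "f a c b = - f a b c" "f c b a = - f a b c" for a b c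
    using Sk_lookup[OF assms(1), of 0 1 "t3 a b c"] Sk_lookup[OF assms(1), of 1 2 "t3 a b c"]
      Sk_lookup[OF assms(1), of 0 2 "t3 a b c"]
    unfolding swap_var_t3 f_def by simp_all
  have l: "Poly_Mapping.lookup t 0 = a" "Poly_Mapping.lookup t 1 = b" "Poly_Mapping.lookup t 2 = c"
    by (simp_all add: t lookup_add lookup_single)
  have "inj_on (Poly_Mapping.lookup t) {..<3}" using Sk_exponents(2)[OF assms(1) nz] .
  then have "a \<noteq> b" "b \<noteq> c" "a \<noteq> c"
    using l inj_onD[of "Poly_Mapping.lookup t" "{..<3}" 0 1] inj_onD[of "Poly_Mapping.lookup t" "{..<3}" 1 2]
      inj_onD[of "Poly_Mapping.lookup t" "{..<3}" 0 2] by auto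
  then consider "c < b" "b < a" | "b < c" "c < a" | "c < a" "a < b" | "a < c" "c < b" | "b < a" "a < c" | "a < b" "b < c"
    by linarith
  then have "f a b c = 0"
  proof cases
    case 1 then show ?thesis using assms(2)[of c b a] by (simp add: f_def)
  next
    case 2 then show ?thesis using assms(2)[of b c a] f(2)[of a b c] by (simp add: f_def)
  next
    case 3 then show ?thesis using assms(2)[of c a b] f(1)[of b a c] by (simp add: f_def)
  next
    case 4
    have "f b c a = 0" using 4 assms(2)[of a c b] by (simp add: f_def)
    then show ?thesis using f(1)[of c b a] f(3)[of a b c] by simp
  next
    case 5
    have "f c a b = 0" using 5 assms(2)[of b a c] by (simp add: f_def)
    then show ?thesis using f(1)[of a c b] f(2)[of a b c] by simp
  next
    case 6 then show ?thesis using assms(2)[of a b c] f(3)[of a b c] assms(2)[of a b c] by (simp add: f_def)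
  qed
  then show False using nz unfolding t f_def by simp
qed

abbreviation cst :: "'f \<Rightarrow> 'm lpoly" where "cst x \<equiv> Poly_Mapping.single 0 (\<kappa> x)"

text \<open>These antisymmetrised monomials and the Vandermonde polynomial \<open>vd\<close> are the
  skewsymmetric polynomials that survive the degree bounds.\<close>

definition l2 :: "'m lpoly" where "l2 = lam 0 - lam 1"
definition q2 :: "'m lpoly" where "q2 = lam 0 ^ 2 - lam 1 ^ 2"
definition c2 :: "'m lpoly" where "c2 = lam 0 ^ 3 - lam 1 ^ 3"
definition c21 :: "'m lpoly" where "c21 = lam 0 ^ 2 * lam 1 - lam 0 * lam 1 ^ 2"
definition vd :: "'m lpoly" where "vd = (lam 0 - lam 1) * (lam 0 - lam 2) * (lam 1 - lam 2)"

lemmas ev_small = ev_simps ev_lam ev_const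

lemma monom2: "lam 0 ^ a * lam 1 ^ b = Poly_Mapping.single (t2 a b) (1 :: 'm)"
  by (simp add: lam_power mult_single)

lemma monom3: "lam 0 ^ a * lam 1 ^ b * lam 2 ^ c = Poly_Mapping.single (t3 a b c) (1 :: 'm)"
  by (simp add: lam_power mult_single)

lemma small_monoms:
  "l2 = Poly_Mapping.single (t2 1 0) 1 - Poly_Mapping.single (t2 0 1) 1"
  "q2 = Poly_Mapping.single (t2 2 0) 1 - Poly_Mapping.single (t2 0 2) 1"
  "c2 = Poly_Mapping.single (t2 3 0) 1 - Poly_Mapping.single (t2 0 3) 1"
  "c21 = Poly_Mapping.single (t2 2 1) 1 - Poly_Mapping.single (t2 1 2) 1"
  by (simp_all only: l2_def q2_def c2_def c21_def monom2[symmetric]) simp_all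

lemma vd_monoms:
  "vd = Poly_Mapping.single (t3 2 1 0) 1 - Poly_Mapping.single (t3 2 0 1) 1 - Poly_Mapping.single (t3 1 2 0) 1
    + Poly_Mapping.single (t3 1 0 2) 1 + Poly_Mapping.single (t3 0 2 1) 1 - Poly_Mapping.single (t3 0 1 2) 1"
  unfolding vd_def monom3[symmetric] by (simp add: algebra_simps power2_eq_square)

lemma lvd_monoms:
  "(lam 0 + lam 1 + lam 2) * vd = Poly_Mapping.single (t3 3 1 0) 1 - Poly_Mapping.single (t3 3 0 1) 1 - Poly_Mapping.single (t3 1 3 0) 1
    + Poly_Mapping.single (t3 1 0 3) 1 + Poly_Mapping.single (t3 0 3 1) 1 - Poly_Mapping.single (t3 0 1 3) 1"
  unfolding vd_def monom3[symmetric] by (simp add: algebra_simps power3_eq_cube)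

lemma less_2_cases_pair: "i < j \<Longrightarrow> j < (2::nat) \<Longrightarrow> i = 0 \<and> j = 1" by auto

lemma less_3_cases_pair: "i < j \<Longrightarrow> j < (3::nat) \<Longrightarrow> i = 0 \<and> j = 1 \<or> i = 0 \<and> j = 2 \<or> i = 1 \<and> j = 2" by auto

lemma Sk_small: "l2 \<in> Sk 2" "q2 \<in> Sk 2" "c2 \<in> Sk 2" "c21 \<in> Sk 2"
  by (rule SkI; (intro lpolys_diff lpolys_mult lpolys_power lpolys_lam | simp add: l2_def q2_def c2_def c21_def ev_small)?;
      (intro lpolys_diff lpolys_mult lpolys_power lpolys_lam)?; (drule (1) less_2_cases_pair)?; simp add: ev_small Transposition.transpose_def)+

lemma Sk_vd: "vd \<in> Sk 3"
proof (rule SkI)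
  show "vd \<in> lpolys 3"
    unfolding vd_def by (intro lpolys_diff lpolys_mult lpolys_lam) auto
  fix i j \<phi> assume "i < j" "j < (3::nat)"
  then have "i = 0 \<and> j = 1 \<or> i = 0 \<and> j = 2 \<or> i = 1 \<and> j = 2" by (rule less_3_cases_pair)
  then show "ev (\<phi> \<circ> Transposition.transpose i j) vd = - ev \<phi> vd"
    by (elim disjE) (simp_all add: vd_def ev_small Transposition.transpose_def, simp_all add: algebra_simps)
qed

end

context vir_module
begin

lemma homog_lam_mult:
  assumes "homog N P"
  shows "homog (Suc N) (lam i * P)"
proof -
  have "lam i * P = (\<Sum>t\<in>Poly_Mapping.keys P. Poly_Mapping.single (Poly_Mapping.single i 1 + t) (Poly_Mapping.lookup P t))"
  proof -
    have "lam i * P = lam i * (\<Sum>t\<in>Poly_Mapping.keys P. Poly_Mapping.single t (Poly_Mapping.lookup P t))"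
      by (simp only: lpoly_sum_monomials)
    then show ?thesis by (simp add: sum_distrib_left lam_def mult_single)
  qed
  moreover have "homog (Suc N) (Poly_Mapping.single (Poly_Mapping.single i 1 + t) (Poly_Mapping.lookup P t))" for t
    using assms by (intro homog_single) (simp add: mdeg_add mdeg_single homog_def)
  ultimately show ?thesis by (simp add: homog_sum)
qed

lemma homog_1: "homog 0 1"
  using homog_single[of 1 0 0] H_\<kappa>[of 1] by (simp add: mdeg_def \<kappa>_simps)

lemma homog_small_single: "homog (mdeg t) (Poly_Mapping.single t (\<kappa> x))"
  by (rule homog_single) (simp add: H_\<kappa>)

lemma homog_monom2: "a + b = N \<Longrightarrow> homog N (Poly_Mapping.single (t2 a b) 1)"
  using homog_small_single[of "t2 a b" 1] by (simp only: mdeg_t2 \<kappa>_simps)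

lemma homog_monom3: "a + b + c = N \<Longrightarrow> homog N (Poly_Mapping.single (t3 a b c) 1)"
  using homog_small_single[of "t3 a b c" 1] by (simp only: mdeg_t3 \<kappa>_simps)

lemma homog_small: "homog 1 l2" "homog 2 q2" "homog 3 c2" "homog 3 c21" "homog 3 vd"
proof -
  show "homog 1 l2" unfolding small_monoms(1) by (rule homog_diff; rule homog_monom2; simp)
  show "homog 2 q2" unfolding small_monoms(2) by (rule homog_diff; rule homog_monom2; simp)
  show "homog 3 c2" unfolding small_monoms(3) by (rule homog_diff; rule homog_monom2; simp)
  show "homog 3 c21" unfolding small_monoms(4) by (rule homog_diff; rule homog_monom2; simp)
  show "homog 3 vd" unfolding vd_monoms by ((rule homog_diff homog_add)+; rule homog_monom3; simp)
qed

lemma lookup_range: "homog N P \<Longrightarrow> mdeg t = N \<Longrightarrow> \<exists>x. Poly_Mapping.lookup P t = \<kappa> x"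
proof (cases "Poly_Mapping.lookup P t = 0")
  case True
  then have "Poly_Mapping.lookup P t = \<kappa> 0" by (simp add: \<kappa>_simps)
  then show ?thesis by blast
next
  case False
  assume "homog N P" "mdeg t = N"
  then show ?thesis using homog_lookup(3)[of N P t] False by blast
qed

text \<open>The exponents (1, 0) would need a coefficient of weight 1; (2, 0) is the only other
  decreasing pair of degree at most 2, and its coefficient has weight 0, hence is a scalar.\<close>

lemma Sk2_homog_2:
  assumes "P \<in> Sk 2" "homog 2 P"
  shows "\<exists>x. P = cst x * q2"
proof -
  obtain x where x: "Poly_Mapping.lookup P (t2 2 0) = \<kappa> x"
    using lookup_range[OF assms(2), of "t2 2 0"] unfolding mdeg_t2 by auto
  define R where "R = P - cst x * q2"
  have R: "R \<in> Sk 2" "homog 2 R"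
    unfolding R_def by (intro Sk_diff Sk_const_mult Sk_small(2) assms) (intro homog_diff homog_scale homog_small(2) assms)
  have "R = 0"
  proof (rule Sk2_eqI[OF R(1)], rule ccontr)
    fix a b :: nat assume ab: "b < a" "Poly_Mapping.lookup R (t2 a b) \<noteq> 0"
    from homog_lookup(1,2)[OF R(2) ab(2)] have "a + b \<le> 2" "2 \<noteq> Suc (a + b)" unfolding mdeg_t2 .
    then have "a = 2" "b = 0" using ab(1) by auto
    moreover have "Poly_Mapping.lookup R (t2 2 0) = 0"
      unfolding R_def small_monoms lookup_minus lookup_const_mult lookup_single t2_eq_iff x by simp
    ultimately show False using ab(2) by simp
  qed
  then show ?thesis by (auto simp: R_def)
qed

text \<open>The exponents (1, 0) now admit a coefficient v of weight 2, in the Virasoro PVA a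
  multiple of L. Degree 2 is excluded by weight 1, and degree 3 allows (3, 0) and (2, 1) with scalar
  coefficients.\<close>

lemma Sk2_homog_3:
  assumes "P \<in> Sk 2" "homog 3 P"
  shows "\<exists>v x y. H v = of_nat 2 * v \<and> P = Poly_Mapping.single 0 v * l2 + cst x * c2 + cst y * c21"
proof -
  define v where "v = Poly_Mapping.lookup P (t2 1 0)"
  have "H v = (of_nat 3 - of_nat (mdeg (t2 1 0))) * v"
    using assms(2) unfolding homog_def v_def by blast
  then have v: "H v = of_nat 2 * v" unfolding mdeg_t2 by simp
  obtain x where x: "Poly_Mapping.lookup P (t2 3 0) = \<kappa> x"
    using lookup_range[OF assms(2), of "t2 3 0"] unfolding mdeg_t2 by auto
  obtain y where y: "Poly_Mapping.lookup P (t2 2 1) = \<kappa> y"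
    using lookup_range[OF assms(2), of "t2 2 1"] unfolding mdeg_t2 by auto
  have vl: "Poly_Mapping.single 0 v * l2 = Poly_Mapping.single (t2 1 0) v - Poly_Mapping.single (t2 0 1) v"
    unfolding small_monoms right_diff_distrib mult_single by simp
  define R where "R = P - (Poly_Mapping.single 0 v * l2 + cst x * c2 + cst y * c21)"
  have "homog 3 (Poly_Mapping.single (t2 1 0) v - Poly_Mapping.single (t2 0 1) v)"
    by (intro homog_diff homog_single) (simp_all add: mdeg_single v)
  then have vl': "homog 3 (Poly_Mapping.single 0 v * l2)" by (simp only: vl)
  have R: "R \<in> Sk 2" "homog 3 R"
    unfolding R_def by (intro Sk_diff Sk_add Sk_const_mult Sk_small assms)
      (intro homog_diff homog_add homog_scale homog_small(3,4) vl' assms)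
  have "R = 0"
  proof (rule Sk2_eqI[OF R(1)], rule ccontr)
    fix a b :: nat assume ab: "b < a" "Poly_Mapping.lookup R (t2 a b) \<noteq> 0"
    from homog_lookup(1,2)[OF R(2) ab(2)] have "a + b \<le> 3" "3 \<noteq> Suc (a + b)" unfolding mdeg_t2 .
    then consider "a = 1" "b = 0" | "a = 3" "b = 0" | "a = 2" "b = 1" using ab(1) by linarith
    moreover have "Poly_Mapping.lookup R (t2 1 0) = 0" "Poly_Mapping.lookup R (t2 3 0) = 0" "Poly_Mapping.lookup R (t2 2 1) = 0"
      unfolding R_def small_monoms lookup_minus lookup_add lookup_const_mult lookup_single t2_eq_iff x y v_def by simp_all
    ultimately show False using ab(2) by cases simp_all
  qed
  then show ?thesis using v by (auto simp: R_def)
qed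

lemma Sk3_homog_3:
  assumes "P \<in> Sk 3" "homog 3 P"
  shows "\<exists>x. P = cst x * vd"
proof -
  obtain x where x: "Poly_Mapping.lookup P (t3 2 1 0) = \<kappa> x"
    using lookup_range[OF assms(2), of "t3 2 1 0"] unfolding mdeg_t3 by auto
  define R where "R = P - cst x * vd"
  have R: "R \<in> Sk 3" "homog 3 R"
    unfolding R_def by (intro Sk_diff Sk_const_mult Sk_vd assms) (intro homog_diff homog_scale homog_small(5) assms)
  have "R = 0"
  proof (rule Sk3_eqI[OF R(1)], rule ccontr)
    fix a b c :: nat assume ab: "c < b" "b < a" "Poly_Mapping.lookup R (t3 a b c) \<noteq> 0"
    from homog_lookup(1)[OF R(2) ab(3)] have "a + b + c \<le> 3" unfolding mdeg_t3 .
    then have "a = 2" "b = 1" "c = 0" using ab(1,2) by auto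
    moreover have "Poly_Mapping.lookup R (t3 2 1 0) = 0"
      unfolding R_def vd_monoms lookup_minus lookup_const_mult lookup_add lookup_single t3_eq_iff x by simp
    ultimately show False using ab(3) by simp
  qed
  then show ?thesis by (auto simp: R_def)
qed

lemma D_vd: "D 3 (cst x * vd) = cst x * ((lam 0 + lam 1 + lam 2) * vd)"
proof (rule ev_eqI)
  fix \<phi>
  have "ev \<phi> (cst x * vd) = \<kappa> (x * ((\<phi> 0 - \<phi> 1) * (\<phi> 0 - \<phi> 2) * (\<phi> 1 - \<phi> 2)))"
    by (simp add: vd_def ev_small \<kappa>_simps)
  then have "dr (ev \<phi> (cst x * vd)) = 0" by (simp only: der_\<kappa>)
  then show "ev \<phi> (D 3 (cst x * vd)) = ev \<phi> (cst x * ((lam 0 + lam 1 + lam 2) * vd))"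
    by (simp add: ev_D eval_nat_numeral) (simp add: ev_small \<kappa>_simps algebra_simps eval_nat_numeral)
qed

text \<open>The exponents (2, 1, 0) would need a coefficient of weight 1, so only (3, 1, 0) remains,
  and there D of the Vandermonde polynomial has coefficient 1.\<close>

lemma Sk3_homog_4:
  assumes "P \<in> Sk 3" "homog 4 P"
  shows "\<exists>x. P = D 3 (cst x * vd)"
proof -
  obtain x where x: "Poly_Mapping.lookup P (t3 3 1 0) = \<kappa> x"
    using lookup_range[OF assms(2), of "t3 3 1 0"] unfolding mdeg_t3 by auto
  define R where "R = P - D 3 (cst x * vd)"
  have "homog (Suc 3) (D 3 (cst x * vd))"
    by (intro homog_D homog_scale homog_small)
  then have R: "R \<in> Sk 3" "homog 4 R"
    unfolding R_def using assms by (auto intro!: Sk_diff Sk_D Sk_const_mult Sk_vd homog_diff)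
  have "R = 0"
  proof (rule Sk3_eqI[OF R(1)], rule ccontr)
    fix a b c :: nat assume ab: "c < b" "b < a" "Poly_Mapping.lookup R (t3 a b c) \<noteq> 0"
    from homog_lookup(1,2)[OF R(2) ab(3)] have "a + b + c \<le> 4" "4 \<noteq> Suc (a + b + c)" unfolding mdeg_t3 .
    then have "a = 3" "b = 1" "c = 0" using ab(1,2) by arith+
    moreover have "Poly_Mapping.lookup R (t3 3 1 0) = 0"
      unfolding R_def D_vd lvd_monoms lookup_minus lookup_const_mult lookup_add lookup_single t3_eq_iff x by simp
    ultimately show False using ab(3) by simp
  qed
  then show ?thesis by (auto simp: R_def)
qed

lemma lpolys_1_homog:
  assumes "P \<in> lpolys 1"
  shows "homog 1 P \<Longrightarrow> \<exists>x. P = cst x * lam 0"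
    "homog 2 P \<Longrightarrow> \<exists>v x. H v = of_nat 2 * v \<and> P = Poly_Mapping.single 0 v + cst x * lam 0 ^ 2"
proof -
  let ?s = "\<lambda>a. Poly_Mapping.single (0 :: nat) (a :: nat)"
  have t: "\<exists>a. t = ?s a" if "Poly_Mapping.lookup P t \<noteq> 0" for t
    using assms that keys_lessThan_1[of t] by (auto simp: lpolys_def in_keys_iff)
  have s: "?s a = ?s b \<longleftrightarrow> a = b" for a b by (metis lookup_single_eq)
  have cl: "cst x * lam 0 ^ m = Poly_Mapping.single (?s m) (\<kappa> x)" for x m
    by (simp add: lam_power mult_single)
  show "\<exists>x. P = cst x * lam 0" if h: "homog 1 P"
  proof -
    obtain x where x: "Poly_Mapping.lookup P (?s 1) = \<kappa> x"
      using lookup_range[OF h mdeg_single[of 0 1]] by blast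
    have "P = cst x * lam 0 ^ 1"
      unfolding cl
    proof (rule poly_mapping_eqI)
      fix t
      show "Poly_Mapping.lookup P t = Poly_Mapping.lookup (Poly_Mapping.single (?s 1) (\<kappa> x)) t"
      proof (cases "Poly_Mapping.lookup P t = 0")
        case True then show ?thesis using x by (auto simp: lookup_single when_def)
      next
        case False
        then obtain a where a: "t = ?s a" using t by blast
        have "a \<le> 1" "1 \<noteq> Suc a" using homog_lookup(1,2)[OF h False] by (auto simp: a mdeg_single)
        then have "a = 1" by simp
        then show ?thesis using a x by simp
      qed
    qed
    then show ?thesis by auto
  qed
  show "\<exists>v x. H v = of_nat 2 * v \<and> P = Poly_Mapping.single 0 v + cst x * lam 0 ^ 2" if h: "homog 2 P"
  proof -
    obtain x where x: "Poly_Mapping.lookup P (?s 2) = \<kappa> x"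
      using lookup_range[OF h mdeg_single[of 0 2]] by blast
    define v where "v = Poly_Mapping.lookup P (?s 0)"
    have "H v = (of_nat 2 - of_nat (mdeg (?s 0))) * v"
      using h unfolding homog_def v_def by blast
    then have v: "H v = of_nat 2 * v" by (simp only: mdeg_single) simp
    have "P = Poly_Mapping.single (?s 0) v + cst x * lam 0 ^ 2"
      unfolding cl
    proof (rule poly_mapping_eqI)
      fix t
      show "Poly_Mapping.lookup P t = Poly_Mapping.lookup (Poly_Mapping.single (?s 0) v + Poly_Mapping.single (?s 2) (\<kappa> x)) t"
      proof (cases "Poly_Mapping.lookup P t = 0")
        case True then show ?thesis using x s[of 0 2] s[of 2 0] by (auto simp: lookup_add lookup_single when_def v_def simp del: single_numeral)
      next
        case False
        then obtain a where a: "t = ?s a" using t by blast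
        have "a \<le> 2" "2 \<noteq> Suc a" using homog_lookup(1,2)[OF h False] by (auto simp: a mdeg_single)
        then have "a = 0 \<or> a = 2" by auto
        then show ?thesis using a x s[of 0 2] s[of 2 0] by (auto simp: lookup_add lookup_single when_def v_def simp del: single_numeral)
      qed
    qed
    then show ?thesis using v by auto
  qed
qed

lemma Sk_1: "P \<in> lpolys 1 \<Longrightarrow> P \<in> Sk 1"
  by (rule SkI) auto

text \<open>At the points (s, 0) the coefficient of s in the differential of v is (H - 1) v = v, so
  v reappears in front of \<open>l2\<close>. The scalars x and y, where the central charge would
  enter, are left open.\<close>

lemma dW_const:
  assumes "H v = of_nat 2 * v"
  shows "\<exists>x y. dW 1 (Poly_Mapping.single 0 v) = Poly_Mapping.single 0 v * l2 + cst x * c2 + cst y * c21"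
proof -
  have "homog 2 (Poly_Mapping.single 0 v)"
    by (rule homog_single) (simp add: mdeg_def assms)
  then have "homog (Suc 2) (dW 1 (Poly_Mapping.single 0 v))" "dW 1 (Poly_Mapping.single 0 v) \<in> Sk (Suc 1)"
    by (intro homog_dW Sk_dW Sk_1 lpolys_const; assumption)+
  then have "homog 3 (dW 1 (Poly_Mapping.single 0 v))" "dW 1 (Poly_Mapping.single 0 v) \<in> Sk 2"
    by (simp_all add: eval_nat_numeral)
  from Sk2_homog_3[OF this(2,1)] obtain v' x y
    where e: "dW 1 (Poly_Mapping.single 0 v) = Poly_Mapping.single 0 v' * l2 + cst x * c2 + cst y * c21" by blast
  define \<phi> :: "'f \<Rightarrow> nat \<Rightarrow> 'f" where "\<phi> s k = (if k = 0 then s else 0)" for s k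
  have 1: "ev (\<phi> s) (dW 1 (Poly_Mapping.single 0 v)) = A s v - A 0 v - \<kappa> s * v" for s
  proof -
    have "{0<..<Suc 1} = {1::nat}" "{1<..<Suc 1} = {}" by auto
    then show ?thesis by (simp add: ev_dW ev_const \<phi>_def)
  qed
  have "lin1 (\<lambda>s. A s v - A 0 v - \<kappa> s * v) (H v - 0 - (\<kappa> 0 * 0 + 1 * v))"
    unfolding A_def H_def by (intro lin1_diff lin1_poly lin1_const lin1_mult lin1_\<kappa>)
  moreover have "lin1 (\<lambda>s. A s v - A 0 v - \<kappa> s * v) v'"
  proof -
    have "A s v - A 0 v - \<kappa> s * v = poly [:0, v', 0, \<kappa> x:] (\<kappa> s)" for s
      unfolding 1[symmetric] e
      by (simp add: ev_small l2_def c2_def c21_def \<phi>_def \<kappa>_simps power2_eq_square power3_eq_cube algebra_simps)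
    then show ?thesis using lin1_poly[of "[:0, v', 0, \<kappa> x:]"] by (simp add: coeff_pCons)
  qed
  ultimately have "v' = H v - v" using lin1_unique by fastforce
  then have "v' = v" using assms by (simp add: algebra_simps)
  then show ?thesis using e by blast
qed

lemma D_small:
  "D 1 (cst x) = cst x * lam 0" "D 1 (cst x * lam 0) = cst x * lam 0 ^ 2"
  "D 2 (cst x * l2) = cst x * q2" "D 2 (cst x * q2) = cst x * (c2 + c21)"
proof -
  \<comment> \<open>\<partial> vanishes on polynomials with scalar values, so there D is
    multiplication by the sum of the variables.\<close>
  have k: "D n P = (\<Sum>i<n. lam i) * P" if h: "\<And>\<phi>. \<exists>y. ev \<phi> P = \<kappa> y" for n P
  proof (rule ev_eqI)
    fix \<phi>
    obtain y where "ev \<phi> P = \<kappa> y" using h[of \<phi>] by blast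
    then show "ev \<phi> (D n P) = ev \<phi> ((\<Sum>i<n. lam i) * P)"
      by (simp add: ev_D der_\<kappa> ev_simps ev_lam rhom_sum[OF \<kappa>])
  qed
  have e: "ev \<phi> (cst x) = \<kappa> x" "ev \<phi> (cst x * lam 0) = \<kappa> (x * \<phi> 0)" "ev \<phi> (cst x * l2) = \<kappa> (x * (\<phi> 0 - \<phi> 1))"
    "ev \<phi> (cst x * q2) = \<kappa> (x * (\<phi> 0 ^ 2 - \<phi> 1 ^ 2))" for \<phi>
    by (simp_all add: ev_small l2_def q2_def \<kappa>_simps)
  have "(\<Sum>i<1. lam i) = (lam 0 :: 'm lpoly)" "(\<Sum>i<2. lam i) = (lam 0 + lam 1 :: 'm lpoly)"
    by (simp_all add: eval_nat_numeral)
  then show "D 1 (cst x) = cst x * lam 0" "D 1 (cst x * lam 0) = cst x * lam 0 ^ 2"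
    "D 2 (cst x * l2) = cst x * q2" "D 2 (cst x * q2) = cst x * (c2 + c21)"
    using k[of "cst x" 1] k[of "cst x * lam 0" 1] k[of "cst x * l2" 2] k[of "cst x * q2" 2] e
    by (auto simp: l2_def q2_def c2_def c21_def algebra_simps power2_eq_square power3_eq_cube)
qed

end

section \<open>Cocycles and coboundaries modulo the image of D\<close>

context coef
begin

text \<open>Skewsymmetric representatives of the generators. In degree 2 the monomial \<lambda>_0^3
  is not skewsymmetric; \<open>c2\<close> represents twice its class modulo D.\<close>

definition yP :: "nat \<Rightarrow> 'm lpoly"
  where "yP n = (if n = 0 then 1 else if n = 2 then c2 else if n = 3 then vd else 0)"

lemma Sk_yP: "yP n \<in> Sk n"
proof -
  have "1 \<in> Sk 0" by (rule SkI[OF lpolys_1]) auto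
  then show ?thesis by (auto simp: yP_def Sk_small Sk_vd Sk_0)
qed

end

context vir_module
begin

lemma cst_mult: "cst x * (cst y * P) = cst (x * y) * P"
  by (simp add: mult_single \<kappa>_simps flip: mult.assoc)

lemma dm_add: "dm n (P + Q) = dm n P + dm n Q"
  by (simp add: dm_def dW_add split: nat.split)

lemma dm_0: "dm n 0 = 0"
  by (simp add: dm_def dW_0 split: nat.split)

lemma additive_dm: "additive (dm n)"
  by (simp add: additive_def dm_add)

lemma dm_scale: "dm n (cst x * P) = cst x * dm n P"
  by (simp add: dm_def dW_scale split: nat.split)

text \<open>For a closed P, Cartan's formula reads d K P = (N - n) P, and N - n is invertible in
  characteristic 0.\<close>

lemma closed_exact:
  assumes P: "P \<in> Sk n" "homog N P" "dW n P = 0" "N \<noteq> n"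
  shows "\<exists>W\<in>Sk (n - 1). P = dm n W"
proof -
  let ?c = "of_nat N - of_nat n :: 'f"
  have c: "?c \<noteq> 0" using assms(4) by simp
  have "dm n (K P) = cst ?c * P"
    using cartan[OF Sk_lpolys[OF P(1)]] P(2,3) by (simp add: additive.zero[OF additive_K] homog_\<Theta>_iff[of _ _ n])
  then have "dm n (cst (1 / ?c) * K P) = P"
    using c by (simp add: dm_scale cst_mult) (simp add: \<kappa>_simps)
  moreover have "cst (1 / ?c) * K P \<in> Sk (n - 1)"
  proof (cases n)
    case 0
    then show ?thesis using K_lpolys_0 Sk_lpolys[OF P(1)] by (simp add: Sk_0)
  next
    case (Suc m)
    then show ?thesis using Sk_K P(1) by (simp add: Sk_const_mult)
  qed
  ultimately show ?thesis by metis
qed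

text \<open>R may be cut down to its component of total degree N - 1, since D raises the degree by
  one. Then P - D R is homogeneous and closed, and \<open>closed_exact\<close> applies.\<close>

lemma exact_generic:
  assumes P: "P \<in> Sk n" "homog N P" and R: "R \<in> Sk n" and e: "dW n P = dW n (D n R)" and N: "N \<noteq> n"
  shows "\<exists>W\<in>Sk (n - 1). \<exists>R\<in>Sk n. P = dm n W + D n R"
proof -
  define R' where "R' = (if N = 0 then 0 else proj (N - 1) R)"
  have R': "R' \<in> Sk n" unfolding R'_def using R by (simp add: Sk_0 Sk_proj)
  have "homog (Suc (N - 1)) (D n (proj (N - 1) R))"
    by (rule homog_D[OF homog_proj])
  then have hD: "homog N (D n R')"
    by (cases "N = 0") (simp_all add: R'_def D_0 homog_0)
  have "proj N (D n R) = D n R'"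
    using proj_D(1)[OF Sk_lpolys[OF R], of "N - 1"] proj_D(2)[OF Sk_lpolys[OF R]]
    by (cases N) (simp_all add: R'_def D_0)
  then have "proj (Suc N) (dW n (D n R)) = dW n (D n R')"
    by (simp add: proj_dW lpolys_D Sk_lpolys[OF R])
  moreover have "proj (Suc N) (dW n P) = dW n P"
    using proj_homog[OF homog_dW[OF Sk_lpolys[OF P(1)] P(2)], of "Suc N"] by simp
  ultimately have "dW n (P - D n R') = 0" by (simp add: e dW_diff)
  then obtain W where "W \<in> Sk (n - 1)" "P - D n R' = dm n W"
    using closed_exact[of "P - D n R'" n N] P R' hD N by (auto simp: Sk_diff Sk_D homog_diff)
  then show ?thesis using R' by (metis diff_add_cancel)
qed

lemma sum_lessThan_ge: "4 \<le> n \<Longrightarrow> n < \<Sum>{..<n::nat}"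
proof (induction n rule: dec_induct)
  case base
  show ?case by (simp add: eval_nat_numeral)
qed simp

text \<open>The case distinction isolates the two degrees where division by an eigenvalue of
  \<open>\<Theta>\<close> fails, N = n for P and N = n + 1 for Q; both are settled by listing
  skewsymmetric polynomials. A genuine class arises for n = 0 and n = 3 with N = n, and for n = 2
  with N = n + 1.\<close>

lemma core_homog:
  assumes P: "P \<in> Sk n" "homog N P" and Q: "Q \<in> Sk (Suc n)" "homog N Q" and e: "dW n P = D (Suc n) Q"
  shows "\<exists>W\<in>Sk (n - 1). \<exists>R\<in>Sk n. \<exists>x. P = dm n W + D n R + cst x * yP n"
proof -
  have triv: ?thesis if "\<exists>W\<in>Sk (n - 1). \<exists>R\<in>Sk n. P = dm n W + D n R"
    using that by (metis \<kappa>_simps(1) add.right_neutral mult_zero_left single_zero)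
  have trivD: ?thesis if "R \<in> Sk n" "P = D n R" for R
    using that by (intro triv bexI[of _ 0] bexI[of _ R]) (simp_all add: dm_0 Sk_0)
  have trivY: ?thesis if "P = cst x * yP n" for x
    using that Sk_0 by (intro bexI[of _ 0] bexI[of _ 0] exI[of _ x]) (simp_all add: dm_0 D_0 Sk_0)
  have "D (Suc (Suc n)) (dW (Suc n) Q) = 0"
    using dW_D[OF Sk_lpolys[OF Q(1)]] dW_dW[OF Sk_lpolys[OF P(1)]] by (simp flip: e)
  then have dQ: "dW (Suc n) Q = 0" by (rule D_inj)
  consider "N \<noteq> n" "N \<noteq> Suc n" | "N \<noteq> n" "Q = 0" | "N = n" | "N = Suc n" "Q \<noteq> 0" by blast
  then show ?thesis
  proof cases
    case 1
    \<comment> \<open>Here Q is d of a multiple of \<open>K Q\<close>, so dP is d of D of that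
      multiple.\<close>
    let ?c = "of_nat N - of_nat (Suc n) :: 'f"
    have c: "?c \<noteq> 0" using 1 by (simp del: of_nat_Suc)
    have "dW n (K Q) = cst ?c * Q"
      using cartan[OF Sk_lpolys[OF Q(1)]] dQ Q(2)
      by (simp add: additive.zero[OF additive_K] homog_\<Theta>_iff[of _ _ "Suc n"] dm_def del: of_nat_Suc)
    then have "dW n (cst (1 / ?c) * K Q) = Q"
      using c by (simp add: dW_scale cst_mult del: of_nat_Suc) (simp add: \<kappa>_simps)
    then have "dW n P = dW n (D n (cst (1 / ?c) * K Q))"
      using Sk_lpolys[OF Sk_const_mult[OF Sk_K[OF Q(1)]]] by (simp add: dW_D e)
    then show ?thesis
      using exact_generic[OF P Sk_const_mult[OF Sk_K[OF Q(1)]] _ 1(1)] triv by blast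
  next
    case 2
    then have "dW n P = dW n (D n 0)" using e by (simp add: D_0 dW_0)
    then show ?thesis using exact_generic[OF P Sk_0 _ 2(1)] triv by blast
  next
    \<comment> \<open>Scalars (n = 0) and the Vandermonde polynomial (n = 3) survive. For n = 1 and
      n = 2 the only candidates are \<lambda>_0 = D 1 and \<open>q2\<close> = D \<open>l2\<close>.
      From n = 4 on the minimal degree n(n - 1)/2 exceeds n.\<close>
    case 3
    consider "n = 0" | "n = 1" | "n = 2" | "n = 3" | "n \<ge> 4" by linarith
    then show ?thesis
    proof cases
      case 1
      then have "t = 0" if "Poly_Mapping.lookup P t \<noteq> 0" for t
        using Sk_exponents(1)[OF P(1) that] by auto
      then have p: "P = Poly_Mapping.single 0 (Poly_Mapping.lookup P 0)"
        by (intro poly_mapping_eqI) (auto simp: lookup_single when_def)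
      obtain x where "Poly_Mapping.lookup P 0 = \<kappa> x"
        using lookup_range[OF P(2), of 0] 1 3 by (auto simp: mdeg_def)
      then show ?thesis using p 1 by (intro trivY[of x]) (simp add: yP_def)
    next
      case 2
      then obtain x where "P = cst x * lam 0"
        using lpolys_1_homog(1)[of P] P 3 Sk_lpolys by auto
      then show ?thesis using 2 D_small(1)[of x] Sk_1[OF lpolys_const] by (intro trivD[of "cst x"]) auto
    next
      case 3
      then obtain x where "P = cst x * q2" using Sk2_homog_2[of P] P \<open>N = n\<close> by auto
      then show ?thesis using 3 D_small(3)[of x] by (intro trivD[of "cst x * l2"]) (auto intro: Sk_const_mult Sk_small)
    next
      case 4
      then obtain x where "P = cst x * vd" using Sk3_homog_3[of P] P \<open>N = n\<close> by auto
      then show ?thesis using 4 by (intro trivY[of x]) (simp add: yP_def)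
    next
      case 5
      then have "P = 0" using Sk_homog_eq_0[OF P] sum_lessThan_ge[of n] 3 by simp
      then show ?thesis using trivD[of 0] by (simp add: Sk_0 D_0)
    qed
  next
    \<comment> \<open>For n = 0 the coefficient would have weight 1. For n = 1 the part of weight 2
      must vanish, and for n = 2 it is removed by a coboundary. For n \<ge> 3, Q has n + 1 \<ge> 4
      variables but only total degree n + 1, so it is zero.\<close>
    case 4
    consider "n = 0" | "n = 1" | "n = 2" | "n \<ge> 3" by linarith
    then show ?thesis
    proof cases
      case 1
      have "P = 0"
      proof (rule poly_mapping_eqI, rule ccontr)
        fix t assume "Poly_Mapping.lookup P t \<noteq> Poly_Mapping.lookup 0 t"
        then have nz: "Poly_Mapping.lookup P t \<noteq> 0" by simp
        then have "t = 0" using Sk_exponents(1)[OF P(1) nz] 1 by simp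
        then show False using homog_lookup(2)[OF P(2) nz] 1 4 by (simp add: mdeg_def)
      qed
      then show ?thesis using trivD[of 0] by (simp add: Sk_0 D_0)
    next
      case 2
      have N2: "N = 2" using 2 4 by simp
      obtain v x where v: "H v = of_nat 2 * v" "P = Poly_Mapping.single 0 v + cst x * lam 0 ^ 2"
        using lpolys_1_homog(2)[of P] P Sk_lpolys N2 2 by blast
      have l0: "cst x * lam 0 \<in> lpolys 1" by (intro lpolys_mult lpolys_const lpolys_lam) simp
      have P': "P = Poly_Mapping.single 0 v + D 1 (cst x * lam 0)" using v(2) D_small(2) by simp
      have "homog 1 (cst x * lam 0)"
        using homog_scale[OF homog_lam_mult[OF homog_1]] by simp
      then have "homog (Suc 1) (dW 1 (cst x * lam 0))" "dW 1 (cst x * lam 0) \<in> Sk (Suc 1)"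
        using homog_dW[OF l0] Sk_dW[OF Sk_1[OF l0]] by blast+
      then obtain q where q: "dW 1 (cst x * lam 0) = cst q * q2"
        using Sk2_homog_2[of "dW 1 (cst x * lam 0)"] by (auto simp: eval_nat_numeral)
      obtain r where r: "Q = cst r * q2" using Sk2_homog_2[of Q] Q 2 N2 by (auto simp: eval_nat_numeral)
      obtain a b where ab: "dW 1 (Poly_Mapping.single 0 v) = Poly_Mapping.single 0 v * l2 + cst a * c2 + cst b * c21"
        using dW_const[OF v(1)] by blast
      have "dW 1 P = dW 1 (Poly_Mapping.single 0 v) + D 2 (dW 1 (cst x * lam 0))"
        unfolding P' dW_add using dW_D[OF l0] by (simp add: eval_nat_numeral)
      moreover have "dW 1 P = D 2 Q" using e 2 by (simp add: eval_nat_numeral)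
      ultimately have "Poly_Mapping.single 0 v * l2 + cst a * c2 + cst b * c21 + cst q * (c2 + c21) = cst r * (c2 + c21)"
        unfolding ab q r D_small by simp
      \<comment> \<open>In the coefficient of \<lambda>_0 only the term with \<open>l2\<close>
        contributes.\<close>
      from arg_cong[OF this, of "\<lambda>p. Poly_Mapping.lookup p (t2 1 0)"] have "v = 0"
        unfolding small_monoms lookup_add lookup_const_mult lookup_minus lookup_single t2_eq_iff by simp
      then show ?thesis using P' 2 Sk_1[OF l0] by (intro trivD[of "cst x * lam 0"]) simp_all
    next
      case 3
      have N3: "homog 3 P" using P(2) 3 4 by simp
      obtain v x y where v: "H v = of_nat 2 * v" "P = Poly_Mapping.single 0 v * l2 + cst x * c2 + cst y * c21"
        using Sk2_homog_3[OF _ N3] P(1) 3 by auto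
      obtain a b where ab: "dW 1 (Poly_Mapping.single 0 v) = Poly_Mapping.single 0 v * l2 + cst a * c2 + cst b * c21"
        using dW_const[OF v(1)] by blast
      have "dm n (Poly_Mapping.single 0 v) = dW 1 (Poly_Mapping.single 0 v)"
        using 3 by (simp add: dm_def eval_nat_numeral)
      moreover have "D n (cst (y - b) * q2) = cst (y - b) * (c2 + c21)"
        using D_small(4) 3 by simp
      moreover have "yP n = c2" using 3 by (simp add: yP_def)
      \<comment> \<open>D \<open>q2\<close> = \<open>c2\<close> + \<open>c21\<close> absorbs the
        whole \<open>c21\<close> part, which fixes the factor y - b; what is left over is a multiple
        of \<open>c2\<close>.\<close>
      moreover have "Poly_Mapping.single 0 v * l2 + cst x * c2 + cst y * c21 =
        (Poly_Mapping.single 0 v * l2 + cst a * c2 + cst b * c21) + cst (y - b) * (c2 + c21) + cst (x - a - (y - b)) * c2"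
        unfolding \<kappa>_simps single_diff by (simp add: algebra_simps)
      ultimately have "P = dm n (Poly_Mapping.single 0 v) + D n (cst (y - b) * q2) + cst (x - a - (y - b)) * yP n"
        unfolding v(2) by (simp only: ab)
      moreover have "Poly_Mapping.single 0 v \<in> Sk (n - 1)" using 3 Sk_1[OF lpolys_const] by simp
      moreover have "cst (y - b) * q2 \<in> Sk n" using 3 by (simp add: Sk_const_mult Sk_small)
      ultimately show ?thesis by blast
    next
      case 4
      then have "Suc n < \<Sum>{..<Suc n}" using sum_lessThan_ge[of "Suc n"] by simp
      then have "Q = 0" using Sk_homog_eq_0[OF Q] \<open>N = Suc n\<close> by simp
      then show ?thesis using \<open>Q \<noteq> 0\<close> by simp
    qed
  qed
qed

text \<open>Q is an arbitrary witness of an equality of cosets; \<open>Sk_D_inv\<close> shows that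
  it is skewsymmetric. Then the finitely many homogeneous components of P are treated separately and
  added up.\<close>

theorem core_exact:
  assumes P: "P \<in> Sk n" and Q: "Q \<in> lpolys (Suc n)" and e: "dW n P = D (Suc n) Q"
  shows "\<exists>W\<in>Sk (n - 1). \<exists>R\<in>Sk n. \<exists>x. P = dm n W + D n R + cst x * yP n"
proof -
  have Q': "Q \<in> Sk (Suc n)"
    using Sk_D_inv[OF _ Q] Sk_dW[OF P] e by simp
  have "\<exists>W\<in>Sk (n - 1). \<exists>R\<in>Sk n. \<exists>x. proj N P = dm n W + D n R + cst x * yP n" for N
  proof (rule core_homog[OF Sk_proj[OF P] homog_proj Sk_proj[OF Q'] homog_proj])
    show "dW n (proj N P) = D (Suc n) (proj N Q)"
      using proj_dW[OF Sk_lpolys[OF P], of N] proj_D(1)[OF Q, of N] e by simp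
  qed
  then obtain W R x where W: "\<And>N. W N \<in> Sk (n - 1)" "\<And>N. R N \<in> Sk n"
    "\<And>N. proj N P = dm n (W N) + D n (R N) + cst (x N) * yP n" by metis
  obtain B where B: "P = (\<Sum>N<B. proj N P)" using proj_sum by blast
  have "(\<Sum>N<B. cst (x N)) = cst (\<Sum>N<B. x N)"
    by (simp add: rhom_sum[OF \<kappa>] rhom_sum[OF rhom_single_zero])
  then have "(\<Sum>N<B. proj N P) = dm n (\<Sum>N<B. W N) + D n (\<Sum>N<B. R N) + cst (\<Sum>N<B. x N) * yP n"
    by (simp only: W(3) sum.distrib additive.sum[OF additive_dm] additive.sum[OF additive_D] sum_distrib_right[symmetric])
  then show ?thesis
    using B W(1,2) by (metis Sk_sum)
qed

text \<open>Degrees decide without computing the differentials in degrees 2 and 3: d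
  \<open>c2\<close> has total degree 4 in three variables, hence is a multiple of D
  \<open>vd\<close>, and d \<open>vd\<close> has total degree 4 in four variables, below the minimum
  6.\<close>

lemma core_cocycle: "\<exists>Q\<in>lpolys (Suc n). dW n (yP n) = D (Suc n) Q"
proof -
  have "dW 0 1 = 0"
    by (rule ev_eqI) (simp add: ev_dW ev_simps A_def ell_1)
  moreover have "\<exists>x. dW 2 c2 = D 3 (cst x * vd)"
    using Sk3_homog_4[of "dW 2 c2"] Sk_dW[OF Sk_small(3)] homog_dW[OF Sk_lpolys[OF Sk_small(3)] homog_small(3)]
    by (simp add: eval_nat_numeral)
  moreover have "dW 3 vd = 0"
    using Sk_homog_eq_0[OF Sk_dW[OF Sk_vd] homog_dW[OF Sk_lpolys[OF Sk_vd] homog_small(5)]] by (simp add: eval_nat_numeral)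
  moreover have "cst x * vd \<in> lpolys 3" for x
    by (intro lpolys_mult lpolys_const Sk_lpolys[OF Sk_vd])
  ultimately show ?thesis
  proof (cases "n = 2")
    case True
    obtain x where "dW 2 c2 = D 3 (cst x * vd)" using \<open>\<exists>x. dW 2 c2 = D 3 (cst x * vd)\<close> by blast
    then have "dW n (yP n) = D (Suc n) (cst x * vd)" using True by (simp add: yP_def)
    moreover have "cst x * vd \<in> lpolys (Suc n)" using True \<open>\<And>x. cst x * vd \<in> lpolys 3\<close> by simp
    ultimately show ?thesis by blast
  next
    case False
    then have "dW n (yP n) = D (Suc n) 0"
      using \<open>dW 0 1 = 0\<close> \<open>dW 3 vd = 0\<close> by (auto simp: yP_def dW_0 D_0)
    then show ?thesis using lpolys_0 by blast
  qed
qed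

text \<open>The equation is compared in the total degree of \<open>yP n\<close>. For n = 0, D only
  reaches positive degrees. For n = 2, the weight 2 part of W vanishes, and the remaining terms on
  the right are divisible by \<lambda>_0 + \<lambda>_1. For n = 3, nothing remains on the right: R
  is zero by its degree, and W is a multiple of D \<open>l2\<close> with d \<open>l2\<close> =
  0.\<close>

lemma core_nonzero:
  assumes n: "n \<in> {0, 2, 3}" and W: "W \<in> Sk (n - 1)" and R: "R \<in> lpolys n"
    and e: "cst x * yP n = dm n W + D n R"
  shows "x = 0"
proof -
  consider "n = 0" | "n = 2" | "n = 3" using n by blast
  then show ?thesis
  proof cases
    case 1
    have "proj 0 (cst x) = cst x"
      using proj_homog[OF homog_small_single[of 0 x]] by (simp add: mdeg_def)
    moreover have "proj 0 (D 0 R) = 0" using proj_D(2)[of R 0] R 1 by simp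
    moreover have "cst x = D 0 R" using e 1 by (simp add: yP_def dm_def)
    ultimately have "cst x = 0" by simp
    then have "\<kappa> x = 0" by (metis lookup_single_eq lookup_zero)
    then show ?thesis by (simp add: \<kappa>_eq_0_iff)
  next
    case 2
    have R2: "R \<in> lpolys 2" and W1: "W \<in> Sk 1" using R W 2 by simp_all
    have e2: "cst x * c2 = dW 1 W + D 2 R" using e 2 by (simp add: yP_def dm_def eval_nat_numeral)
    have Suc1: "Suc 1 = 2" by simp
    have "D 2 R = cst x * c2 - dW 1 W" using e2 by simp
    moreover have "cst x * c2 - dW 1 W \<in> Sk 2"
      by (intro Sk_diff Sk_const_mult Sk_small Sk_dW[OF W1, unfolded Suc1])
    ultimately have RS: "R \<in> Sk 2"
      using Sk_D_inv[of 1 R, unfolded Suc1] R2 by simp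
    have "proj (Suc 2) (cst x * c2) = cst x * c2"
      using proj_homog[OF homog_scale[OF homog_small(3), of x]] by simp
    moreover have "proj (Suc 2) (dW 1 W + D 2 R) = dW 1 (proj 2 W) + D 2 (proj 2 R)"
      by (simp only: additive.add[OF additive_proj] proj_dW[OF Sk_lpolys[OF W1]] proj_D(1)[OF R2])
    ultimately have e3: "cst x * c2 = dW 1 (proj 2 W) + D 2 (proj 2 R)" using e2 by simp
    obtain q where q: "proj 2 R = cst q * q2" using Sk2_homog_2[OF Sk_proj[OF RS] homog_proj] by blast
    obtain v y where v: "H v = of_nat 2 * v" "proj 2 W = Poly_Mapping.single 0 v + cst y * lam 0 ^ 2"
      using lpolys_1_homog(2)[OF lpolys_proj[OF Sk_lpolys[OF W1]] homog_proj] by blast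
    obtain a b where ab: "dW 1 (Poly_Mapping.single 0 v) = Poly_Mapping.single 0 v * l2 + cst a * c2 + cst b * c21"
      using dW_const[OF v(1)] by blast
    have l0: "cst y * lam 0 \<in> lpolys 1" by (intro lpolys_mult lpolys_const lpolys_lam) simp
    have "homog 1 (cst y * lam 0)"
      using homog_scale[OF homog_lam_mult[OF homog_1]] by simp
    then have "homog (Suc 1) (dW 1 (cst y * lam 0))" "dW 1 (cst y * lam 0) \<in> Sk (Suc 1)"
      using homog_dW[OF l0] Sk_dW[OF Sk_1[OF l0]] by blast+
    then obtain r where r: "dW 1 (cst y * lam 0) = cst r * q2"
      using Sk2_homog_2[of "dW 1 (cst y * lam 0)"] by (auto simp: eval_nat_numeral)
    have "dW 1 (cst y * lam 0 ^ 2) = D 2 (cst r * q2)"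
      using dW_D[OF l0] r D_small(2)[of y] by (simp add: eval_nat_numeral)
    then have e4: "cst x * c2 = dW 1 (Poly_Mapping.single 0 v) + cst r * (c2 + c21) + cst q * (c2 + c21)"
      using e3 unfolding v(2) dW_add q D_small by simp
    from arg_cong[OF e4, of "\<lambda>p. Poly_Mapping.lookup p (t2 1 0)"] have "v = 0"
      unfolding ab small_monoms lookup_add lookup_const_mult lookup_minus lookup_single t2_eq_iff by simp
    then have "cst x * c2 = (cst r + cst q) * (c2 + c21)"
      using e4 by (simp add: dW_0 distrib_right)
    \<comment> \<open>At (1, -1) the factor \<lambda>_0 + \<lambda>_1 of \<open>c2\<close> +
      \<open>c21\<close> vanishes, while \<open>c2\<close> takes the value 2.\<close>
    from arg_cong[OF this, of "ev (\<lambda>k. if k = 0 then 1 else - 1)"]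
    have "\<kappa> x * 2 = 0" by (simp add: c2_def c21_def ev_small \<kappa>_simps)
    then have "\<kappa> (x * 2) = 0" by (metis \<kappa>_simps(4) \<kappa>_simps(7) of_nat_numeral)
    then show ?thesis by (simp only: \<kappa>_eq_0_iff) simp
  next
    case 3
    have R3: "R \<in> lpolys 3" and W2: "W \<in> Sk 2" using R W 3 by simp_all
    have e2: "cst x * vd = dW 2 W + D 3 R" using e 3 by (simp add: yP_def dm_def eval_nat_numeral)
    have "D (Suc 2) R = cst x * vd - dW 2 W" using e2 by simp
    moreover have "cst x * vd - dW 2 W \<in> Sk (Suc 2)"
      using Sk_diff[OF Sk_const_mult[OF Sk_vd] Sk_dW[OF W2, simplified]] by simp
    ultimately have RS: "R \<in> Sk 3"
      using Sk_D_inv[of 2 R] R3 by simp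
    have "proj (Suc 2) (cst x * vd) = cst x * vd"
      using proj_homog[OF homog_scale[OF homog_small(5), of x]] by simp
    moreover have "proj (Suc 2) (dW 2 W + D 3 R) = dW 2 (proj 2 W) + D 3 (proj 2 R)"
      by (simp only: additive.add[OF additive_proj] proj_dW[OF Sk_lpolys[OF W2]] proj_D(1)[OF R3])
    ultimately have e3: "cst x * vd = dW 2 (proj 2 W) + D 3 (proj 2 R)" using e2 by simp
    have "proj 2 R = 0"
      by (rule Sk_homog_eq_0[OF Sk_proj[OF RS] homog_proj]) (simp add: eval_nat_numeral)
    moreover obtain b where b: "proj 2 W = cst b * q2"
      using Sk2_homog_2[OF Sk_proj[OF W2] homog_proj] by blast
    \<comment> \<open>\<open>q2\<close> is D of \<open>l2\<close>, and d \<open>l2\<close> is zero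
      because its total degree 2 is below the minimum 3 for three variables.\<close>
    moreover have "dW 2 (cst b * q2) = 0"
    proof -
      have l: "cst b * l2 \<in> Sk 2" by (rule Sk_const_mult[OF Sk_small(1)])
      have "dW 2 (cst b * l2) = 0"
        using Sk_homog_eq_0[OF Sk_dW[OF l] homog_dW[OF Sk_lpolys[OF l] homog_scale[OF homog_small(1)]]]
        by (simp add: eval_nat_numeral)
      then show ?thesis using dW_D[OF Sk_lpolys[OF l]] D_small(3)[of b] by (simp add: D_0)
    qed
    ultimately have "cst x * vd = 0" using e3 by (simp add: D_0)
    from arg_cong[OF this, of "\<lambda>p. Poly_Mapping.lookup p (t3 2 1 0)"] have "\<kappa> x = 0"
      unfolding lookup_const_mult vd_monoms lookup_add lookup_minus lookup_single t3_eq_iff by simp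
    then show ?thesis by (simp add: \<kappa>_eq_0_iff)
  qed
qed

end

section \<open>Cohomology of a complex presented by skewsymmetric polynomials\<close>

text \<open>The interface through which both complexes receive their cohomology: cochains are
  classes of skewsymmetric polynomials modulo the image of D on all polynomials, and the
  differential is \<open>dW\<close> up to sign.\<close>

locale presentation = vir_module \<kappa> dr ell w
  for \<kappa> :: "'f::field_char_0 \<Rightarrow> 'm::idom" and dr ell w +
  fixes C :: "nat \<Rightarrow> ('f, 'y) module" and df :: "nat \<Rightarrow> 'y \<Rightarrow> 'y" and \<Phi> :: "nat \<Rightarrow> 'm lpoly \<Rightarrow> 'y"
  assumes carrier_C: "carrier (C n) = \<Phi> n ` Sk n"
    and \<Phi>_eq_iff: "P \<in> Sk n \<Longrightarrow> Q \<in> Sk n \<Longrightarrow> \<Phi> n P = \<Phi> n Q \<longleftrightarrow> P - Q \<in> D n ` lpolys n"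
    and \<Phi>_add: "P \<in> Sk n \<Longrightarrow> Q \<in> Sk n \<Longrightarrow> \<Phi> n P \<oplus>\<^bsub>C n\<^esub> \<Phi> n Q = \<Phi> n (P + Q)"
    and \<Phi>_smult: "P \<in> Sk n \<Longrightarrow> x \<odot>\<^bsub>C n\<^esub> \<Phi> n P = \<Phi> n (cst x * P)"
    and \<Phi>_zero: "\<zero>\<^bsub>C n\<^esub> = \<Phi> n 0"
    and df_\<Phi>: "P \<in> Sk n \<Longrightarrow> df n (\<Phi> n P) = \<Phi> (Suc n) (cst ((- 1) ^ (n + 1)) * dW n P)"
begin

lemma cst_add: "cst (x + y) = cst x + cst y" and cst_minus: "cst (- x) = - cst x" and cst_1: "cst 1 = 1"
  by (simp_all add: \<kappa>_simps single_add single_uminus)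

lemma vsp_image:
  assumes "S \<subseteq> Sk n" "0 \<in> S" "\<And>P Q. P \<in> S \<Longrightarrow> Q \<in> S \<Longrightarrow> P + Q \<in> S" "\<And>x P. P \<in> S \<Longrightarrow> cst x * P \<in> S"
  shows "vsp ((C n)\<lparr>carrier := \<Phi> n ` S\<rparr>)"
proof -
  have S: "P \<in> Sk n" if "P \<in> S" for P using that assms(1) by blast
  note r = \<Phi>_add[OF S S] \<Phi>_smult[OF S] \<Phi>_zero assms(2-4)
  show ?thesis
  proof (unfold_locales, simp_all)
    fix u v w' x y
    show "\<zero>\<^bsub>C n\<^esub> \<in> \<Phi> n ` S" unfolding \<Phi>_zero using assms(2) by blast
    assume "u \<in> \<Phi> n ` S"
    then obtain P where P: "P \<in> S" "u = \<Phi> n P" by blast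
    have xP: "x \<odot>\<^bsub>C n\<^esub> u = \<Phi> n (cst x * P)" "cst x * P \<in> S" for x
      unfolding P(2) by (rule r(2)[OF P(1)], rule r(6)[OF P(1)])
    show "x \<odot>\<^bsub>C n\<^esub> u \<in> \<Phi> n ` S" "1 \<odot>\<^bsub>C n\<^esub> u = u"
      using xP[of x] xP[of 1] P(2) by (auto simp: cst_1)
    show "\<zero>\<^bsub>C n\<^esub> \<oplus>\<^bsub>C n\<^esub> u = u"
      unfolding P(2) \<Phi>_zero r(1)[OF assms(2) P(1)] by simp
    have "P + cst (- 1) * P = 0" by (simp only: cst_minus cst_1) simp
    then show "u \<oplus>\<^bsub>C n\<^esub> (- 1) \<odot>\<^bsub>C n\<^esub> u = \<zero>\<^bsub>C n\<^esub>"
      unfolding xP unfolding P(2) \<Phi>_zero r(1)[OF P(1) xP(2)] by simp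
    show "(x + y) \<odot>\<^bsub>C n\<^esub> u = x \<odot>\<^bsub>C n\<^esub> u \<oplus>\<^bsub>C n\<^esub> y \<odot>\<^bsub>C n\<^esub> u"
      unfolding xP r(1)[OF xP(2) xP(2)] by (simp only: cst_add distrib_right)
    show "x \<odot>\<^bsub>C n\<^esub> (y \<odot>\<^bsub>C n\<^esub> u) = (x * y) \<odot>\<^bsub>C n\<^esub> u"
      unfolding xP r(2)[OF xP(2)] by (simp only: cst_mult)
    assume "v \<in> \<Phi> n ` S"
    then obtain Q where Q: "Q \<in> S" "v = \<Phi> n Q" by blast
    show "u \<oplus>\<^bsub>C n\<^esub> v \<in> \<Phi> n ` S" "u \<oplus>\<^bsub>C n\<^esub> v = v \<oplus>\<^bsub>C n\<^esub> u"
      "x \<odot>\<^bsub>C n\<^esub> (u \<oplus>\<^bsub>C n\<^esub> v) = x \<odot>\<^bsub>C n\<^esub> u \<oplus>\<^bsub>C n\<^esub> x \<odot>\<^bsub>C n\<^esub> v"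
      using P Q r(5,6) by (auto simp: r(1,2) add.commute distrib_left)
    assume "w' \<in> \<Phi> n ` S"
    then obtain R where R: "R \<in> S" "w' = \<Phi> n R" by blast
    show "(u \<oplus>\<^bsub>C n\<^esub> v) \<oplus>\<^bsub>C n\<^esub> w' = u \<oplus>\<^bsub>C n\<^esub> (v \<oplus>\<^bsub>C n\<^esub> w')"
      using P Q R r(5) by (simp add: r(1) add.assoc)
  qed
qed

definition Zs :: "nat \<Rightarrow> 'm lpoly set"
  where "Zs n = {P \<in> Sk n. dW n P \<in> D (Suc n) ` lpolys (Suc n)}"

lemma D_image_add: "p \<in> D n ` lpolys n \<Longrightarrow> q \<in> D n ` lpolys n \<Longrightarrow> p + q \<in> D n ` lpolys n"
  using lpolys_add by (auto simp: D_add[symmetric])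

lemma D_image_scale: "p \<in> D n ` lpolys n \<Longrightarrow> cst x * p \<in> D n ` lpolys n"
  using lpolys_mult[OF lpolys_const] by (auto simp: D_scale[symmetric])

lemma D_image_0: "0 \<in> D n ` lpolys n"
  using D_0[of n] lpolys_0 by (metis image_eqI)

lemma \<Phi>_eq_0_iff: "P \<in> Sk n \<Longrightarrow> \<Phi> n P = \<Phi> n 0 \<longleftrightarrow> P \<in> D n ` lpolys n"
  using \<Phi>_eq_iff[OF _ Sk_0] by simp

lemma D_image_sign: "cst ((- 1) ^ k) * p \<in> D n ` lpolys n \<longleftrightarrow> p \<in> D n ` lpolys n"
proof
  assume "cst ((- 1) ^ k) * p \<in> D n ` lpolys n"
  from D_image_scale[OF this, of "(- 1) ^ k"] show "p \<in> D n ` lpolys n"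
    by (simp add: cst_mult cst_1 flip: power_mult_distrib)
qed (rule D_image_scale)

lemma cocycles_eq: "cocycles C df n = \<Phi> n ` Zs n"
proof -
  have "df n (\<Phi> n P) = \<zero>\<^bsub>C (Suc n)\<^esub> \<longleftrightarrow> P \<in> Zs n" if "P \<in> Sk n" for P
    unfolding df_\<Phi>[OF that] \<Phi>_zero \<Phi>_eq_0_iff[OF Sk_const_mult[OF Sk_dW[OF that]]] D_image_sign
    using that by (simp add: Zs_def)
  then show ?thesis
    unfolding cocycles_def carrier_C by (auto simp: Zs_def)
qed

lemma dm_Sk: "W \<in> Sk (n - 1) \<Longrightarrow> dm n W \<in> Sk n"
  using Sk_dW by (cases n) (auto simp: dm_def Sk_0)

lemma coboundaries_eq: "coboundaries C df n = \<Phi> n ` dm n ` Sk (n - 1)"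
proof (cases n)
  case 0
  then show ?thesis using Sk_0[of 0] by (auto simp: coboundaries_def \<Phi>_zero dm_def)
next
  case (Suc m)
  have "df m ` \<Phi> m ` Sk m = \<Phi> n ` dW m ` Sk m"
  proof (intro equalityI subsetI)
    fix Y assume "Y \<in> df m ` \<Phi> m ` Sk m"
    then obtain P where "P \<in> Sk m" "Y = \<Phi> n (dW m (cst ((- 1) ^ (m + 1)) * P))"
      using Suc by (auto simp: df_\<Phi> dW_scale)
    then show "Y \<in> \<Phi> n ` dW m ` Sk m" using Sk_const_mult by blast
  next
    fix Y assume "Y \<in> \<Phi> n ` dW m ` Sk m"
    then obtain P where P: "P \<in> Sk m" "Y = \<Phi> n (dW m P)" by blast
    have "df m (\<Phi> m (cst ((- 1) ^ (m + 1)) * P)) = \<Phi> n (cst ((- 1) ^ (m + 1) * (- 1) ^ (m + 1)) * dW m P)"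
      using Suc Sk_const_mult[OF P(1)] by (simp add: df_\<Phi> dW_scale cst_mult)
    then have "df m (\<Phi> m (cst ((- 1) ^ (m + 1)) * P)) = Y"
      using P by (simp add: cst_1 flip: power_mult_distrib)
    then show "Y \<in> df m ` \<Phi> m ` Sk m" using Sk_const_mult[OF P(1)] by blast
  qed
  then show ?thesis using Suc by (simp add: coboundaries_def carrier_C dm_def image_image)
qed

lemma Zs_subspace: "Zs n \<subseteq> Sk n" "0 \<in> Zs n" "P \<in> Zs n \<Longrightarrow> Q \<in> Zs n \<Longrightarrow> P + Q \<in> Zs n" "P \<in> Zs n \<Longrightarrow> cst x * P \<in> Zs n"
  by (auto simp: Zs_def Sk_0 dW_0 D_image_0 Sk_add dW_add D_image_add Sk_const_mult dW_scale D_image_scale)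

lemma dm_Zs: "W \<in> Sk (n - 1) \<Longrightarrow> dm n W \<in> Zs n"
  using dm_Sk[of W n] dW_dW Sk_lpolys by (cases n) (auto simp: Zs_def dm_def dW_0 D_image_0)

abbreviation Zsp where "Zsp n \<equiv> (C n)\<lparr>carrier := cocycles C df n\<rparr>"

lemma vsp_Zsp: "vsp (Zsp n)"
  unfolding cocycles_eq by (rule vsp_image[OF Zs_subspace])

lemma subsp_H: "subsp (Zsp n) (coboundaries C df n)"
proof -
  interpret vsp "Zsp n" by (rule vsp_Zsp)
  show ?thesis
  proof (unfold_locales)
    show "coboundaries C df n \<subseteq> carrier (Zsp n)"
      using dm_Zs by (auto simp: coboundaries_eq cocycles_eq)
    show "\<zero>\<^bsub>Zsp n\<^esub> \<in> coboundaries C df n"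
      using dm_0[of n] Sk_0 by (auto simp: coboundaries_eq \<Phi>_zero image_iff intro!: bexI[of _ 0])
  next
    fix u v assume "u \<in> coboundaries C df n" "v \<in> coboundaries C df n"
    then obtain P Q where PQ: "P \<in> Sk (n - 1)" "Q \<in> Sk (n - 1)" "u = \<Phi> n (dm n P)" "v = \<Phi> n (dm n Q)"
      by (auto simp: coboundaries_eq)
    then have "u \<oplus>\<^bsub>Zsp n\<^esub> v = \<Phi> n (dm n (P + Q))"
      by (simp add: \<Phi>_add dm_Sk dm_add)
    then show "u \<oplus>\<^bsub>Zsp n\<^esub> v \<in> coboundaries C df n"
      using Sk_add[OF PQ(1,2)] by (auto simp: coboundaries_eq)
  next
    fix v x assume "v \<in> coboundaries C df n"
    then obtain P where P: "P \<in> Sk (n - 1)" "v = \<Phi> n (dm n P)" by (auto simp: coboundaries_eq)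
    then have "x \<odot>\<^bsub>Zsp n\<^esub> v = \<Phi> n (dm n (cst x * P))"
      by (simp add: \<Phi>_smult dm_Sk dm_scale)
    then show "x \<odot>\<^bsub>Zsp n\<^esub> v \<in> coboundaries C df n"
      using Sk_const_mult[OF P(1)] by (auto simp: coboundaries_eq)
  qed
qed

lemma vsp_H: "vsp (cohomology C df n)"
  unfolding cohomology_def by (rule subsp.vsp_quot[OF subsp_H])

lemma coh_class_eq: "coh_class C df n Y = coboundaries C df n +>\<^bsub>Zsp n\<^esub> Y"
  by (simp add: coh_class_def a_r_coset_def')

lemma mem_coboundaries_iff:
  assumes "P \<in> Sk n"
  shows "\<Phi> n P \<in> coboundaries C df n \<longleftrightarrow> (\<exists>W\<in>Sk (n - 1). \<exists>R\<in>lpolys n. P = dm n W + D n R)"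
proof -
  have "\<Phi> n P \<in> coboundaries C df n \<longleftrightarrow> (\<exists>W\<in>Sk (n - 1). P - dm n W \<in> D n ` lpolys n)"
  proof -
    have "\<Phi> n P \<in> coboundaries C df n \<longleftrightarrow> (\<exists>W\<in>Sk (n - 1). \<Phi> n P = \<Phi> n (dm n W))"
      unfolding coboundaries_eq by blast
    also have "\<dots> \<longleftrightarrow> (\<exists>W\<in>Sk (n - 1). P - dm n W \<in> D n ` lpolys n)"
      by (intro bex_cong refl \<Phi>_eq_iff[OF assms dm_Sk])
    finally show ?thesis .
  qed
  then show ?thesis by (auto simp: image_iff algebra_simps)
qed

lemma cohomology_representative:
  assumes "P \<in> Zs n"
  shows "\<exists>x. \<Phi> n P \<oplus>\<^bsub>C n\<^esub> (- 1) \<odot>\<^bsub>C n\<^esub> \<Phi> n (cst x * yP n) \<in> coboundaries C df n"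
proof -
  obtain Q where Q: "Q \<in> lpolys (Suc n)" "dW n P = D (Suc n) Q" using assms by (auto simp: Zs_def)
  have P: "P \<in> Sk n" using assms by (simp add: Zs_def)
  obtain W R x where W: "W \<in> Sk (n - 1)" "R \<in> Sk n" "P = dm n W + D n R + cst x * yP n"
    using core_exact[OF P Q] by blast
  have y: "cst x * yP n \<in> Sk n" by (rule Sk_const_mult[OF Sk_yP])
  have "\<Phi> n P \<oplus>\<^bsub>C n\<^esub> (- 1) \<odot>\<^bsub>C n\<^esub> \<Phi> n (cst x * yP n) = \<Phi> n (P + cst (- 1) * (cst x * yP n))"
    using y by (simp add: \<Phi>_smult \<Phi>_add P Sk_const_mult)
  also have "P + cst (- 1) * (cst x * yP n) = P - cst x * yP n"
    by (simp only: cst_minus cst_1) simp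
  also have "\<Phi> n (P - cst x * yP n) \<in> coboundaries C df n"
    unfolding mem_coboundaries_iff[OF Sk_diff[OF P y]]
  proof (intro bexI)
    show "P - cst x * yP n = dm n W + D n R" using W(3) by simp
  qed (use W Sk_lpolys in auto)
  finally show ?thesis by blast
qed

text \<open>The factor s serves degree 2, where the prescribed generator \<lambda>_1^3 corresponds
  to half of \<open>yP 2\<close>.\<close>

theorem cohomology_line:
  assumes "n \<in> {0, 2, 3}" "s \<noteq> 0"
  shows "is_line_on (cohomology C df n) (coh_class C df n (\<Phi> n (cst s * yP n)))"
proof -
  interpret subsp "Zsp n" "coboundaries C df n" by (rule subsp_H)
  let ?y = "\<lambda>x. \<Phi> n (cst x * yP n)" and ?B = "coboundaries C df n"
  have yZ: "cst x * yP n \<in> Zs n" for x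
    using Zs_subspace(4)[of "yP n" n x] core_cocycle[of n] Sk_yP[of n] by (auto simp: Zs_def)
  then have yc: "?y x \<in> carrier (Zsp n)" for x by (simp add: cocycles_eq)
  have sm: "x \<odot>\<^bsub>C n\<^esub> ?y s = ?y (x * s)" for x
    using \<Phi>_smult[OF Sk_const_mult[OF Sk_yP]] by (simp add: cst_mult)
  have smq: "x \<odot>\<^bsub>cohomology C df n\<^esub> (?B +>\<^bsub>Zsp n\<^esub> ?y s) = ?B +>\<^bsub>Zsp n\<^esub> ?y (x * s)" for x
    unfolding cohomology_def using smult_quot[OF yc, of x s] by (simp add: sm)
  show ?thesis
    unfolding is_line_on_def coh_class_eq
  proof (intro conjI)
    show "?B +>\<^bsub>Zsp n\<^esub> ?y s \<in> carrier (cohomology C df n)"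
      unfolding cohomology_def carrier_quot using yc by blast
    show "?B +>\<^bsub>Zsp n\<^esub> ?y s \<noteq> \<zero>\<^bsub>cohomology C df n\<^esub>"
    proof
      assume "?B +>\<^bsub>Zsp n\<^esub> ?y s = \<zero>\<^bsub>cohomology C df n\<^esub>"
      then have "?y s \<in> ?B"
        unfolding cohomology_def zero_quot using coset_eq_sub_iff[OF yc] by simp
      then obtain W R where "W \<in> Sk (n - 1)" "R \<in> lpolys n" "cst s * yP n = dm n W + D n R"
        using mem_coboundaries_iff[OF Sk_const_mult[OF Sk_yP]] by blast
      then show False using core_nonzero[OF assms(1)] assms(2) by blast
    qed
    show "carrier (cohomology C df n) = {x \<odot>\<^bsub>cohomology C df n\<^esub> (?B +>\<^bsub>Zsp n\<^esub> ?y s) |x. True}"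
    proof (intro equalityI subsetI)
      fix A assume "A \<in> carrier (cohomology C df n)"
      then obtain P where P: "P \<in> Zs n" "A = ?B +>\<^bsub>Zsp n\<^esub> \<Phi> n P"
        unfolding cohomology_def carrier_quot by (auto simp: cocycles_eq)
      have Pc: "\<Phi> n P \<in> carrier (Zsp n)" using P(1) by (simp add: cocycles_eq)
      obtain x where "\<Phi> n P \<oplus>\<^bsub>C n\<^esub> (- 1) \<odot>\<^bsub>C n\<^esub> ?y x \<in> ?B"
        using cohomology_representative[OF P(1)] by blast
      then have "A = ?B +>\<^bsub>Zsp n\<^esub> ?y (x / s * s)"
        using coset_eq_iff[OF Pc yc, of x] P(2) assms(2) by simp
      then show "A \<in> {x \<odot>\<^bsub>cohomology C df n\<^esub> (?B +>\<^bsub>Zsp n\<^esub> ?y s) |x. True}"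
        unfolding smq by blast
    next
      fix A assume "A \<in> {x \<odot>\<^bsub>cohomology C df n\<^esub> (?B +>\<^bsub>Zsp n\<^esub> ?y s) |x. True}"
      then show "A \<in> carrier (cohomology C df n)"
        unfolding smq unfolding cohomology_def carrier_quot using yc by blast
    qed
  qed
qed

theorem cohomology_zero:
  assumes "n \<notin> {0, 2, 3}"
  shows "carrier (cohomology C df n) = {\<zero>\<^bsub>cohomology C df n\<^esub>}"
proof -
  interpret subsp "Zsp n" "coboundaries C df n" by (rule subsp_H)
  interpret Q: vsp "cohomology C df n" by (rule vsp_H)
  have y: "yP n = 0" using assms by (simp add: yP_def)
  have "A = coboundaries C df n" if "A \<in> carrier (cohomology C df n)" for A
  proof -
    obtain P where P: "P \<in> Zs n" "A = coboundaries C df n +>\<^bsub>Zsp n\<^esub> \<Phi> n P"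
      using \<open>A \<in> carrier (cohomology C df n)\<close> unfolding cohomology_def carrier_quot by (auto simp: cocycles_eq)
    have PS: "P \<in> Sk n" using P(1) by (simp add: Zs_def)
    have "\<Phi> n P \<oplus>\<^bsub>C n\<^esub> (- 1) \<odot>\<^bsub>C n\<^esub> \<Phi> n 0 \<in> coboundaries C df n"
      using cohomology_representative[OF P(1)] by (simp add: y)
    then have "\<Phi> n P \<in> coboundaries C df n"
      using \<Phi>_smult[OF Sk_0] \<Phi>_add[OF PS Sk_0] by simp
    then show ?thesis
      using coset_eq_sub_iff[of "\<Phi> n P"] P by (simp add: cocycles_eq)
  qed
  then show ?thesis
    using Q.zero_closed unfolding cohomology_def zero_quot by blast
qed

end

section \<open>Cochains determined by their value on a generator\<close>

text \<open>
  \<open>X i a\<close> turns a polynomial, regarded as the value of a cochain with the generator in slot \<open>i\<close>,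
  into the value of that cochain with \<open>a\<close> in slot \<open>i\<close>.
\<close>

definition fill :: "(nat \<Rightarrow> 'r \<Rightarrow> 'p \<Rightarrow> 'p) \<Rightarrow> 'r list \<Rightarrow> 'p \<Rightarrow> nat set \<Rightarrow> 'p"
  where "fill X as P I = Finite_Set.fold (\<lambda>i. X i (as ! i)) P I"

definition Phi :: "('f::comm_ring_1, 'm::comm_monoid_add, 'z) dmod_scheme \<Rightarrow> (nat \<Rightarrow> 'r \<Rightarrow> 'm lpoly \<Rightarrow> 'm lpoly) \<Rightarrow>
    nat \<Rightarrow> 'm lpoly \<Rightarrow> 'r list \<Rightarrow> 'm lpoly set"
  where "Phi M X n P = (\<lambda>as\<in>{as. length as = n}. lcoset M n (fill X as P {..<n}))"

text \<open>The pair (x, a) stands for the operator a_x; its bracket with (y, b) is [a_x b] at the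
  point x + y. On modules the commutator of such operators is the operator of the bracket.\<close>

definition brR :: "('f::comm_ring_1, 'r::comm_monoid_add) conf_alg \<Rightarrow> 'f \<times> 'r \<Rightarrow> 'f \<times> 'r \<Rightarrow> 'f \<times> 'r"
  where "brR R x y = (fst x + fst y,
    \<Sum>k\<le>degree (act R (snd x) (snd y)). scl R (fst x ^ k) (coeff (act R (snd x) (snd y)) k))"

lemma map_nth_upt: "n \<le> length xs \<Longrightarrow> map ((!) xs) [m..<n] = take (n - m) (drop m xs)"
  by (rule nth_equalityI) auto

lemma omit_single: "i \<le> n \<Longrightarrow> omit n {i} = [0..<i] @ [Suc i..<Suc n]"
proof -
  assume "i \<le> n"
  then have "[0..<Suc n] = [0..<i] @ i # [Suc i..<Suc n]"
    using upt_add_eq_append[of 0 i "Suc n - i"] upt_conv_Cons[of i "Suc n"] by simp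
  then show ?thesis unfolding omit_def by (simp only: filter_append filter.simps) (simp add: filter_True)
qed

lemma omit_pair: "i < j \<Longrightarrow> j \<le> n \<Longrightarrow> omit n {i, j} = [0..<i] @ [Suc i..<j] @ [Suc j..<Suc n]"
proof -
  assume "i < j" "j \<le> n"
  then have "[0..<Suc n] = [0..<i] @ i # [Suc i..<j] @ j # [Suc j..<Suc n]"
    using upt_add_eq_append[of 0 i "Suc n - i"] upt_conv_Cons[of i "Suc n"]
      upt_add_eq_append[of "Suc i" j "Suc n - j"] upt_conv_Cons[of j "Suc n"] by simp
  then show ?thesis using \<open>i < j\<close> unfolding omit_def
    by (simp only: filter_append filter.simps) (simp add: filter_True)
qed

lemma map_nth_omit_single: "i \<le> n \<Longrightarrow> length xs = Suc n \<Longrightarrow> map ((!) xs) (omit n {i}) = del i xs"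
  by (simp add: omit_single map_nth_upt del: upt_Suc)

lemma map_nth_omit_pair:
  "i < j \<Longrightarrow> j \<le> n \<Longrightarrow> length xs = Suc n \<Longrightarrow> map ((!) xs) (omit n {i, j}) = del i (del j xs)"
  by (simp add: omit_pair map_nth_upt drop_take min_def del: upt_Suc)

lemma length_omit: "i \<le> n \<Longrightarrow> length (omit n {i}) = n" "i < j \<Longrightarrow> j \<le> n \<Longrightarrow> length (omit n {i, j}) = n - 1"
  by (simp_all add: omit_single omit_pair del: upt_Suc)

lemma sum_omit:
  fixes \<phi> :: "nat \<Rightarrow> 'a::comm_monoid_add"
  shows "i \<le> n \<Longrightarrow> \<phi> i + (\<Sum>k<n. \<phi> (omit n {i} ! k)) = (\<Sum>k<Suc n. \<phi> k)"
    "i < j \<Longrightarrow> j \<le> n \<Longrightarrow> \<phi> i + \<phi> j + (\<Sum>k<n - 1. \<phi> (omit n {i, j} ! k)) = (\<Sum>k<Suc n. \<phi> k)"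
proof -
  have s: "(\<Sum>k<length xs. \<phi> (xs ! k)) = sum \<phi> (set xs)" if "distinct xs" for xs
    using that by (simp add: sum.distinct_set_conv_list sum_list_sum_nth atLeast0LessThan)
  have d: "distinct (omit n I)" "set (omit n I) = {..<Suc n} - I" for I
    by (auto simp: omit_def simp del: upt_Suc)
  show "i \<le> n \<Longrightarrow> \<phi> i + (\<Sum>k<n. \<phi> (omit n {i} ! k)) = (\<Sum>k<Suc n. \<phi> k)"
    using s[OF d(1), of "{i}"] sum.remove[of "{..<Suc n}" i \<phi>] by (simp add: length_omit d del: sum.lessThan_Suc)
  show "i < j \<Longrightarrow> j \<le> n \<Longrightarrow> \<phi> i + \<phi> j + (\<Sum>k<n - 1. \<phi> (omit n {i, j} ! k)) = (\<Sum>k<Suc n. \<phi> k)"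
  proof -
    assume "i < j" "j \<le> n"
    moreover have "{..<Suc n} - {i, j} = {..<Suc n} - {i} - {j}" by auto
    ultimately show ?thesis
      using s[OF d(1), of "{i, j}"] sum.remove[of "{..<Suc n}" i \<phi>] sum.remove[of "{..<Suc n} - {i}" j \<phi>]
      by (simp add: length_omit d add.assoc del: sum.lessThan_Suc)
  qed
qed

section \<open>Values of cochains as polynomials modulo the image of D\<close>

locale lmod = vir_module \<kappa> dr ell w
  for \<kappa> :: "'f::field_char_0 \<Rightarrow> 'm::idom" and dr ell w +
  fixes M :: "('f, 'r::ab_group_add, 'm) conf_module"
  assumes scl_M: "scl M = sc" and der_M: "der M = dr"
begin

lemma vsp_lspace: "vsp (lspace M n)"
proof -
  have s: "Poly_Mapping.map (scl M x) p = cst x * p" for x p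
    by (simp add: scl_M mult_map_scale_conv_mult)
  show ?thesis
    by (unfold_locales)
      (simp_all add: lspace_def s lpolys_0 lpolys_add lpolys_mult lpolys_const algebra_simps \<kappa>_simps single_add single_uminus
        mult_single flip: mult.assoc)
qed

lemma lrel_eq: "lrel M n = D n ` lpolys n"
  by (simp add: lrel_def D_def scl_M der_M)

lemma subsp_lrel: "subsp (lspace M n) (lrel M n)"
proof -
  interpret vsp "lspace M n" by (rule vsp_lspace)
  have s: "Poly_Mapping.map (scl M x) p = cst x * p" for x p
    by (simp add: scl_M mult_map_scale_conv_mult)
  show ?thesis
  proof unfold_locales
    show "lrel M n \<subseteq> carrier (lspace M n)" by (auto simp: lrel_eq lspace_def lpolys_D)
    show "\<zero>\<^bsub>lspace M n\<^esub> \<in> lrel M n"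
      using D_0[of n] lpolys_0 by (metis image_eqI lrel_eq lspace_def ring.simps(1))
    show "u \<oplus>\<^bsub>lspace M n\<^esub> v \<in> lrel M n" if "u \<in> lrel M n" "v \<in> lrel M n" for u v
      using that lpolys_add by (auto simp: lrel_eq lspace_def D_add[symmetric])
    show "x \<odot>\<^bsub>lspace M n\<^esub> v \<in> lrel M n" if "v \<in> lrel M n" for x v
      using that lpolys_mult[OF lpolys_const] by (auto simp: lrel_eq lspace_def s D_scale[symmetric])
  qed
qed

lemma carrier_lspace: "carrier (lspace M n) = lpolys n"
  by (simp add: lspace_def)

lemma carrier_lquot: "carrier (lquot M n) = lcoset M n ` lpolys n"
  unfolding lquot_def lcoset_def subsp.carrier_quot[OF subsp_lrel] by (auto simp: lspace_def)

lemma lcoset_eq_iff: "p \<in> lpolys n \<Longrightarrow> q \<in> lpolys n \<Longrightarrow> lcoset M n p = lcoset M n q \<longleftrightarrow> p - q \<in> D n ` lpolys n"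
proof -
  assume pq: "p \<in> lpolys n" "q \<in> lpolys n"
  have "p \<oplus>\<^bsub>lspace M n\<^esub> (- 1) \<odot>\<^bsub>lspace M n\<^esub> q = p - q"
    by (simp add: lspace_def scl_M mult_map_scale_conv_mult \<kappa>_simps single_uminus)
  then show ?thesis
    using subsp.coset_eq_iff[OF subsp_lrel, of p n q] pq by (simp add: lcoset_def carrier_lspace lrel_eq)
qed

lemma lcoset_eqI: "p \<in> lpolys n \<Longrightarrow> q \<in> lpolys n \<Longrightarrow> r \<in> lpolys n \<Longrightarrow> p = q + D n r \<Longrightarrow> lcoset M n p = lcoset M n q"
  by (subst lcoset_eq_iff) auto

lemma lcoset_add: "p \<in> lpolys n \<Longrightarrow> q \<in> lpolys n \<Longrightarrow> lcoset M n p \<oplus>\<^bsub>lquot M n\<^esub> lcoset M n q = lcoset M n (p + q)"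
  using subsp.add_quot[OF subsp_lrel, of p n q] by (simp add: lquot_def lcoset_def carrier_lspace) (simp add: lspace_def)

lemma lcoset_smult: "p \<in> lpolys n \<Longrightarrow> x \<odot>\<^bsub>lquot M n\<^esub> lcoset M n p = lcoset M n (cst x * p)"
  using subsp.smult_quot[OF subsp_lrel, of p n x] by (simp add: lquot_def lcoset_def carrier_lspace)
    (simp add: lspace_def scl_M mult_map_scale_conv_mult)

lemma lcoset_zero: "\<zero>\<^bsub>lquot M n\<^esub> = lcoset M n 0"
  using subsp.zero_quot[OF subsp_lrel, of n] subsp.coset_zero[OF subsp_lrel, of n] by (simp add: lquot_def lcoset_def lspace_def)

lemma rep_lcoset:
  assumes "p \<in> lpolys n"
  shows "\<exists>q\<in>lpolys n. rep (lcoset M n p) = p + D n q"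
proof -
  obtain u where u: "u \<in> lrel M n" "rep (lcoset M n p) = u \<oplus>\<^bsub>lspace M n\<^esub> p"
    using subsp.rep_coset[OF subsp_lrel, of p n] assms by (auto simp: lcoset_def carrier_lspace)
  then show ?thesis by (auto simp: lrel_eq lspace_def add.commute)
qed

lemma D_lam: "lam i * D n q = D n (lam i * q)"
  by (rule ev_eqI) (simp add: ev_D ev_simps ev_lam der_scale algebra_simps)

lemma lmult_lam: "lmult sc (lam i) p = lam i * p"
  by (rule ev_eqI) (simp add: ev_lmult evF_lam ev_simps ev_lam)

lemma lcoset_lam_rep:
  assumes p: "p \<in> lpolys n" and i: "i < n"
  shows "lcoset M n (- lmult (scl M) (lam i) (rep (lcoset M n p))) = lcoset M n (- (lam i * p))"
proof -
  obtain q where q: "q \<in> lpolys n" "rep (lcoset M n p) = p + D n q" using rep_lcoset[OF p] by blast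
  have l: "lam i * r \<in> lpolys n" if "r \<in> lpolys n" for r :: "'m lpoly"
    using lpolys_mult[OF lpolys_lam that] i by simp
  have "lcoset M n (- lmult sc (lam i) (p + D n q)) = lcoset M n (- (lam i * p))"
  proof (rule lcoset_eqI[of _ _ _ "- (lam i * q)"])
    show "- lmult sc (lam i) (p + D n q) = - (lam i * p) + D n (- (lam i * q))"
      by (simp add: lmult_lam distrib_left D_lam additive.minus[OF additive_D])
  qed (use p q l in \<open>auto simp: lmult_lam intro!: lpolys_minus lpolys_add lpolys_D\<close>)
  then show ?thesis by (simp only: q(2) scl_M)
qed

lemma lc_cochains_slot:
  assumes Y: "Y \<in> lc_cochains R M n" and as: "length as = n" "i < n"
  shows "p \<in> lpolys n \<Longrightarrow> q \<in> lpolys n \<Longrightarrow> Y (as[i := a]) = lcoset M n p \<Longrightarrow> Y (as[i := b]) = lcoset M n q \<Longrightarrow>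
      Y (as[i := a + b]) = lcoset M n (p + q)"
    "p \<in> lpolys n \<Longrightarrow> Y (as[i := a]) = lcoset M n p \<Longrightarrow> Y (as[i := scl R x a]) = lcoset M n (cst x * p)"
    "p \<in> lpolys n \<Longrightarrow> Y (as[i := a]) = lcoset M n p \<Longrightarrow> Y (as[i := der R a]) = lcoset M n (- (lam i * p))"
proof -
  have "Y (as[i := a + b]) = Y (as[i := a]) \<oplus>\<^bsub>lquot M n\<^esub> Y (as[i := b])"
    "Y (as[i := scl R x a]) = x \<odot>\<^bsub>lquot M n\<^esub> Y (as[i := a])"
    "Y (as[i := der R a]) = lcoset M n (- lmult (scl M) (lam i) (rep (Y (as[i := a]))))"
    using Y as unfolding lc_cochains_def by blast+
  then show "p \<in> lpolys n \<Longrightarrow> q \<in> lpolys n \<Longrightarrow> Y (as[i := a]) = lcoset M n p \<Longrightarrow> Y (as[i := b]) = lcoset M n q \<Longrightarrow>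
      Y (as[i := a + b]) = lcoset M n (p + q)"
    "p \<in> lpolys n \<Longrightarrow> Y (as[i := a]) = lcoset M n p \<Longrightarrow> Y (as[i := scl R x a]) = lcoset M n (cst x * p)"
    "p \<in> lpolys n \<Longrightarrow> Y (as[i := a]) = lcoset M n p \<Longrightarrow> Y (as[i := der R a]) = lcoset M n (- (lam i * p))"
    using as by (simp_all add: lcoset_add lcoset_smult lcoset_lam_rep)
qed

lemma lc_cochains_value:
  assumes "Y \<in> lc_cochains R M n" "length as = n"
  shows "\<exists>p\<in>lpolys n. Y as = lcoset M n p"
proof -
  have "Y \<in> {as. length as = n} \<rightarrow>\<^sub>E carrier (lquot M n)" using assms(1) by (simp add: lc_cochains_def)
  then have "Y as \<in> carrier (lquot M n)" by (rule PiE_mem) (simp add: assms(2))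
  then show ?thesis by (auto simp: carrier_lquot)
qed

end

text \<open>The laws of a slot map \<open>X\<close> that presents the cochains of C by polynomials.
  \<open>C_mem\<close> and \<open>C_slot\<close> express that a cochain of the LCA complex lies in C
  exactly when each of its slots is filled by \<open>X\<close>, starting from the value at
  L.\<close>

locale slots = lmod \<kappa> dr ell w M
  for \<kappa> :: "'f::field_char_0 \<Rightarrow> 'm::idom" and dr ell w and M :: "('f, 'r::ab_group_add, 'm) conf_module" +
  fixes R :: "('f, 'r::ab_group_add) conf_alg" and L :: 'r
    and X :: "nat \<Rightarrow> 'r \<Rightarrow> 'm lpoly \<Rightarrow> 'm lpoly" and C :: "nat \<Rightarrow> ('f, 'r list \<Rightarrow> 'm lpoly set) module"
  assumes act_add: "act M a (m + m') = act M a m + act M a m'"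
    and act_scale: "act M a (\<kappa> x * m) = map_poly (sc x) (act M a m)"
    and act_der: "poly (act M a (dr m)) (\<kappa> x) = \<kappa> x * poly (act M a m) (\<kappa> x) + dr (poly (act M a m) (\<kappa> x))"
    and X_add: "X i a (p + q) = X i a p + X i a q"
    and X_cst: "X i a (cst x * p) = cst x * X i a p"
    and X_add_arg: "X i (a + b) p = X i a p + X i b p"
    and X_scl_arg: "X i (scl R x a) p = cst x * X i a p"
    and X_der_arg: "X i (der R a) p = - (lam i * X i a p)"
    and X_L: "X i L p = p"
    and X_D: "i < n \<Longrightarrow> X i a (D n p) = D n (X i a p)"
    and X_comm: "i \<noteq> j \<Longrightarrow> X i a (X j b p) = X j b (X i a p)"
    and X_lpolys: "i < n \<Longrightarrow> p \<in> lpolys n \<Longrightarrow> X i a p \<in> lpolys n"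
    and X_perm: "\<pi> permutes {..<n} \<Longrightarrow> lsubst sc (\<lambda>k. lam (\<pi> k)) (X i a p) = X (\<pi> i) a (lsubst sc (\<lambda>k. lam (\<pi> k)) p)"
    and C_zero: "\<zero>\<^bsub>C n\<^esub> = \<zero>\<^bsub>lc_complex R M n\<^esub>"
    and C_add: "(\<oplus>\<^bsub>C n\<^esub>) = (\<oplus>\<^bsub>lc_complex R M n\<^esub>)"
    and C_smult: "(\<odot>\<^bsub>C n\<^esub>) = (\<odot>\<^bsub>lc_complex R M n\<^esub>)"
    and C_sub: "carrier (C n) \<subseteq> lc_cochains R M n"
    and C_mem: "Y \<in> lc_cochains R M n \<Longrightarrow>
      (\<And>as i. length as = n \<Longrightarrow> i < n \<Longrightarrow> \<exists>q\<in>lpolys n. \<forall>a. Y (as[i := a]) = lcoset M n (X i a q)) \<Longrightarrow>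
      Y \<in> carrier (C n)"
    and C_slot: "Y \<in> carrier (C n) \<Longrightarrow> length as = n \<Longrightarrow> i < n \<Longrightarrow> p \<in> lpolys n \<Longrightarrow>
      Y (as[i := L]) = lcoset M n p \<Longrightarrow> Y (as[i := a]) = lcoset M n (X i a p)"
begin

lemma comp_fun_commute_X: "comp_fun_commute (\<lambda>i. X i (as ! i))"
proof
  fix x y
  show "X y (as ! y) \<circ> X x (as ! x) = X x (as ! x) \<circ> X y (as ! y)"
    by (cases "x = y") (auto simp: X_comm)
qed

lemma fill_empty: "fill X as P {} = P"
  by (simp add: fill_def)

lemma fill_insert: "finite I \<Longrightarrow> i \<notin> I \<Longrightarrow> fill X as P (insert i I) = X i (as ! i) (fill X as P I)"
proof -
  interpret comp_fun_commute "\<lambda>i. X i (as ! i)" by (rule comp_fun_commute_X)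
  assume "finite I" "i \<notin> I"
  then show ?thesis unfolding fill_def by (rule fold_insert)
qed

lemma fill_cong:
  assumes "finite I" "\<And>i. i \<in> I \<Longrightarrow> as ! i = bs ! i"
  shows "fill X as P I = fill X bs P I"
  using assms by (induction I) (auto simp: fill_empty fill_insert)

lemma fill_remove:
  assumes "i < n" "length as = n"
  shows "fill X (as[i := a]) P {..<n} = X i a (fill X as P ({..<n} - {i}))"
proof -
  have I: "{..<n} = insert i ({..<n} - {i})" using assms by auto
  have "fill X (as[i := a]) P (insert i ({..<n} - {i})) = X i ((as[i := a]) ! i) (fill X (as[i := a]) P ({..<n} - {i}))"
    by (rule fill_insert) auto
  also have "fill X (as[i := a]) P ({..<n} - {i}) = fill X as P ({..<n} - {i})"
    by (rule fill_cong) auto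
  finally show ?thesis using assms I by simp
qed

lemma fill_lpolys: "I \<subseteq> {..<n} \<Longrightarrow> P \<in> lpolys n \<Longrightarrow> fill X as P I \<in> lpolys n"
proof -
  assume *: "I \<subseteq> {..<n}" "P \<in> lpolys n"
  then have "finite I" using finite_subset by blast
  then show ?thesis using * by (induction I) (auto simp: fill_empty fill_insert X_lpolys)
qed

lemma fill_add: "finite I \<Longrightarrow> fill X as (P + Q) I = fill X as P I + fill X as Q I"
  by (induction I rule: finite_induct) (auto simp: fill_empty fill_insert X_add)

lemma fill_cst: "finite I \<Longrightarrow> fill X as (cst x * P) I = cst x * fill X as P I"
  by (induction I rule: finite_induct) (auto simp: fill_empty fill_insert X_cst)

lemma fill_D: "I \<subseteq> {..<n} \<Longrightarrow> fill X as (D n P) I = D n (fill X as P I)"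
proof -
  assume *: "I \<subseteq> {..<n}"
  then have "finite I" using finite_subset by blast
  then show ?thesis using * by (induction I) (auto simp: fill_empty fill_insert X_D)
qed

lemma fill_L: "finite I \<Longrightarrow> (\<And>i. i \<in> I \<Longrightarrow> as ! i = L) \<Longrightarrow> fill X as P I = P"
  by (induction I rule: finite_induct) (auto simp: fill_empty fill_insert X_L)

text \<open>Renaming variables carries slot i to slot \<pi> i, and entry i of the permuted list is
  entry \<pi> i of the list, so the same elements meet the same variables.\<close>

lemma fill_perm:
  assumes "\<pi> permutes {..<n}" "length as = n"
  shows "lsubst sc (\<lambda>k. lam (\<pi> k)) (fill X (permute_list \<pi> as) P {..<n}) =
    fill X as (lsubst sc (\<lambda>k. lam (\<pi> k)) P) {..<n}"
proof -
  have "lsubst sc (\<lambda>k. lam (\<pi> k)) (fill X (permute_list \<pi> as) P I) =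
    fill X as (lsubst sc (\<lambda>k. lam (\<pi> k)) P) (\<pi> ` I)" if "finite I" "I \<subseteq> {..<n}" for I
    using that
  proof (induction I)
    case (insert i I)
    have "\<pi> i \<notin> \<pi> ` I" using insert permutes_inj[OF assms(1)] by (auto dest: injD)
    moreover have "permute_list \<pi> as ! i = as ! \<pi> i"
      using insert assms by (intro permute_list_nth) auto
    ultimately show ?case
      using insert by (simp add: fill_insert X_perm[OF assms(1)])
  qed (simp add: fill_empty)
  from this[of "{..<n}"] show ?thesis
    using permutes_image[OF assms(1)] by simp
qed

lemma ev_perm: "ev \<phi> (lsubst sc (\<lambda>k. lam (\<pi> k)) p) = ev (\<lambda>k. \<phi> (\<pi> k)) p"
  by (simp add: ev_lsubst evF_lam)

lemma lsubst_perm_D: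
  assumes "\<pi> permutes {..<n}"
  shows "lsubst sc (\<lambda>k. lam (\<pi> k)) (D n q) = D n (lsubst sc (\<lambda>k. lam (\<pi> k)) q)"
proof (rule ev_eqI)
  fix \<phi> :: "nat \<Rightarrow> 'f"
  have "(\<Sum>i<n. \<phi> (\<pi> i)) = (\<Sum>i<n. \<phi> i)"
    using sum.permute[OF assms, of \<phi>] by (simp add: comp_def)
  then show "ev \<phi> (lsubst sc (\<lambda>k. lam (\<pi> k)) (D n q)) = ev \<phi> (D n (lsubst sc (\<lambda>k. lam (\<pi> k)) q))"
    by (simp add: ev_perm ev_D)
qed

lemma lsubst_perm_add: "lsubst sc (\<lambda>k. lam (\<pi> k)) (p + q) = lsubst sc (\<lambda>k. lam (\<pi> k)) p + lsubst sc (\<lambda>k. lam (\<pi> k)) q"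
  by (rule ev_eqI) (simp add: ev_perm ev_simps)

lemma lsubst_perm_lpolys:
  assumes "\<pi> permutes {..<n}" "p \<in> lpolys n"
  shows "lsubst sc (\<lambda>k. lam (\<pi> k)) p \<in> lpolys n"
proof (rule mem_lpolysI)
  fix \<phi> \<psi> :: "nat \<Rightarrow> 'f"
  assume *: "\<And>k. k < n \<Longrightarrow> \<phi> k = \<psi> k"
  show "ev \<phi> (lsubst sc (\<lambda>k. lam (\<pi> k)) p) = ev \<psi> (lsubst sc (\<lambda>k. lam (\<pi> k)) p)"
    unfolding ev_perm using * permutes_in_image[OF assms(1)] by (intro ev_lpolys_cong[OF assms(2)]) simp
qed

lemma Sk_perm:
  assumes "P \<in> Sk n" "\<pi> permutes {..<n}"
  shows "lsubst sc (\<lambda>k. lam (\<pi> k)) P = cst (of_int (sign \<pi>)) * P"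
proof (rule ev_eqI)
  fix \<phi> :: "nat \<Rightarrow> 'f"
  have "ev (\<lambda>k. \<phi> (\<pi> k)) P = \<kappa> (of_int (sign \<pi>)) * ev \<phi> P"
    using assms(2) finite_lessThan[of n]
  proof (induction arbitrary: \<phi> rule: permutes_induct)
    case id
    show ?case by (simp add: \<kappa>_simps sign_id)
  next
    case (swap a b p)
    have "ev (\<lambda>k. \<phi> ((Transposition.transpose a b \<circ> p) k)) P = \<kappa> (of_int (sign p)) * ev (\<phi> \<circ> Transposition.transpose a b) P"
      using swap.IH[of "\<phi> \<circ> Transposition.transpose a b"] by (simp add: comp_def)
    also have "\<dots> = - (\<kappa> (of_int (sign p)) * ev \<phi> P)"
      using Sk_ev[OF assms(1), of a b \<phi>] swap by simp
    also have "sign (Transposition.transpose a b \<circ> p) = - sign p"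
      using swap sign_compose[OF permutation_swap_id permutes_imp_permutation[OF finite_lessThan \<open>p permutes {..<n}\<close>], of a b]
      by (simp add: sign_swap_id)
    then have "- (\<kappa> (of_int (sign p)) * ev \<phi> P) = \<kappa> (of_int (sign (Transposition.transpose a b \<circ> p))) * ev \<phi> P"
      by (simp add: \<kappa>_simps)
    finally show ?case .
  qed
  then show "ev \<phi> (lsubst sc (\<lambda>k. lam (\<pi> k)) P) = ev \<phi> (cst (of_int (sign \<pi>)) * P)"
    by (simp add: ev_perm ev_simps ev_const)
qed

lemma Phi_apply: "length as = n \<Longrightarrow> Phi M X n P as = lcoset M n (fill X as P {..<n})"
  by (simp add: Phi_def)

lemma Phi_lc_cochains:
  assumes P: "P \<in> Sk n"
  shows "Phi M X n P \<in> lc_cochains R M n"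
proof -
  note Pl = Sk_lpolys[OF P]
  have G: "fill X as P ({..<n} - {i}) \<in> lpolys n" for as i by (rule fill_lpolys[OF _ Pl]) auto
  have F: "fill X as P {..<n} \<in> lpolys n" for as by (rule fill_lpolys[OF _ Pl]) auto
  have Y: "Phi M X n P (as[i := a]) = lcoset M n (X i a (fill X as P ({..<n} - {i})))"
    if "length as = n" "i < n" for as i a
    using that by (simp add: Phi_apply fill_remove)
  show ?thesis
    unfolding lc_cochains_def
  proof (intro CollectI conjI allI impI; (elim conjE)?)
    show "Phi M X n P \<in> {as. length as = n} \<rightarrow>\<^sub>E carrier (lquot M n)"
      using F by (auto simp: Phi_def carrier_lquot)
  next
    fix as :: "'r list" and i a b assume "length as = n" "i < n"
    then show "Phi M X n P (as[i := a + b]) = Phi M X n P (as[i := a]) \<oplus>\<^bsub>lquot M n\<^esub> Phi M X n P (as[i := b])"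
      using G X_lpolys by (simp add: Y lcoset_add X_add_arg)
  next
    fix as :: "'r list" and i x a assume "length as = n" "i < n"
    then show "Phi M X n P (as[i := scl R x a]) = x \<odot>\<^bsub>lquot M n\<^esub> Phi M X n P (as[i := a])"
      using G X_lpolys by (simp add: Y lcoset_smult X_scl_arg)
  next
    fix as :: "'r list" and i a assume *: "length as = n" "i < n"
    let ?p = "X i a (fill X as P ({..<n} - {i}))"
    have p: "?p \<in> lpolys n" using G X_lpolys * by simp
    show "Phi M X n P (as[i := der R a]) = lcoset M n (- lmult (scl M) (lam i) (rep (Phi M X n P (as[i := a]))))"
      using * by (simp add: Y X_der_arg lcoset_lam_rep[OF p])
  next
    fix as :: "'r list" and \<pi> assume *: "length as = n" "\<pi> permutes {..<n}"
    let ?p = "fill X (permute_list \<pi> as) P {..<n}" let ?s = "lsubst sc (\<lambda>k. lam (\<pi> k))"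
    obtain q where q: "q \<in> lpolys n" "rep (lcoset M n ?p) = ?p + D n q" using rep_lcoset[OF F] by blast
    have "?s ?p = cst (of_int (sign \<pi>)) * fill X as P {..<n}"
      using fill_perm[OF *(2,1), of P] by (simp add: Sk_perm[OF P *(2)] fill_cst)
    moreover have "lcoset M n (?s (?p + D n q)) = lcoset M n (?s ?p)"
      by (rule lcoset_eqI[of _ _ _ "?s q"])
        (simp_all add: lsubst_perm_lpolys[OF *(2)] lpolys_add lpolys_D F q lsubst_perm_add lsubst_perm_D[OF *(2)])
    ultimately show "lcoset M n (lsubst (scl M) (\<lambda>k. lam (\<pi> k)) (rep (Phi M X n P (permute_list \<pi> as)))) =
      of_int (sign \<pi>) \<odot>\<^bsub>lquot M n\<^esub> Phi M X n P as"
      using * F by (simp add: Phi_apply q(2) scl_M lcoset_smult)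
  qed
qed

text \<open>The signed average over all permutations is skewsymmetric; each of its terms is
  congruent to P modulo the image of D, and so is the average. Division by n! uses characteristic
  0.\<close>

lemma antisymmetrise:
  assumes P: "P \<in> lpolys n"
    and skew: "\<And>\<pi>. \<pi> permutes {..<n} \<Longrightarrow> lsubst sc (\<lambda>k. lam (\<pi> k)) P - cst (of_int (sign \<pi>)) * P \<in> D n ` lpolys n"
  shows "\<exists>Q\<in>Sk n. Q - P \<in> D n ` lpolys n"
proof -
  let ?S = "{\<pi>. \<pi> permutes {..<n}}" let ?s = "\<lambda>\<pi>. lsubst sc (\<lambda>k. lam (\<pi> k)) P"
  let ?g = "\<lambda>\<pi>. cst (of_int (sign \<pi>)) :: 'm lpoly"
  define Q where "Q = cst (1 / fact n) * (\<Sum>\<pi>\<in>?S. ?g \<pi> * ?s \<pi>)"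
  have fin: "finite ?S" by (rule finite_permutations) simp
  have card: "card ?S = fact n" by (rule card_permutations) auto
  have gg: "?g \<pi> * ?g \<pi> = 1" for \<pi>
    by (simp add: mult_single flip: of_int_mult) (simp flip: of_int_mult \<kappa>_simps(4), simp add: \<kappa>_simps)
  have Dadd: "p + q \<in> D n ` lpolys n" if "p \<in> D n ` lpolys n" "q \<in> D n ` lpolys n" for p q
    using that lpolys_add by (auto simp: D_add[symmetric])
  have Dsc: "cst x * p \<in> D n ` lpolys n" if "p \<in> D n ` lpolys n" for x p
    using that lpolys_mult[OF lpolys_const] by (auto simp: D_scale[symmetric])
  have D0: "0 \<in> D n ` lpolys n" using D_0[of n] lpolys_0 by (metis image_eqI)
  have Dsum: "(\<Sum>x\<in>I. f x) \<in> D n ` lpolys n" if "\<And>x. x \<in> I \<Longrightarrow> f x \<in> D n ` lpolys n" for I and f :: "(nat \<Rightarrow> nat) \<Rightarrow> 'm lpoly"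
    using that by (induction I rule: infinite_finite_induct) (auto simp: D0 intro: Dadd)
  have "Q - P = cst (1 / fact n) * (\<Sum>\<pi>\<in>?S. ?g \<pi> * (?s \<pi> - ?g \<pi> * P))"
  proof -
    have "(\<Sum>\<pi>\<in>?S. ?g \<pi> * (?s \<pi> - ?g \<pi> * P)) = (\<Sum>\<pi>\<in>?S. ?g \<pi> * ?s \<pi> - P)"
      by (intro sum.cong refl) (simp add: right_diff_distrib gg flip: mult.assoc)
    also have "\<dots> = (\<Sum>\<pi>\<in>?S. ?g \<pi> * ?s \<pi>) - of_nat (fact n) * P"
      by (simp add: sum_subtractf card)
    finally have "cst (1 / fact n) * (\<Sum>\<pi>\<in>?S. ?g \<pi> * (?s \<pi> - ?g \<pi> * P)) = Q - cst (1 / fact n) * (of_nat (fact n) * P)"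
      by (simp only: Q_def right_diff_distrib)
    moreover have "of_nat (fact n) = cst (fact n)"
      using \<kappa>_simps(7)[of "fact n"] by (simp flip: single_of_nat)
    then have "cst (1 / fact n) * (of_nat (fact n) * P) = P"
      by (simp only: cst_mult) (simp add: \<kappa>_simps)
    ultimately show ?thesis by simp
  qed
  then have "Q - P \<in> D n ` lpolys n"
    using skew by (auto intro!: Dsc Dsum)
  moreover have "Q \<in> Sk n"
  proof (rule SkI)
    show "Q \<in> lpolys n"
      unfolding Q_def by (intro lpolys_mult lpolys_const lpolys_sum lsubst_perm_lpolys[OF _ P]) auto
    fix i j and \<phi> :: "nat \<Rightarrow> 'f" assume ij: "i < j" "j < n"
    let ?t = "Transposition.transpose i j"
    have t: "?t permutes {..<n}" using ij by (intro permutes_swap_id) auto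
    have sg: "sign (?t \<circ> \<pi>) = - sign \<pi>" if "\<pi> permutes {..<n}" for \<pi>
      using ij sign_compose[OF permutation_swap_id permutes_imp_permutation[OF finite_lessThan that], of i j]
      by (simp add: sign_swap_id)
    have "(\<Sum>\<pi>\<in>?S. \<kappa> (of_int (sign \<pi>)) * ev (\<lambda>k. \<phi> (\<pi> k)) P) =
      (\<Sum>\<pi>\<in>?S. \<kappa> (of_int (sign (?t \<circ> \<pi>))) * ev (\<lambda>k. \<phi> ((?t \<circ> \<pi>) k)) P)"
      by (rule setum_permutations_compose_left[OF t])
    also have "\<dots> = - (\<Sum>\<pi>\<in>?S. \<kappa> (of_int (sign \<pi>)) * ev (\<lambda>k. (\<phi> \<circ> ?t) (\<pi> k)) P)"
      by (simp add: sg \<kappa>_simps sum_negf)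
    finally show "ev (\<phi> \<circ> ?t) Q = - ev \<phi> Q"
      by (simp add: Q_def ev_simps ev_const ev_perm comp_def)
  qed
  ultimately show ?thesis by blast
qed

text \<open>The list of n copies of L is invariant under permutations, so the value there is
  skewsymmetric modulo D and can be antisymmetrised. The other values follow by replacing the copies
  of L one at a time from the left.\<close>

lemma C_presented:
  assumes Y: "Y \<in> carrier (C n)"
  shows "\<exists>P\<in>Sk n. Y = Phi M X n P"
proof -
  have Yc: "Y \<in> lc_cochains R M n" using Y C_sub by blast
  let ?L = "replicate n L"
  obtain P0 where P0: "P0 \<in> lpolys n" "Y ?L = lcoset M n P0" using lc_cochains_value[OF Yc, of ?L] by auto
  have "lsubst sc (\<lambda>k. lam (\<pi> k)) P0 - cst (of_int (sign \<pi>)) * P0 \<in> D n ` lpolys n" if \<pi>: "\<pi> permutes {..<n}" for \<pi>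
  proof -
    let ?s = "lsubst sc (\<lambda>k. lam (\<pi> k))"
    have "\<pi> i < n" if "i < n" for i using permutes_in_image[OF \<pi>, of i] that by simp
    then have "permute_list \<pi> ?L = ?L"
      by (intro nth_equalityI) (simp_all add: permute_list_def)
    moreover have "length ?L = n \<and> \<pi> permutes {..<n} \<longrightarrow>
        lcoset M n (lsubst (scl M) (\<lambda>k. lam (\<pi> k)) (rep (Y (permute_list \<pi> ?L)))) =
        of_int (sign \<pi>) \<odot>\<^bsub>lquot M n\<^esub> Y ?L"
      using Yc unfolding lc_cochains_def by blast
    ultimately have "lcoset M n (?s (rep (Y ?L))) = of_int (sign \<pi>) \<odot>\<^bsub>lquot M n\<^esub> Y ?L"
      using \<pi> by (simp add: scl_M)
    moreover obtain q where q: "q \<in> lpolys n" "rep (lcoset M n P0) = P0 + D n q" using rep_lcoset[OF P0(1)] by blast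
    have "lcoset M n (?s (P0 + D n q)) = lcoset M n (?s P0)"
      by (rule lcoset_eqI[of _ _ _ "?s q"])
        (simp_all add: lsubst_perm_lpolys[OF \<pi>] lpolys_add lpolys_D P0 q lsubst_perm_add lsubst_perm_D[OF \<pi>])
    ultimately have "lcoset M n (?s P0) = lcoset M n (cst (of_int (sign \<pi>)) * P0)"
      by (simp add: P0 q(2) lcoset_smult)
    then show ?thesis
      using lcoset_eq_iff[OF lsubst_perm_lpolys[OF \<pi> P0(1)] lpolys_mult[OF lpolys_const P0(1)]] by simp
  qed
  from antisymmetrise[OF P0(1) this] obtain P where P: "P \<in> Sk n" "P - P0 \<in> D n ` lpolys n" by blast
  have YL: "Y ?L = lcoset M n P"
    using lcoset_eq_iff[OF Sk_lpolys[OF P(1)] P0(1)] P(2) P0(2) by simp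
  have "Y (take k as @ replicate (n - k) L) = lcoset M n (fill X as P {..<k})" if "length as = n" "k \<le> n" for as k
    using that(2)
  proof (induction k)
    case 0
    then show ?case using YL by (simp add: fill_empty)
  next
    case (Suc k)
    let ?b = "take k as @ replicate (n - k) L"
    have b: "?b[k := L] = ?b" "?b[k := as ! k] = take (Suc k) as @ replicate (n - Suc k) L"
    proof -
      have "replicate (n - k) L = L # replicate (n - Suc k) L"
        using Suc.prems by (metis Suc_diff_Suc Suc_le_lessD replicate_Suc)
      then show "?b[k := L] = ?b" "?b[k := as ! k] = take (Suc k) as @ replicate (n - Suc k) L"
        using Suc.prems that by (simp_all add: list_update_append take_Suc_conv_app_nth)
    qed
    have "Y (?b[k := as ! k]) = lcoset M n (X k (as ! k) (fill X as P {..<k}))"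
    proof (rule C_slot[OF Y])
      show "length ?b = n" using Suc.prems that by simp
      show "fill X as P {..<k} \<in> lpolys n" using Suc.prems by (intro fill_lpolys Sk_lpolys[OF P(1)]) auto
      show "Y (?b[k := L]) = lcoset M n (fill X as P {..<k})" using Suc by (simp only: b(1))
    qed (use Suc.prems in auto)
    then show ?case
      using fill_insert[of "{..<k}" k as P] by (simp only: b(2) lessThan_Suc finite_lessThan) simp
  qed
  from this[of _ n] have "Y as = Phi M X n P as" if "length as = n" for as
    using that by (simp add: Phi_apply)
  moreover have "Y as = Phi M X n P as" if "length as \<noteq> n" for as
    using that Yc by (simp add: Phi_def lc_cochains_def PiE_def extensional_def)
  ultimately have "Y = Phi M X n P" by blast
  then show ?thesis using P by blast
qed

end

section \<open>The differential of a cochain presented by a polynomial\<close>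

context slots
begin

definition B :: "'f \<Rightarrow> 'r \<Rightarrow> 'm \<Rightarrow> 'm" where "B x a m = poly (act M a m) (\<kappa> x)"

definition acM :: "'f \<times> 'r \<Rightarrow> 'm \<Rightarrow> 'm" where "acM x m = B (fst x) (snd x) m"

definition Zf :: "nat \<Rightarrow> 'm lpoly \<Rightarrow> ('f \<times> 'r) list \<Rightarrow> 'm"
  where "Zf n P xs = (if length xs = n then ev (lst (map fst xs)) (fill X (map snd xs) P {..<n}) else 0)"

lemma B_add: "B x a (m + m') = B x a m + B x a m'"
  by (simp add: B_def act_add)

lemma B_scale: "B x a (\<kappa> y * m) = \<kappa> y * B x a m"
  unfolding B_def act_scale by (rule poly_map_poly_additive) (simp_all add: additive_def algebra_simps)

lemma B_der: "B x a (dr m) = \<kappa> x * B x a m + dr (B x a m)"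
  unfolding B_def by (rule act_der)

lemma ev_lact_M: "ev \<phi> (lact M a q p) = B (evF \<phi> q) a (ev \<phi> p)"
  unfolding B_def by (rule ev_lact[OF scl_M act_add act_scale])

text \<open>The body of \<open>lc_diff\<close> with an arbitrary choice \<rho> of representatives,
  so that the effect of changing the representatives by D can be computed.\<close>

definition lterm :: "nat \<Rightarrow> ('r list \<Rightarrow> 'm lpoly) \<Rightarrow> 'r list \<Rightarrow> 'm lpoly"
  where "lterm n \<rho> as =
    (\<Sum>i\<le>n. lmult (scl M) ((-1) ^ (n + i + 1))
        (lact M (as ! i) (lam i)
          (lsubst (scl M) (\<lambda>k. lam (omit n {i} ! k)) (\<rho> (map ((!) as) (omit n {i})))))) +
     (\<Sum>j\<le>n. \<Sum>i<j. \<Sum>k\<le>degree (act R (as ! i) (as ! j)).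
        lmult (scl M) ((-1) ^ (n + i + j + 1) * lam i ^ k)
          (lsubst (scl M)
            (\<lambda>l. case l of 0 \<Rightarrow> lam i + lam j | Suc l' \<Rightarrow> lam (omit n {i, j} ! l'))
            (\<rho> (coeff (act R (as ! i) (as ! j)) k # map ((!) as) (omit n {i, j})))))"

lemma lc_diff_lterm:
  "lc_diff R M n Y = (\<lambda>as\<in>{as. length as = Suc n}. lcoset M (Suc n) (lterm n (\<lambda>bs. rep (Y bs)) as))"
  unfolding lc_diff_def lterm_def ..

lemma ev_lterm: "ev \<phi> (lterm n \<rho> as) =
    (\<Sum>i\<le>n. \<kappa> ((-1) ^ (n + i + 1)) * B (\<phi> i) (as ! i)
      (ev (\<lambda>k. \<phi> (omit n {i} ! k)) (\<rho> (map ((!) as) (omit n {i}))))) +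
    (\<Sum>j\<le>n. \<Sum>i<j. \<Sum>k\<le>degree (act R (as ! i) (as ! j)). \<kappa> ((-1) ^ (n + i + j + 1) * \<phi> i ^ k) *
      ev (case_nat (\<phi> i + \<phi> j) (\<lambda>l. \<phi> (omit n {i, j} ! l)))
        (\<rho> (coeff (act R (as ! i) (as ! j)) k # map ((!) as) (omit n {i, j}))))"
proof -
  have c: "(\<lambda>l. evF \<phi> (case l of 0 \<Rightarrow> lam i + lam j | Suc l' \<Rightarrow> lam (omit n {i, j} ! l'))) =
    case_nat (\<phi> i + \<phi> j) (\<lambda>l. \<phi> (omit n {i, j} ! l))" for i j
    by (rule ext) (simp add: evF_simps evF_lam split: nat.split)
  have s: "evF \<phi> (- 1) = - 1"
    by (simp only: rhomD[OF rhom_evF])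
  show ?thesis
    unfolding lterm_def
    by (simp only: scl_M rhomD[OF rhom_ev] rhom_sum[OF rhom_ev] ev_lmult ev_lact_M ev_lsubst s evF_lam c
        rhomD(4)[OF rhom_evF] rhom_power[OF rhom_evF])
qed

lemma lterm_add: "lterm n (\<lambda>bs. \<rho> bs + \<sigma> bs) as = lterm n \<rho> as + lterm n \<sigma> as"
  by (rule ev_eqI) (simp only: ev_lterm rhomD(3)[OF rhom_ev] B_add distrib_left sum.distrib add_ac)

lemma omit_nth_le: "i \<le> n \<Longrightarrow> k < n \<Longrightarrow> omit n {i} ! k < Suc n"
  "i < j \<Longrightarrow> j \<le> n \<Longrightarrow> k < n - 1 \<Longrightarrow> omit n {i, j} ! k < Suc n"
  using nth_mem[of k "omit n {i}"] nth_mem[of k "omit n {i, j}"] length_omit[of i n] length_omit(2)[of i j n]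
  by (auto simp: omit_def simp del: upt_Suc)

lemma lterm_lpolys:
  assumes "\<And>bs. length bs = n \<Longrightarrow> \<rho> bs \<in> lpolys n" "length as = Suc n"
  shows "lterm n \<rho> as \<in> lpolys (Suc n)"
proof (rule mem_lpolysI)
  fix \<phi> \<psi> :: "nat \<Rightarrow> 'f"
  assume *: "\<And>k. k < Suc n \<Longrightarrow> \<phi> k = \<psi> k"
  have 1: "ev (\<lambda>k. \<phi> (omit n {i} ! k)) (\<rho> (map ((!) as) (omit n {i}))) =
      ev (\<lambda>k. \<psi> (omit n {i} ! k)) (\<rho> (map ((!) as) (omit n {i})))" "\<phi> i = \<psi> i" if "i \<le> n" for i
    using that by (intro ev_lpolys_cong[OF assms(1)] *; simp add: length_omit omit_nth_le)+
  have 2: "ev (case_nat (\<phi> i + \<phi> j) (\<lambda>l. \<phi> (omit n {i, j} ! l))) (\<rho> (c # map ((!) as) (omit n {i, j}))) =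
      ev (case_nat (\<psi> i + \<psi> j) (\<lambda>l. \<psi> (omit n {i, j} ! l))) (\<rho> (c # map ((!) as) (omit n {i, j})))"
    if "i < j" "j \<le> n" for i j c
    using that by (intro ev_lpolys_cong[OF assms(1)])
      (auto simp: length_omit * omit_nth_le split: nat.split)
  have e2: "\<kappa> (s * \<phi> i ^ k) * ev (case_nat (\<phi> i + \<phi> j) (\<lambda>l. \<phi> (omit n {i, j} ! l))) (\<rho> (c # map ((!) as) (omit n {i, j}))) =
      \<kappa> (s * \<psi> i ^ k) * ev (case_nat (\<psi> i + \<psi> j) (\<lambda>l. \<psi> (omit n {i, j} ! l))) (\<rho> (c # map ((!) as) (omit n {i, j})))"
    if "i < j" "j \<le> n" for i j c s k
    using 2[OF that, of c] * that by simp
  show "ev \<phi> (lterm n \<rho> as) = ev \<psi> (lterm n \<rho> as)"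
    unfolding ev_lterm by (intro arg_cong2[of _ _ _ _ "(+)"] sum.cong refl) (simp only: 1 atMost_iff, rule e2, simp_all)
qed

text \<open>Every term conserves the total of the variables: acting by a at \<lambda>_i adds
  \<lambda>_i to the remaining sum by sesquilinearity, and a bracket puts \<lambda>_i + \<lambda>_j
  into one slot.\<close>

lemma lterm_D:
  assumes "length as = Suc n"
  shows "lterm n (\<lambda>bs. D n (q bs)) as = D (Suc n) (lterm n q as)"
proof (rule ev_eqI)
  fix \<phi> :: "nat \<Rightarrow> 'f"
  let ?S = "\<Sum>k<Suc n. \<phi> k"
  define \<delta> where "\<delta> m = dr m + \<kappa> ?S * m" for m
  have add: "additive \<delta>"
    by (simp add: additive_def \<delta>_def der_add distrib_left del: sum.lessThan_Suc)
  have sc: "\<delta> (\<kappa> x * m) = \<kappa> x * \<delta> m" for x m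
    by (simp add: \<delta>_def der_scale distrib_left mult.left_commute del: sum.lessThan_Suc)
  have 1: "B (\<phi> i) a (ev (\<lambda>k. \<phi> (omit n {i} ! k)) (D n p)) = \<delta> (B (\<phi> i) a (ev (\<lambda>k. \<phi> (omit n {i} ! k)) p))"
    if "i \<le> n" for i a p
  proof -
    let ?m = "ev (\<lambda>k. \<phi> (omit n {i} ! k)) p" let ?s = "\<Sum>k<n. \<phi> (omit n {i} ! k)"
    have "B (\<phi> i) a (dr ?m + \<kappa> ?s * ?m) = dr (B (\<phi> i) a ?m) + \<kappa> (\<phi> i + ?s) * B (\<phi> i) a ?m"
      by (simp only: B_add B_der B_scale \<kappa>_simps distrib_right add_ac)
    then show ?thesis unfolding \<delta>_def ev_D sum_omit(1)[OF that] .
  qed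
  have 2: "ev (case_nat (\<phi> i + \<phi> j) (\<lambda>l. \<phi> (omit n {i, j} ! l))) (D n p) =
      \<delta> (ev (case_nat (\<phi> i + \<phi> j) (\<lambda>l. \<phi> (omit n {i, j} ! l))) p)" if ij: "i < j" "j \<le> n" for i j p
  proof -
    obtain m where m: "n = Suc m" using ij by (cases n) auto
    have "(\<Sum>l<n. case_nat (\<phi> i + \<phi> j) (\<lambda>l. \<phi> (omit n {i, j} ! l)) l) = \<phi> i + \<phi> j + (\<Sum>l<n - 1. \<phi> (omit n {i, j} ! l))"
      unfolding m by (simp only: sum.lessThan_Suc_shift nat.case diff_Suc_1)
    then show ?thesis unfolding \<delta>_def ev_D sum_omit(2)[OF ij] by (simp only:)
  qed
  have "ev \<phi> (lterm n (\<lambda>bs. D n (q bs)) as) = \<delta> (ev \<phi> (lterm n q as))"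
    unfolding ev_lterm additive.add[OF add] additive.sum[OF add] sc
    by (intro arg_cong2[of _ _ _ _ "(+)"] sum.cong refl) (simp_all only: 1 2 atMost_iff lessThan_iff)
  then show "ev \<phi> (lterm n (\<lambda>bs. D n (q bs)) as) = ev \<phi> (D (Suc n) (lterm n q as))"
    by (simp only: \<delta>_def ev_D)
qed

lemma Zf_alternating:
  assumes P: "P \<in> Sk n"
  shows "alternating (Zf n P)"
  unfolding alternating_def
proof (intro allI)
  fix us vs :: "('f \<times> 'r) list" and x y :: "'f \<times> 'r"
  let ?a = "us @ x # y # vs" and ?b = "us @ y # x # vs"
  show "Zf n P ?a = - Zf n P ?b"
  proof (cases "length ?a = n")
    case True
    let ?i = "length us" let ?t = "Transposition.transpose ?i (Suc ?i)"
    have t: "?t permutes {..<n}" using True by (intro permutes_swap_id) auto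
    have l: "lst (map fst ?a) = lst (map fst ?b) \<circ> ?t"
      by (rule ext) (auto simp: lst_def Transposition.transpose_def nth_append nth_Cons split: nat.split)
    have p: "permute_list ?t (map snd ?b) = map snd ?a"
      using True permute_list_nth[of ?t "map snd ?b"] t
      by (intro nth_equalityI) (auto simp: Transposition.transpose_def nth_append nth_Cons split: nat.split)
    have "ev (lst (map fst ?b) \<circ> ?t) (fill X (permute_list ?t (map snd ?b)) P {..<n}) =
      ev (lst (map fst ?b)) (fill X (map snd ?b) (cst (of_int (sign ?t)) * P) {..<n})"
    proof -
      have "ev (lst (map fst ?b) \<circ> ?t) q = ev (lst (map fst ?b)) (lsubst sc (\<lambda>k. lam (?t k)) q)" for q
        by (simp only: ev_perm comp_def)
      moreover have "length (map snd ?b) = n" using True by simp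
      ultimately show ?thesis by (simp only: fill_perm[OF t] Sk_perm[OF P t])
    qed
    also have "\<dots> = - ev (lst (map fst ?b)) (fill X (map snd ?b) P {..<n})"
      by (simp only: fill_cst[OF finite_lessThan] sign_swap_id) (simp add: ev_simps ev_const \<kappa>_simps)
    finally show ?thesis
      unfolding l[symmetric] p using True by (simp add: Zf_def)
  qed (simp add: Zf_def)
qed

lemma fill_replicate: "fill X (replicate n L) P {..<n} = P"
  by (rule fill_L) auto

lemma X_sum_arg: "X i (\<Sum>k\<in>I. scl R (x k) (a k)) p = (\<Sum>k\<in>I. cst (x k) * X i (a k) p)"
proof -
  have "X i 0 p = 0" using X_add_arg[of i 0 0 p] by (simp only: add_0_left add_cancel_right_right)
  then show ?thesis
    by (induction I rule: infinite_finite_induct) (simp_all add: X_add_arg X_scl_arg)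
qed

text \<open>The two sums agree term by term up to (-1)^(n+1). In \<open>lc_diff\<close> the bracket
  is expanded in powers of \<lambda>_i; linearity of \<open>X 0\<close> in its entry gathers the
  expansion into the value of the bracket at the point.\<close>

lemma ev_lterm_fill:
  assumes P: "P \<in> Sk n" and as: "length as = Suc n"
  shows "ev \<phi> (lterm n (\<lambda>bs. fill X bs P {..<n}) as) =
    \<kappa> ((- 1) ^ (n + 1)) * ced (brR R) acM (Zf n P) (zip (map \<phi> [0..<Suc n]) as)"
proof -
  let ?xs = "zip (map \<phi> [0..<Suc n]) as"
  have len: "length ?xs = Suc n" using as by simp
  have nth: "?xs ! k = (\<phi> k, as ! k)" if "k < Suc n" for k
    using that as by (simp del: upt_Suc)
  have F: "fill X bs P {..<n} \<in> lpolys n" for bs by (rule fill_lpolys[OF _ Sk_lpolys[OF P]]) auto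
  have mp: "map f (map ((!) ?xs) (omit n I)) = map (\<lambda>k. f (\<phi> k, as ! k)) (omit n I)" for f :: "'f \<times> 'r \<Rightarrow> 'c" and I
    by (auto simp: omit_def nth simp del: upt_Suc)
  have 1: "Zf n P (del i ?xs) = ev (\<lambda>k. \<phi> (omit n {i} ! k)) (fill X (map ((!) as) (omit n {i})) P {..<n})"
    if "i \<le> n" for i
  proof -
    have "ev (lst (map \<phi> (omit n {i}))) (fill X (map ((!) as) (omit n {i})) P {..<n}) =
      ev (\<lambda>k. \<phi> (omit n {i} ! k)) (fill X (map ((!) as) (omit n {i})) P {..<n})"
      by (rule ev_lpolys_cong[OF F]) (simp add: lst_map length_omit that)
    then show ?thesis
      unfolding map_nth_omit_single[OF that len, symmetric] Zf_def mp by (simp add: length_omit that)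
  qed
  have 2: "Zf n P (brR R (?xs ! i) (?xs ! j) # del i (del j ?xs)) =
    (\<Sum>k\<le>degree (act R (as ! i) (as ! j)). \<kappa> (\<phi> i ^ k) * ev (case_nat (\<phi> i + \<phi> j) (\<lambda>l. \<phi> (omit n {i, j} ! l)))
        (fill X (coeff (act R (as ! i) (as ! j)) k # map ((!) as) (omit n {i, j})) P {..<n}))" if ij: "i < j" "j \<le> n" for i j
  proof -
    let ?cs = "map ((!) as) (omit n {i, j})" let ?d = "degree (act R (as ! i) (as ! j))"
    let ?c = "coeff (act R (as ! i) (as ! j))"
    let ?\<psi> = "case_nat (\<phi> i + \<phi> j) (\<lambda>l. \<phi> (omit n {i, j} ! l))"
    have n0: "0 < n" using ij by simp
    have lc: "length (a # ?cs) = n" for a using ij by (simp add: length_omit)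
    have br: "brR R (?xs ! i) (?xs ! j) = (\<phi> i + \<phi> j, \<Sum>k\<le>?d. scl R (\<phi> i ^ k) (?c k))"
      using ij nth[of i] nth[of j] by (simp add: brR_def del: nth_zip upt_Suc)
    have fr: "fill X (a # ?cs) P {..<n} = X 0 a (fill X (0 # ?cs) P ({..<n} - {0}))" for a
      using fill_remove[OF n0 lc[of 0], of a P] by simp
    have "ev (lst ((\<phi> i + \<phi> j) # map \<phi> (omit n {i, j}))) (fill X (a # ?cs) P {..<n}) = ev ?\<psi> (fill X (a # ?cs) P {..<n})" for a
    proof (rule ev_lpolys_cong[OF F])
      fix k assume "k < n"
      then show "lst ((\<phi> i + \<phi> j) # map \<phi> (omit n {i, j})) k = ?\<psi> k"
        using ij by (cases k) (auto simp: lst_def length_omit)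
    qed
    then have "Zf n P (brR R (?xs ! i) (?xs ! j) # map ((!) ?xs) (omit n {i, j})) =
        ev ?\<psi> (fill X ((\<Sum>k\<le>?d. scl R (\<phi> i ^ k) (?c k)) # ?cs) P {..<n})"
      unfolding Zf_def br list.map mp fst_conv snd_conv using lc by simp
    also have "\<dots> = (\<Sum>k\<le>?d. \<kappa> (\<phi> i ^ k) * ev ?\<psi> (fill X (?c k # ?cs) P {..<n}))"
      by (simp only: fr X_sum_arg rhom_sum[OF rhom_ev] rhomD(4)[OF rhom_ev] ev_const)
    finally show ?thesis
      unfolding map_nth_omit_pair[OF ij len] .
  qed
  have sg: "\<kappa> ((- 1) ^ m) = (- 1) ^ m" for m by (simp only: rhom_power[OF \<kappa>] \<kappa>_simps)
  have "ced (brR R) acM (Zf n P) ?xs = (\<Sum>i\<le>n. (- 1) ^ i * acM (?xs ! i) (Zf n P (del i ?xs))) +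
    (\<Sum>j\<le>n. \<Sum>i<j. (- 1) ^ (i + j) * Zf n P (brR R (?xs ! i) (?xs ! j) # del i (del j ?xs)))"
    unfolding ced_expand_alternating[OF Zf_alternating[OF P]] len lessThan_Suc_atMost ..
  also have "\<dots> = (\<Sum>i\<le>n. (- 1) ^ i * B (\<phi> i) (as ! i) (ev (\<lambda>k. \<phi> (omit n {i} ! k)) (fill X (map ((!) as) (omit n {i})) P {..<n}))) +
    (\<Sum>j\<le>n. \<Sum>i<j. (- 1) ^ (i + j) * (\<Sum>k\<le>degree (act R (as ! i) (as ! j)). \<kappa> (\<phi> i ^ k) * ev (case_nat (\<phi> i + \<phi> j) (\<lambda>l. \<phi> (omit n {i, j} ! l)))
        (fill X (coeff (act R (as ! i) (as ! j)) k # map ((!) as) (omit n {i, j})) P {..<n})))"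
  proof (intro arg_cong2[of _ _ _ _ "(+)"] sum.cong refl arg_cong2[of _ _ _ _ "(*)"])
    fix i assume "i \<in> {..n}"
    then show "acM (?xs ! i) (Zf n P (del i ?xs)) = B (\<phi> i) (as ! i) (ev (\<lambda>k. \<phi> (omit n {i} ! k)) (fill X (map ((!) as) (omit n {i})) P {..<n}))"
      using nth[of i] 1[of i] by (simp add: acM_def del: nth_zip upt_Suc)
  next
    fix i j assume "j \<in> {..n}" "i \<in> {..<j}"
    then show "Zf n P (brR R (?xs ! i) (?xs ! j) # del i (del j ?xs)) = (\<Sum>k\<le>degree (act R (as ! i) (as ! j)). \<kappa> (\<phi> i ^ k) * ev (case_nat (\<phi> i + \<phi> j) (\<lambda>l. \<phi> (omit n {i, j} ! l)))
        (fill X (coeff (act R (as ! i) (as ! j)) k # map ((!) as) (omit n {i, j})) P {..<n}))"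
      by (intro 2) auto
  qed
  finally have e: "ced (brR R) acM (Zf n P) ?xs = \<dots>" .
  have r: "n + i + 1 = (n + 1) + i" "n + i + j + 1 = (n + 1) + (i + j)" for i j by simp_all
  show ?thesis
    unfolding e ev_lterm distrib_left sum_distrib_left r power_add[of _ "n + 1"] \<kappa>_simps(4) sg mult.assoc ..
qed

end

text \<open>What remains is that d of a filled cochain is the filling of \<open>dW n P\<close>. The
  LCA obtains it by mapping its arguments to pairs of \<open>br_vir\<close>, the PVA by uniqueness
  of functions that are slot maps in every argument.\<close>

locale slots_complex = slots \<kappa> dr ell w M R L X C
  for \<kappa> :: "'f::field_char_0 \<Rightarrow> 'm::idom" and dr ell w
    and M :: "('f, 'r::ab_group_add, 'm) conf_module" and R :: "('f, 'r) conf_alg" and L X C +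
  assumes ced_fill: "P \<in> Sk n \<Longrightarrow> length xs = Suc n \<Longrightarrow> ced (brR R) acM (Zf n P) xs = Zf (Suc n) (dW n P) xs"
begin

text \<open>The unknown summand D q of each chosen representative is carried by
  \<open>lterm_D\<close> into the image of D and drops out.\<close>

lemma lc_diff_Phi:
  assumes P: "P \<in> Sk n"
  shows "lc_diff R M n (Phi M X n P) = Phi M X (Suc n) (cst ((- 1) ^ (n + 1)) * dW n P)"
proof -
  let ?F = "\<lambda>bs. fill X bs P {..<n}"
  have F: "?F bs \<in> lpolys n" for bs by (rule fill_lpolys[OF _ Sk_lpolys[OF P]]) auto
  then have "\<forall>bs. \<exists>q\<in>lpolys n. rep (lcoset M n (?F bs)) = ?F bs + D n q" using rep_lcoset by blast
  then obtain q where q: "\<And>bs. q bs \<in> lpolys n" "\<And>bs. rep (lcoset M n (?F bs)) = ?F bs + D n (q bs)" by metis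
  have "lcoset M (Suc n) (lterm n (\<lambda>bs. rep (Phi M X n P bs)) as) =
    lcoset M (Suc n) (fill X as (cst ((- 1) ^ (n + 1)) * dW n P) {..<Suc n})" if as: "length as = Suc n" for as
  proof -
    have "lterm n (\<lambda>bs. rep (Phi M X n P bs)) as = lterm n (\<lambda>bs. ?F bs + D n (q bs)) as"
      unfolding lterm_def
      by (intro arg_cong2[of _ _ _ _ "(+)"] sum.cong refl)
        (simp_all add: Phi_apply q(2) length_omit)
    also have "\<dots> = lterm n ?F as + D (Suc n) (lterm n q as)"
      by (simp only: lterm_add lterm_D[OF as])
    finally have 1: "lterm n (\<lambda>bs. rep (Phi M X n P bs)) as = lterm n ?F as + D (Suc n) (lterm n q as)" .
    have 2: "lterm n ?F as = fill X as (cst ((- 1) ^ (n + 1)) * dW n P) {..<Suc n}"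
    proof (rule ev_eqI)
      fix \<phi> :: "nat \<Rightarrow> 'f"
      have "Zf (Suc n) (dW n P) (zip (map \<phi> [0..<Suc n]) as) = ev \<phi> (fill X as (dW n P) {..<Suc n})"
      proof -
        have "ev (lst (map \<phi> [0..<Suc n])) (fill X as (dW n P) {..<Suc n}) = ev \<phi> (fill X as (dW n P) {..<Suc n})"
          by (rule ev_lpolys_cong[OF fill_lpolys[OF order_refl Sk_lpolys[OF Sk_dW[OF P]]]])
            (simp add: lst_map del: upt_Suc)
        then show ?thesis using as by (simp add: Zf_def del: upt_Suc)
      qed
      then show "ev \<phi> (lterm n ?F as) = ev \<phi> (fill X as (cst ((- 1) ^ (n + 1)) * dW n P) {..<Suc n})"
        using ced_fill[OF P, of "zip (map \<phi> [0..<Suc n]) as"] as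
        by (simp add: ev_lterm_fill[OF P as] fill_cst ev_simps ev_const del: upt_Suc)
    qed
    show ?thesis
      unfolding 1 2[symmetric]
      by (rule lcoset_eqI[OF _ _ _ refl]) (auto intro!: lpolys_add lpolys_D lterm_lpolys F q as)
  qed
  then show ?thesis
    unfolding lc_diff_lterm Phi_def by (intro restrict_ext) auto
qed

lemma Phi_C:
  assumes P: "P \<in> Sk n"
  shows "Phi M X n P \<in> carrier (C n)"
proof (rule C_mem[OF Phi_lc_cochains[OF P]])
  fix as :: "'r list" and i
  assume as: "length as = n" "i < n"
  show "\<exists>q\<in>lpolys n. \<forall>a. Phi M X n P (as[i := a]) = lcoset M n (X i a q)"
    by (intro bexI[of _ "fill X as P ({..<n} - {i})"] allI fill_lpolys Sk_lpolys[OF P])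
      (auto simp: Phi_apply as fill_remove)
qed

sublocale presentation \<kappa> dr ell w C "lc_diff R M" "Phi M X"
proof
  fix n
  show "carrier (C n) = Phi M X n ` Sk n"
    using C_presented Phi_C by blast
  have F: "fill X as P {..<n} \<in> lpolys n" if "P \<in> Sk n" for as P
    by (rule fill_lpolys[OF _ Sk_lpolys[OF that]]) auto
  show "\<zero>\<^bsub>C n\<^esub> = Phi M X n 0"
  proof -
    have "fill X as 0 {..<n} = 0" for as using fill_cst[of "{..<n}" as 0 0] by (simp add: \<kappa>_simps)
    then show ?thesis by (simp add: C_zero lc_complex_def Phi_def lcoset_zero)
  qed
  fix P assume P: "P \<in> Sk n"
  show "x \<odot>\<^bsub>C n\<^esub> Phi M X n P = Phi M X n (cst x * P)" for x
    unfolding C_smult lc_complex_def Phi_def using F[OF P]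
    by (simp add: lcoset_smult fill_cst cong: restrict_cong)
  show "lc_diff R M n (Phi M X n P) = Phi M X (Suc n) (cst ((- 1) ^ (n + 1)) * dW n P)"
    by (rule lc_diff_Phi[OF P])
  fix Q assume Q: "Q \<in> Sk n"
  show "Phi M X n P \<oplus>\<^bsub>C n\<^esub> Phi M X n Q = Phi M X n (P + Q)"
    unfolding C_add lc_complex_def Phi_def using F[OF P] F[OF Q]
    by (simp add: lcoset_add fill_add cong: restrict_cong)
  show "Phi M X n P = Phi M X n Q \<longleftrightarrow> P - Q \<in> D n ` lpolys n"
  proof
    assume "Phi M X n P = Phi M X n Q"
    then have "Phi M X n P (replicate n L) = Phi M X n Q (replicate n L)" by simp
    then show "P - Q \<in> D n ` lpolys n"
      using lcoset_eq_iff[OF Sk_lpolys[OF P] Sk_lpolys[OF Q]] by (simp add: Phi_apply fill_replicate)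
  next
    assume "P - Q \<in> D n ` lpolys n"
    then obtain r where r: "r \<in> lpolys n" "P = Q + D n r" by (auto simp: algebra_simps)
    have "lcoset M n (fill X as P {..<n}) = lcoset M n (fill X as Q {..<n})" for as
    proof (rule lcoset_eqI[of _ _ _ "fill X as r {..<n}"])
      show "fill X as P {..<n} = fill X as Q {..<n} + D n (fill X as r {..<n})"
        unfolding r(2) by (simp add: fill_add fill_D)
    qed (simp_all add: F P Q fill_lpolys r(1))
    then show "Phi M X n P = Phi M X n Q" by (simp add: Phi_def)
  qed
qed

text \<open>A prescribed value such as \<lambda>_1^3 is not skewsymmetric, so it is only congruent
  modulo D to the polynomial P that presents the cochain.\<close>

lemma determined:
  assumes P: "P \<in> Sk n" and p: "p \<in> lpolys n" "p - P \<in> D n ` lpolys n"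
  shows "determined_cochain (C n) (replicate n L) (lcoset M n p) (Phi M X n P)"
proof -
  have v: "Phi M X n Q (replicate n L) = lcoset M n Q" for Q by (simp add: Phi_apply fill_replicate)
  have e: "lcoset M n p = lcoset M n P" using lcoset_eq_iff[OF p(1) Sk_lpolys[OF P]] p(2) by simp
  show ?thesis
    unfolding determined_cochain_def
  proof (intro conjI ballI impI)
    show "Phi M X n P \<in> carrier (C n)" using P carrier_C by blast
    show "Phi M X n P (replicate n L) = lcoset M n p" by (simp add: v e)
    fix Z assume Z: "Z \<in> carrier (C n)" "Z (replicate n L) = lcoset M n p"
    then obtain Q where Q: "Q \<in> Sk n" "Z = Phi M X n Q" using carrier_C by blast
    then have "lcoset M n Q = lcoset M n P" using Z(2) by (simp add: v e)
    then show "Z = Phi M X n P"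
      using lcoset_eq_iff[OF Sk_lpolys[OF Q(1)] Sk_lpolys[OF P]] \<Phi>_eq_iff[OF Q(1) P] Q(2) by simp
  qed
qed

lemma cohomology_generators:
  "\<exists>Y0 Y2 Y3.
    determined_cochain (C 0) [] (lcoset M 0 1) Y0 \<and>
    determined_cochain (C 2) [L, L] (lcoset M 2 (lam 0 ^ 3)) Y2 \<and>
    determined_cochain (C 3) [L, L, L] (lcoset M 3 ((lam 0 - lam 1) * (lam 0 - lam 2) * (lam 1 - lam 2))) Y3 \<and>
    is_line_on (cohomology C (lc_diff R M) 0) (coh_class C (lc_diff R M) 0 Y0) \<and>
    is_line_on (cohomology C (lc_diff R M) 2) (coh_class C (lc_diff R M) 2 Y2) \<and>
    is_line_on (cohomology C (lc_diff R M) 3) (coh_class C (lc_diff R M) 3 Y3)"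
proof (intro exI conjI)
  have S: "cst x * yP n \<in> Sk n" for x n by (rule Sk_const_mult[OF Sk_yP])
  have D0: "0 \<in> D n ` lpolys n" for n using D_0[of n] lpolys_0 by (metis image_eqI)
  have d: "determined_cochain (C n) (replicate n L) (lcoset M n (cst 1 * yP n)) (Phi M X n (cst 1 * yP n))" for n
    by (rule determined[OF S Sk_lpolys[OF S]]) (simp add: D0)
  have y: "cst 1 * yP 0 = 1" "cst 1 * yP 3 = (lam 0 - lam 1) * (lam 0 - lam 2) * (lam 1 - lam 2)"
    by (simp_all add: yP_def vd_def \<kappa>_simps)
  show "is_line_on (cohomology C (lc_diff R M) 0) (coh_class C (lc_diff R M) 0 (Phi M X 0 (cst 1 * yP 0)))"
    "is_line_on (cohomology C (lc_diff R M) 2) (coh_class C (lc_diff R M) 2 (Phi M X 2 (cst (1 / 2) * yP 2)))"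
    "is_line_on (cohomology C (lc_diff R M) 3) (coh_class C (lc_diff R M) 3 (Phi M X 3 (cst 1 * yP 3)))"
    by (rule cohomology_line; simp)+
  show "determined_cochain (C 0) [] (lcoset M 0 1) (Phi M X 0 (cst 1 * yP 0))"
    using d[of 0] by (simp add: y)
  show "determined_cochain (C 3) [L, L, L] (lcoset M 3 ((lam 0 - lam 1) * (lam 0 - lam 2) * (lam 1 - lam 2)))
      (Phi M X 3 (cst 1 * yP 3))"
    using d[of 3] unfolding y by (simp add: numeral_3_eq_3)
  have y2: "yP 2 = lam 0 ^ 3 - lam 1 ^ 3" by (simp add: yP_def c2_def)
  \<comment> \<open>Half the cofactor of \<lambda>_0 + \<lambda>_1 in \<lambda>_0^3 + \<lambda>_1^3,
    because \<lambda>_0^3 - (\<lambda>_0^3 - \<lambda>_1^3)/2 is half of that sum of cubes.\<close>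
  let ?q = "cst (1 / 2) * (lam 0 ^ 2 - lam 0 * lam 1 + lam 1 ^ 2)"
  have q: "?q \<in> lpolys 2"
    by (intro lpolys_mult lpolys_const lpolys_add lpolys_diff lpolys_power lpolys_lam) simp_all
  have "lam 0 ^ 3 - cst (1 / 2) * yP 2 = D 2 ?q"
  proof (rule ev_eqI)
    fix \<phi> :: "nat \<Rightarrow> 'f"
    have e: "ev \<phi> ?q = \<kappa> (1 / 2 * (\<phi> 0 ^ 2 - \<phi> 0 * \<phi> 1 + \<phi> 1 ^ 2))"
      by (simp only: ev_simps ev_lam ev_const \<kappa>_simps)
    have "ev \<phi> (D 2 ?q) = \<kappa> ((\<phi> 0 + \<phi> 1) * (1 / 2 * (\<phi> 0 ^ 2 - \<phi> 0 * \<phi> 1 + \<phi> 1 ^ 2)))"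
    proof -
      have "(\<Sum>i<2. \<phi> i) = \<phi> 0 + \<phi> 1" by (simp add: lessThan_Suc eval_nat_numeral add.commute)
      then show ?thesis unfolding ev_D e der_\<kappa> by (simp only: \<kappa>_simps(4) add_0_left)
    qed
    also have "(\<phi> 0 + \<phi> 1) * (1 / 2 * (\<phi> 0 ^ 2 - \<phi> 0 * \<phi> 1 + \<phi> 1 ^ 2)) = \<phi> 0 ^ 3 - 1 / 2 * (\<phi> 0 ^ 3 - \<phi> 1 ^ 3)"
      by (simp add: field_simps power2_eq_square power3_eq_cube)
    also have "\<kappa> \<dots> = ev \<phi> (lam 0 ^ 3 - cst (1 / 2) * yP 2)"
      by (simp only: y2 ev_simps ev_lam ev_const \<kappa>_simps)
    finally show "ev \<phi> (lam 0 ^ 3 - cst (1 / 2) * yP 2) = ev \<phi> (D 2 ?q)" by (rule sym)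
  qed
  then have "lam 0 ^ 3 - cst (1 / 2) * yP 2 \<in> D 2 ` lpolys 2" using q by blast
  moreover have "(lam 0 ^ 3 :: 'm lpoly) \<in> lpolys 2" by (intro lpolys_power lpolys_lam) simp
  ultimately show "determined_cochain (C 2) [L, L] (lcoset M 2 (lam 0 ^ 3)) (Phi M X 2 (cst (1 / 2) * yP 2))"
    using determined[OF S, of "lam 0 ^ 3" 2 "1 / 2"] by (simp add: numeral_2_eq_2)
qed

end

section \<open>The Virasoro LCA with trivial coefficients\<close>

text \<open>Sesquilinearity makes the entry f(\<partial>)L in slot i act as multiplication by
  f(-\<lambda>_i).\<close>

definition Xlc :: "nat \<Rightarrow> 'f::field_char_0 poly \<Rightarrow> 'f lpoly \<Rightarrow> 'f lpoly"
  where "Xlc i f p = leval (*) f (- lam i) * p"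

text \<open>The trivial module sits entirely in weight 0, where L acts by zero.\<close>

interpretation LC: lmod "\<lambda>x :: 'f::field_char_0. x" "\<lambda>_. 0" "\<lambda>_. 0" "\<lambda>k m. if k = 0 then m else 0" triv
proof (unfold_locales, goal_cases)
  case (13 m)
  then show ?case by (intro exI[of _ 1]) auto
qed (auto simp: rhom_id triv_def fun_eq_iff)

lemma LC_ev_X: "LC.ev \<phi> (Xlc i f p) = poly f (- \<phi> i) * LC.ev \<phi> p"
  by (simp add: Xlc_def LC.ev_simps LC.ev_leval LC.evF_simps LC.evF_lam)

text \<open>The explicit bracket with \<lambda> = x and then \<partial> = y. In a slot with
  coordinate z the relevant value is y = -z.\<close>

lemma poly_rvir_act:
  "poly (\<Sum>k\<le>degree (act rvir f g). Polynomial.smult (x ^ k) (coeff (act rvir f g) k)) y =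
    poly f (- x) * poly g (x + y) * (y + 2 * x)"
proof -
  have a: "(\<Sum>k\<le>degree P. Polynomial.smult (x ^ k) (coeff P k)) = poly P [:x:]" for P :: "'a poly poly"
    by (simp add: poly_altdef poly_const_pow mult.commute[of _ "[:_:]"])
  have b: "poly (poly (poly (map_poly (\<lambda>x. [:[:x:]:]) f) [:0, -1:]) [:x:]) y = poly f (- x)"
    by (induction f) (simp_all add: map_poly_pCons)
  have c: "poly (poly (poly (map_poly (\<lambda>x. [:[:x:]:]) g) [:[:0, 1:], 1:]) [:x:]) y = poly g (x + y)"
    by (induction g) (simp_all add: map_poly_pCons algebra_simps)
  have "act rvir f g = poly (map_poly (\<lambda>x. [:[:x:]:]) f) [:0, -1:] * poly (map_poly (\<lambda>x. [:[:x:]:]) g) [:[:0, 1:], 1:] *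
      [:[:0, 1:], 2:]"
    by (simp only: rvir_def conf_module.simps dmod.simps)
  moreover have "poly (poly [:[:0, 1:], 2:] [:x:]) y = y + 2 * x"
    by (simp add: numeral_poly)
  ultimately show ?thesis
    unfolding a by (simp only: poly_mult b c)
qed

interpretation LC: slots "\<lambda>x :: 'f::field_char_0. x" "\<lambda>_. 0" "\<lambda>_. 0" "\<lambda>k m. if k = 0 then m else 0" triv
  rvir 1 Xlc "lc_complex rvir triv"
proof (unfold_locales, goal_cases)
  case (1 a m m') show ?case by (simp add: triv_def)
next
  case (2 a x m) show ?case by (simp add: triv_def)
next
  case (3 a m x) show ?case by (simp add: triv_def)
next
  case (4 i a p q) show ?case by (simp add: Xlc_def distrib_left)
next
  case (5 i a x p) show ?case by (simp add: Xlc_def mult.left_commute)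
next
  case (6 i a b p) show ?case by (rule LC.ev_eqI) (simp add: LC_ev_X LC.ev_simps distrib_right)
next
  case (7 i x a p) show ?case by (rule LC.ev_eqI) (simp add: LC_ev_X LC.ev_simps LC.ev_const rvir_def mult.assoc)
next
  case (8 i a p) show ?case by (rule LC.ev_eqI) (simp add: LC_ev_X LC.ev_simps LC.ev_lam rvir_def mult.assoc)
next
  case (9 i p) show ?case by (rule LC.ev_eqI) (simp add: LC_ev_X)
next
  case (10 i n a p) show ?case by (rule LC.ev_eqI) (simp add: LC_ev_X LC.ev_D mult.left_commute)
next
  case (11 i j a b p) show ?case by (rule LC.ev_eqI) (simp add: LC_ev_X mult.left_commute)
next
  case (12 i n p a)
  show ?case
  proof (rule LC.mem_lpolysI)
    fix \<phi> \<psi> :: "nat \<Rightarrow> 'f"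
    assume "\<And>k. k < n \<Longrightarrow> \<phi> k = \<psi> k"
    then show "LC.ev \<phi> (Xlc i a p) = LC.ev \<psi> (Xlc i a p)"
      using LC.ev_lpolys_cong[OF 12(2), of \<phi> \<psi>] 12(1) by (simp add: LC_ev_X)
  qed
next
  case (13 \<pi> n i a p)
  show ?case by (rule LC.ev_eqI) (simp add: LC.ev_lsubst LC.evF_lam LC_ev_X)
next
  case (19 Y n as i p a)
  note Y = 19(1)[unfolded lc_complex_def, simplified]
  have l: "Xlc i f p \<in> lpolys n" for f
  proof (rule LC.mem_lpolysI)
    fix \<phi> \<psi> :: "nat \<Rightarrow> 'f"
    assume "\<And>k. k < n \<Longrightarrow> \<phi> k = \<psi> k"
    then show "LC.ev \<phi> (Xlc i f p) = LC.ev \<psi> (Xlc i f p)"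
      using LC.ev_lpolys_cong[OF 19(4), of \<phi> \<psi>] 19(3) by (simp add: LC_ev_X)
  qed
  show ?case
  \<comment> \<open>\<open>pCons c f\<close> is c L + \<partial>(f(\<partial>)L), so linearity and
    sesquilinearity suffice.\<close>
  proof (induction a)
    case 0
    have "Y (as[i := scl rvir 0 1]) = lcoset triv n (Poly_Mapping.single 0 0 * p)"
      by (rule LC.lc_cochains_slot(2)[OF Y 19(2,3,4,5)])
    moreover have "Xlc i 0 p = 0" by (rule LC.ev_eqI) (simp add: LC_ev_X LC.ev_simps)
    ultimately show ?case by (simp add: rvir_def)
  next
    case (pCons c f)
    have "Y (as[i := scl rvir c 1]) = lcoset triv n (Poly_Mapping.single 0 c * p)"
      by (rule LC.lc_cochains_slot(2)[OF Y 19(2,3,4,5)])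
    moreover have "Y (as[i := der rvir f]) = lcoset triv n (- (lam i * Xlc i f p))"
      by (rule LC.lc_cochains_slot(3)[OF Y 19(2,3) l pCons(2)])
    ultimately have "Y (as[i := scl rvir c 1 + der rvir f]) = lcoset triv n (Poly_Mapping.single 0 c * p + - (lam i * Xlc i f p))"
      using LC.lpolys_mult[OF LC.lpolys_const 19(4)] LC.lpolys_minus[OF LC.lpolys_mult[OF LC.lpolys_lam[OF 19(3)] l]]
      by (intro LC.lc_cochains_slot(1)[OF Y 19(2,3)]) auto
    moreover have "scl rvir c 1 + der rvir f = pCons c f" by (simp add: rvir_def one_pCons)
    moreover have "Poly_Mapping.single 0 c * p + - (lam i * Xlc i f p) = Xlc i (pCons c f) p"
      by (rule LC.ev_eqI) (simp add: LC_ev_X LC.ev_simps LC.ev_const LC.ev_lam algebra_simps)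
    ultimately show ?case by simp
  qed
qed (simp_all add: lc_complex_def)

interpretation LC: slots_complex "\<lambda>x :: 'f::field_char_0. x" "\<lambda>_. 0" "\<lambda>_. 0" "\<lambda>k m. if k = 0 then m else 0" triv
  rvir 1 Xlc "lc_complex rvir triv"
proof
  fix P :: "'f lpoly" and n and xs :: "('f \<times> 'f poly) list"
  assume P: "P \<in> LC.Sk n" and xs: "length xs = Suc n"
  \<comment> \<open>At the point x the element f(\<partial>)L is seen as f(-x) L_x.\<close>
  define g :: "'f \<times> 'f poly \<Rightarrow> 'f \<times> 'f" where "g x = (fst x, poly (snd x) (- fst x))" for x
  have fst_g: "map fst (map g ys) = map fst ys" for ys by (simp add: g_def comp_def)
  have ev_fill: "LC.ev \<phi> (fill Xlc as Q I) = (\<Prod>i\<in>I. poly (as ! i) (- \<phi> i)) * LC.ev \<phi> Q" if "finite I" for \<phi> as Q I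
    using that by (induction I) (simp_all add: LC.fill_empty LC.fill_insert LC_ev_X mult.assoc)
  have Zf: "LC.Zf m Q ys = LC.Zw m Q (map g ys)" for m Q ys
  proof (cases "length ys = m")
    case True
    have "prod_list (map snd (map g ys)) = (\<Prod>i<m. poly (map snd ys ! i) (- lst (map fst ys) i))"
      using True by (simp add: prod.list_conv_set_nth atLeast0LessThan g_def lst_map)
    then show ?thesis using True by (simp only: LC.Zf_def LC.Zw_def ev_fill finite_lessThan fst_g length_map)
  qed (simp add: LC.Zf_def LC.Zw_def)
  have br: "br_vir (g x) (g y) = g (brR rvir x y)" for x y
  proof -
    have "scl (rvir :: ('f, 'f poly) conf_alg) = Polynomial.smult" by (simp add: rvir_def)
    \<comment> \<open>With y = -(x + x') the bracket becomes f(-x) g(-x') (x - x'), the structure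
      constant of \<open>br_vir\<close>.\<close>
    then have "poly (snd (brR rvir x y)) (- (fst x + fst y)) = poly (snd x) (- fst x) * poly (snd y) (fst x + - (fst x + fst y)) * (- (fst x + fst y) + 2 * fst x)"
      by (simp only: brR_def snd_conv poly_rvir_act)
    then show ?thesis by (simp add: br_vir_def g_def brR_def)
  qed
  have "ced br_vir LC.ac (LC.Zw n P) (map g xs) = ced (brR rvir) LC.acM (\<lambda>ys. LC.Zw n P (map g ys)) xs"
  proof (rule ced_transfer)
    have "act triv a m = 0" for a :: "'f poly" and m by (simp add: triv_def)
    then show "LC.ac (g x) m = LC.acM x m" for x m
      by (simp add: LC.ac_def LC.A_def LC.acM_def LC.B_def)
  qed (simp add: br)
  then show "ced (brR rvir) LC.acM (LC.Zf n P) xs = LC.Zf (Suc n) (LC.dW n P) xs"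
    using LC.ced_Zw[OF LC.Sk_lpolys[OF P], of "map g xs"] xs by (simp add: Zf[abs_def])
qed

section \<open>Differential algebra of the Virasoro PVA\<close>

lemma lderiv_add: "lderiv i (p + q) = lderiv i p + lderiv i q"
  unfolding lderiv_def by (rule sum_keys_add) (simp add: distrib_left single_add)

lemma additive_lderiv: "additive (lderiv i)"
  by (simp add: additive_def lderiv_add)

lemma lderiv_single: "lderiv i (Poly_Mapping.single t c) =
    Poly_Mapping.single (t - Poly_Mapping.single i 1) (of_nat (Poly_Mapping.lookup t i) * c)"
  by (cases "c = 0") (simp_all add: lderiv_def)

lemma lderiv_const: "lderiv i (Poly_Mapping.single 0 c) = 0"
  by (simp add: lderiv_single)

lemma lderiv_const_mult: "lderiv i (Poly_Mapping.single 0 c * p) = Poly_Mapping.single 0 c * lderiv i p"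
  by (rule additive_lpoly_eqI[of "\<lambda>p. lderiv i (Poly_Mapping.single 0 c * p)"])
    (simp_all add: additive_def lderiv_add distrib_left mult_single lderiv_single mult.left_commute)

lemma lderiv_lam_mult: "lderiv i (lam j * p) = (if i = j then p else 0) + lam j * lderiv i p"
proof (rule additive_lpoly_eqI[of "\<lambda>p. lderiv i (lam j * p)"])
  show "additive (\<lambda>p. lderiv i (lam j * p))" "additive (\<lambda>p. (if i = j then p else 0) + lam j * lderiv i p)"
    by (simp_all add: additive_def lderiv_add distrib_left)
  fix t and c :: 'a
  let ?s = "\<lambda>k. Poly_Mapping.single k 1 :: nat \<Rightarrow>\<^sub>0 nat"
  have l: "lam j * Poly_Mapping.single u x = Poly_Mapping.single (?s j + u) x" for u and x :: 'a
    by (simp add: lam_def mult_single)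
  show "lderiv i (lam j * Poly_Mapping.single t c) =
    (if i = j then Poly_Mapping.single t c else 0) + lam j * lderiv i (Poly_Mapping.single t c)"
  proof (cases "Poly_Mapping.lookup t i = 0")
    case True
    then show ?thesis by (auto simp: l lderiv_single lookup_add lookup_single when_def)
  next
    case False
    then have "?s j + t - ?s i = ?s j + (t - ?s i)"
      by (intro poly_mapping_eqI) (auto simp: lookup_add lookup_minus lookup_single when_def)
    moreover have "?s i + t - ?s i = t" by simp
    ultimately show ?thesis
      by (auto simp: l lderiv_single lookup_add lookup_single when_def distrib_right single_add simp del: One_nat_def)
  qed
qed

lemma lderiv_mult: "lderiv i (p * q) = p * lderiv i q + q * lderiv i p"
proof (induction p rule: lpoly_induct)
  case (const c)
  show ?case by (simp add: lderiv_const_mult lderiv_const)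
next
  case (lam j p)
  have "lderiv i (lam j * p * q) = (if i = j then p * q else 0) + lam j * lderiv i (p * q)"
    using lderiv_lam_mult[of i j "p * q"] by (simp add: mult.assoc)
  then show ?case by (simp only: lam lderiv_lam_mult) (simp add: algebra_simps)
next
  case (add p p')
  then show ?case by (simp add: lderiv_add algebra_simps)
qed

lemma lderiv_power_lam: "(lderiv i ^^ Suc k) (lam i * p) = lam i * (lderiv i ^^ Suc k) p + of_nat (Suc k) * (lderiv i ^^ k) p"
proof (induction k)
  case 0
  show ?case by (simp add: lderiv_lam_mult)
next
  case (Suc k)
  have n: "lderiv i (of_nat n * q) = of_nat n * lderiv i q" for n and q :: "'a lpoly"
    using lderiv_const_mult[of i "of_nat n" q] by simp
  have "(lderiv i ^^ Suc (Suc k)) (lam i * p) = lderiv i ((lderiv i ^^ Suc k) (lam i * p))" by simp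
  also have "\<dots> = (lderiv i ^^ Suc k) p + lam i * lderiv i ((lderiv i ^^ Suc k) p) + of_nat (Suc k) * lderiv i ((lderiv i ^^ k) p)"
    unfolding Suc lderiv_add lderiv_lam_mult n by simp
  also have "lderiv i ((lderiv i ^^ k) p) = (lderiv i ^^ Suc k) p" by simp
  finally show ?case by (simp add: distrib_right)
qed

lemma lderiv_power_add: "(lderiv i ^^ k) (p + q) = (lderiv i ^^ k) p + (lderiv i ^^ k) q"
  by (induction k) (simp_all add: lderiv_add)

lemma lderiv_power_const_mult: "(lderiv i ^^ k) (Poly_Mapping.single 0 c * p) = Poly_Mapping.single 0 c * (lderiv i ^^ k) p"
  by (induction k) (simp_all add: lderiv_const_mult)

lemma lderiv_power_lam_other: "i \<noteq> j \<Longrightarrow> (lderiv i ^^ k) (lam j * p) = lam j * (lderiv i ^^ k) p"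
  by (induction k) (simp_all add: lderiv_lam_mult)

lemma lderiv_power_eq_0: "\<exists>K. \<forall>k\<ge>K. (lderiv i ^^ k) p = 0"
proof (induction p rule: lpoly_induct)
  case (const c)
  have "(lderiv i ^^ Suc k) (Poly_Mapping.single 0 c) = 0" for k
    by (induction k) (simp_all add: lderiv_const additive.zero[OF additive_lderiv])
  then show ?case by (intro exI[of _ 1]) (metis Suc_le_D One_nat_def)
next
  case (lam j p)
  then obtain K where K: "\<And>k. k \<ge> K \<Longrightarrow> (lderiv i ^^ k) p = 0" by blast
  show ?case
  proof (intro exI[of _ "Suc K"] allI impI)
    fix k assume "Suc K \<le> k"
    then obtain m where m: "k = Suc m" "K \<le> m" by (cases k) auto
    show "(lderiv i ^^ k) (lam j * p) = 0"
      using K[of m] K[of "Suc m"] m lderiv_power_lam[of m i p] lderiv_power_lam_other[of i j k p]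
      by (cases "i = j") auto
  qed
next
  case (add p q)
  then obtain K K' where "\<forall>k\<ge>K. (lderiv i ^^ k) p = 0" "\<forall>k\<ge>K'. (lderiv i ^^ k) q = 0" by blast
  then show ?case by (intro exI[of _ "max K K'"]) (simp add: lderiv_power_add)
qed

locale virpva =
  fixes c :: "'f::field_char_0" and V :: "('f, 'f vir) conf_alg"
  assumes virasoro: "is_virasoro_pva c V"
begin

abbreviation \<kappa> :: "'f \<Rightarrow> 'f vir" where "\<kappa> \<equiv> Poly_Mapping.single 0"
abbreviation dr :: "'f vir \<Rightarrow> 'f vir" where "dr \<equiv> vir_der"
abbreviation L :: "'f vir" where "L \<equiv> virL 0"

sublocale coef \<kappa>
  by (unfold_locales) (rule rhom_single_zero)

lemma scl_V: "scl V = sc" and der_V: "der V = dr" and pva: "is_pva V"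
  and act_L_L: "act V L L = [:dr L, 2 * L:] + monom (\<kappa> (c / 12)) 3"
  using virasoro by (simp_all add: is_virasoro_pva_def)

lemma lca: "is_lca V"
  and dr_mult: "dr (a * b) = dr a * b + a * dr b"
  and act_mult: "act V a (b * b') = Polynomial.smult b' (act V a b) + Polynomial.smult b (act V a b')"
  using pva by (simp_all add: is_pva_def der_V)

lemma dr_add: "dr (a + b) = dr a + dr b" and dr_scale: "dr (\<kappa> x * a) = \<kappa> x * dr a"
proof -
  have "Vector_Spaces.linear (scl V) (scl V) dr"
    using lca by (simp add: is_lca_def is_dmod_def der_V)
  then show "dr (a + b) = dr a + dr b" "dr (\<kappa> x * a) = \<kappa> x * dr a"
    by (simp_all add: Vector_Spaces.linear_iff scl_V)
qed

lemma additive_dr: "additive dr"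
  by (simp add: additive_def dr_add)

lemma conf_action: "is_conf_action V V"
  using lca by (simp add: is_lca_def)

lemma act_add_left: "act V (a + b) m = act V a m + act V b m"
  and act_add_right: "act V a (m + k) = act V a m + act V a k"
  and act_scale_left: "act V (\<kappa> x * a) m = Polynomial.smult (\<kappa> x) (act V a m)"
  and act_scale_right: "act V a (\<kappa> x * m) = Polynomial.smult (\<kappa> x) (act V a m)"
  and act_der_left: "act V (dr a) m = - pCons 0 (act V a m)"
  and act_der_right: "act V a (dr m) = pCons 0 (act V a m) + map_poly dr (act V a m)"
proof -
  have "map_poly ((*) x) p = Polynomial.smult x p" for x and p :: "'f vir poly"
    by (rule poly_eqI) (simp add: coeff_map_poly)
  then show "act V (a + b) m = act V a m + act V b m" "act V a (m + k) = act V a m + act V a k"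
    "act V (\<kappa> x * a) m = Polynomial.smult (\<kappa> x) (act V a m)" "act V a (\<kappa> x * m) = Polynomial.smult (\<kappa> x) (act V a m)"
    "act V (dr a) m = - pCons 0 (act V a m)" "act V a (dr m) = pCons 0 (act V a m) + map_poly dr (act V a m)"
    using conf_action by (simp_all add: is_conf_action_def scl_V der_V)
qed

definition Am :: "'f \<Rightarrow> 'f vir \<Rightarrow> 'f vir \<Rightarrow> 'f vir" where "Am x a m = poly (act V a m) (\<kappa> x)"

lemma Am_add_left: "Am x (a + b) m = Am x a m + Am x b m"
  and Am_add_right: "Am x a (m + k) = Am x a m + Am x a k"
  and Am_scale_left: "Am x (\<kappa> y * a) m = \<kappa> y * Am x a m"
  and Am_scale_right: "Am x a (\<kappa> y * m) = \<kappa> y * Am x a m"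
  and Am_der_left: "Am x (dr a) m = - (\<kappa> x * Am x a m)"
  unfolding Am_def act_add_left act_add_right act_scale_left act_scale_right act_der_left
  by simp_all

lemma Am_mult: "Am x a (m * k) = Am x a m * k + m * Am x a k"
  unfolding Am_def act_mult by (simp add: mult.commute)

lemma Am_der_right: "Am x a (dr m) = \<kappa> x * Am x a m + dr (Am x a m)"
proof -
  have "poly (map_poly dr p) (\<kappa> x) = dr (poly p (\<kappa> x))" for p
    by (rule poly_map_poly_additive[OF additive_dr]) (metis dr_scale mult.commute)
  then show ?thesis by (simp add: Am_def act_der_right)
qed

lemma additive_Am: "additive (Am x a)"
  by (simp add: additive_def Am_add_right)

lemma Am_sum_left: "Am x (\<Sum>k\<in>I. \<kappa> (f k) * g k) m = (\<Sum>k\<in>I. \<kappa> (f k) * Am x (g k) m)"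
proof -
  have ad: "additive (\<lambda>a. Am x a m)" by (simp add: additive_def Am_add_left)
  show ?thesis by (simp only: additive.sum[OF ad] Am_scale_left)
qed

lemma Am_altdef: "Am x a b = (\<Sum>k\<le>degree (act V a b). \<kappa> (x ^ k) * coeff (act V a b) k)"
  by (simp add: Am_def poly_altdef rhom_power[OF \<kappa>] mult.commute)

lemma ev_lact_V: "ev \<phi> (lact V a q p) = Am (evF \<phi> q) a (ev \<phi> p)"
proof -
  have "map_poly ((*) x) p = Polynomial.smult x p" for x and p :: "'f vir poly"
    by (rule poly_eqI) (simp add: coeff_map_poly)
  then show ?thesis
    unfolding Am_def by (intro ev_lact) (simp_all add: scl_V act_add_right act_scale_right)
qed

lemma Am_jacobi: "Am x a (Am y b m) - Am y b (Am x a m) = Am (x + y) (Am x a b) m"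
proof -
  define \<phi> :: "nat \<Rightarrow> 'f" where "\<phi> k = (if k = 0 then x else y)" for k
  have "lact V a (lam 0) (lact V b (lam 1) (Poly_Mapping.single 0 m)) -
      lact V b (lam 1) (lact V a (lam 0) (Poly_Mapping.single 0 m)) =
      (\<Sum>k\<le>degree (act V a b).
        lmult (scl V) (lam 0 ^ k)
          (lact V (coeff (act V a b) k) (lam 0 + lam 1) (Poly_Mapping.single 0 m)))"
    using conf_action unfolding is_conf_action_def by blast
  from arg_cong[OF this, of "ev \<phi>"] have "Am x a (Am y b m) - Am y b (Am x a m) =
      (\<Sum>k\<le>degree (act V a b). \<kappa> (x ^ k) * Am (x + y) (coeff (act V a b) k) m)"
    by (simp add: scl_V ev_simps ev_lact_V ev_lmult evF_lam evF_simps ev_const \<phi>_def)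
  then show ?thesis by (simp add: Am_altdef[of x a b] Am_sum_left)
qed

text \<open>\<open>Ep b p\<close> is \<open>(e\<^bsup>\<partial>\<partial>\<^sub>\<lambda>\<^esup> b) p\<close> for a polynomial \<open>p\<close> in \<open>\<lambda>\<close>, by recursion on \<open>p\<close>.\<close>

definition Ep :: "'f vir \<Rightarrow> 'f vir poly \<Rightarrow> 'f vir poly"
  where "Ep b p = fold_coeffs (\<lambda>v F b. [:b * v:] + pCons 0 (F b) + F (dr b)) p (\<lambda>_. 0) b"

lemma Ep_0: "Ep b 0 = 0"
  by (simp add: Ep_def)

text \<open>Commuting the operator past \<lambda> replaces b by \<partial>b; this recursion stands
  in for the exponential series.\<close>

lemma Ep_pCons: "Ep b (pCons v p) = [:b * v:] + pCons 0 (Ep b p) + Ep (dr b) p"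
proof (cases "p = 0 \<and> v = 0")
  case True
  then show ?thesis by (simp add: Ep_0)
next
  case False
  then show ?thesis by (cases "p = 0") (simp_all add: Ep_def fold_coeffs_pCons_coeff_not_0_eq fold_coeffs_pCons_not_0_0_eq)
qed

lemma Ep_add: "Ep b (p + q) = Ep b p + Ep b q"
proof (induction p arbitrary: q b)
  case (pCons v p)
  then show ?case by (cases q) (simp add: Ep_pCons distrib_left algebra_simps)
qed (simp add: Ep_0)

lemma Ep_smult: "Ep b (Polynomial.smult v p) = Polynomial.smult v (Ep b p)"
  by (induction p arbitrary: b) (simp_all add: Ep_0 Ep_pCons smult_add_right mult.left_commute)

lemma Ep_minus: "Ep b (- p) = - Ep b p"
  using Ep_smult[of b "- 1" p] by simp

lemma Ep_diff: "Ep b (p - q) = Ep b p - Ep b q"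
  using Ep_add[of b p "- q"] by (simp add: Ep_minus)

lemma dr_\<kappa>: "dr (\<kappa> x) = 0"
  by (simp add: vir_der_def)

lemma Ep_1: "Ep 1 p = p"
proof -
  have "Ep 0 p = 0" for p by (induction p) (simp_all add: Ep_0 Ep_pCons additive.zero[OF additive_dr])
  moreover have "dr 1 = 0" using dr_\<kappa>[of 1] by simp
  ultimately show ?thesis by (induction p) (simp_all add: Ep_0 Ep_pCons)
qed

lemma map_dr_add: "map_poly dr (p + q) = map_poly dr p + map_poly dr q"
  by (rule poly_eqI) (simp add: coeff_map_poly additive.zero[OF additive_dr] dr_add)

lemma map_dr_pCons: "map_poly dr (pCons v p) = pCons (dr v) (map_poly dr p)"
  by (rule map_poly_pCons) (simp add: additive.zero[OF additive_dr])

lemma map_dr_Ep: "map_poly dr (Ep b p) = Ep (dr b) p + Ep b (map_poly dr p)"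
proof (induction p arbitrary: b)
  case (pCons v p)
  show ?case
    by (simp add: Ep_pCons map_dr_add map_dr_pCons pCons dr_mult additive.zero[OF additive_dr])
qed (simp add: Ep_0)

text \<open>Multiplication by -\<lambda> - \<partial>, whose powers express the substitution in the
  skewsymmetry axiom.\<close>

definition T :: "'f vir poly \<Rightarrow> 'f vir poly" where "T P = - pCons 0 P - map_poly dr P"

text \<open>Commuting \<open>Ep b\<close> past \<lambda> and past \<partial> produces the term with
  \<partial>b twice, with opposite signs.\<close>

lemma Ep_T: "Ep b (T p) = T (Ep b p)"
  by (simp add: T_def Ep_diff Ep_minus Ep_pCons map_dr_Ep)

lemma T_add: "T (p + q) = T p + T q"
  by (simp add: T_def map_dr_add)

lemma T_pow_add: "(T ^^ k) (p + q) = (T ^^ k) p + (T ^^ k) q"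
  by (induction k) (simp_all add: T_add)

lemma Ep_T_pow: "Ep b ((T ^^ k) p) = (T ^^ k) (Ep b p)"
  by (induction k) (simp_all add: Ep_T)

text \<open>The range is any bound N on the degree, so that several brackets can be summed over one
  range.\<close>

lemma act_skew:
  assumes "degree (act V b a) \<le> N"
  shows "act V a b = - (\<Sum>k\<le>N. (T ^^ k) [:coeff (act V b a) k:])"
proof -
  have T0: "(T ^^ k) 0 = 0" for k using T_pow_add[of k 0 0] by (simp only: add_0_left add_cancel_right_right)
  have "act V a b = - (\<Sum>k\<le>degree (act V b a). (T ^^ k) [:coeff (act V b a) k:])"
  proof -
    have "(\<lambda>P. - pCons 0 P - map_poly (der V) P) = T" by (simp add: fun_eq_iff T_def der_V)
    moreover have "act V a b = - (\<Sum>k\<le>degree (act V b a).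
        ((\<lambda>P. - pCons 0 P - map_poly (der V) P) ^^ k) [:coeff (act V b a) k:])"
      using lca unfolding is_lca_def by blast
    ultimately show ?thesis by (simp only:)
  qed
  also have "(\<Sum>k\<le>degree (act V b a). (T ^^ k) [:coeff (act V b a) k:]) = (\<Sum>k\<le>N. (T ^^ k) [:coeff (act V b a) k:])"
    using assms by (intro sum.mono_neutral_left) (auto simp: coeff_eq_0 T0 not_le)
  finally show ?thesis .
qed

text \<open>The left Leibniz rule follows from the right one by skewsymmetry: on constants,
  multiplication by u is \<open>Ep u\<close>, which commutes with the powers of
  \<open>T\<close>.\<close>

lemma act_mult_left: "act V (a * b) m = Ep a (act V b m) + Ep b (act V a m)"
proof -
  define N where "N = max (degree (act V m (a * b))) (max (degree (act V m a)) (degree (act V m b)))"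
  have s: "act V (a * b) m = - (\<Sum>k\<le>N. (T ^^ k) [:coeff (act V m (a * b)) k:])"
    "act V a m = - (\<Sum>k\<le>N. (T ^^ k) [:coeff (act V m a) k:])"
    "act V b m = - (\<Sum>k\<le>N. (T ^^ k) [:coeff (act V m b) k:])"
    by (rule act_skew, simp add: N_def)+
  have Es: "Ep u (sum f I) = (\<Sum>k\<in>I. Ep u (f k))" for u f and I :: "nat set"
    by (induction I rule: infinite_finite_induct) (simp_all add: Ep_0 Ep_add)
  have E: "Ep u (- (\<Sum>k\<le>N. (T ^^ k) [:f k:])) = - (\<Sum>k\<le>N. (T ^^ k) [:u * f k:])" for u f
    by (simp add: Ep_minus Es Ep_T_pow Ep_pCons Ep_0)
  have "[:coeff (act V m (a * b)) k:] = [:a * coeff (act V m b) k:] + [:b * coeff (act V m a) k:]" for k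
    by (simp add: act_mult add.commute)
  then have "(\<Sum>k\<le>N. (T ^^ k) [:coeff (act V m (a * b)) k:]) =
    (\<Sum>k\<le>N. (T ^^ k) [:a * coeff (act V m b) k:]) + (\<Sum>k\<le>N. (T ^^ k) [:b * coeff (act V m a) k:])"
    by (simp only: T_pow_add sum.distrib)
  then show ?thesis unfolding s E by simp
qed

lemma act_1: "act V a 1 = 0" "act V 1 a = 0"
proof -
  show "act V a 1 = 0" using act_mult[of a 1 1] by (simp only: mult_1 smult_1_left add_cancel_right_right)
  show "act V 1 a = 0" using act_mult_left[of 1 1 a] by (simp only: mult_1 Ep_1 add_cancel_right_right)
qed

section \<open>The operators L_(0) and L_(1) on the Virasoro PVA\<close>

lemma dr_virL: "dr (virL k) = virL (Suc k)"
  by (simp add: vir_der_def virL_def)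

lemma virL_lam: "virL k = lam k"
  by (simp add: virL_def lam_def)

lemma vir_induct [case_names const gen add]:
  assumes "\<And>x. P (\<kappa> x)" "\<And>j a. P a \<Longrightarrow> P (virL j * a)" "\<And>a b. P a \<Longrightarrow> P b \<Longrightarrow> P (a + b)"
  shows "P (a :: 'f vir)"
  by (induction a rule: lpoly_induct) (use assms in \<open>auto simp: virL_lam\<close>)

text \<open>Both sides are derivations that commute with \<partial> and agree on L.\<close>

lemma act_L_coeff_0: "coeff (act V L m) 0 = dr m"
proof -
  have "coeff (act V L (virL j)) 0 = dr (virL j)" for j
  proof (induction j)
    case 0 show ?case by (simp add: act_L_L)
  next
    case (Suc j)
    then show ?case
      using act_der_right[of L "virL j"] by (simp add: dr_virL coeff_map_poly additive.zero[OF additive_dr])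
  qed
  moreover have "act V L (\<kappa> x) = 0" for x
    using act_scale_right[of L x 1] by (simp add: act_1)
  ultimately show ?thesis
    by (induction m rule: vir_induct) (simp_all add: dr_\<kappa> act_mult dr_mult act_add_right dr_add mult.commute)
qed

text \<open>The conformal weight: L has weight 2 and each \<partial> adds 1, so L^(k) has weight k +
  2. In particular no monomial has weight 1.\<close>

definition wt :: "(nat \<Rightarrow>\<^sub>0 nat) \<Rightarrow> nat"
  where "wt t = (\<Sum>k\<in>Poly_Mapping.keys t. (k + 2) * Poly_Mapping.lookup t k)"

lemma wt_add: "wt (s + t) = wt s + wt t"
proof -
  let ?A = "Poly_Mapping.keys s \<union> Poly_Mapping.keys t"
  have sup: "wt u = (\<Sum>k\<in>?A. (k + 2) * Poly_Mapping.lookup u k)" if "Poly_Mapping.keys u \<subseteq> ?A" for u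
    unfolding wt_def using that by (intro sum.mono_neutral_left) (auto simp: in_keys_iff)
  have "Poly_Mapping.keys (s + t) \<subseteq> ?A" using keys_add[of s t] by auto
  then show ?thesis by (simp add: sup lookup_add sum.distrib distrib_left)
qed

lemma wt_single: "wt (Poly_Mapping.single j 1) = j + 2"
  by (simp add: wt_def)

lemma wt_cases: "t = 0 \<or> 2 \<le> wt t"
proof (cases "t = 0")
  case False
  then obtain k where k: "k \<in> Poly_Mapping.keys t" by fastforce
  then have "2 \<le> (k + 2) * Poly_Mapping.lookup t k" by (cases "Poly_Mapping.lookup t k") (auto simp: in_keys_iff)
  also have "\<dots> \<le> wt t" unfolding wt_def using k by (intro member_le_sum) auto
  finally show ?thesis by simp
qed simp

lemma wt_0: "wt 0 = 0"
  by (simp add: wt_def)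

definition Hw :: "'f vir \<Rightarrow> 'f vir" where "Hw = wmap (\<lambda>t. (*) (of_nat (wt t)))"

lemma lookup_Hw: "Poly_Mapping.lookup (Hw m) t = of_nat (wt t) * Poly_Mapping.lookup m t"
  unfolding Hw_def by (rule lookup_wmap[OF additive_mult_left])

lemma additive_Hw: "additive Hw"
  unfolding Hw_def by (rule additive_wmap[OF additive_mult_left])

lemma Hw_single: "Hw (Poly_Mapping.single t x) = Poly_Mapping.single t (of_nat (wt t) * x)"
  unfolding Hw_def by (rule wmap_single[OF additive_mult_left])

text \<open>Both sides are derivations. On L^(j), sesquilinearity gives L_(1) \<partial> = L_(0) +
  \<partial> L_(1), so each derivative adds one to the eigenvalue 2 of L.\<close>

lemma act_L_coeff_1: "coeff (act V L m) 1 = Hw m"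
proof -
  have g: "coeff (act V L (virL j)) 1 = of_nat (j + 2) * virL j" for j
  proof (induction j)
    case 0 show ?case by (simp add: act_L_L coeff_pCons)
  next
    case (Suc j)
    have d: "dr (of_nat k * a) = of_nat k * dr a" for k a
      using dr_scale[of "of_nat k" a] by simp
    have "coeff (act V L (virL (Suc j))) 1 = coeff (act V L (virL j)) 0 + dr (coeff (act V L (virL j)) 1)"
      unfolding act_der_right[of L "virL j", unfolded dr_virL]
      by (simp add: coeff_map_poly additive.zero[OF additive_dr] coeff_pCons)
    also have "\<dots> = virL (Suc j) + of_nat (j + 2) * virL (Suc j)"
      by (simp only: Suc act_L_coeff_0 d dr_virL)
    finally show ?case by (simp add: distrib_right)
  qed
  have "act V L (\<kappa> x) = 0" for x
    using act_scale_right[of L x 1] by (simp add: act_1)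
  moreover have "Hw (virL j * m) = of_nat (j + 2) * (virL j * m) + virL j * Hw m" for j m
  proof (rule additive_lpoly_eqI[of "\<lambda>m. Hw (virL j * m)"])
    show "additive (\<lambda>m. Hw (virL j * m))" "additive (\<lambda>m. of_nat (j + 2) * (virL j * m) + virL j * Hw m)"
      by (simp_all add: additive_def distrib_left additive.add[OF additive_Hw])
    fix t and x :: 'f
    have sn: "of_nat n * Poly_Mapping.single u x = Poly_Mapping.single u (of_nat n * x)" for n and u :: "nat \<Rightarrow>\<^sub>0 nat"
      using mult_single[of 0 "of_nat n" u x] by simp
    show "Hw (virL j * Poly_Mapping.single t x) =
      of_nat (j + 2) * (virL j * Poly_Mapping.single t x) + virL j * Hw (Poly_Mapping.single t x)"
      unfolding virL_def by (simp only: mult_single Hw_single wt_add wt_single sn mult_1)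
        (simp only: single_add[symmetric] of_nat_add distrib_right)
  qed
  ultimately show ?thesis
    by (induction m rule: vir_induct)
      (simp_all add: Hw_single wt_0 act_mult act_add_right additive.add[OF additive_Hw] g[unfolded One_nat_def] algebra_simps)
qed

definition w :: "nat \<Rightarrow> 'f vir \<Rightarrow> 'f vir"
  where "w k = wmap (\<lambda>t x. if wt t = k then x else 0)"

lemma lookup_w: "Poly_Mapping.lookup (w k m) t = (if wt t = k then Poly_Mapping.lookup m t else 0)"
  unfolding w_def by (rule lookup_wmap) (simp add: additive_def)

lemma Am_L_L: "Am x L L = dr L + \<kappa> (2 * x) * L + \<kappa> (c / 12 * x ^ 3) * 1"
proof -
  have 1: "\<kappa> (2 * x) = 2 * \<kappa> x" using rhomD(4)[OF \<kappa>, of 2 x] by simp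
  have 2: "\<kappa> (c / 12 * x ^ 3) = \<kappa> (c / 12) * \<kappa> x ^ 3"
    by (simp only: rhomD(4)[OF \<kappa>] rhom_power[OF \<kappa>])
  show ?thesis
    unfolding Am_def act_L_L 1 2 by (simp add: poly_monom)
qed

sublocale lmod \<kappa> dr "act V L" w V
proof (unfold_locales, goal_cases)
  case (5 m y x)
  \<comment> \<open>\<partial>L acts as -(x + y) times L, and the central term, a scalar, acts by
    zero; the factor left is 2x - (x + y) = x - y.\<close>
  have "Am (x + y) (Am x L L) m = - (\<kappa> (x + y) * Am (x + y) L m) + \<kappa> (2 * x) * Am (x + y) L m"
    unfolding Am_L_L Am_add_left Am_scale_left Am_der_left by (simp add: Am_def act_1)
  also have "\<dots> = \<kappa> (x - y) * Am (x + y) L m"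
  proof -
    have "- \<kappa> (x + y) + \<kappa> (2 * x) = \<kappa> (x - y)"
      by (simp flip: \<kappa>_simps add: single_uminus[symmetric] single_add[symmetric])
    then show ?thesis by (metis distrib_right mult_minus_left)
  qed
  finally show ?case using Am_jacobi[of x L y L m] by (simp only: Am_def)
next
  case (6 m x) show ?case using Am_der_right[of x L m] by (simp only: Am_def)
next
  case (9 k m m')
  show ?case by (rule poly_mapping_eqI) (simp add: lookup_w lookup_add)
next
  case (10 k m)
  have "of_nat k * a = \<kappa> (of_nat k) * a" for a :: "'f vir" by simp
  then show ?case
    unfolding act_L_coeff_1 by (intro poly_mapping_eqI) (simp only: lookup_w lookup_Hw lookup_const_mult, simp)
next
  case (11 k m)
  have "of_nat k * a = \<kappa> (of_nat k) * a" for a :: "'f vir" by simp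
  then show ?case
    unfolding act_L_coeff_1 by (intro poly_mapping_eqI) (simp only: lookup_w lookup_Hw lookup_const_mult, simp)
next
  case (12 m)
  define B where "B = Suc (\<Sum>t\<in>Poly_Mapping.keys m. wt t)"
  have B: "wt t < B" if "t \<in> Poly_Mapping.keys m" for t
    unfolding B_def less_Suc_eq_le using that by (intro member_le_sum) auto
  show ?case
  proof (intro exI[of _ B] conjI allI impI)
    show "m = (\<Sum>k<B. w k m)"
      using B by (intro poly_mapping_eqI) (auto simp: lookup_sum lookup_w in_keys_iff)
    show "w k m = 0" if "B \<le> k" for k
      using B that by (intro poly_mapping_eqI) (fastforce simp: lookup_w in_keys_iff)
  qed
next
  case (13 m)
  then have z: "of_nat (wt t) * Poly_Mapping.lookup m t = 0" for t
    using lookup_Hw[of m t] unfolding act_L_coeff_1 by simp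
  have "m = \<kappa> (Poly_Mapping.lookup m 0)"
  proof (rule poly_mapping_eqI)
    fix t
    show "Poly_Mapping.lookup m t = Poly_Mapping.lookup (\<kappa> (Poly_Mapping.lookup m 0)) t"
      using z[of t] wt_cases[of t] by (auto simp: lookup_single when_def)
  qed
  then show ?case by blast
next
  case (14 m)
  show ?case
  proof (rule poly_mapping_eqI)
    fix t
    have "of_nat (wt t) * Poly_Mapping.lookup m t = of_nat 1 * Poly_Mapping.lookup m t"
      using lookup_Hw[of m t] 14 unfolding act_L_coeff_1 by simp
    then have "wt t = 1 \<or> Poly_Mapping.lookup m t = 0" by (simp only: mult_cancel_right of_nat_eq_iff) blast
    then show "Poly_Mapping.lookup m t = Poly_Mapping.lookup 0 t"
      using wt_cases[of t] wt_0 by auto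
  qed
qed (simp_all add: dr_add dr_scale act_add_right act_scale_right act_L_coeff_0 act_1 scl_V der_V)

end

section \<open>The exponential operators of the Leibniz rule in several variables\<close>

context virpva
begin

abbreviation E :: "nat \<Rightarrow> 'f vir \<Rightarrow> 'f vir lpoly \<Rightarrow> 'f vir lpoly" where "E \<equiv> exp_mult V"

lemma E_sum:
  assumes "\<And>k. N \<le> k \<Longrightarrow> (lderiv i ^^ k) p = 0"
  shows "E i b p = (\<Sum>k<N. Poly_Mapping.single 0 (\<kappa> (1 / fact k) * (dr ^^ k) b) * (lderiv i ^^ k) p)"
proof -
  have t: "Poly_Mapping.map (scl V (1 / fact k)) (Poly_Mapping.single 0 ((der V ^^ k) b) * (lderiv i ^^ k) p) =
    Poly_Mapping.single 0 (\<kappa> (1 / fact k) * (dr ^^ k) b) * (lderiv i ^^ k) p" for k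
    by (simp add: scl_V der_V mult_map_scale_conv_mult mult_single flip: mult.assoc)
  show ?thesis
    unfolding exp_mult_def t
    by (rule Sum_any.expand_superset) (use assms in \<open>auto simp: not_less[symmetric]\<close>)
qed

lemma E_add: "E i b (p + q) = E i b p + E i b q"
proof -
  obtain K K' where "\<And>k. K \<le> k \<Longrightarrow> (lderiv i ^^ k) p = 0" "\<And>k. K' \<le> k \<Longrightarrow> (lderiv i ^^ k) q = 0"
    using lderiv_power_eq_0 by metis
  then have "E i b r = (\<Sum>k<max K K'. Poly_Mapping.single 0 (\<kappa> (1 / fact k) * (dr ^^ k) b) * (lderiv i ^^ k) r)"
    if "r \<in> {p, q, p + q}" for r
    using that by (intro E_sum) (auto simp: lderiv_power_add)
  then show ?thesis by (simp add: lderiv_power_add distrib_left sum.distrib)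
qed

lemma additive_E: "additive (E i b)"
  by (simp add: additive_def E_add)

lemma E_const_mult: "E i b (Poly_Mapping.single 0 v * p) = Poly_Mapping.single 0 v * E i b p"
proof -
  obtain K where "\<And>k. K \<le> k \<Longrightarrow> (lderiv i ^^ k) p = 0"
    using lderiv_power_eq_0 by metis
  then have "E i b r = (\<Sum>k<K. Poly_Mapping.single 0 (\<kappa> (1 / fact k) * (dr ^^ k) b) * (lderiv i ^^ k) r)"
    if "r \<in> {p, Poly_Mapping.single 0 v * p}" for r
    using that by (intro E_sum) (auto simp: lderiv_power_const_mult)
  then show ?thesis by (simp add: lderiv_power_const_mult sum_distrib_left mult.left_commute)
qed

lemma E_lam_other:
  assumes "i \<noteq> j"
  shows "E i b (lam j * p) = lam j * E i b p"
proof -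
  obtain K where "\<And>k. K \<le> k \<Longrightarrow> (lderiv i ^^ k) p = 0"
    using lderiv_power_eq_0 by metis
  then have "E i b r = (\<Sum>k<K. Poly_Mapping.single 0 (\<kappa> (1 / fact k) * (dr ^^ k) b) * (lderiv i ^^ k) r)"
    if "r \<in> {p, lam j * p}" for r
    using that by (intro E_sum) (auto simp: lderiv_power_lam_other[OF assms])
  then show ?thesis by (simp add: lderiv_power_lam_other[OF assms] sum_distrib_left mult.left_commute)
qed

text \<open>The k-th derivative of \<lambda>p yields k times the derivative of order k - 1, and k/k!
  = 1/(k-1)! shifts the series. With the rules for constants and for other variables, this reduces
  properties of \<open>E\<close> to induction on polynomials.\<close>

lemma E_lam: "E i b (lam i * p) = lam i * E i b p + E i (dr b) p"
proof -
  obtain K where K: "\<And>k. K \<le> k \<Longrightarrow> (lderiv i ^^ k) p = 0"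
    using lderiv_power_eq_0 by metis
  define a where "a k b = (Poly_Mapping.single 0 (\<kappa> (1 / fact k) * (dr ^^ k) b) :: 'f vir lpoly)" for k b
  have K': "(lderiv i ^^ k) (lam i * p) = 0" if "Suc K \<le> k" for k
  proof -
    obtain m where m: "k = Suc m" "K \<le> m" using \<open>Suc K \<le> k\<close> by (cases k) auto
    show ?thesis unfolding m(1) lderiv_power_lam using K[of m] K[of "Suc m"] m(2) by simp
  qed
  have n: "a (Suc k) b * of_nat (Suc k) = a k (dr b)" for k
  proof -
    have o: "(of_nat m :: 'f vir lpoly) = Poly_Mapping.single 0 (\<kappa> (of_nat m))" for m by (simp only: single_of_nat)
    have "a (Suc k) b * of_nat (Suc k) = Poly_Mapping.single 0 (\<kappa> (1 / fact (Suc k)) * \<kappa> (of_nat (Suc k)) * (dr ^^ Suc k) b)"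
      unfolding a_def o by (simp only: mult_single add_0_left mult_ac)
    also have "\<kappa> (1 / fact (Suc k)) * \<kappa> (of_nat (Suc k)) = \<kappa> (1 / fact k)"
      unfolding \<kappa>_simps(4)[symmetric] by (simp del: of_nat_Suc)
    finally show ?thesis unfolding a_def by (simp only: funpow_Suc_right comp_apply)
  qed
  have "E i b (lam i * p) = (\<Sum>k<Suc K. a k b * (lderiv i ^^ k) (lam i * p))"
    unfolding a_def by (rule E_sum[OF K'])
  also have "\<dots> = a 0 b * (lam i * p) + (\<Sum>k<K. a (Suc k) b * (lderiv i ^^ Suc k) (lam i * p))"
    unfolding sum.lessThan_Suc_shift by simp
  also have "\<dots> = lam i * (a 0 b * p + (\<Sum>k<K. a (Suc k) b * (lderiv i ^^ Suc k) p)) + (\<Sum>k<K. a k (dr b) * (lderiv i ^^ k) p)"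
    unfolding lderiv_power_lam n[symmetric] by (simp only: distrib_left sum.distrib sum_distrib_left mult_ac add_ac)
  also have "a 0 b * p + (\<Sum>k<K. a (Suc k) b * (lderiv i ^^ Suc k) p) = (\<Sum>k<Suc K. a k b * (lderiv i ^^ k) p)"
    unfolding sum.lessThan_Suc_shift by simp
  also have "\<dots> = E i b p" unfolding a_def by (rule E_sum[symmetric], rule K) simp
  also have "(\<Sum>k<K. a k (dr b) * (lderiv i ^^ k) p) = E i (dr b) p" unfolding a_def by (rule E_sum[symmetric, OF K])
  finally show ?thesis .
qed

lemma E_const: "E i b (Poly_Mapping.single 0 v) = Poly_Mapping.single 0 (b * v)"
proof -
  have "(lderiv i ^^ k) (Poly_Mapping.single 0 v) = 0" if "1 \<le> k" for k
    using that by (induction k) (auto simp: le_Suc_eq lderiv_const additive.zero[OF additive_lderiv])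
  from E_sum[OF this, where b = b] show ?thesis by (simp add: mult_single)
qed

lemma E_lam_if: "E i b (lam j * p) = lam j * E i b p + (if j = i then E i (dr b) p else 0)"
  by (simp add: E_lam E_lam_other)

lemma E_add_arg: "E i (a + b) p = E i a p + E i b p"
  by (induction p arbitrary: a b rule: lpoly_induct)
    (simp_all add: E_const E_lam_if E_add distrib_right single_add distrib_left dr_add add_ac)

lemma additive_E_arg: "additive (\<lambda>b. E i b p)"
  by (simp add: additive_def E_add_arg)

lemma E_0_arg: "E i 0 p = 0" and E_0: "E i b 0 = 0"
  using additive.zero[OF additive_E_arg] additive.zero[OF additive_E] by auto

lemma E_mult: "E i (a * b) p = E i a (E i b p)"
  by (induction p arbitrary: a b rule: lpoly_induct)
    (simp_all add: E_const E_lam_if E_add distrib_left dr_mult E_add_arg E_0 mult.assoc add_ac)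

lemma E_\<kappa>: "E i (\<kappa> x) p = cst x * p"
  by (induction p rule: lpoly_induct)
    (simp_all add: E_const E_lam_if E_add distrib_left dr_\<kappa> E_0_arg mult_single mult.left_commute)

lemma E_1: "E i 1 p = p"
  using E_\<kappa>[of i 1 p] by simp

lemma E_comm: "i \<noteq> j \<Longrightarrow> E i a (E j b p) = E j b (E i a p)"
  by (induction p arbitrary: a b rule: lpoly_induct) (simp_all add: E_const E_lam_if E_add E_0 mult.left_commute)

text \<open>Commuting past \<partial> and past \<lambda>_i produces terms with \<partial>b of
  opposite sign; i < n ensures that \<lambda>_i is one of the summands of D.\<close>

lemma E_D:
  assumes i: "i < n"
  shows "E i b (D n p) = D n (E i b p)"
proof (induction p arbitrary: b rule: lpoly_induct)
  case (const v)
  have D: "D n (Poly_Mapping.single 0 u) = Poly_Mapping.single 0 (dr u) + (\<Sum>j<n. lam j * Poly_Mapping.single 0 u)" for u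
    by (rule ev_eqI) (simp add: ev_D ev_simps ev_const ev_lam rhom_sum[OF \<kappa>] sum_distrib_right)
  have "E i b (\<Sum>j<n. lam j * Poly_Mapping.single 0 v) =
      (\<Sum>j<n. lam j * Poly_Mapping.single 0 (b * v) + (if j = i then Poly_Mapping.single 0 (dr b * v) else 0))"
    unfolding additive.sum[OF additive_E] E_lam_if E_const ..
  also have "\<dots> = (\<Sum>j<n. lam j * Poly_Mapping.single 0 (b * v)) + Poly_Mapping.single 0 (dr b * v)"
    using i by (simp add: sum.distrib)
  finally show ?case
    by (simp add: D E_add E_const dr_mult single_add)
next
  case (lam j p)
  then show ?case by (simp add: E_lam_if D_lam[symmetric] D_add D_0)
next
  case (add p q)
  then show ?case by (simp add: E_add D_add)
qed

lemma E_lpolys: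
  assumes "p \<in> lpolys n" "i < n"
  shows "E i b p \<in> lpolys n"
  using assms(1)
proof (induction p arbitrary: b rule: lpolys_induct)
  case (lam j p)
  then show ?case
    by (auto simp: E_lam_if intro!: lpolys_add lpolys_mult lpolys_lam lpolys_0)
qed (simp_all add: E_const E_add lpolys_const lpolys_add)

lemma E_perm:
  assumes "\<pi> permutes S"
  shows "lsubst sc (\<lambda>k. lam (\<pi> k)) (E i b p) = E (\<pi> i) b (lsubst sc (\<lambda>k. lam (\<pi> k)) p)"
proof -
  let ?s = "lsubst sc (\<lambda>k. lam (\<pi> k))"
  have s: "?s (p + q) = ?s p + ?s q" "?s (lam j * p) = lam (\<pi> j) * ?s p"
      "?s (Poly_Mapping.single 0 v) = Poly_Mapping.single 0 v" "?s 0 = 0" for p q j v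
    by (rule ev_eqI; simp add: ev_lsubst evF_lam ev_simps ev_lam ev_const)+
  have "\<pi> j = \<pi> i \<longleftrightarrow> j = i" for j using permutes_inj[OF assms] by (auto dest: injD)
  then show ?thesis
    by (induction p arbitrary: b rule: lpoly_induct) (simp_all add: s E_const E_lam_if E_add E_0)
qed

subsection \<open>Filling a slot by the Leibniz rule\<close>

definition Xv :: "nat \<Rightarrow> 'f vir \<Rightarrow> 'f vir lpoly \<Rightarrow> 'f vir lpoly"
  where "Xv i a p = Sum_any (\<lambda>k. E i (lderiv k a) ((- lam i) ^ k * p))"

lemma lderiv_lpolys: "a \<in> lpolys n \<Longrightarrow> n \<le> k \<Longrightarrow> lderiv k a = 0"
  by (induction a rule: lpolys_induct) (simp_all add: lderiv_const lderiv_lam_mult lderiv_add)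

lemma lderiv_bound: obtains N where "\<And>k. N \<le> k \<Longrightarrow> lderiv k a = (0 :: 'f vir)"
  using mem_lpolys[of a] lderiv_lpolys by blast

lemma lderiv_bound2: obtains N where "\<And>k. N \<le> k \<Longrightarrow> lderiv k a = (0 :: 'f vir)" "\<And>k. N \<le> k \<Longrightarrow> lderiv k b = (0 :: 'f vir)"
proof -
  obtain K K' where "\<And>k. K \<le> k \<Longrightarrow> lderiv k a = 0" "\<And>k. K' \<le> k \<Longrightarrow> lderiv k b = 0"
    using lderiv_bound by metis
  then show thesis by (intro that[of "max K K'"]) auto
qed

lemma Xv_sum:
  assumes "\<And>k. N \<le> k \<Longrightarrow> lderiv k a = 0"
  shows "Xv i a p = (\<Sum>k<N. E i (lderiv k a) ((- lam i) ^ k * p))"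
proof -
  have "E i (lderiv k a) ((- lam i) ^ k * p) = 0" if "N \<le> k" for k using assms[OF that] by (simp add: E_0_arg)
  then have "{k. E i (lderiv k a) ((- lam i) ^ k * p) \<noteq> 0} \<subseteq> {..<N}" by (auto simp: not_le[symmetric])
  then show ?thesis unfolding Xv_def by (rule Sum_any.expand_superset[OF finite_lessThan])
qed

lemma Xv_add: "Xv i a (p + q) = Xv i a p + Xv i a q"
proof -
  obtain N where N: "\<And>k. N \<le> k \<Longrightarrow> lderiv k a = 0" by (rule lderiv_bound[of a]) blast
  show ?thesis by (simp add: Xv_sum[OF N] distrib_left E_add sum.distrib)
qed

lemma Xv_cst: "Xv i a (cst x * p) = cst x * Xv i a p"
proof -
  obtain N where N: "\<And>k. N \<le> k \<Longrightarrow> lderiv k a = 0" by (rule lderiv_bound[of a]) blast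
  show ?thesis by (simp only: Xv_sum[OF N] mult.left_commute[of _ "cst x"] E_const_mult sum_distrib_left)
qed

lemma Xv_add_arg: "Xv i (a + b) p = Xv i a p + Xv i b p"
proof -
  obtain N where N: "\<And>k. N \<le> k \<Longrightarrow> lderiv k a = 0" "\<And>k. N \<le> k \<Longrightarrow> lderiv k b = 0" by (rule lderiv_bound2) blast
  then have "\<And>k. N \<le> k \<Longrightarrow> lderiv k (a + b) = 0" by (simp add: lderiv_add)
  from Xv_sum[OF this] Xv_sum[OF N(1)] Xv_sum[OF N(2)] show ?thesis
    by (simp only: lderiv_add E_add_arg sum.distrib)
qed

lemma Xv_mult: "Xv i (a * b) p = E i a (Xv i b p) + E i b (Xv i a p)"
proof -
  obtain N where N: "\<And>k. N \<le> k \<Longrightarrow> lderiv k a = 0" "\<And>k. N \<le> k \<Longrightarrow> lderiv k b = 0" by (rule lderiv_bound2) blast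
  then have "\<And>k. N \<le> k \<Longrightarrow> lderiv k (a * b) = 0" by (simp add: lderiv_mult)
  from Xv_sum[OF this] Xv_sum[OF N(1)] Xv_sum[OF N(2)] show ?thesis
    by (simp only: lderiv_mult E_add_arg E_mult sum.distrib additive.sum[OF additive_E])
qed

lemma Xv_\<kappa>: "Xv i (\<kappa> x) p = 0"
  using Xv_sum[of 0 "\<kappa> x"] lderiv_const[of _ x] by simp

lemma Xv_scl_arg: "Xv i (\<kappa> x * a) p = cst x * Xv i a p"
  by (simp add: Xv_mult Xv_\<kappa> E_0 E_\<kappa>)

text \<open>The commutator of the partial derivative by L^(k) with \<partial> is the partial
  derivative by L^(k-1), because \<partial> sends L^(k-1) to L^(k).\<close>

lemma lderiv_dr: "lderiv k (dr a) = dr (lderiv k a) + (case k of 0 \<Rightarrow> 0 | Suc m \<Rightarrow> lderiv m a)"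
proof (induction a rule: vir_induct)
  case (const x)
  show ?case by (simp add: dr_\<kappa> lderiv_const additive.zero[OF additive_dr] additive.zero[OF additive_lderiv] split: nat.split)
next
  case (gen j a)
  have L: "lderiv k (virL j :: 'f vir) = (if k = j then 1 else 0)" for k j
    using lderiv_lam_mult[of k j "1 :: 'f vir"] lderiv_const[of k "1 :: 'f"] by (simp add: virL_lam)
  have "dr 1 = 0" using dr_\<kappa>[of 1] by simp
  then have d: "dr (if P then 1 else 0) = 0" for P by (simp add: additive.zero[OF additive_dr])
  show ?case
    using gen by (cases k) (simp_all add: dr_mult lderiv_add lderiv_mult L dr_virL dr_add d distrib_left distrib_right)
next
  case (add a b)
  then show ?case by (simp add: dr_add lderiv_add split: nat.split)
qed

text \<open>The commutator from \<open>lderiv_dr\<close> raises the power of -\<lambda>_i by one;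
  moving the new factor out by \<open>E_lam\<close> leaves the desired multiple and terms with
  \<partial> of the partial derivatives, which cancel the others.\<close>

lemma Xv_der_arg: "Xv i (dr a) p = - (lam i * Xv i a p)"
proof -
  obtain N where N: "\<And>k. N \<le> k \<Longrightarrow> lderiv k a = 0" by (rule lderiv_bound[of a]) blast
  let ?q = "\<lambda>k. (- lam i) ^ k * p"
  have N': "lderiv k (dr a) = 0" if "Suc N \<le> k" for k
    using that N[of k] N[of "k - 1"] by (cases k) (simp_all add: lderiv_dr additive.zero[OF additive_dr])
  have n: "E i b (- q) = - E i b q" for b q by (rule additive.minus[OF additive_E])
  have s: "E i (lderiv k a) (?q (Suc k)) = - (lam i * E i (lderiv k a) (?q k)) - E i (dr (lderiv k a)) (?q k)" for k
  proof -
    have "?q (Suc k) = - (lam i * ?q k)" by (simp add: mult.assoc)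
    then show ?thesis by (simp only: n E_lam) simp
  qed
  have "Xv i (dr a) p = (\<Sum>k<Suc N. E i (lderiv k (dr a)) (?q k))" by (rule Xv_sum[OF N'])
  also have "\<dots> = (\<Sum>k<Suc N. E i (dr (lderiv k a)) (?q k)) + (\<Sum>k<Suc N. E i (case k of 0 \<Rightarrow> 0 | Suc m \<Rightarrow> lderiv m a) (?q k))"
    by (simp only: lderiv_dr E_add_arg sum.distrib)
  also have "(\<Sum>k<Suc N. E i (case k of 0 \<Rightarrow> 0 | Suc m \<Rightarrow> lderiv m a) (?q k)) = (\<Sum>k<N. E i (lderiv k a) (?q (Suc k)))"
    by (simp only: sum.lessThan_Suc_shift nat.case E_0_arg add_0_left)
  also have "\<dots> = - (\<Sum>k<N. lam i * E i (lderiv k a) (?q k)) - (\<Sum>k<N. E i (dr (lderiv k a)) (?q k))"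
    by (simp only: s sum_subtractf sum_negf)
  also have "(\<Sum>k<Suc N. E i (dr (lderiv k a)) (?q k)) = (\<Sum>k<N. E i (dr (lderiv k a)) (?q k))"
    using N[of N] by (simp add: additive.zero[OF additive_dr] E_0_arg)
  finally show ?thesis by (simp add: Xv_sum[OF N] sum_distrib_left)
qed

lemma Xv_L: "Xv i L p = p"
proof -
  have L: "lderiv k (L :: 'f vir) = (if k = 0 then 1 else 0)" for k
    using lderiv_lam_mult[of k 0 "1 :: 'f vir"] lderiv_const[of k "1 :: 'f"] by (simp add: virL_lam)
  then have "Xv i L p = (\<Sum>k<1. E i (lderiv k L) ((- lam i) ^ k * p))" by (intro Xv_sum) auto
  then show ?thesis by (simp add: L E_1)
qed

lemma minus_lam_power_D: "(- lam i) ^ k * D n p = D n ((- lam i) ^ k * p)"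
proof (rule ev_eqI)
  fix \<phi> :: "nat \<Rightarrow> 'f"
  have "ev \<phi> ((- lam i) ^ k * q) = \<kappa> ((- \<phi> i) ^ k) * ev \<phi> q" for q
    by (simp add: ev_simps ev_lam \<kappa>_simps)
  then show "ev \<phi> ((- lam i) ^ k * D n p) = ev \<phi> (D n ((- lam i) ^ k * p))"
    by (simp only: ev_D der_scale distrib_left mult.left_commute)
qed

lemma Xv_D: "i < n \<Longrightarrow> Xv i a (D n p) = D n (Xv i a p)"
proof -
  assume i: "i < n"
  obtain N where N: "\<And>k. N \<le> k \<Longrightarrow> lderiv k a = 0" by (rule lderiv_bound[of a]) blast
  show ?thesis by (simp only: Xv_sum[OF N] minus_lam_power_D E_D[OF i] additive.sum[OF additive_D])
qed

lemma E_minus_lam_power: "i \<noteq> j \<Longrightarrow> E i b ((- lam j) ^ k * p) = (- lam j) ^ k * E i b p"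
proof (induction k arbitrary: p)
  case (Suc k)
  have "E i b (- lam j * q) = - lam j * E i b q" for q
    using E_lam_other[OF Suc.prems, of b q] additive.minus[OF additive_E, of i b "lam j * q"] by simp
  then show ?case by (simp only: power_Suc mult.assoc Suc.IH[OF Suc.prems])
qed simp

lemma Xv_comm:
  assumes "i \<noteq> j"
  shows "Xv i a (Xv j b p) = Xv j b (Xv i a p)"
proof -
  obtain N where N: "\<And>k. N \<le> k \<Longrightarrow> lderiv k a = 0" "\<And>k. N \<le> k \<Longrightarrow> lderiv k b = 0" by (rule lderiv_bound2) blast
  have "Xv i a (Xv j b p) = (\<Sum>k<N. \<Sum>l<N. E i (lderiv k a) (E j (lderiv l b) ((- lam i) ^ k * ((- lam j) ^ l * p))))"
    by (simp only: Xv_sum[OF N(1)] Xv_sum[OF N(2)] sum_distrib_left additive.sum[OF additive_E]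
        E_minus_lam_power[OF assms[symmetric]])
  also have "\<dots> = (\<Sum>l<N. \<Sum>k<N. E j (lderiv l b) (E i (lderiv k a) ((- lam j) ^ l * ((- lam i) ^ k * p))))"
    by (subst sum.swap) (simp only: E_comm[OF assms] mult.left_commute[of "(- lam i) ^ _"])
  also have "\<dots> = Xv j b (Xv i a p)"
    by (simp only: Xv_sum[OF N(1)] Xv_sum[OF N(2)] sum_distrib_left additive.sum[OF additive_E]
        E_minus_lam_power[OF assms])
  finally show ?thesis .
qed

lemma Xv_lpolys: "i < n \<Longrightarrow> p \<in> lpolys n \<Longrightarrow> Xv i a p \<in> lpolys n"
proof -
  assume i: "i < n" "p \<in> lpolys n"
  obtain N where N: "\<And>k. N \<le> k \<Longrightarrow> lderiv k a = 0" by (rule lderiv_bound[of a]) blast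
  have "(\<Sum>k<N. E i (lderiv k a) ((- lam i) ^ k * p)) \<in> lpolys n"
    using i by (intro lpolys_sum E_lpolys lpolys_mult lpolys_power lpolys_minus lpolys_lam)
  then show ?thesis by (simp only: Xv_sum[OF N])
qed

lemma Xv_perm:
  assumes "\<pi> permutes S"
  shows "lsubst sc (\<lambda>k. lam (\<pi> k)) (Xv i a p) = Xv (\<pi> i) a (lsubst sc (\<lambda>k. lam (\<pi> k)) p)"
proof -
  let ?s = "lsubst sc (\<lambda>k. lam (\<pi> k))"
  obtain N where N: "\<And>k. N \<le> k \<Longrightarrow> lderiv k a = 0" by (rule lderiv_bound[of a]) blast
  have s: "?s (sum f I) = (\<Sum>x\<in>I. ?s (f x))" "?s ((- lam i) ^ k * q) = (- lam (\<pi> i)) ^ k * ?s q" for f and I :: "nat set" and k q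
    by (rule ev_eqI; simp add: ev_lsubst evF_lam ev_simps ev_lam)+
  show ?thesis by (simp only: Xv_sum[OF N] s E_perm[OF assms])
qed

lemma pv_carrier: "Y \<in> carrier (pv_complex V n) \<longleftrightarrow> Y \<in> lc_cochains V V n \<and>
  (\<forall>as i b c. length as = n \<and> i < n \<longrightarrow>
    Y (as[i := b * c]) = lcoset V n (E i b (rep (Y (as[i := c]))) + E i c (rep (Y (as[i := b])))))"
  by (simp add: pv_complex_def)

lemma lcoset_E_rep:
  assumes "i < n" "p \<in> lpolys n" "q \<in> lpolys n"
  shows "lcoset V n (E i b (rep (lcoset V n p)) + E i b' (rep (lcoset V n q))) = lcoset V n (E i b p + E i b' q)"
proof -
  obtain r s where r: "r \<in> lpolys n" "rep (lcoset V n p) = p + D n r" and s: "s \<in> lpolys n" "rep (lcoset V n q) = q + D n s"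
    using rep_lcoset[OF assms(2)] rep_lcoset[OF assms(3)] by blast
  show ?thesis
  proof (rule lcoset_eqI[of _ _ _ "E i b r + E i b' s"])
    show "E i b (rep (lcoset V n p)) + E i b' (rep (lcoset V n q)) = E i b p + E i b' q + D n (E i b r + E i b' s)"
      unfolding r(2) s(2) by (simp add: E_add E_D[OF assms(1)] D_add)
  qed (use assms r s in \<open>auto intro!: lpolys_add E_lpolys lpolys_D\<close>)
qed

text \<open>\<open>Xv_mult\<close> gives the Leibniz rule for filled slots. Conversely, a Leibniz
  cochain is forced on 1, on every L^(j) by sesquilinearity, and on products by the Leibniz
  rule.\<close>

sublocale slots \<kappa> dr "act V L" w V V L Xv "pv_complex V"
proof (unfold_locales, goal_cases)
  case (2 a x m)
  have "map_poly ((*) y) p = Polynomial.smult y p" for y and p :: "'f vir poly"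
    by (rule poly_eqI) (simp add: coeff_map_poly)
  then show ?case by (simp add: act_scale_right)
next
  case (3 a m x) show ?case using Am_der_right[of x a m] by (simp only: Am_def)
next
  case (10 i n a p) then show ?case by (rule Xv_D)
next
  case (11 i j a b p) then show ?case by (rule Xv_comm)
next
  case (12 i n p a) then show ?case by (rule Xv_lpolys)
next
  case (13 \<pi> n i a p) then show ?case by (rule Xv_perm)
next
  case (18 Y n)
  have "Y (as[i := b * b']) = lcoset V n (E i b (rep (Y (as[i := b']))) + E i b' (rep (Y (as[i := b]))))"
    if as: "length as = n" "i < n" for as i b b'
  proof -
    obtain q where q: "q \<in> lpolys n" "\<And>a. Y (as[i := a]) = lcoset V n (Xv i a q)" using 18(2)[OF as] by blast
    show ?thesis
      unfolding q(2) Xv_mult by (rule lcoset_E_rep[symmetric]) (use as q Xv_lpolys in auto)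
  qed
  then show ?case using 18(1) unfolding pv_carrier by blast
next
  case (19 Y n as i p a)
  have Y: "Y \<in> lc_cochains V V n" using 19(1) by (simp add: pv_carrier)
  have leib: "Y (as[i := b * b']) = lcoset V n (E i b q' + E i b' q)"
    if "q \<in> lpolys n" "q' \<in> lpolys n" "Y (as[i := b]) = lcoset V n q" "Y (as[i := b']) = lcoset V n q'" for b b' q q'
  proof -
    have "Y (as[i := b * b']) = lcoset V n (E i b (rep (Y (as[i := b']))) + E i b' (rep (Y (as[i := b]))))"
      using 19(1-3) unfolding pv_carrier by blast
    then show ?thesis using that lcoset_E_rep[OF 19(3) that(2,1)] by simp
  qed
  have l: "Xv i b p \<in> lpolys n" for b by (rule Xv_lpolys[OF 19(3,4)])
  \<comment> \<open>The Leibniz rule for 1 = 1 1 says that the value at 1 equals its double modulo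
    D.\<close>
  have one: "Y (as[i := 1]) = lcoset V n 0"
  proof -
    obtain q where q: "q \<in> lpolys n" "Y (as[i := 1]) = lcoset V n q"
      using lc_cochains_value[OF Y, of "as[i := 1]"] 19(2) by auto
    then have "lcoset V n (q + q) = lcoset V n q" using leib[OF q(1) q(1) q(2) q(2)] by (simp add: E_1)
    then have "q \<in> D n ` lpolys n" using lcoset_eq_iff[OF lpolys_add[OF q(1) q(1)] q(1)] by (simp only: add_diff_cancel_right')
    then show ?thesis using lcoset_eq_iff[of q n 0] q by (simp add: lpolys_0)
  qed
  have gen: "Y (as[i := virL j]) = lcoset V n (Xv i (virL j) p)" for j
  proof (induction j)
    case 0 show ?case using 19(5) by (simp add: Xv_L)
  next
    case (Suc j)
    from lc_cochains_slot(3)[OF Y 19(2,3) l Suc] show ?case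
      by (simp add: der_V dr_virL Xv_der_arg flip: dr_virL)
  qed
  show ?case
  proof (induction a rule: vir_induct)
    case (const x)
    from lc_cochains_slot(2)[OF Y 19(2,3) lpolys_0 one, of x] show ?case by (simp add: scl_V Xv_\<kappa>)
  next
    case (gen j a)
    from leib[OF l l \<open>\<And>j. Y (as[i := virL j]) = _\<close> gen] show ?case by (simp add: Xv_mult)
  next
    case (add a b)
    from lc_cochains_slot(1)[OF Y 19(2,3) l l add] show ?case by (simp add: Xv_add_arg)
  qed
qed (simp_all add: act_add_right Xv_add Xv_cst Xv_add_arg Xv_scl_arg Xv_der_arg Xv_L scl_V der_V pv_complex_def lc_complex_def)

end

section \<open>Cochains as families of slot maps\<close>

context virpva
begin

text \<open>
  \<open>G a\<close> is the value of a cochain with \<open>a\<close> in one slot, as a polynomial in the variable of that slot,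
  the other entries and variables being fixed.
\<close>

definition smap :: "('f vir \<Rightarrow> 'f vir poly) \<Rightarrow> bool"
  where "smap G \<longleftrightarrow> (\<forall>a b. G (a + b) = G a + G b) \<and> (\<forall>x a. G (\<kappa> x * a) = Polynomial.smult (\<kappa> x) (G a)) \<and>
    (\<forall>a. G (dr a) = - pCons 0 (G a)) \<and> (\<forall>a b. G (a * b) = Ep a (G b) + Ep b (G a))"

lemma smapI:
  assumes "\<And>a b. G (a + b) = G a + G b" "\<And>x a. G (\<kappa> x * a) = Polynomial.smult (\<kappa> x) (G a)"
    "\<And>a. G (dr a) = - pCons 0 (G a)" "\<And>a b. G (a * b) = Ep a (G b) + Ep b (G a)"
  shows "smap G"
  unfolding smap_def using assms by blast

lemma smapD:
  assumes "smap G"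
  shows "G (a + b) = G a + G b" "G (\<kappa> x * a) = Polynomial.smult (\<kappa> x) (G a)"
    "G (dr a) = - pCons 0 (G a)" "G (a * b) = Ep a (G b) + Ep b (G a)"
  using assms unfolding smap_def by blast+

lemma smap_1: "smap G \<Longrightarrow> G 1 = 0"
  using smapD(4)[of G 1 1] by (simp only: mult_1 Ep_1 add_cancel_right_right)

lemma smap_eqI:
  assumes "smap G" "smap G'" "G L = G' L"
  shows "G a = G' a"
proof -
  have gen: "G (virL j) = G' (virL j)" for j
  proof (induction j)
    case (Suc j)
    then show ?case using smapD(3)[OF assms(1), of "virL j"] smapD(3)[OF assms(2), of "virL j"] by (simp add: dr_virL)
  qed (rule assms(3))
  show ?thesis
  proof (induction a rule: vir_induct)
    case (const x)
    show ?case using smapD(2)[OF assms(1), of x 1] smapD(2)[OF assms(2), of x 1] assms by (simp add: smap_1)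
  next
    case (gen j a)
    then show ?case using smapD(4)[OF assms(1), of "virL j" a] smapD(4)[OF assms(2), of "virL j" a]
      \<open>\<And>j. G (virL j) = G' (virL j)\<close> by simp
  next
    case (add a b)
    then show ?case using smapD(1)[OF assms(1), of a b] smapD(1)[OF assms(2), of a b] by simp
  qed
qed

lemma smap_0: "smap (\<lambda>_. 0)"
  by (rule smapI) (simp_all add: Ep_0)

lemma smap_diff: "smap G \<Longrightarrow> smap G' \<Longrightarrow> smap (\<lambda>a. G a - G' a)"
  by (rule smapI) (simp_all add: smapD smult_diff_right Ep_diff)

text \<open>The derived left Leibniz rule makes the action term of the differential a slot map in
  the acting element.\<close>

lemma smap_act: "smap (\<lambda>a. act V a m)"
  by (rule smapI) (rule act_add_left act_scale_left act_der_left act_mult_left)+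

lemma Ep_add_arg: "Ep (a + b) p = Ep a p + Ep b p"
  by (induction p arbitrary: a b) (simp_all add: Ep_0 Ep_pCons dr_add distrib_right)

lemma Ep_scale_arg: "Ep (\<kappa> x * a) p = Polynomial.smult (\<kappa> x) (Ep a p)"
  by (induction p arbitrary: a) (simp_all add: Ep_0 Ep_pCons dr_scale smult_add_right mult.assoc)

text \<open>The substitution of x + \<lambda> for \<lambda>: bracketing with a_x moves the
  coordinate of a slot by x.\<close>

definition Sh :: "'f \<Rightarrow> 'f vir poly \<Rightarrow> 'f vir poly" where "Sh x p = pcompose p [:\<kappa> x, 1:]"

lemma Sh_add: "Sh x (p + q) = Sh x p + Sh x q"
  by (simp add: Sh_def pcompose_add)

lemma Sh_smult: "Sh x (Polynomial.smult v p) = Polynomial.smult v (Sh x p)"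
  by (simp add: Sh_def pcompose_smult)

lemma Sh_minus: "Sh x (- p) = - Sh x p"
  using Sh_smult[of x "- 1" p] by simp

lemma Sh_pCons: "Sh x (pCons v p) = [:v:] + Polynomial.smult (\<kappa> x) (Sh x p) + pCons 0 (Sh x p)"
  by (simp add: Sh_def pcompose_pCons)

lemma Sh_0: "Sh x 0 = 0"
  by (simp add: Sh_def)

lemma poly_Sh: "poly (Sh x p) (\<kappa> y) = poly p (\<kappa> (x + y))"
  by (simp add: Sh_def poly_pcompose \<kappa>_simps)

lemma Sh_Ep: "Sh x (Ep b p) = Ep b (Sh x p)"
proof (induction p arbitrary: b)
  case (pCons v p)
  show ?case by (simp add: Ep_pCons Sh_add Sh_pCons Sh_0 pCons Ep_add Ep_smult Ep_0)
qed (simp add: Sh_0 Ep_0)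

lemma map_Am_add: "map_poly (Am x a) (p + q) = map_poly (Am x a) p + map_poly (Am x a) q"
  by (rule poly_eqI) (simp add: coeff_map_poly additive.zero[OF additive_Am] Am_add_right)

lemma map_Am_minus: "map_poly (Am x a) (- p) = - map_poly (Am x a) p"
  by (rule poly_eqI) (simp add: coeff_map_poly additive.zero[OF additive_Am] additive.minus[OF additive_Am])

lemma map_Am_smult: "map_poly (Am x a) (Polynomial.smult (\<kappa> y) p) = Polynomial.smult (\<kappa> y) (map_poly (Am x a) p)"
  by (rule poly_eqI) (simp add: coeff_map_poly additive.zero[OF additive_Am] Am_scale_right)

lemma map_Am_pCons: "map_poly (Am x a) (pCons v p) = pCons (Am x a v) (map_poly (Am x a) p)"
  by (rule map_poly_pCons) (simp add: additive.zero[OF additive_Am])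

text \<open>a_x is a derivation with a_x \<partial> = (x + \<partial>) a_x, so in the exponential
  series \<partial>^k b becomes (x + \<partial>)^k [a_x b]; the part with x is the Taylor shift by
  x.\<close>

lemma map_Am_Ep: "map_poly (Am x a) (Ep b p) = Ep b (map_poly (Am x a) p) + Sh x (Ep (Am x a b) p)"
proof (induction p arbitrary: b)
  case (pCons v p)
  show ?case
    by (simp add: Ep_pCons map_Am_add map_Am_pCons pCons Am_mult additive.zero[OF additive_Am] Am_der_right
        Ep_add_arg Ep_scale_arg Sh_add Sh_smult Sh_pCons Sh_0)
qed (simp add: Ep_0 Sh_0)

text \<open>In the Leibniz rule, the shifted terms in which a_x hits one factor and G the other
  occur both in a_x G(b b') and in G([a_x, b b']), and cancel in the difference.\<close>

lemma smap_lieder: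
  assumes G: "smap G"
  shows "smap (\<lambda>b. map_poly (Am x a) (G b) - Sh x (G (Am x a b)))"
proof (rule smapI)
  fix b b' :: "'f vir" and y :: 'f
  show "map_poly (Am x a) (G (b + b')) - Sh x (G (Am x a (b + b'))) =
    map_poly (Am x a) (G b) - Sh x (G (Am x a b)) + (map_poly (Am x a) (G b') - Sh x (G (Am x a b')))"
    by (simp add: smapD[OF G] Am_add_right map_Am_add Sh_add)
  show "map_poly (Am x a) (G (\<kappa> y * b)) - Sh x (G (Am x a (\<kappa> y * b))) =
    Polynomial.smult (\<kappa> y) (map_poly (Am x a) (G b) - Sh x (G (Am x a b)))"
    by (simp only: smapD(2)[OF G] Am_scale_right map_Am_smult Sh_smult smult_diff_right)
  show "map_poly (Am x a) (G (dr b)) - Sh x (G (Am x a (dr b))) =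
    - pCons 0 (map_poly (Am x a) (G b) - Sh x (G (Am x a b)))"
    by (simp only: smapD(1-3)[OF G] Am_der_right map_Am_minus map_Am_pCons Sh_add Sh_smult Sh_minus Sh_pCons)
      (simp add: additive.zero[OF additive_Am])
  have "map_poly (Am x a) (G (b * b')) = Ep b (map_poly (Am x a) (G b')) + Sh x (Ep (Am x a b) (G b')) +
    (Ep b' (map_poly (Am x a) (G b)) + Sh x (Ep (Am x a b') (G b)))"
    by (simp only: smapD(4)[OF G] map_Am_add map_Am_Ep)
  moreover have "Sh x (G (Am x a (b * b'))) = Sh x (Ep (Am x a b) (G b')) + Ep b' (Sh x (G (Am x a b))) +
    (Ep b (Sh x (G (Am x a b'))) + Sh x (Ep (Am x a b') (G b)))"
    by (simp only: Am_mult smapD(1,4)[OF G] Sh_add Sh_Ep)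
  ultimately show "map_poly (Am x a) (G (b * b')) - Sh x (G (Am x a (b * b'))) =
    Ep b (map_poly (Am x a) (G b') - Sh x (G (Am x a b'))) + Ep b' (map_poly (Am x a) (G b) - Sh x (G (Am x a b)))"
    by (simp add: Ep_diff)
qed

text \<open>The pair (x, a) means the entry a in a slot whose variable has value x. A single G for
  all x makes the dependence on the point polynomial.\<close>

definition good :: "('f \<times> 'f vir \<Rightarrow> 'f vir) \<Rightarrow> bool"
  where "good h \<longleftrightarrow> (\<exists>G. smap G \<and> (\<forall>x a. h (x, a) = poly (G a) (\<kappa> x)))"

definition slotwise :: "(('f \<times> 'f vir) list \<Rightarrow> 'f vir) \<Rightarrow> bool"
  where "slotwise Z \<longleftrightarrow> (\<forall>us vs. good (\<lambda>x. Z (us @ x # vs)))"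

lemma goodI: "smap G \<Longrightarrow> (\<And>x a. h (x, a) = poly (G a) (\<kappa> x)) \<Longrightarrow> good h"
  unfolding good_def by blast

lemma goodE:
  assumes "good h"
  obtains G where "smap G" "\<And>x a. h (x, a) = poly (G a) (\<kappa> x)"
  using assms unfolding good_def by blast

lemma good_0: "good (\<lambda>_. 0)"
  by (rule goodI[OF smap_0]) simp

lemma good_diff:
  assumes "good h" "good h'"
  shows "good (\<lambda>x. h x - h' x)"
proof -
  obtain G G' where "smap G" "\<And>x a. h (x, a) = poly (G a) (\<kappa> x)" "smap G'" "\<And>x a. h' (x, a) = poly (G' a) (\<kappa> x)"
    using assms by (meson goodE)
  then show ?thesis by (intro goodI[of "\<lambda>a. G a - G' a"] smap_diff) simp_all
qed

lemma good_minus: "good h \<Longrightarrow> good (\<lambda>x. - h x)"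
  using good_diff[OF good_0] by simp

lemma good_add: "good h \<Longrightarrow> good h' \<Longrightarrow> good (\<lambda>x. h x + h' x)"
  using good_diff[OF _ good_minus] by fastforce

lemma good_sum: "(\<And>j. j \<in> I \<Longrightarrow> good (h j)) \<Longrightarrow> good (\<lambda>x. \<Sum>j\<in>I. h j x)"
  by (induction I rule: infinite_finite_induct) (simp_all add: good_0 good_add)

lemma good_linear:
  assumes "good h"
  shows "h (x, a + b) = h (x, a) + h (x, b)" "h (x, \<kappa> y * a) = \<kappa> y * h (x, a)" "h (x, dr a) = - (\<kappa> x * h (x, a))" "h (x, 1) = 0"
proof -
  obtain G where "smap G" "\<And>x a. h (x, a) = poly (G a) (\<kappa> x)" using assms unfolding good_def by blast
  then show "h (x, a + b) = h (x, a) + h (x, b)" "h (x, \<kappa> y * a) = \<kappa> y * h (x, a)" "h (x, dr a) = - (\<kappa> x * h (x, a))" "h (x, 1) = 0"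
    using smapD[of G] smap_1[of G] by simp_all
qed

lemma good_eqI:
  assumes "good h" "good h'" "\<And>x. h (x, L) = h' (x, L)"
  shows "h u = h' u"
proof -
  obtain G G' where *: "smap G" "\<And>x a. h (x, a) = poly (G a) (\<kappa> x)" "smap G'" "\<And>x a. h' (x, a) = poly (G' a) (\<kappa> x)"
    using assms by (meson goodE)
  have "G L = G' L" by (rule poly_\<kappa>_eqI) (use assms(3) * in simp)
  then have "G a = G' a" for a by (rule smap_eqI[OF *(1,3)])
  then show ?thesis by (cases u) (simp add: *)
qed

lemma acM_eq: "acM (x, a) m = Am x a m"
  by (simp add: acM_def B_def Am_def)

lemma brR_eq: "brR V (x, a) (y, b) = (x + y, Am x a b)"
  by (simp add: brR_def scl_V Am_altdef)

lemma good_acM: "good (\<lambda>u. acM u m)"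
  by (rule goodI[OF smap_act]) (simp add: acM_eq Am_def)

lemma good_lieder:
  assumes "good h"
  shows "good (\<lambda>u. acM v (h u) - h (brR V v u))"
proof -
  obtain G where G: "smap G" "\<And>x a. h (x, a) = poly (G a) (\<kappa> x)" using assms unfolding good_def by blast
  obtain x a where v: "v = (x, a)" by (cases v)
  have "poly (map_poly (Am x a) p) (\<kappa> y) = Am x a (poly p (\<kappa> y))" for p y
    by (rule poly_map_poly_additive[OF additive_Am]) (metis Am_scale_right mult.commute)
  then show ?thesis
    by (intro goodI[OF smap_lieder[OF G(1), of x a]]) (simp add: v brR_eq acM_eq G(2) poly_Sh)
qed

text \<open>At the point z = x + y the entry \<partial>m counts as -z m, so -\<lambda> - \<partial>
  at \<lambda> = x turns into -x + z = y. Skewsymmetry then gives -[b_y a] inside the slot.\<close>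

lemma good_brR:
  assumes "good h"
  shows "h (brR V u v) = - h (brR V v u)"
proof -
  obtain x a y b where uv: "u = (x, a)" "v = (y, b)" by (cases u, cases v)
  have drp: "poly (map_poly dr p) (\<kappa> x) = dr (poly p (\<kappa> x))" for p
    by (rule poly_map_poly_additive[OF additive_dr]) (metis dr_scale mult.commute)
  let ?z = "x + y"
  have ad: "additive (\<lambda>a. h (?z, a))" by (simp add: additive_def good_linear[OF assms])
  have T: "h (?z, poly (T p) (\<kappa> x)) = \<kappa> y * h (?z, poly p (\<kappa> x))" for p
  proof -
    have "h (?z, poly (T p) (\<kappa> x)) = h (?z, - (\<kappa> x * poly p (\<kappa> x)) - dr (poly p (\<kappa> x)))"
      by (simp add: T_def drp)
    also have "\<dots> = - (\<kappa> x * h (?z, poly p (\<kappa> x))) + \<kappa> ?z * h (?z, poly p (\<kappa> x))"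
      by (simp only: additive.diff[OF ad] additive.minus[OF ad] good_linear[OF assms] diff_minus_eq_add)
    finally show ?thesis by (simp only: \<kappa>_simps(3)) (simp add: distrib_right)
  qed
  have Tk: "h (?z, poly ((T ^^ k) [:m:]) (\<kappa> x)) = \<kappa> (y ^ k) * h (?z, m)" for k m
  proof (induction k)
    case (Suc k)
    then show ?case by (simp add: T \<kappa>_simps mult.assoc)
  qed (simp add: \<kappa>_simps)
  have "h (?z, Am x a b) = - (\<Sum>k\<le>degree (act V b a). h (?z, poly ((T ^^ k) [:coeff (act V b a) k:]) (\<kappa> x)))"
    unfolding Am_def act_skew[OF order_refl, of a b] by (simp only: poly_minus poly_sum additive.minus[OF ad] additive.sum[OF ad])
  also have "\<dots> = - h (?z, Am y b a)"
    unfolding Tk Am_altdef[of y] additive.sum[OF ad] good_linear(2)[OF assms] ..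
  finally show ?thesis by (simp add: uv brR_eq add.commute)
qed

lemma slotwiseD: "slotwise Z \<Longrightarrow> good (\<lambda>x. Z (us @ x # vs))"
  unfolding slotwise_def by blast

lemma slotwise_Cons: "slotwise Z \<Longrightarrow> slotwise (\<lambda>ys. Z (u # ys))"
  using slotwiseD[of Z "u # _"] by (simp add: slotwise_def)

interpretation br: ce "brR V" acM
  by standard (simp add: acM_def B_add)

text \<open>The recursion brackets earlier arguments into later ones, so the last argument occurs as
  a plain entry, as second entry of a bracket, or as the acting element; each is a slot map.\<close>

lemma good_ced_last: "slotwise Z \<Longrightarrow> good (\<lambda>x. ced (brR V) acM Z (us @ [x]))"
proof (induction us arbitrary: Z)
  case Nil
  show ?case using good_acM[of "Z []"] by (simp add: lieder_def)
next
  case (Cons u us)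
  let ?n = "length us"
  have l: "lieder (brR V) acM u Z (us @ [x]) = acM u (Z (us @ [x])) - Z (us @ [brR V u x]) -
    (\<Sum>j<?n. Z (us[j := brR V u (us ! j)] @ [x]))" for x
    by (simp add: lieder_def nth_append list_update_append)
  have "good (\<lambda>x. lieder (brR V) acM u Z (us @ [x]))"
    unfolding l by (intro good_diff good_sum good_lieder[OF slotwiseD[OF Cons.prems], of u us "[]", simplified])
      (rule slotwiseD[OF Cons.prems])
  then show ?case
    using good_diff[OF _ Cons.IH[OF slotwise_Cons[OF Cons.prems]]] by simp
qed

text \<open>Any argument can be moved to the last place at the cost of a sign, where
  \<open>good_ced_last\<close> applies.\<close>

lemma slotwise_ced:
  assumes Z: "slotwise Z" "alternating Z"
  shows "slotwise (ced (brR V) acM Z)"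
  unfolding slotwise_def
proof (intro allI)
  fix us vs :: "('f \<times> 'f vir) list"
  let ?d = "ced (brR V) acM Z"
  have al: "alternating ?d"
    by (rule br.d_alternating[OF Z(2)]) (rule good_brR[OF slotwiseD[OF Z(1)]])
  have "?d (us @ x # vs) = (- 1) ^ length vs * ?d ((us @ vs) @ [x])" for x
  proof -
    have "(- 1) ^ length vs * ?d ((us @ vs) @ [x]) = ((- 1) ^ length vs * (- 1) ^ length vs) * ((- 1) ^ length us * ?d (x # us @ vs))"
      unfolding alternating_move[OF al, of "us @ vs" x "[]"] by (simp add: power_add)
    also have "(- 1) ^ length vs * (- 1) ^ length vs = (1 :: 'f vir)"
      by (simp flip: power_mult_distrib)
    finally show ?thesis unfolding alternating_move[OF al, of us x vs] by simp
  qed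
  moreover have "good (\<lambda>x. (- 1) ^ k * ?d ((us @ vs) @ [x]))" for k :: nat
    by (induction k) (simp_all add: good_minus good_ced_last[OF Z(1), of "us @ vs", simplified])
  ultimately show "good (\<lambda>x. ?d (us @ x # vs))" by simp
qed

lemma slotwise_eqI:
  assumes "slotwise Z" "slotwise Z'" "\<And>ts. length ts = n \<Longrightarrow> Z (map (\<lambda>t. (t, L)) ts) = Z' (map (\<lambda>t. (t, L)) ts)"
  shows "length xs = n \<Longrightarrow> Z xs = Z' xs"
proof -
  have "Z (xs @ map (\<lambda>t. (t, L)) ts) = Z' (xs @ map (\<lambda>t. (t, L)) ts)" if "length xs + length ts = n" for xs ts
    using that
  proof (induction xs arbitrary: ts rule: rev_induct)
    case (snoc u us)
    have "Z (us @ u # map (\<lambda>t. (t, L)) ts) = Z' (us @ u # map (\<lambda>t. (t, L)) ts)"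
    proof (rule good_eqI[OF slotwiseD[OF assms(1)] slotwiseD[OF assms(2)]])
      fix x :: 'f
      show "Z (us @ (x, L) # map (\<lambda>t. (t, L)) ts) = Z' (us @ (x, L) # map (\<lambda>t. (t, L)) ts)"
        using snoc.IH[of "x # ts"] snoc.prems by simp
    qed
    then show ?case by simp
  qed (simp add: assms(3))
  from this[of xs "[]"] show "length xs = n \<Longrightarrow> Z xs = Z' xs" by simp
qed

lemma slotwise_Zf: "slotwise (Zf n P)"
  unfolding slotwise_def
proof (intro allI)
  fix us vs :: "('f \<times> 'f vir) list"
  let ?i = "length us" and ?bs = "map snd us @ 0 # map snd vs"
  show "good (\<lambda>x. Zf n P (us @ x # vs))"
  proof (cases "length us + Suc (length vs) = n")
    case True
    define \<phi> where "\<phi> = lst (map fst us @ 0 # map fst vs)"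
    define q where "q = fill Xv ?bs P ({..<n} - {?i})"
    \<comment> \<open>All variables but that of the slot take their values, and the remaining one
      becomes the variable of a univariate polynomial; this turns \<open>E\<close> into
      \<open>Ep\<close>.\<close>
    define sp where "sp = lhom (\<lambda>v. [:v:]) (\<lambda>k. if k = ?i then [:0, 1:] else [:\<kappa> (\<phi> k):])"
    note r = rhom_const_poly[where ?'a = "'f vir"]
    have sp: "sp (p + q) = sp p + sp q" "sp (lam k * p) = (if k = ?i then pCons 0 (sp p) else Polynomial.smult (\<kappa> (\<phi> k)) (sp p))"
      "sp (Poly_Mapping.single 0 v) = [:v:]" "sp (Poly_Mapping.single 0 v * p) = Polynomial.smult v (sp p)" "sp (- p) = - sp p" "sp 0 = 0" for p q k v
      unfolding sp_def using rhomD(1,5)[OF rhom_lhom[OF r]]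
      by (simp_all add: lhom_add[OF r] lhom_mult[OF r] lhom_lam[OF r] lhom_const[OF r])
    have spE: "sp (E ?i b p) = Ep b (sp p)" for b p
      by (induction p arbitrary: b rule: lpoly_induct)
        (simp_all add: E_const E_lam_if E_add sp Ep_pCons Ep_0 Ep_smult Ep_add)
    have ev: "poly (sp p) (\<kappa> x) = ev (\<phi>(?i := x)) p" for p x
      by (induction p rule: lpoly_induct) (simp_all add: sp ev_simps ev_const ev_lam)
    have "smap (\<lambda>a. sp (Xv ?i a q))"
      by (rule smapI) (simp only: Xv_add_arg sp, simp only: Xv_scl_arg sp, simp add: Xv_der_arg sp, simp only: Xv_mult sp spE)
    moreover have "Zf n P (us @ (x, a) # vs) = poly (sp (Xv ?i a q)) (\<kappa> x)" for x a
    proof -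
      have "fill Xv (?bs[?i := a]) P {..<n} = Xv ?i a q"
        unfolding q_def using True by (intro fill_remove) auto
      moreover have "?bs[?i := a] = map snd us @ a # map snd vs"
        by (metis length_map list_update_length)
      moreover have "lst (map fst us @ x # map fst vs) = \<phi>(?i := x)"
        by (rule ext) (auto simp: \<phi>_def lst_def nth_append nth_Cons split: nat.split)
      ultimately show ?thesis using True by (simp add: Zf_def ev)
    qed
    ultimately show ?thesis by (rule goodI)
  next
    case False
    then show ?thesis by (simp add: Zf_def good_0)
  qed
qed

lemma Zf_L: "Zf n P (map (\<lambda>x. (fst x, \<kappa> (snd x) * L)) xs) = Zw n P xs"
proof (cases "length xs = n")
  case True
  let ?bs = "map snd (map (\<lambda>x. (fst x, \<kappa> (snd x) * L)) xs)"
  have "fill Xv ?bs P I = cst (\<Prod>i\<in>I. snd (xs ! i)) * P" if "finite I" "I \<subseteq> {..<n}" for I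
    using that
  proof (induction I)
    case (insert i I)
    then have "fill Xv ?bs P (insert i I) = Xv i (\<kappa> (snd (xs ! i)) * L) (cst (\<Prod>i\<in>I. snd (xs ! i)) * P)"
      using True by (simp add: fill_insert)
    also have "\<dots> = cst (snd (xs ! i)) * (cst (\<Prod>i\<in>I. snd (xs ! i)) * P)"
      by (simp only: Xv_scl_arg Xv_L)
    finally show ?case using insert by (simp add: cst_mult)
  qed (simp add: fill_empty \<kappa>_simps)
  from this[of "{..<n}"] have "fill Xv ?bs P {..<n} = cst (prod_list (map snd xs)) * P"
    using True by (simp add: prod.list_conv_set_nth atLeast0LessThan)
  then show ?thesis using True by (simp add: Zf_def Zw_def comp_def ev_simps ev_const)
qed (simp add: Zf_def Zw_def)

sublocale slots_complex \<kappa> dr "act V L" w V V L Xv "pv_complex V"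
proof
  fix P :: "'f vir lpoly" and n and xs :: "('f \<times> 'f vir) list"
  assume P: "P \<in> Sk n" and xs: "length xs = Suc n"
  define f :: "'f \<times> 'f \<Rightarrow> 'f \<times> 'f vir" where "f x = (fst x, \<kappa> (snd x) * L)" for x
  have ZL: "Zf m Q (map f ys) = Zw m Q ys" for m Q ys unfolding f_def by (rule Zf_L)
  \<comment> \<open>Inside a slot at s + s' the entry \<partial>L counts as -(s + s') L, and the
    central term vanishes since \<open>h\<close> kills scalars. The factor left is -(s + s') + 2s =
    s - s', as in \<open>br_vir\<close>.\<close>
  have br: "h (brR V (f x) (f y)) = h (f (br_vir x y))" if h: "good h" for h x y
  proof -
    obtain s r s' r' where xy: "x = (s, r)" "y = (s', r')" by (cases x, cases y)
    let ?z = "s + s'" let ?c = "\<kappa> (r * r')"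
    have "Am s (\<kappa> r * L) (\<kappa> r' * L) = ?c * (dr L + \<kappa> (2 * s) * L + \<kappa> (c / 12 * s ^ 3) * 1)"
      unfolding Am_scale_left Am_scale_right Am_L_L by (simp only: \<kappa>_simps(4) mult_ac)
    then have "h (?z, Am s (\<kappa> r * L) (\<kappa> r' * L)) = ?c * (- (\<kappa> ?z * h (?z, L)) + \<kappa> (2 * s) * h (?z, L))"
      by (simp only: good_linear[OF h] mult_zero_right add_0_right)
    also have "\<dots> = \<kappa> (r * r' * (- ?z + 2 * s)) * h (?z, L)"
      by (simp only: \<kappa>_simps(3-6) distrib_left distrib_right mult_minus_left mult_minus_right mult.assoc)
    also have "- ?z + 2 * s = s - s'" by simp
    finally show ?thesis by (simp only: xy f_def fst_conv snd_conv brR_eq br_vir_def good_linear[OF h])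
  qed
  have "ced (brR V) acM (Zf n P) (map f ys) = Zf (Suc n) (dW n P) (map f ys)" if "length ys = Suc n" for ys
  proof -
    have "ced (brR V) acM (Zf n P) (map f ys) = ced br_vir ac (\<lambda>ys. Zf n P (map f ys)) ys"
    proof (rule ced_transfer)
      show "Zf n P (map f us @ brR V (f x) (f y) # map f vs) = Zf n P (map f us @ f (br_vir x y) # map f vs)" for us x y vs
        by (rule br[OF slotwiseD[OF slotwise_Zf]])
      show "acM (f x) m = ac x m" for x m
        by (simp only: f_def acM_eq Am_scale_left ac_def A_def) (simp only: Am_def)
    qed
    then show ?thesis using ced_Zw[OF Sk_lpolys[OF P], of ys] that by (simp add: ZL)
  qed
  note * = this
  show "ced (brR V) acM (Zf n P) xs = Zf (Suc n) (dW n P) xs"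
  \<comment> \<open>Both sides are slot maps in every argument, so agreement on copies of L is
    enough.\<close>
  proof (rule slotwise_eqI[OF slotwise_ced[OF slotwise_Zf Zf_alternating[OF P]] slotwise_Zf _ xs])
    fix ts :: "'f list"
    assume "length ts = Suc n"
    moreover have "map (\<lambda>t. (t, L)) ts = map f (map (\<lambda>t. (t, 1)) ts)" by (simp add: f_def \<kappa>_simps)
    ultimately show "ced (brR V) acM (Zf n P) (map (\<lambda>t. (t, L)) ts) = Zf (Suc n) (dW n P) (map (\<lambda>t. (t, L)) ts)"
      using *[of "map (\<lambda>t. (t, 1)) ts"] by (simp only: length_map)
  qed
qed

end

theorem theorem4p17:
  fixes c :: "'f::field_char_0"
    and V :: "('f, 'f vir) conf_alg"
    and R :: "('f, 'f poly) conf_alg"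
    and F :: "('f, 'f poly, 'f) conf_module"
  assumes "is_virasoro_pva c V"
    and "R = rvir"
    and "F = triv"
  shows
    "(\<forall>n. lin_isomorphic (H_PV V n) (H_LC R F n)) \<and>
      (\<exists>Y0 Y2 Y3.
        determined_cochain (lc_complex R F 0) [] (lcoset F 0 1) Y0 \<and>
        determined_cochain (lc_complex R F 2) [1, 1] (lcoset F 2 (lam 0 ^ 3)) Y2 \<and>
        determined_cochain (lc_complex R F 3) [1, 1, 1]
          (lcoset F 3 ((lam 0 - lam 1) * (lam 0 - lam 2) * (lam 1 - lam 2))) Y3 \<and>
        is_line_on (H_LC R F 0) (coh_class (lc_complex R F) (lc_diff R F) 0 Y0) \<and>
        is_line_on (H_LC R F 2) (coh_class (lc_complex R F) (lc_diff R F) 2 Y2) \<and>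
        is_line_on (H_LC R F 3) (coh_class (lc_complex R F) (lc_diff R F) 3 Y3)) \<and>
      (\<forall>n. n \<notin> {0, 2, 3} \<longrightarrow> carrier (H_LC R F n) = {\<zero>\<^bsub>H_LC R F n\<^esub>}) \<and>
      (\<exists>Y0 Y2 Y3.
        determined_cochain (pv_complex V 0) [] (lcoset V 0 1) Y0 \<and>
        determined_cochain (pv_complex V 2) [virL 0, virL 0] (lcoset V 2 (lam 0 ^ 3)) Y2 \<and>
        determined_cochain (pv_complex V 3) [virL 0, virL 0, virL 0]
          (lcoset V 3 ((lam 0 - lam 1) * (lam 0 - lam 2) * (lam 1 - lam 2))) Y3 \<and>
        is_line_on (H_PV V 0) (coh_class (pv_complex V) (lc_diff V V) 0 Y0) \<and>
        is_line_on (H_PV V 2) (coh_class (pv_complex V) (lc_diff V V) 2 Y2) \<and>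
        is_line_on (H_PV V 3) (coh_class (pv_complex V) (lc_diff V V) 3 Y3)) \<and>
      (\<forall>n. n \<notin> {0, 2, 3} \<longrightarrow> carrier (H_PV V n) = {\<zero>\<^bsub>H_PV V n\<^esub>})"
proof -
  interpret PV: virpva c V by unfold_locales (rule assms(1))
  have "lin_isomorphic (H_PV V n) (H_LC rvir triv n)" for n
  proof (cases "n \<in> {0, 2, 3}")
    case True
    then show ?thesis
      by (intro lin_isomorphic_lines[OF PV.vsp_H PV.cohomology_line[of n 1] LC.vsp_H LC.cohomology_line[of n 1]]) simp_all
  next
    case False
    then show ?thesis
      by (intro lin_isomorphic_zero[OF PV.vsp_H PV.cohomology_zero LC.vsp_H LC.cohomology_zero])
  qed
  then show ?thesis
    unfolding assms(2,3)
    using LC.cohomology_generators PV.cohomology_generators LC.cohomology_zero PV.cohomology_zero by blast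
qed

end
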